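(* Let $p$ be a prime and let $G$ be a finitely generated pro-$p$ group. If $\mathbb{F}_p[\![G]\!]$ is a Sylvester domain, then $G$ is finitely presented (as a pro-$p$ group) and its cohomological dimension satisfies $\operatorname{cd} G\le 2$.
   Context: Generation and presentation of pro-$p$ groups are in the topological (pro-$p$) sense. Sylvester matrix rank function on a unital ring $S$: a non-negative real-valued function $\operatorname{rk}$ on the set of all matrices over $S$ such that (1) $\operatorname{rk}(A)=0$ if $A$ is a zero matrix and $\operatorname{rk}(1)=1$; (2) $\operatorname{rk}(AB)\le\min\{\operatorname{rk}(A),\operatorname{rk}(B)\}$ whenever $AB$ is defined; (3) $\operatorname{rk}\begin{pmatrix}A&0\\0&B\end{pmatrix}=\operatorname{rk}(A)+\operatorname{rk}(B)$; (4) $\operatorname{rk}\begin{pmatrix}A&C\\0&B\end{pmatrix}\ge\operatorname{rk}(A)+\operatorname{rk}(B)$ for $A,B,C$ of appropriate sizes. Inner rank: for a non-zero $A\in\mathrm{Mat}_{n\times m}(S)$, $\operatorname{irk}_S(A)$ is the least $k$ such that $A=BC$ with $B\in\mathrm{Mat}_{n\times k}(S)$, $C\in\mathrm{Mat}_{k\times m}(S)$; zero matrices have inner rank $0$. $S$ is a Sylvester domain if $\operatorname{irk}_S$ is a Sylvester matrix rank function on $S$. *)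

theory Defs
  imports
    "HOL-Analysis.Analysis"
    "HOL-Algebra.Elementary_Groups"
    "HOL-Algebra.Group_Action"
    "HOL-Library.Extended_Nat"
    "Jordan_Normal_Form.Matrix"
    "HOL-Number_Theory.Residues"
begin

section \<open>Matrices over a ring, inner rank and Sylvester domains\<close>

text \<open>Matrices are those of \<^theory>\<open>Jordan_Normal_Form.Matrix\<close>, with entries in the carrier of a
  ring record. The product cannot be the one of that theory, which uses the type class operations.
  Matrices without rows or without columns are allowed; they are zero matrices.\<close>

definition matrices :: "('a, 'b) ring_scheme \<Rightarrow> nat \<Rightarrow> nat \<Rightarrow> 'a mat set" where
  "matrices S n m = {A \<in> carrier_mat n m. elements_mat A \<subseteq> carrier S}"

definition zero_matrix :: "('a, 'b) ring_scheme \<Rightarrow> nat \<Rightarrow> nat \<Rightarrow> 'a mat" where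
  "zero_matrix S n m = mat n m (\<lambda>_. \<zero>\<^bsub>S\<^esub>)"

definition matrix_mult :: "('a, 'b) ring_scheme \<Rightarrow> 'a mat \<Rightarrow> 'a mat \<Rightarrow> 'a mat" where
  "matrix_mult S A B =
     mat (dim_row A) (dim_col B) (\<lambda>(i, j). \<Oplus>\<^bsub>S\<^esub>k\<in>{..<dim_col A}. A $$ (i, k) \<otimes>\<^bsub>S\<^esub> B $$ (k, j))"

definition sylvester_rank_function :: "('a, 'b) ring_scheme \<Rightarrow> ('a mat \<Rightarrow> real) \<Rightarrow> bool" where
  "sylvester_rank_function S rk \<longleftrightarrow>
     (\<forall>n m. \<forall>A \<in> matrices S n m. rk A \<ge> 0) \<and>
     (\<forall>n m. rk (zero_matrix S n m) = 0) \<and>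
     rk (mat 1 1 (\<lambda>_. \<one>\<^bsub>S\<^esub>)) = 1 \<and>
     (\<forall>n m k. \<forall>A \<in> matrices S n m. \<forall>B \<in> matrices S m k.
        rk (matrix_mult S A B) \<le> min (rk A) (rk B)) \<and>
     (\<forall>n m k l. \<forall>A \<in> matrices S n m. \<forall>B \<in> matrices S k l.
        rk (four_block_mat A (zero_matrix S n l) (zero_matrix S k m) B) = rk A + rk B) \<and>
     (\<forall>n m k l. \<forall>A \<in> matrices S n m. \<forall>B \<in> matrices S k l. \<forall>C \<in> matrices S n l.
        rk (four_block_mat A C (zero_matrix S k m) B) \<ge> rk A + rk B)"

definition inner_rank :: "('a, 'b) ring_scheme \<Rightarrow> 'a mat \<Rightarrow> nat" where
  "inner_rank S A =
     (if A = zero_matrix S (dim_row A) (dim_col A) then 0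
      else LEAST k. \<exists>B \<in> matrices S (dim_row A) k. \<exists>C \<in> matrices S k (dim_col A).
                      A = matrix_mult S B C)"

definition sylvester_domain :: "('a, 'b) ring_scheme \<Rightarrow> bool" where
  "sylvester_domain S \<longleftrightarrow> ring S \<and> sylvester_rank_function S (\<lambda>A. real (inner_rank S A))"


section \<open>Pro-p groups\<close>

locale topological_group = group G for G (structure) +
  fixes T :: "'a topology"
  assumes topspace_eq: "topspace T = carrier G"
    and continuous_mult: "continuous_map (prod_topology T T) T (\<lambda>(x, y). x \<otimes> y)"
    and continuous_inv: "continuous_map T T (\<lambda>x. inv x)"

locale profinite_group = topological_group +
  assumes compact: "compact_space T"
    and Hausdorff: "Hausdorff_space T"
    and totally_disconnected: "connectedin T C \<Longrightarrow> \<exists>x. C \<subseteq> {x}"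

locale pro_p_group = profinite_group G T for p :: nat and G (structure) and T +
  assumes prime_p: "prime p"
    and index_open_normal: "\<lbrakk>N \<lhd> G; openin T N\<rbrakk> \<Longrightarrow> \<exists>k. card (rcosets N) = p ^ k"

definition topologically_finitely_generated ::
    "('a, 'b) monoid_scheme \<Rightarrow> 'a topology \<Rightarrow> bool" where
  "topologically_finitely_generated G T \<longleftrightarrow>
     (\<exists>X. finite X \<and> X \<subseteq> carrier G \<and> T closure_of (generate G X) = carrier G)"


section \<open>The completed group algebra\<close>

text \<open>The group algebra of a finite group \<open>H\<close>: functions from \<open>H\<close> to \<open>R\<close> with convolution.\<close>

definition group_algebra ::
    "('r, 'c) ring_scheme \<Rightarrow> ('h, 'd) monoid_scheme \<Rightarrow> ('h \<Rightarrow> 'r) ring" where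
  "group_algebra R H =
     \<lparr>carrier = carrier H \<rightarrow>\<^sub>E carrier R,
      mult = \<lambda>f g. \<lambda>z\<in>carrier H. \<Oplus>\<^bsub>R\<^esub>x\<in>carrier H. f x \<otimes>\<^bsub>R\<^esub> g (inv\<^bsub>H\<^esub> x \<otimes>\<^bsub>H\<^esub> z),
      one = \<lambda>z\<in>carrier H. if z = \<one>\<^bsub>H\<^esub> then \<one>\<^bsub>R\<^esub> else \<zero>\<^bsub>R\<^esub>,
      zero = \<lambda>z\<in>carrier H. \<zero>\<^bsub>R\<^esub>,
      add = \<lambda>f g. \<lambda>z\<in>carrier H. f z \<oplus>\<^bsub>R\<^esub> g z\<rparr>"

text \<open>For \<open>U \<subseteq> V\<close>, the map \<open>R[G/U] \<rightarrow> R[G/V]\<close> that extends the projection \<open>G/U \<rightarrow> G/V\<close>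
  linearly: the coefficient at a coset \<open>D\<close> of \<open>V\<close> is the sum of the coefficients at the cosets of
  \<open>U\<close> that are contained in \<open>D\<close>.\<close>

definition group_algebra_proj ::
    "('r, 'c) ring_scheme \<Rightarrow> ('g, 'd) monoid_scheme \<Rightarrow> 'g set \<Rightarrow> 'g set \<Rightarrow>
     ('g set \<Rightarrow> 'r) \<Rightarrow> ('g set \<Rightarrow> 'r)" where
  "group_algebra_proj R G U V f =
     (\<lambda>D\<in>carrier (G Mod V). \<Oplus>\<^bsub>R\<^esub>C\<in>{C \<in> carrier (G Mod U). C \<subseteq> D}. f C)"

definition open_normal_subgroups :: "('g, 'd) monoid_scheme \<Rightarrow> 'g topology \<Rightarrow> 'g set set" where
  "open_normal_subgroups G T = {U. U \<lhd> G \<and> openin T U}"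

text \<open>The inverse limit of the rings \<open>R[G/U]\<close>, as the ring of compatible families.\<close>

definition completed_group_algebra ::
    "('r, 'c) ring_scheme \<Rightarrow> ('g, 'd) monoid_scheme \<Rightarrow> 'g topology \<Rightarrow>
     ('g set \<Rightarrow> 'g set \<Rightarrow> 'r) ring" where
  "completed_group_algebra R G T =
     (let \<U> = open_normal_subgroups G T; A = (\<lambda>U. group_algebra R (G Mod U)) in
      \<lparr>carrier = {a \<in> (\<Pi>\<^sub>E U\<in>\<U>. carrier (A U)).
                    \<forall>U\<in>\<U>. \<forall>V\<in>\<U>. U \<subseteq> V \<longrightarrow> group_algebra_proj R G U V (a U) = a V},
       mult = \<lambda>a b. \<lambda>U\<in>\<U>. a U \<otimes>\<^bsub>A U\<^esub> b U,
       one = \<lambda>U\<in>\<U>. \<one>\<^bsub>A U\<^esub>,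
       zero = \<lambda>U\<in>\<U>. \<zero>\<^bsub>A U\<^esub>,
       add = \<lambda>a b. \<lambda>U\<in>\<U>. a U \<oplus>\<^bsub>A U\<^esub> b U\<rparr>)"


section \<open>Free pro-p groups and finite presentation\<close>

text \<open>Words over \<open>X \<times> UNIV\<close>, where \<open>(x, True)\<close> and \<open>(x, False)\<close> stand for the two letters
  \<open>x\<close> and \<open>x\<close> inverse, up to insertion and deletion of cancelling pairs.\<close>

inductive_set free_group_rel :: "'x set \<Rightarrow> (('x \<times> bool) list \<times> ('x \<times> bool) list) set"
  for X :: "'x set" where
  refl: "w \<in> lists (X \<times> UNIV) \<Longrightarrow> (w, w) \<in> free_group_rel X"
| sym: "(v, w) \<in> free_group_rel X \<Longrightarrow> (w, v) \<in> free_group_rel X"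
| trans: "\<lbrakk>(u, v) \<in> free_group_rel X; (v, w) \<in> free_group_rel X\<rbrakk> \<Longrightarrow> (u, w) \<in> free_group_rel X"
| cancel: "\<lbrakk>u \<in> lists (X \<times> UNIV); v \<in> lists (X \<times> UNIV); x \<in> X\<rbrakk> \<Longrightarrow>
    (u @ [(x, b), (x, \<not> b)] @ v, u @ v) \<in> free_group_rel X"

definition free_group :: "'x set \<Rightarrow> ('x \<times> bool) list set monoid" where
  "free_group X =
     \<lparr>carrier = lists (X \<times> UNIV) // free_group_rel X,
      mult = \<lambda>A B. \<Union>u\<in>A. \<Union>v\<in>B. free_group_rel X `` {u @ v},
      one = free_group_rel X `` {[]}\<rparr>"

definition normal_subgroups_p_power_index ::
    "nat \<Rightarrow> ('a, 'b) monoid_scheme \<Rightarrow> 'a set set" where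
  "normal_subgroups_p_power_index p G = {N. N \<lhd> G \<and> (\<exists>k. card (rcosets\<^bsub>G\<^esub> N) = p ^ k)}"

text \<open>The pro-p completion: the inverse limit of the discrete groups \<open>G/N\<close> over the normal
  subgroups \<open>N\<close> of p-power index. For \<open>N \<subseteq> M\<close>, the projection \<open>G/N \<rightarrow> G/M\<close> sends a coset of
  \<open>N\<close> to the coset of \<open>M\<close> that contains it.\<close>

definition pro_p_completion ::
    "nat \<Rightarrow> ('a, 'b) monoid_scheme \<Rightarrow> ('a set \<Rightarrow> 'a set) monoid" where
  "pro_p_completion p G =
     (let \<N> = normal_subgroups_p_power_index p G in
      \<lparr>carrier = {x \<in> (\<Pi>\<^sub>E N\<in>\<N>. carrier (G Mod N)). \<forall>N\<in>\<N>. \<forall>M\<in>\<N>. N \<subseteq> M \<longrightarrow> x N \<subseteq> x M},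
       mult = \<lambda>x y. \<lambda>N\<in>\<N>. x N \<otimes>\<^bsub>G Mod N\<^esub> y N,
       one = \<lambda>N\<in>\<N>. \<one>\<^bsub>G Mod N\<^esub>\<rparr>)"

definition pro_p_completion_topology ::
    "nat \<Rightarrow> ('a, 'b) monoid_scheme \<Rightarrow> ('a set \<Rightarrow> 'a set) topology" where
  "pro_p_completion_topology p G =
     subtopology
       (product_topology (\<lambda>N. discrete_topology (carrier (G Mod N)))
          (normal_subgroups_p_power_index p G))
       (carrier (pro_p_completion p G))"

text \<open>The free pro-p group of rank \<open>n\<close> is the pro-p completion of the abstract free group of
  rank \<open>n\<close>.\<close>

abbreviation free_pro_p_group ::
    "nat \<Rightarrow> nat \<Rightarrow> ((nat \<times> bool) list set set \<Rightarrow> (nat \<times> bool) list set set) monoid" where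
  "free_pro_p_group p n \<equiv> pro_p_completion p (free_group {..<n})"

abbreviation free_pro_p_topology ::
    "nat \<Rightarrow> nat \<Rightarrow> ((nat \<times> bool) list set set \<Rightarrow> (nat \<times> bool) list set set) topology" where
  "free_pro_p_topology p n \<equiv> pro_p_completion_topology p (free_group {..<n})"

definition closed_normal_closure ::
    "('a, 'b) monoid_scheme \<Rightarrow> 'a topology \<Rightarrow> 'a set \<Rightarrow> 'a set" where
  "closed_normal_closure G T R = \<Inter>{N. N \<lhd> G \<and> closedin T N \<and> R \<subseteq> N}"

text \<open>Since free pro-p groups are compact, a continuous epimorphism onto a Hausdorff group \<open>G\<close>
  induces an isomorphism of topological groups from the quotient by its kernel to \<open>G\<close>.\<close>

definition finitely_presented_pro_p ::
    "nat \<Rightarrow> ('a, 'b) monoid_scheme \<Rightarrow> 'a topology \<Rightarrow> bool" where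
  "finitely_presented_pro_p p G T \<longleftrightarrow>
     (\<exists>n R \<phi>. finite R \<and> R \<subseteq> carrier (free_pro_p_group p n) \<and>
        \<phi> \<in> hom (free_pro_p_group p n) G \<and>
        continuous_map (free_pro_p_topology p n) T \<phi> \<and>
        \<phi> ` carrier (free_pro_p_group p n) = carrier G \<and>
        kernel (free_pro_p_group p n) G \<phi> =
          closed_normal_closure (free_pro_p_group p n) (free_pro_p_topology p n) R)"


section \<open>Continuous cohomology and cohomological dimension\<close>

text \<open>Discrete modules are commutative groups in multiplicative notation.\<close>

locale discrete_module =
  G: topological_group G T + A: comm_group A + group_action G "carrier A" \<phi>
  for G :: "('g, 'b) monoid_scheme" and T :: "'g topology"
    and A :: "('m, 'c) monoid_scheme" and \<phi> :: "'g \<Rightarrow> 'm \<Rightarrow> 'm" +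
  assumes action_hom: "g \<in> carrier G \<Longrightarrow> \<phi> g \<in> hom A A"
    and continuous_action:
      "continuous_map (prod_topology T (discrete_topology (carrier A)))
         (discrete_topology (carrier A)) (\<lambda>(g, a). \<phi> g a)"

locale discrete_torsion_module = discrete_module +
  assumes torsion: "a \<in> carrier A \<Longrightarrow> \<exists>n>0. a [^]\<^bsub>A\<^esub> (n::nat) = \<one>\<^bsub>A\<^esub>"

text \<open>The group of inhomogeneous continuous cochains of degree \<open>q\<close>; the points of \<open>G\<^sup>q\<close> are
  extensional functions on \<open>{0, \<dots>, q - 1}\<close>.\<close>

definition cochain_group ::
    "('g, 'b) monoid_scheme \<Rightarrow> 'g topology \<Rightarrow> ('m, 'c) monoid_scheme \<Rightarrow> nat \<Rightarrow>
     ((nat \<Rightarrow> 'g) \<Rightarrow> 'm) monoid" where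
  "cochain_group G T A q =
     \<lparr>carrier = {f \<in> ({..<q} \<rightarrow>\<^sub>E carrier G) \<rightarrow>\<^sub>E carrier A.
                   continuous_map (product_topology (\<lambda>_. T) {..<q})
                     (discrete_topology (carrier A)) f},
      mult = \<lambda>f h. \<lambda>x\<in>{..<q} \<rightarrow>\<^sub>E carrier G. f x \<otimes>\<^bsub>A\<^esub> h x,
      one = \<lambda>x\<in>{..<q} \<rightarrow>\<^sub>E carrier G. \<one>\<^bsub>A\<^esub>\<rparr>"

text \<open>In additive notation, and with arguments numbered from \<open>0\<close>, the coboundary of \<open>f\<close> at
  \<open>(x\<^sub>0, \<dots>, x\<^sub>q)\<close> is the sum of \<open>x\<^sub>0 \<cdot> f (x\<^sub>1, \<dots>, x\<^sub>q)\<close>, of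
  \<open>(-1)\<^bsup>i + 1\<^esup> f (x\<^sub>0, \<dots>, x\<^sub>i x\<^bsub>i + 1\<^esub>, \<dots>, x\<^sub>q)\<close> for \<open>i < q\<close>, and of
  \<open>(-1)\<^bsup>q + 1\<^esup> f (x\<^sub>0, \<dots>, x\<^bsub>q - 1\<^esub>)\<close>.\<close>

definition coboundary ::
    "('g, 'b) monoid_scheme \<Rightarrow> ('m, 'c) monoid_scheme \<Rightarrow> ('g \<Rightarrow> 'm \<Rightarrow> 'm) \<Rightarrow> nat \<Rightarrow>
     ((nat \<Rightarrow> 'g) \<Rightarrow> 'm) \<Rightarrow> ((nat \<Rightarrow> 'g) \<Rightarrow> 'm)" where
  "coboundary G A \<phi> q f =
     (\<lambda>x\<in>{..<Suc q} \<rightarrow>\<^sub>E carrier G.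
        \<phi> (x 0) (f (\<lambda>j\<in>{..<q}. x (Suc j))) \<otimes>\<^bsub>A\<^esub>
        (\<Otimes>\<^bsub>A\<^esub>i\<in>{..<q}.
           f (\<lambda>j\<in>{..<q}. if j < i then x j
                          else if j = i then x i \<otimes>\<^bsub>G\<^esub> x (Suc i)
                          else x (Suc j)) [^]\<^bsub>A\<^esub> ((-1) ^ Suc i :: int)) \<otimes>\<^bsub>A\<^esub>
        f (restrict x {..<q}) [^]\<^bsub>A\<^esub> ((-1) ^ Suc q :: int))"

definition cocycles ::
    "('g, 'b) monoid_scheme \<Rightarrow> 'g topology \<Rightarrow> ('m, 'c) monoid_scheme \<Rightarrow> ('g \<Rightarrow> 'm \<Rightarrow> 'm) \<Rightarrow> nat \<Rightarrow>
     ((nat \<Rightarrow> 'g) \<Rightarrow> 'm) set" where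
  "cocycles G T A \<phi> q =
     kernel (cochain_group G T A q) (cochain_group G T A (Suc q)) (coboundary G A \<phi> q)"

fun coboundaries ::
    "('g, 'b) monoid_scheme \<Rightarrow> 'g topology \<Rightarrow> ('m, 'c) monoid_scheme \<Rightarrow> ('g \<Rightarrow> 'm \<Rightarrow> 'm) \<Rightarrow> nat \<Rightarrow>
     ((nat \<Rightarrow> 'g) \<Rightarrow> 'm) set" where
  "coboundaries G T A \<phi> 0 = {\<one>\<^bsub>cochain_group G T A 0\<^esub>}"
| "coboundaries G T A \<phi> (Suc q) = coboundary G A \<phi> q ` carrier (cochain_group G T A q)"

definition cohomology_group ::
    "('g, 'b) monoid_scheme \<Rightarrow> 'g topology \<Rightarrow> ('m, 'c) monoid_scheme \<Rightarrow> ('g \<Rightarrow> 'm \<Rightarrow> 'm) \<Rightarrow> nat \<Rightarrow>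
     ((nat \<Rightarrow> 'g) \<Rightarrow> 'm) set monoid" where
  "cohomology_group G T A \<phi> q =
     (cochain_group G T A q)\<lparr>carrier := cocycles G T A \<phi> q\<rparr> Mod coboundaries G T A \<phi> q"

text \<open>The least \<open>n\<close> such that all torsion modules have zero cohomology in degrees above \<open>n\<close>, and
  \<open>\<infinity>\<close> if there is none. A HOL formula cannot quantify over types, so the type \<open>'m\<close> of the
  elements of the modules is a parameter. An upper bound is meant to be stated with \<open>'m\<close> a type
  variable, that is, for the modules over all types.\<close>

definition cohomological_dimension ::
    "'m itself \<Rightarrow> ('g, 'b) monoid_scheme \<Rightarrow> 'g topology \<Rightarrow> enat" where
  "cohomological_dimension _ G T =
     Inf {enat n | n. \<forall>(A :: 'm monoid) \<phi>. discrete_torsion_module G T A \<phi> \<longrightarrow>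
                        (\<forall>q>n. trivial_group (cohomology_group G T A \<phi> q))}"

end

theory Submission
  imports Defs "HOL-Algebra.SndIsomorphismGrp"
begin

text \<open>The elements of \<open>S = F\<^sub>p[[G]]\<close> are the functionals on the space \<open>C\<close> of locally constant functions from \<open>G\<close> to
  \<open>F\<^sub>p\<close>. Over a Sylvester domain, \<open>X Y = 0\<close> bounds the sum of the inner ranks by the inner dimension. For generators
  \<open>x\<^sub>1, \<dots>, x\<^sub>d\<close> of \<open>G\<close> let \<open>\<delta> : C \<rightarrow> C\<^sup>d\<close> be the map dual to the row \<open>(x\<^sub>i - 1)\<close>. Applied to this row and to a
  matrix of functionals that vanish on the image of \<open>\<delta>\<close>, the bound shows that \<open>(C\<^sup>d / im \<delta>)\<^sup>G\<close> has some dimension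
  \<open>s \<le> d\<close>, and that a basis of it gives an exact sequence \<open>0 \<rightarrow> F\<^sub>p \<rightarrow> C \<rightarrow> C\<^sup>d \<rightarrow> C\<^sup>s \<rightarrow> 0\<close> of coinduced
  modules. Hence \<open>H\<^sup>q(G, F\<^sub>p) = 0\<close> for \<open>q > 2\<close>, and induction on finite submodules extends this to torsion modules.
  If \<open>K\<close> is the kernel of an epimorphism from the free pro-p group of rank \<open>d\<close>, then transgression embeds the
  \<open>G\<close>-invariant characters \<open>K \<rightarrow> F\<^sub>p\<close> into \<open>(C\<^sup>d / im \<delta>)\<^sup>G\<close>, so there are at most \<open>d\<close> independent ones, and the
  elements of a dual system generate \<open>K\<close> as a closed normal subgroup.\<close>

section \<open>Actions of p-groups\<close>

text \<open>Nothing about \<open>H\<^sup>2\<close> is known in advance, and the cokernel of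
  \<open>\<delta>\<close> may be large. What controls both conclusions is the fixed space of this
  cokernel, which maps onto \<open>H\<^sup>2(G, F\<^sub>p)\<close>; the dimension of the latter is
  the least number of relators. The Sylvester condition enters through one dichotomy for a matrix of
  functionals dual to fixed classes. If this matrix factored through a smaller dimension, the
  nullity bound would make the left factor vanish on the image of \<open>\<delta>\<close> as well,
  and evaluation on the fixed classes would turn a factorization over \<open>S\<close> into one of
  an invertible matrix over \<open>F\<^sub>p\<close>. So the matrix has full rank: this bounds the
  dimension by \<open>d\<close>, and the absence of a right kernel is dual to surjectivity of the
  map from \<open>C\<^sup>d\<close> to \<open>C\<^sup>s\<close>. Exactness at
  \<open>C\<^sup>d\<close> has another source: a nonzero finite module of p-power order over a
  p-group has a nonzero fixed vector. Working with \<open>C\<close> instead of \<open>S\<close>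
  keeps all modules discrete, so that this fixed point argument and continuous cochains apply
  directly.\<close>

lemma (in group) int_pow_commute:
 assumes x: "x \<in> carrier G" and y: "y \<in> carrier G" and c: "x \<otimes> y = y \<otimes> x"
 shows "x \<otimes> y [^] (i::int) = y [^] i \<otimes> x"
proof -
 have nat: "x \<otimes> y [^] (n::nat) = y [^] n \<otimes> x" for n
 proof (induction n)
  case (Suc n)
  have "x \<otimes> (y [^] n \<otimes> y) = (y [^] n \<otimes> x) \<otimes> y"
   using Suc x y by (simp flip: m_assoc)
  also have "... = y [^] n \<otimes> y \<otimes> x"
   using c x y by (simp add: m_assoc)
  finally show ?case by simp
 qed (use x in simp)
 show ?thesis
 proof (cases i)
  case (nonneg n)
  thus ?thesis using nat by (simp add: int_pow_int)
 next
  case (neg n)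
  define z where "z = y [^] Suc n"
  have z: "z \<in> carrier G" "x \<otimes> z = z \<otimes> x" unfolding z_def using y nat[of "Suc n"] by simp_all
  have "inv z \<otimes> (x \<otimes> z) \<otimes> inv z = inv z \<otimes> (z \<otimes> x) \<otimes> inv z" using z by simp
  moreover have "inv z \<otimes> (z \<otimes> x) \<otimes> inv z = x \<otimes> inv z"
   using x z(1) by (simp flip: m_assoc)
  moreover have "inv z \<otimes> (x \<otimes> z) \<otimes> inv z = inv z \<otimes> x"
   using x z(1) by (simp add: m_assoc)
  ultimately have "x \<otimes> inv z = inv z \<otimes> x" by simp
  thus ?thesis unfolding neg z_def using y by (simp only: int_pow_neg_int)
 qed
qed

text \<open>Orbit count: if \<open>e0\<close> were the only fixed point, the size of every other
  orbit would be a positive power of \<open>p\<close>, and \<open>card E\<close> would be 1 modulo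
  \<open>p\<close>.\<close>

lemma (in group_action) p_group_fixed_point:
 assumes "prime p" "order G = p ^ k" "finite E" "p dvd card E"
  and "e0 \<in> E" "!!g. g \<in> carrier G ==> \<phi> g e0 = e0"
 shows "\<exists>e\<in>E. e ~= e0 \<and> (\<forall>g\<in>carrier G. \<phi> g e = e)"
proof (rule ccontr)
 assume no: "\<not> ?thesis"
 interpret G: group G using group_hom group_hom.axioms(1) by blast
 have orb0: "orbit G \<phi> e0 = {e0}"
  unfolding orbit_def using assms(6) by (auto intro: exI[of _ "\<one>"])
 have fin: "finite (orbits G E \<phi>)"
  unfolding orbits_def using assms(3) by simp
 have in0: "{e0} \<in> orbits G E \<phi>"
  unfolding orbits_def using assms(5) orb0 by auto
 have others: "p dvd card X" if X: "X \<in> orbits G E \<phi> - {{e0}}" for X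
 proof -
  obtain x where x: "x \<in> E" "X = orbit G \<phi> x"
   using X unfolding orbits_def by auto
  have "card X dvd p ^ k"
   using orbit_stabilizer_theorem[OF x(1)] assms(2) x(2) by (metis dvd_triv_left)
  then obtain j where j: "card X = p ^ j"
   using assms(1) divides_primepow_nat by blast
  have "j ~= 0"
  proof
   assume "j = 0"
   hence "card X = 1" using j by simp
   moreover have "x \<in> X" using orbit_refl x by blast
   ultimately have X1: "X = {x}" by (metis card_1_singletonE singletonD)
   hence "\<forall>g\<in>carrier G. \<phi> g x = x"
    using x(2) unfolding orbit_def by auto
   hence "x = e0" using no x(1) by blast
   thus False using X X1 by blast
  qed
  thus ?thesis using j by simp
 qed
 have "card E = (\<Sum>X\<in>orbits G E \<phi>. card X)"
  using disjoint_sum[OF assms(3), of "%_. 1::nat"] by simp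
 also have "... = 1 + (\<Sum>X\<in>orbits G E \<phi> - {{e0}}. card X)"
  by (subst sum.remove[OF fin in0]) simp
 finally have "p dvd 1 + (\<Sum>X\<in>orbits G E \<phi> - {{e0}}. card X)"
  using assms(4) by simp
 moreover have "p dvd (\<Sum>X\<in>orbits G E \<phi> - {{e0}}. card X)"
  using others by (rule dvd_sum)
 ultimately have "p dvd 1" using dvd_add_left_iff by blast
 thus False using assms(1) by simp
qed

text \<open>A pro-p group is infinite in general, so the orbit count cannot be applied to
  \<open>G\<close> itself. Since \<open>U\<close> acts trivially, the homomorphism into
  \<open>BijGroup E\<close> factors through \<open>G Mod U\<close>, whose order is a power of
  \<open>p\<close>.\<close>

lemma p_group_fixed_point_mod:
 fixes \<alpha> :: "'g => 'e => 'e"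
 assumes "prime p" "U \<lhd> G" "card (rcosets\<^bsub>G\<^esub> U) = p ^ k" "finite E" "p dvd card E"
  and "e0 \<in> E" "!!g. g \<in> carrier G ==> \<alpha> g e0 = e0"
  and closed: "!!g e. g \<in> carrier G ==> e \<in> E ==> \<alpha> g e \<in> E"
  and comp: "!!g h e. g \<in> carrier G ==> h \<in> carrier G ==> e \<in> E ==>
         \<alpha> (g \<otimes>\<^bsub>G\<^esub> h) e = \<alpha> g (\<alpha> h e)"
  and triv: "!!u e. u \<in> U ==> e \<in> E ==> \<alpha> u e = e"
 shows "\<exists>e\<in>E. e ~= e0 \<and> (\<forall>g\<in>carrier G. \<alpha> g e = e)"
proof -
 interpret normal U G by fact
 have one: "\<alpha> \<one>\<^bsub>G\<^esub> e = e" if "e \<in> E" for e using triv that by simp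
 \<comment> \<open>Restricted to \<open>E\<close>, because the elements of \<open>BijGroup E\<close>
   are extensional.\<close>
 let ?h = "%g. \<lambda>e\<in>E. \<alpha> g e"
 have bij: "bij_betw (?h g) E E" if "g \<in> carrier G" for g
 proof (rule bij_betwI[where g = "\<alpha> (inv\<^bsub>G\<^esub> g)"])
  show "?h g \<in> E \<rightarrow> E" "\<alpha> (inv\<^bsub>G\<^esub> g) \<in> E \<rightarrow> E" using closed that by auto
  show "\<alpha> (inv\<^bsub>G\<^esub> g) (?h g x) = x" if "x \<in> E" for x
   using that \<open>g \<in> carrier G\<close> comp[of "inv\<^bsub>G\<^esub> g" g x] one by simp
  show "?h g (\<alpha> (inv\<^bsub>G\<^esub> g) x) = x" if "x \<in> E" for x
   using that \<open>g \<in> carrier G\<close> comp[of g "inv\<^bsub>G\<^esub> g" x] one closed by simp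
 qed
 have hom: "?h \<in> hom G (BijGroup E)"
 proof (rule homI)
  show "?h g \<in> carrier (BijGroup E)" if "g \<in> carrier G" for g
   using bij[OF that] by (simp add: BijGroup_def Bij_def)
  show "?h (g \<otimes>\<^bsub>G\<^esub> h) = ?h g \<otimes>\<^bsub>BijGroup E\<^esub> ?h h"
   if "g \<in> carrier G" "h \<in> carrier G" for g h
  proof -
   have "?h g \<in> Bij E" "?h h \<in> Bij E" using bij that by (auto simp: Bij_def)
   hence "?h g \<otimes>\<^bsub>BijGroup E\<^esub> ?h h = compose E (?h g) (?h h)"
    by (simp add: BijGroup_def)
   also have "... = ?h (g \<otimes>\<^bsub>G\<^esub> h)"
    using that comp closed by (auto simp: compose_def fun_eq_iff)
   finally show ?thesis by simp
  qed
 qed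
 have "?h x = ?h y" if "x \<in> carrier G" "y \<in> carrier G" "U #>\<^bsub>G\<^esub> x = U #>\<^bsub>G\<^esub> y" for x y
 proof -
  have "x \<in> U #>\<^bsub>G\<^esub> y" using that rcos_self subgroup_axioms by metis
  then obtain u where u: "u \<in> U" "x = u \<otimes>\<^bsub>G\<^esub> y" by (auto simp: r_coset_def)
  show ?thesis
  proof (rule restrict_ext)
   fix e assume "e \<in> E"
   thus "\<alpha> x e = \<alpha> y e"
    using u comp[of u y e] triv closed that by auto
  qed
 qed
 with hom obtain \<psi> where \<psi>: "\<psi> \<in> hom (G Mod U) (BijGroup E)"
  "!!x. x \<in> carrier G ==> \<psi> (U #>\<^bsub>G\<^esub> x) = ?h x"
  using FactGroup_universal[OF hom normal_axioms] by blast
 interpret A: group_action "G Mod U" E \<psi>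
  using \<psi>(1) factorgroup_is_group group_BijGroup
  by (simp add: group_action_def group_hom_def group_hom_axioms_def)
 have "\<exists>e\<in>E. e ~= e0 \<and> (\<forall>D\<in>carrier (G Mod U). \<psi> D e = e)"
  using assms(3,6,7)
  by (intro A.p_group_fixed_point[OF assms(1) _ assms(4,5)])
    (auto simp: order_def FactGroup_def RCOSETS_def \<psi>(2))
 then obtain e where e: "e \<in> E" "e ~= e0" "!!D. D \<in> carrier (G Mod U) ==> \<psi> D e = e"
  by blast
 have "\<alpha> g e = e" if "g \<in> carrier G" for g
  using e(3)[of "U #>\<^bsub>G\<^esub> g"] \<psi>(2)[OF that] e(1) that by (simp add: carrier_FactGroup)
 thus ?thesis using e by blast
qed

text \<open>The action of \<open>G\<close> on \<open>M / L\<close> factors through the finite p-group \<open>G / U\<close>.\<close>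

locale p_action_mod =
 fixes p :: nat and M :: "('m, 'c) monoid_scheme" (structure) and L :: "'m set"
  and G :: "('g, 'd) monoid_scheme" and U :: "'g set" and k :: nat
  and act :: "'g => 'm => 'm"
 assumes prime_p: "prime p" and L_normal: "L \<lhd> M"
  and finite_index: "finite (rcosets L)" and L_proper: "L ~= carrier M"
  and p_power: "m \<in> carrier M ==> \<exists>j. m [^] (p ^ j :: nat) \<in> L"
  and U_normal: "U \<lhd> G" and U_index: "card (rcosets\<^bsub>G\<^esub> U) = p ^ k"
  and act_hom: "g \<in> carrier G ==> act g \<in> hom M M"
  and act_mult: "[|g \<in> carrier G; h \<in> carrier G; m \<in> carrier M|] ==>
     act (g \<otimes>\<^bsub>G\<^esub> h) m = act g (act h m)"
  and act_L: "[|g \<in> carrier G; l \<in> L|] ==> act g l \<in> L"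
  and act_U: "[|u \<in> U; m \<in> carrier M|] ==> act u m \<otimes> inv m \<in> L"
begin

sublocale L: normal L M by (fact L_normal)
sublocale U: normal U G by (fact U_normal)

abbreviation Q where "Q \<equiv> M Mod L"

sublocale Q: group Q by (fact L.factorgroup_is_group)

lemma act_closed [simp]: "[|g \<in> carrier G; m \<in> carrier M|] ==> act g m \<in> carrier M"
 using act_hom by (auto simp: hom_def)

lemma coset_eq_iff:
 assumes "a \<in> carrier M" "b \<in> carrier M"
 shows "L #> a = L #> b \<longleftrightarrow> a \<otimes> inv b \<in> L"
proof
 assume "L #> a = L #> b"
 hence "a \<in> L #> b" using assms L.rcos_self L.subgroup_axioms by metis
 thus "a \<otimes> inv b \<in> L" using assms L.rcos_module by (metis L.is_group)
next
 assume "a \<otimes> inv b \<in> L"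
 hence "a \<in> L #> b" using assms L.rcos_module by (metis L.is_group)
 thus "L #> a = L #> b"
  using assms L.repr_independence L.subgroup_axioms by metis
qed

lemma coset_L_iff: "a \<in> carrier M ==> L #> a = L \<longleftrightarrow> a \<in> L"
 using L.coset_join1 L.coset_join2 L.subgroup_axioms L.subset by metis

lemma coset_in_Q [simp]: "a \<in> carrier M ==> L #> a \<in> carrier Q"
 by (auto simp: carrier_FactGroup)

lemma coset_hom: "(%a. L #> a) \<in> hom M Q" by (rule L.r_coset_hom_Mod)

lemma coset_mult: "[|a \<in> carrier M; b \<in> carrier M|] ==>
  L #> (a \<otimes> b) = (L #> a) \<otimes>\<^bsub>Q\<^esub> (L #> b)"
 using coset_hom by (simp only: hom_mult)

lemma coset_pow: "a \<in> carrier M ==> L #> (a [^] (n::nat)) = (L #> a) [^]\<^bsub>Q\<^esub> n"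
 using hom_nat_pow[OF coset_hom _ L.is_group Q.is_group, of a n] by simp

lemma coset_act_cong:
 assumes "g \<in> carrier G" "a \<in> carrier M" "b \<in> carrier M" "L #> a = L #> b"
 shows "L #> act g a = L #> act g b"
proof -
 interpret h: group_hom M M "act g"
  using act_hom[OF assms(1)] by (simp add: group_hom_def group_hom_axioms_def L.is_group)
 have "a \<otimes> inv b \<in> L" using assms coset_eq_iff by simp
 hence "act g (a \<otimes> inv b) \<in> L" using act_L assms(1) by simp
 thus ?thesis using assms coset_eq_iff by simp
qed

definition fixed :: "'m => bool" where
 "fixed m \<longleftrightarrow> m \<in> carrier M \<and> (\<forall>g\<in>carrier G. act g m \<otimes> inv m \<in> L)"

lemma fixed_iff: "fixed m \<longleftrightarrow> m \<in> carrier M \<and> (\<forall>g\<in>carrier G. L #> act g m = L #> m)"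
 unfolding fixed_def by (simp add: coset_eq_iff cong: conj_cong)

lemma fixed_pow:
 assumes "fixed m" shows "fixed (m [^] (n::nat))"
proof -
 have m: "m \<in> carrier M" using assms fixed_def by simp
 have "act g (m [^] n) = act g m [^] n" if "g \<in> carrier G" for g
  using hom_nat_pow[OF act_hom[OF that] m L.is_group L.is_group] .
 thus ?thesis using assms m by (simp add: fixed_iff coset_pow)
qed

text \<open>The order of any nontrivial coset is a positive power of \<open>p\<close> by
  \<open>p_power\<close>, and it divides the order of the quotient.\<close>

lemma p_dvd_index: "p dvd card (rcosets L)"
proof -
 obtain m where m: "m \<in> carrier M" "m \<notin> L" using L_proper L.subset by blast
 obtain j where j: "m [^] (p ^ j :: nat) \<in> L" using p_power m by blast
 let ?C = "L #> m"
 have C: "?C \<in> carrier Q" using m by simp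
 have "?C [^]\<^bsub>Q\<^esub> (p ^ j :: nat) = \<one>\<^bsub>Q\<^esub>" using j m coset_pow coset_L_iff by (metis L.mem_carrier one_FactGroup)
 hence "Q.ord ?C dvd p ^ j" using Q.pow_eq_id C by blast
 then obtain i where i: "Q.ord ?C = p ^ i" using prime_p divides_primepow_nat by blast
 have "i ~= 0" using i C m coset_L_iff Q.ord_eq_1 by (metis one_FactGroup power_0)
 hence "p dvd Q.ord ?C" using i by simp
 also have "Q.ord ?C dvd order Q" using Q.ord_dvd_group_order C by blast
 finally show ?thesis by (simp add: order_def FactGroup_def)
qed

text \<open>The cosets of \<open>L\<close> form a finite set with the fixed point \<open>L\<close>
  and with size divisible by \<open>p\<close>, so there is a second fixed coset. A suitable power of
  it has order exactly \<open>p\<close>.\<close>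

lemma fixed_coset:
 "\<exists>m. fixed m \<and> m \<notin> L \<and> m [^] p \<in> L"
proof -
 define rep :: "'m set => 'm" where "rep C = (SOME a. a \<in> carrier M \<and> C = L #> a)" for C
 have rep: "rep C \<in> carrier M" "L #> rep C = C" if "C \<in> rcosets L" for C
  using someI_ex[of "%a. a \<in> carrier M \<and> C = L #> a"] that
  by (auto simp: rep_def RCOSETS_def)
 define \<alpha> where "\<alpha> g C = L #> act g (rep C)" for g C
 have \<alpha>: "\<alpha> g (L #> a) = L #> act g a" if "g \<in> carrier G" "a \<in> carrier M" for g a
  unfolding \<alpha>_def using that coset_act_cong rep
  by (metis L.rcosetsI L.subset)
 have cos: "\<exists>a\<in>carrier M. C = L #> a" if "C \<in> rcosets L" for C
  using that by (auto simp: RCOSETS_def)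
 have "\<exists>C\<in>rcosets L. C ~= L \<and> (\<forall>g\<in>carrier G. \<alpha> g C = C)"
 proof (rule p_group_fixed_point_mod[OF prime_p U_normal U_index finite_index p_dvd_index])
  show "L \<in> rcosets L" by (rule L.subgroup_in_rcosets) (rule L.is_group)
  show "\<alpha> g L = L" if "g \<in> carrier G" for g
   using \<alpha>[OF that L.one_closed] that act_L coset_L_iff
   by (metis L.one_closed act_closed coset_L_iff subgroup.one_closed L.subgroup_axioms)
  show "\<alpha> g C \<in> rcosets L" if "g \<in> carrier G" "C \<in> rcosets L" for g C
   unfolding \<alpha>_def using that rep by (simp add: L.rcosetsI L.subset)
  show "\<alpha> (g \<otimes>\<^bsub>G\<^esub> h) C = \<alpha> g (\<alpha> h C)"
   if "g \<in> carrier G" "h \<in> carrier G" "C \<in> rcosets L" for g h C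
   using cos[OF that(3)] that \<alpha> act_mult by auto
  show "\<alpha> u C = C" if uC: "u \<in> U" "C \<in> rcosets L" for u C
  proof -
   obtain a where a: "a \<in> carrier M" "C = L #> a" using cos[OF uC(2)] ..
   thus ?thesis using uC(1) by (simp add: \<alpha> coset_eq_iff act_U)
  qed
 qed
 then obtain m where m: "m \<in> carrier M" "m \<notin> L" "fixed m"
  unfolding fixed_iff using cos \<alpha> coset_L_iff by metis
 \<comment> \<open>Minimality of \<open>j\<close> puts the power with exponent
   \<open>p ^ (j - 1)\<close> outside \<open>L\<close> and its \<open>p\<close>-th power inside;
   powers of fixed elements stay fixed.\<close>
 define j where "j = (LEAST j. m [^] (p ^ j :: nat) \<in> L)"
 have j: "m [^] (p ^ j :: nat) \<in> L" unfolding j_def using p_power[OF m(1)] by (rule LeastI_ex)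
 have "j ~= 0" using j m by (metis L.nat_pow_eone power_0)
 then obtain i where i: "j = Suc i" by (cases j) auto
 have "m [^] (p ^ i :: nat) \<notin> L" using not_less_Least i unfolding j_def by (metis lessI)
 moreover have "(m [^] (p ^ i :: nat)) [^] p \<in> L"
  using j i m by (simp add: L.nat_pow_pow mult.commute)
 ultimately show ?thesis using fixed_pow m by blast
qed

end

text \<open>If \<open>L\<close> is a maximal invariant subgroup then \<open>M / L\<close> is cyclic of order \<open>p\<close> with trivial
 action, which is recorded by a character \<open>\<xi>\<close> with values in the integers modulo \<open>p\<close>.\<close>

locale p_action_mod_maximal = p_action_mod +
 assumes fixed_central: "[|fixed m; x \<in> carrier M|] ==>
   x \<otimes> m \<otimes> inv x \<otimes> inv m \<in> L"
  and maximal: "[|L' \<lhd> M; L \<subseteq> L'; L' ~= L; !!g l. g \<in> carrier G ==> l \<in> L' ==> act g l \<in> L'|]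
   ==> L' = carrier M"
begin

context
 notes mult_FactGroup [simp del] one_FactGroup [simp del]
begin

text \<open>The fixed coset \<open>C\<close> of order \<open>p\<close> is central, so its powers
  form a normal invariant subgroup, and by maximality the preimage of this subgroup is all of
  \<open>M\<close>. The character is the discrete logarithm to the base \<open>C\<close>. Centrality
  comes from \<open>fixed_central\<close>, which covers both a commutative \<open>M\<close> and a
  normal subgroup on which a larger group acts by conjugation.\<close>

lemma invariant_character:
 "\<exists>m0\<in>carrier M. \<exists>\<xi>::_ => int.
   (\<forall>a\<in>carrier M. \<forall>b\<in>carrier M. [\<xi> (a \<otimes> b) = \<xi> a + \<xi> b] (mod int p)) \<and>
   (\<forall>a\<in>carrier M. a \<in> L \<longleftrightarrow> [\<xi> a = 0] (mod int p)) \<and> [\<xi> m0 = 1] (mod int p) \<and>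
   (\<forall>g\<in>carrier G. \<forall>a\<in>carrier M. [\<xi> (act g a) = \<xi> a] (mod int p))"
proof -
 obtain m where m: "fixed m" "m \<notin> L" "m [^] p \<in> L" using fixed_coset by blast
 have mM: "m \<in> carrier M" using m(1) by (simp add: fixed_iff)
 define C where "C = L #> m"
 have C: "C \<in> carrier Q" by (simp add: C_def mM)
 have "C [^]\<^bsub>Q\<^esub> p = \<one>\<^bsub>Q\<^esub>"
  using m(3) coset_pow[OF mM, of p] coset_L_iff[of "m [^] p"] mM by (simp add: C_def one_FactGroup)
 moreover have "C ~= \<one>\<^bsub>Q\<^esub>" using m(2) mM coset_L_iff by (simp add: C_def one_FactGroup)
 ultimately have ord: "Q.ord C = p"
  using Q.pow_eq_id[OF C] Q.ord_eq_1[OF C] prime_p by (metis prime_nat_iff)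
 have central: "(L #> x) \<otimes>\<^bsub>Q\<^esub> C = C \<otimes>\<^bsub>Q\<^esub> (L #> x)" if x: "x \<in> carrier M" for x
 proof -
  have "(x \<otimes> m) \<otimes> inv (m \<otimes> x) \<in> L"
   using fixed_central[OF m(1) x] x mM by (simp add: L.inv_mult_group L.m_assoc)
  hence "L #> (x \<otimes> m) = L #> (m \<otimes> x)"
   using coset_eq_iff x mM by simp
  thus ?thesis using x mM by (simp add: coset_mult C_def)
 qed
 define L' where "L' = {x \<in> carrier M. \<exists>i::int. L #> x = C [^]\<^bsub>Q\<^esub> i}"
 have L'I: "x \<in> L'" if "x \<in> carrier M" "L #> x = C [^]\<^bsub>Q\<^esub> (i::int)" for x i
  using that unfolding L'_def by auto
 have coset_inv: "L #> (inv x) = inv\<^bsub>Q\<^esub> (L #> x)" if "x \<in> carrier M" for x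
 proof -
  interpret h: group_hom M Q "%a. L #> a"
   using coset_hom by (simp add: group_hom_def group_hom_axioms_def L.is_group Q.is_group)
  show ?thesis using that by simp
 qed
 have sub: "subgroup L' M"
 proof (rule L.subgroupI)
  show "L' \<subseteq> carrier M" by (auto simp: L'_def)
  have "L #> \<one> = C [^]\<^bsub>Q\<^esub> (0::int)" using coset_L_iff by (simp add: one_FactGroup)
  thus "L' ~= {}" unfolding L'_def by blast
  show "inv a \<in> L'" if aL: "a \<in> L'" for a
  proof -
   obtain i where "L #> a = C [^]\<^bsub>Q\<^esub> (i::int)" and a: "a \<in> carrier M"
    using aL unfolding L'_def by blast
   hence "L #> inv a = C [^]\<^bsub>Q\<^esub> (- i)"
    using coset_inv Q.int_pow_neg[OF C] by simp
   thus ?thesis unfolding L'_def using a by blast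
  qed
  show "a \<otimes> b \<in> L'" if abL: "a \<in> L'" "b \<in> L'" for a b
  proof -
   obtain i j where "L #> a = C [^]\<^bsub>Q\<^esub> (i::int)" "L #> b = C [^]\<^bsub>Q\<^esub> (j::int)"
    and ab: "a \<in> carrier M" "b \<in> carrier M"
    using abL unfolding L'_def by blast
   hence "L #> (a \<otimes> b) = C [^]\<^bsub>Q\<^esub> (i + j)"
    using coset_mult Q.int_pow_mult[OF C] by simp
   thus ?thesis unfolding L'_def using ab by blast
  qed
 qed
 have pow_central: "D \<otimes>\<^bsub>Q\<^esub> C [^]\<^bsub>Q\<^esub> (i::int) = C [^]\<^bsub>Q\<^esub> i \<otimes>\<^bsub>Q\<^esub> D" if D: "D \<in> carrier Q" for D i
 proof -
  obtain x where x: "x \<in> carrier M" "D = L #> x" using D by (auto simp: carrier_FactGroup)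
  thus ?thesis using C D central[OF x(1)] by (intro Q.int_pow_commute) simp_all
 qed
 have "L' \<lhd> M"
 proof (rule L.normal_invI[OF sub])
  fix x y assume "x \<in> carrier M" "y \<in> L'"
  then obtain i where i: "L #> y = C [^]\<^bsub>Q\<^esub> (i::int)" and y: "y \<in> carrier M" and x: "x \<in> carrier M"
   unfolding L'_def by blast
  have "L #> (x \<otimes> y \<otimes> inv x)
    = C [^]\<^bsub>Q\<^esub> i \<otimes>\<^bsub>Q\<^esub> (L #> x) \<otimes>\<^bsub>Q\<^esub> inv\<^bsub>Q\<^esub> (L #> x)"
   using x y i pow_central[of "L #> x" i] coset_inv by (simp add: coset_mult)
  also have "... = C [^]\<^bsub>Q\<^esub> i" using x C by (simp add: Q.m_assoc)
  finally show "x \<otimes> y \<otimes> inv x \<in> L'" unfolding L'_def using x y by auto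
 qed
 moreover have "L \<subseteq> L'"
 proof
  fix x assume x: "x \<in> L"
  hence "L #> x = C [^]\<^bsub>Q\<^esub> (0::int)" using coset_L_iff by (simp add: one_FactGroup)
  thus "x \<in> L'" by (rule L'I[OF L.mem_carrier[OF x]])
 qed
 moreover have "L' ~= L"
 proof -
  have "L #> m = C [^]\<^bsub>Q\<^esub> (1::int)" by (simp only: Q.int_pow_1[OF C]) (simp only: C_def)
  with mM have "m \<in> L'" by (rule L'I)
  thus ?thesis using m(2) by auto
 qed
 moreover have act_coset: "L #> act g x = L #> x"
  if g: "g \<in> carrier G" and x: "x \<in> carrier M" "L #> x = C [^]\<^bsub>Q\<^esub> (i::int)" for g x i
 proof -
  have pw: "L #> (y [^] i) = (L #> y) [^]\<^bsub>Q\<^esub> i" if "y \<in> carrier M" for y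
   using hom_int_pow[OF coset_hom that L.is_group Q.is_group] .
  have "L #> x = L #> (m [^] i)" using pw mM x by (simp add: C_def)
  hence "L #> act g x = L #> act g (m [^] i)"
   using coset_act_cong[OF g x(1)] mM by simp
  also have "... = (L #> act g m) [^]\<^bsub>Q\<^esub> i"
   using hom_int_pow[OF act_hom[OF g] mM L.is_group L.is_group] pw g mM by simp
  also have "... = L #> x" using m(1) g x by (simp add: fixed_iff C_def)
  finally show ?thesis .
 qed
 ultimately have L': "L' = carrier M"
  by (intro maximal) (auto simp: L'_def)
 \<comment> \<open>The exponent is determined only modulo \<open>p\<close>, the order of
   \<open>C\<close>; this is why the properties of \<open>\<xi>\<close> are congruences.\<close>
 define \<xi> where "\<xi> a = (SOME i::int. L #> a = C [^]\<^bsub>Q\<^esub> i)" for a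
 have \<xi>: "L #> a = C [^]\<^bsub>Q\<^esub> \<xi> a" if "a \<in> carrier M" for a
  unfolding \<xi>_def by (rule someI_ex) (use that L' L'_def in auto)
 have eq: "[i = j] (mod int p)" if "C [^]\<^bsub>Q\<^esub> i = C [^]\<^bsub>Q\<^esub> j" for i j :: int
  using Q.int_pow_eq[OF C, of i j] that ord by (simp add: cong_iff_dvd_diff dvd_diff_commute)
 have "[\<xi> (a \<otimes> b) = \<xi> a + \<xi> b] (mod int p)" if "a \<in> carrier M" "b \<in> carrier M" for a b
  using that \<xi>[of a] \<xi>[of b] \<xi>[of "a \<otimes> b"] by (intro eq) (simp add: coset_mult Q.int_pow_mult[OF C])
 moreover have "a \<in> L \<longleftrightarrow> [\<xi> a = 0] (mod int p)" if "a \<in> carrier M" for a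
  using that \<xi>[OF that] coset_L_iff[OF that] Q.int_pow_eq_id[OF C, of "\<xi> a"] ord
  by (simp add: cong_0_iff one_FactGroup)
 moreover have "[\<xi> m = 1] (mod int p)"
  using \<xi>[OF mM] C by (intro eq) (simp add: C_def)
 moreover have "[\<xi> (act g a) = \<xi> a] (mod int p)" if "g \<in> carrier G" "a \<in> carrier M" for g a
  using \<xi>[OF that(2)] \<xi>[of "act g a"] act_coset[OF that \<xi>[OF that(2)]] that by (intro eq) simp
 ultimately show ?thesis using mM by blast
qed

end

end

section \<open>Pro-p groups\<close>

context topological_group
begin

lemma continuous_map_right: "a \<in> carrier G ==> continuous_map T T (%x. x \<otimes> a)"
proof -
 assume "a \<in> carrier G"
 hence "continuous_map T (prod_topology T T) (%x. (x, a))"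
  by (simp add: continuous_map_pairwise o_def topspace_eq)
 from continuous_map_compose[OF this continuous_mult] show ?thesis by (simp add: o_def)
qed

lemma r_coset_vimage:
 assumes "A \<subseteq> carrier G" "a \<in> carrier G"
 shows "A #> a = {x \<in> carrier G. x \<otimes> inv a \<in> A}"
proof
 show "A #> a \<subseteq> {x \<in> carrier G. x \<otimes> inv a \<in> A}"
  using assms by (auto simp: r_coset_def m_assoc subsetD)
 show "{x \<in> carrier G. x \<otimes> inv a \<in> A} \<subseteq> A #> a"
 proof
  fix x assume "x \<in> {x \<in> carrier G. x \<otimes> inv a \<in> A}"
  hence "x = (x \<otimes> inv a) \<otimes> a" "x \<otimes> inv a \<in> A" using assms by (auto simp: m_assoc)
  thus "x \<in> A #> a" unfolding r_coset_def by blast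
 qed
qed

lemma openin_r_coset: "openin T A ==> a \<in> carrier G ==> openin T (A #> a)"
 using openin_continuous_map_preimage[OF continuous_map_right, of "inv a" A] openin_subset[of T A]
 by (simp add: r_coset_vimage topspace_eq)

lemma closedin_r_coset: "closedin T A ==> a \<in> carrier G ==> closedin T (A #> a)"
 using closedin_continuous_map_preimage[OF continuous_map_right, of "inv a" A] closedin_subset[of T A]
 by (simp add: r_coset_vimage topspace_eq)

lemma open_subgroup_closed:
 assumes "subgroup U G" "openin T U" shows "closedin T U"
proof -
 have "carrier G - U = (\<Union>a\<in>carrier G - U. U #> a)"
 proof
  show "carrier G - U \<subseteq> (\<Union>a\<in>carrier G - U. U #> a)"
   using rcos_self assms(1) by blast
  show "(\<Union>a\<in>carrier G - U. U #> a) \<subseteq> carrier G - U"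
  proof
   fix x assume "x \<in> (\<Union>a\<in>carrier G - U. U #> a)"
   then obtain a u where au: "a \<in> carrier G" "a \<notin> U" "u \<in> U" "x = u \<otimes> a"
    by (auto simp: r_coset_def)
   have u: "u \<in> carrier G" using au subgroup.mem_carrier[OF assms(1)] by blast
   have "inv u \<otimes> x = a" using au u by (simp flip: m_assoc)
   hence "x \<notin> U" using au assms(1) by (metis subgroup.m_closed subgroup.m_inv_closed)
   thus "x \<in> carrier G - U" using au u by simp
  qed
 qed
 moreover have "openin T (\<Union>a\<in>carrier G - U. U #> a)"
  using openin_r_coset[OF assms(2)] by (intro openin_Union) auto
 ultimately show ?thesis
  using assms openin_subset[OF assms(2)] by (simp add: closedin_def topspace_eq)
qed

end

context profinite_group
begin

abbreviation \<U> where "\<U> \<equiv> open_normal_subgroups G T"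

text \<open>The connected component of \<open>x\<close> is \<open>{x}\<close>, and in a compact
  Hausdorff space a component contained in an open set has a clopen neighbourhood inside that
  set.\<close>

lemma clopen_basis:
 assumes W: "openin T W" and x: "x \<in> W"
 obtains K where "openin T K" "closedin T K" "x \<in> K" "K \<subseteq> W"
proof -
 have xt: "x \<in> topspace T" using W x openin_subset by blast
 have "connectedin T (connected_component_of_set T x)"
  by (simp add: connectedin_connected_component_of)
 then obtain y where "connected_component_of_set T x \<subseteq> {y}" using totally_disconnected by blast
 moreover have "x \<in> connected_component_of_set T x" using xt by (simp add: connected_component_of_refl)
 ultimately have cx: "connected_component_of_set T x = {x}" by auto
 have "{x} \<in> connected_components_of T"
  using xt cx unfolding connected_components_of_def by blast
 moreover have "locally_compact_space T" using compact by (simp add: compact_imp_locally_compact_space)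
 ultimately obtain A B where AB: "openin T A" "openin T B" "disjnt A B" "A \<union> B = topspace T"
   "{x} \<subseteq> A" "A \<subseteq> W"
  using wilder_locally_compact_component_thm[of T "{x}" W] Hausdorff W x xt by auto
 have "A = topspace T - B" using AB by (auto simp: disjnt_iff)
 hence "closedin T A" using closedin_diff[OF closedin_topspace AB(2)] by simp
 thus thesis using that AB by simp
qed

text \<open>For a clopen set \<open>K\<close>, the set of all \<open>g\<close> such that \<open>x g y \<in> K \<longleftrightarrow> x y \<in> K\<close> for all \<open>x\<close> and
 \<open>y\<close> is a normal subgroup. It is open because \<open>G \<times> G\<close> is compact.\<close>

lemma open_normal_subgroup_basis:
 assumes W: "openin T W" and 1: "\<one> \<in> W"
 obtains U where "U \<in> \<U>" "U \<subseteq> W"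
proof -
 obtain K where K: "openin T K" "closedin T K" "\<one> \<in> K" "K \<subseteq> W"
  using clopen_basis[OF W 1] .
 define U where "U = {g \<in> carrier G. \<forall>x\<in>carrier G. \<forall>y\<in>carrier G. x \<otimes> g \<otimes> y \<in> K \<longleftrightarrow> x \<otimes> y \<in> K}"
 have sub: "subgroup U G"
 proof (rule subgroupI)
  show "U \<subseteq> carrier G" by (auto simp: U_def)
  show "U ~= {}" unfolding U_def using one_closed by (force simp: m_assoc)
  show "inv a \<in> U" if a: "a \<in> U" for a
  proof -
   have aG: "a \<in> carrier G" using a by (simp add: U_def)
   have "x \<otimes> inv a \<otimes> y \<in> K \<longleftrightarrow> x \<otimes> y \<in> K" if "x \<in> carrier G" "y \<in> carrier G" for x y
   proof -
    have "x \<otimes> inv a \<otimes> a \<otimes> y \<in> K \<longleftrightarrow> x \<otimes> inv a \<otimes> y \<in> K"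
     using a that aG unfolding U_def by simp
    thus ?thesis using that aG by (simp add: m_assoc)
   qed
   thus ?thesis using aG by (simp add: U_def)
  qed
  show "a \<otimes> b \<in> U" if ab: "a \<in> U" "b \<in> U" for a b
  proof -
   have abG: "a \<in> carrier G" "b \<in> carrier G" using ab by (auto simp: U_def)
   have "x \<otimes> (a \<otimes> b) \<otimes> y \<in> K \<longleftrightarrow> x \<otimes> y \<in> K" if "x \<in> carrier G" "y \<in> carrier G" for x y
   proof -
    have "x \<otimes> a \<otimes> (b \<otimes> y) \<in> K \<longleftrightarrow> x \<otimes> (b \<otimes> y) \<in> K"
     using ab that abG unfolding U_def by simp
    moreover have "x \<otimes> b \<otimes> y \<in> K \<longleftrightarrow> x \<otimes> y \<in> K"
     using ab that abG unfolding U_def by simp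
    ultimately show ?thesis using that abG by (simp add: m_assoc)
   qed
   thus ?thesis using abG by (simp add: U_def)
  qed
 qed
 have normal: "U \<lhd> G"
 proof (rule normal_invI[OF sub])
  fix a g assume a: "a \<in> carrier G" and g: "g \<in> U"
  have gG: "g \<in> carrier G" using g by (simp add: U_def)
  have "x \<otimes> (a \<otimes> g \<otimes> inv a) \<otimes> y \<in> K \<longleftrightarrow> x \<otimes> y \<in> K" if xy: "x \<in> carrier G" "y \<in> carrier G" for x y
  proof -
   have "(x \<otimes> a) \<otimes> g \<otimes> (inv a \<otimes> y) \<in> K \<longleftrightarrow> (x \<otimes> a) \<otimes> (inv a \<otimes> y) \<in> K"
    using g a xy unfolding U_def by simp
   moreover have "(x \<otimes> a) \<otimes> (inv a \<otimes> y) = x \<otimes> y"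
    using a xy by (metis inv_closed m_assoc m_closed r_inv r_one)
   ultimately show ?thesis using a xy gG by (simp add: m_assoc)
  qed
  thus "a \<otimes> g \<otimes> inv a \<in> U" using a gG by (simp add: U_def)
 qed
 define P where "P = prod_topology T (prod_topology T T)"
 have cg: "continuous_map P T (%z. fst z)" and cx: "continuous_map P T (%z. fst (snd z))"
  and cy: "continuous_map P T (%z. snd (snd z))"
  unfolding P_def
  by (intro continuous_map_fst continuous_map_compose[OF continuous_map_snd, unfolded o_def]
    continuous_map_snd continuous_map_fst)+
 have mult: "continuous_map P T (%z. f z \<otimes> h z)" if "continuous_map P T f" "continuous_map P T h" for f h
 proof -
  have "continuous_map P (prod_topology T T) (%z. (f z, h z))" using that by (simp add: continuous_map_paired)
  from continuous_map_compose[OF this continuous_mult] show ?thesis by (simp add: o_def)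
 qed
 let ?m3 = "%z. fst (snd z) \<otimes> fst z \<otimes> snd (snd z)"
 let ?m2 = "%z. fst (snd z) \<otimes> snd (snd z)"
 have c3: "continuous_map P T ?m3" and c2: "continuous_map P T ?m2"
  by (intro mult cg cx cy)+
 let ?K' = "topspace T - K"
 \<comment> \<open>The triples for which the two memberships differ. Both \<open>K\<close> and its
   complement are closed, so \<open>Z\<close> is closed, and the projection to the first factor is a
   closed map because the other two factors are compact.\<close>
 define Z where "Z = ({z \<in> topspace P. ?m3 z \<in> K} \<inter> {z \<in> topspace P. ?m2 z \<in> ?K'})
          \<union> ({z \<in> topspace P. ?m3 z \<in> ?K'} \<inter> {z \<in> topspace P. ?m2 z \<in> K})"
 have K': "closedin T ?K'" using K by blast
 have "closedin P Z" unfolding Z_def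
  using closedin_continuous_map_preimage[OF c3 K(2)] closedin_continuous_map_preimage[OF c2 K(2)]
   closedin_continuous_map_preimage[OF c3 K'] closedin_continuous_map_preimage[OF c2 K']
  by (intro closedin_Un closedin_Int) auto
 moreover have "closed_map P T fst"
  unfolding P_def using compact by (intro closed_map_fst) (simp add: compact_space_prod_topology)
 ultimately have "closedin T (fst ` Z)" by (simp add: closed_map_def)
 moreover have "U = topspace T - fst ` Z"
 proof -
  have "g \<in> fst ` Z \<longleftrightarrow> (\<exists>x\<in>carrier G. \<exists>y\<in>carrier G. (x \<otimes> g \<otimes> y \<in> K) ~= (x \<otimes> y \<in> K))"
   if "g \<in> carrier G" for g
  proof
   assume "g \<in> fst ` Z"
   then obtain x y where "(g, x, y) \<in> Z" by auto
   thus "\<exists>x\<in>carrier G. \<exists>y\<in>carrier G. (x \<otimes> g \<otimes> y \<in> K) ~= (x \<otimes> y \<in> K)"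
    unfolding Z_def P_def by (auto simp: topspace_eq)
  next
   assume "\<exists>x\<in>carrier G. \<exists>y\<in>carrier G. (x \<otimes> g \<otimes> y \<in> K) ~= (x \<otimes> y \<in> K)"
   then obtain x y where "x \<in> carrier G" "y \<in> carrier G" "(x \<otimes> g \<otimes> y \<in> K) ~= (x \<otimes> y \<in> K)" by blast
   hence "(g, x, y) \<in> Z" unfolding Z_def P_def using that by (auto simp: topspace_eq)
   thus "g \<in> fst ` Z" by force
  qed
  thus ?thesis unfolding U_def by (auto simp: topspace_eq)
 qed
 ultimately have "openin T U" using openin_diff[OF openin_topspace, of T "fst ` Z"] by simp
 hence "U \<in> \<U>" using normal by (simp add: open_normal_subgroups_def)
 moreover have "U \<subseteq> W"
 proof
  fix g assume g: "g \<in> U"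
  hence gG: "g \<in> carrier G" by (simp add: U_def)
  have "\<one> \<otimes> g \<otimes> \<one> \<in> K \<longleftrightarrow> \<one> \<otimes> \<one> \<in> K" using g one_closed unfolding U_def by blast
  thus "g \<in> W" using gG K by auto
 qed
 ultimately show thesis by (rule that)
qed

lemma ons_normal: "U \<in> \<U> ==> U \<lhd> G"
 and ons_open: "U \<in> \<U> ==> openin T U"
 and ons_subgroup: "U \<in> \<U> ==> subgroup U G"
 by (auto simp: open_normal_subgroups_def normal_def)

lemma carrier_in_ons: "carrier G \<in> \<U>"
 using normal_self openin_topspace[of T] by (simp add: open_normal_subgroups_def topspace_eq)

lemma ons_Int: "U \<in> \<U> ==> V \<in> \<U> ==> U \<inter> V \<in> \<U>"
 using normal_subgroup_intersect by (auto simp: open_normal_subgroups_def)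

lemma ons_INT:
 assumes "finite I" "!!i. i \<in> I ==> U i \<in> \<U>"
 obtains V where "V \<in> \<U>" "!!i. i \<in> I ==> V \<subseteq> U i"
proof -
 have "\<exists>V\<in>\<U>. \<forall>i\<in>I. V \<subseteq> U i"
  using assms
 proof (induction I rule: finite_induct)
  case empty
  thus ?case using carrier_in_ons by blast
 next
  case (insert i I)
  then obtain V where "V \<in> \<U>" "\<forall>i\<in>I. V \<subseteq> U i" by auto
  thus ?case using insert.prems ons_Int[of V "U i"] by (intro bexI[of _ "V \<inter> U i"]) auto
 qed
 thus thesis using that by blast
qed

lemma ons_r_coset_basis:
 assumes "openin T W" "x \<in> W"
 obtains U where "U \<in> \<U>" "U #> x \<subseteq> W"
proof -
 have x: "x \<in> carrier G" using assms openin_subset topspace_eq by blast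
 have "\<one> \<in> W #> inv x" using assms x unfolding r_coset_def by force
 then obtain U where U: "U \<in> \<U>" "U \<subseteq> W #> inv x"
  using open_normal_subgroup_basis openin_r_coset assms x inv_closed by metis
 have "U #> x \<subseteq> W #> inv x #> x" using U(2) by (auto simp: r_coset_def)
 also have "... = W" using x assms openin_subset[OF assms(1)] by (simp add: coset_mult_assoc topspace_eq)
 finally show thesis using that U(1) by blast
qed

lemma ons_separate:
 assumes "x \<in> carrier G" "x ~= \<one>"
 obtains U where "U \<in> \<U>" "x \<notin> U"
proof -
 obtain A B where "openin T A" "\<one> \<in> A" "x \<in> B" "disjnt A B"
  using Hausdorff assms unfolding Hausdorff_space_def topspace_eq by (metis one_closed)
 thus thesis using open_normal_subgroup_basis[of A] that by (metis disjnt_iff subsetD)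
qed

lemma ons_conj:
 assumes "U \<in> \<U>" "u \<in> U" "x \<in> carrier G"
 shows "x \<otimes> u \<otimes> inv x \<in> U" "inv x \<otimes> u \<otimes> x \<in> U"
 using assms normal.inv_op_closed1[OF ons_normal] normal.inv_op_closed2[OF ons_normal] by auto

lemma ons_carrier: "U \<in> \<U> ==> u \<in> U ==> u \<in> carrier G"
 by (rule subgroup.mem_carrier[OF ons_subgroup])

text \<open>Uniform continuity. Near each point a continuous map to a discrete space is constant on
  a box of cosets; compactness leaves finitely many boxes, and one \<open>V\<close> inside all their
  subgroups serves everywhere. This form replaces the topology on the powers of \<open>G\<close> in
  the later arguments about cochains.\<close>

lemma continuous_map_discrete_iff:
 fixes I :: "'i set"
 assumes I: "finite I"
 shows "continuous_map (product_topology (%_. T) I) (discrete_topology A) f \<longleftrightarrow>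
   f \<in> (I \<rightarrow>\<^sub>E carrier G) \<rightarrow> A \<and>
   (\<exists>U\<in>\<U>. \<forall>x\<in>I \<rightarrow>\<^sub>E carrier G. \<forall>y\<in>I \<rightarrow>\<^sub>E carrier G. (\<forall>i\<in>I. y i \<in> U #> x i) --> f y = f x)"
  (is "?cont \<longleftrightarrow> ?fun \<and> ?unif")
proof -
 define X where "X = (I \<rightarrow>\<^sub>E carrier G)"
 define P where "P = product_topology (%_::'i. T) I"
 have tP: "topspace P = X" by (simp add: P_def X_def topspace_eq)
 define box where "box U x = {y \<in> X. \<forall>i\<in>I. y i \<in> U #> x i}" for U x
 have box_PiE: "box U x = (\<Pi>\<^sub>E i\<in>I. U #> x i)" if "U \<in> \<U>" "x \<in> X" for U x
 proof -
  have "U #> x i \<subseteq> carrier G" if "i \<in> I" for i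
   using that \<open>x \<in> X\<close> \<open>U \<in> \<U>\<close> ons_subgroup subgroup.subset unfolding X_def
   by (metis PiE_mem r_coset_subset_G)
  thus ?thesis unfolding box_def X_def by (auto simp: PiE_iff extensional_def)
 qed
 have box_open: "openin P (box U x)" if "U \<in> \<U>" "x \<in> X" for U x
  unfolding box_PiE[OF that] P_def
  using that I openin_r_coset ons_open unfolding X_def
  by (subst openin_PiE_gen) (auto simp: PiE_iff)
 have box_self: "x \<in> box U x" if "U \<in> \<U>" "x \<in> X" for U x
  using that rcos_self ons_subgroup unfolding box_def X_def by auto
 have "?unif" if c: ?cont
 proof -
  have "\<exists>U\<in>\<U>. \<forall>y\<in>box U x. f y = f x" if x: "x \<in> X" for x
  proof -
   have "f x \<in> A" using c x continuous_map_image_subset_topspace[OF c] tP P_def by auto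
   hence "openin P {y \<in> X. f y \<in> {f x}}"
    using openin_continuous_map_preimage[OF c, of "{f x}"] tP P_def by simp
   hence "\<forall>z\<in>{y \<in> X. f y \<in> {f x}}. \<exists>W. (\<forall>i\<in>I. openin T (W i)) \<and> z \<in> Pi\<^sub>E I W \<and>
     Pi\<^sub>E I W \<subseteq> {y \<in> X. f y \<in> {f x}}"
    unfolding P_def openin_product_topology_alt by meson
   moreover have "x \<in> {y \<in> X. f y \<in> {f x}}" using x by simp
   ultimately obtain W where W: "\<forall>i\<in>I. openin T (W i)" "x \<in> Pi\<^sub>E I W" "Pi\<^sub>E I W \<subseteq> {y \<in> X. f y \<in> {f x}}"
    by meson
   have "\<exists>U. U \<in> \<U> \<and> U #> x i \<subseteq> W i" if i: "i \<in> I" for i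
   proof -
    have "openin T (W i)" "x i \<in> W i" using W i by (auto simp: PiE_iff)
    then obtain U where "U \<in> \<U>" "U #> x i \<subseteq> W i" by (rule ons_r_coset_basis)
    thus ?thesis by blast
   qed
   then obtain U where U: "!!i. i \<in> I ==> U i \<in> \<U> \<and> U i #> x i \<subseteq> W i" by metis
   obtain V where V: "V \<in> \<U>" "!!i. i \<in> I ==> V \<subseteq> U i" using ons_INT[OF I, of U] U by blast
   have "V #> x i \<subseteq> W i" if "i \<in> I" for i
    using U[OF that] V(2)[OF that] by (force simp: r_coset_def)
   hence "box V x \<subseteq> Pi\<^sub>E I W" unfolding box_def X_def by (intro subsetI PiE_I) (auto simp: PiE_iff extensional_def subset_iff)
   thus ?thesis using V W by blast
  qed
  then obtain U where U: "!!x. x \<in> X ==> U x \<in> \<U>" "!!x y. x \<in> X ==> y \<in> box (U x) x ==> f y = f x"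
   by metis
  have "compact_space P" unfolding P_def using compact by (simp add: compact_space_product_topology)
  moreover have "\<forall>B\<in>(%x. box (U x) x) ` X. openin P B" using box_open U(1) by simp
  moreover have "topspace P \<subseteq> \<Union>((%x. box (U x) x) ` X)" using box_self U(1) tP by auto
  ultimately obtain \<F> where \<F>: "finite \<F>" "\<F> \<subseteq> (%x. box (U x) x) ` X" "topspace P \<subseteq> \<Union>\<F>"
   unfolding compact_space_alt by meson
  obtain F where F: "finite F" "F \<subseteq> X" "X \<subseteq> (\<Union>x\<in>F. box (U x) x)"
   using finite_subset_image[OF \<F>(1,2)] \<F>(3) tP by auto
  \<comment> \<open>If \<open>y\<close> lies in the box around \<open>x\<close> and \<open>z\<close>
    differs from \<open>y\<close> by elements of \<open>V\<close>, then \<open>z\<close> lies in the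
    same box, since \<open>V\<close> is contained in the subgroup of that box.\<close>
  obtain V where V: "V \<in> \<U>" "!!x. x \<in> F ==> V \<subseteq> U x" using ons_INT[OF F(1), of U] U F by blast
  have "f z = f y" if y: "y \<in> X" and z: "z \<in> X" and zy: "\<forall>i\<in>I. z i \<in> V #> y i" for y z
  proof -
   obtain x where x: "x \<in> F" "y \<in> box (U x) x" using F(3) y by blast
   have xX: "x \<in> X" using x F by blast
   have "z i \<in> U x #> x i" if i: "i \<in> I" for i
   proof -
    obtain v where v: "v \<in> V" "z i = v \<otimes> y i" using zy i by (auto simp: r_coset_def)
    obtain u where u: "u \<in> U x" "y i = u \<otimes> x i" using x(2) i by (auto simp: box_def r_coset_def)
    have vU: "v \<in> U x" using v V(2)[OF x(1)] by blast
    have "v \<otimes> u \<in> U x" using u vU ons_subgroup[OF U(1)[OF xX]] by (simp add: subgroup.m_closed)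
    moreover have "z i = v \<otimes> u \<otimes> x i"
     using u v vU ons_carrier[OF U(1)[OF xX]] xX i by (auto simp: m_assoc X_def PiE_iff)
    ultimately show ?thesis by (auto simp: r_coset_def)
   qed
   hence "z \<in> box (U x) x" using z by (simp add: box_def)
   thus ?thesis using U(2)[OF xX] x(2) by simp
  qed
  thus ?unif using V(1) unfolding X_def by blast
 qed
 moreover have ?cont if fn: ?fun and un: ?unif
 proof -
  from un[folded X_def] obtain U where U: "U \<in> \<U>"
    "\<forall>x\<in>X. \<forall>y\<in>X. (\<forall>i\<in>I. y i \<in> U #> x i) --> f y = f x"
   by (rule bexE)
  have "openin P {x \<in> X. f x \<in> B}" for B
  proof (subst openin_subopen, intro ballI)
   fix x assume x: "x \<in> {x \<in> X. f x \<in> B}"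
   hence "box U x \<subseteq> {x \<in> X. f x \<in> B}" using U(2) by (auto simp: box_def)
   moreover have "openin P (box U x)" "x \<in> box U x" using box_open[OF U(1)] box_self[OF U(1)] x by auto
   ultimately show "\<exists>B'. openin P B' \<and> x \<in> B' \<and> B' \<subseteq> {x \<in> X. f x \<in> B}" by metis
  qed
  thus ?cont
   using fn tP unfolding continuous_map_def P_def X_def by simp
 qed
 moreover have ?fun if c: ?cont
  using continuous_map_image_subset_topspace[OF c] tP by (auto simp: P_def X_def)
 ultimately show ?thesis by argo
qed

text \<open>Every coset of \<open>U\<close> is open and therefore meets the dense subgroup, which is
  contained in \<open>H\<close>; as \<open>H\<close> contains \<open>U\<close> too, it contains the
  whole coset.\<close>

lemma dense_open_subgroup:
 assumes X: "X \<subseteq> carrier G" "T closure_of (generate G X) = carrier G"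
  and H: "subgroup H G" "X \<subseteq> H" and U: "U \<in> \<U>" "U \<subseteq> H"
 shows "H = carrier G"
proof
 show "H \<subseteq> carrier G" using H(1) by (rule subgroup.subset)
 show "carrier G \<subseteq> H"
 proof
  fix g assume g: "g \<in> carrier G"
  have "openin T (U #> g)" "g \<in> U #> g"
   using openin_r_coset ons_open[OF U(1)] g rcos_self ons_subgroup[OF U(1)] by auto
  moreover have "g \<in> T closure_of (generate G X)" using X(2) g by simp
  ultimately obtain h where h: "h \<in> generate G X" "h \<in> U #> g"
   unfolding in_closure_of by blast
  have "h \<in> H" using h(1) generate_subgroup_incl[OF H(2,1)] by blast
  moreover obtain u where u: "u \<in> U" "h = u \<otimes> g" using h(2) by (auto simp: r_coset_def)
  moreover have "g = inv u \<otimes> h" using u g ons_carrier[OF U(1)] by (auto simp flip: m_assoc)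
  ultimately show "g \<in> H" using U(2) H(1) by (metis subgroup.m_closed subgroup.m_inv_closed subsetD)
 qed
qed

end

lemma (in pro_p_group) ons_index:
 assumes "U \<in> \<U>" obtains k where "card (rcosets U) = p ^ k"
 using assms index_open_normal by (auto simp: open_normal_subgroups_def)

lemma (in pro_p_group) ons_finite_index:
 assumes "U \<in> \<U>" shows "finite (rcosets U)"
proof -
 obtain k where "card (rcosets U) = p ^ k" using ons_index[OF assms] .
 hence "card (rcosets U) > 0" using prime_p by (simp add: prime_gt_0_nat)
 thus ?thesis by (rule card_ge_0_finite)
qed

section \<open>Locally constant functions and functionals\<close>

lemma finsum_residue_ring:
 assumes "prime p" "finite A" "!!x. x \<in> A ==> f x \<in> {0..int p - 1}"
 shows "(\<Oplus>\<^bsub>residue_ring (int p)\<^esub>x\<in>A. f x) = (\<Sum>x\<in>A. f x) mod int p"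
proof -
 interpret cring "residue_ring (int p)"
  using residues.cring[of "int p"] prime_gt_1_nat[OF assms(1)] by (simp add: residues_def)
 show ?thesis using assms(2,3)
 proof (induction A rule: finite_induct)
  case empty
  show ?case by (subst finsum_empty) (simp add: residue_ring_def)
 next
  case (insert x A)
  have "(\<Oplus>\<^bsub>residue_ring (int p)\<^esub>x\<in>insert x A. f x)
    = f x \<oplus>\<^bsub>residue_ring (int p)\<^esub> (\<Oplus>\<^bsub>residue_ring (int p)\<^esub>x\<in>A. f x)"
   using insert by (intro finsum_insert) (auto simp: residue_ring_def)
  also have "... = (f x + (\<Sum>x\<in>A. f x) mod int p) mod int p"
   using insert by (simp add: residue_ring_def)
  finally show ?case using insert by (simp add: mod_add_right_eq)
 qed
qed

text \<open>Elements of the field with \<open>p\<close> elements are represented by integers up to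
  this congruence. As a constant of its own it supports calculations that mix it with
  equality.\<close>

definition mod_eq :: "nat => int => int => bool" where
 "mod_eq p a b \<longleftrightarrow> [a = b] (mod int p)"

lemma meq_refl [simp, intro!]: "mod_eq p a a"
 by (simp add: mod_eq_def)

lemma meq_sym: "mod_eq p a b ==> mod_eq p b a"
 by (simp add: mod_eq_def cong_sym)

lemma meq_trans [trans]: "mod_eq p a b ==> mod_eq p b c ==> mod_eq p a c"
 unfolding mod_eq_def by (rule cong_trans)

lemma meq_add: "mod_eq p a b ==> mod_eq p c d ==> mod_eq p (a + c) (b + d)"
 unfolding mod_eq_def by (rule cong_add)

lemma meq_diff: "mod_eq p a b ==> mod_eq p c d ==> mod_eq p (a - c) (b - d)"
 unfolding mod_eq_def by (rule cong_diff)

lemma meq_scale_left: "mod_eq p a b ==> mod_eq p (c * a) (c * b)"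
 unfolding mod_eq_def by (rule cong_scalar_left)

lemma meq_scale_right: "mod_eq p a b ==> mod_eq p (a * c) (b * c)"
 unfolding mod_eq_def by (rule cong_scalar_right)

lemma meq_sum: "(!!x. x \<in> A ==> mod_eq p (f x) (g x)) ==> mod_eq p (sum f A) (sum g A)"
 unfolding mod_eq_def by (rule cong_sum)

lemma meq_iff_dvd: "mod_eq p a b \<longleftrightarrow> int p dvd a - b"
 by (simp add: mod_eq_def cong_iff_dvd_diff)

lemma meq_mod [simp]: "mod_eq p (a mod int p) b \<longleftrightarrow> mod_eq p a b" "mod_eq p a (b mod int p) \<longleftrightarrow> mod_eq p a b"
 by (simp_all add: mod_eq_def)

lemma meq_iff_diff: "mod_eq p a b \<longleftrightarrow> mod_eq p (a - b) 0"
 by (simp add: meq_iff_dvd)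

context pro_p_group
begin

abbreviation mod_eq_p :: "int => int => bool" (infix \<open>\<doteq>\<close> 50) where
 "a \<doteq> b \<equiv> mod_eq p a b"

abbreviation rep :: "'a set => 'a" where "rep D \<equiv> (SOME x. x \<in> D)"

lemma rep_coset:
 assumes "U \<in> \<U>" "D \<in> rcosets U"
 shows "rep D \<in> D" "rep D \<in> carrier G" "D = U #> rep D"
proof -
 obtain a where a: "a \<in> carrier G" "D = U #> a" using assms by (auto simp: RCOSETS_def)
 have "a \<in> D" using a rcos_self ons_subgroup[OF assms(1)] by simp
 thus r: "rep D \<in> D" by (rule someI)
 thus "rep D \<in> carrier G"
  using a r_coset_subset_G[OF subgroup.subset[OF ons_subgroup[OF assms(1)]] a(1)] by blast
 show "D = U #> rep D"
  using repr_independence[of "rep D" U a] r a ons_subgroup[OF assms(1)] by simp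
qed

lemma coset_in_rcosets: "U \<in> \<U> ==> x \<in> carrier G ==> U #> x \<in> rcosets U"
 using rcosetsI subgroup.subset[OF ons_subgroup] by blast

lemma mem_coset_iff:
 assumes "U \<in> \<U>" "x \<in> carrier G" "D \<in> rcosets U"
 shows "x \<in> D \<longleftrightarrow> U #> x = D"
proof -
 obtain a where a: "a \<in> carrier G" "D = U #> a" using assms by (auto simp: RCOSETS_def)
 show ?thesis
  using a assms repr_independence[of x U a] rcos_self[of x U] ons_subgroup[OF assms(1)] by auto
qed

definition invariant :: "'a set => ('a => int) => bool" where
 "invariant U f \<longleftrightarrow> (\<forall>x\<in>carrier G. \<forall>u\<in>U. f (u \<otimes> x) \<doteq> f x)"

definition loc_const :: "('a => int) set" where
 "loc_const = {f. \<exists>U\<in>\<U>. invariant U f}"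

lemma loc_constI: "U \<in> \<U> ==> invariant U f ==> f \<in> loc_const"
 by (auto simp: loc_const_def)

lemma loc_constE:
 assumes "f \<in> loc_const" obtains U where "U \<in> \<U>" "invariant U f"
 using assms by (auto simp: loc_const_def)

lemma invariantD: "invariant U f ==> x \<in> carrier G ==> u \<in> U ==> f (u \<otimes> x) \<doteq> f x"
 by (simp add: invariant_def)

lemma invariant_subset: "invariant U f ==> V \<subseteq> U ==> invariant V f"
 by (auto simp: invariant_def)

lemma invariant_right:
 assumes "invariant U f" "U \<in> \<U>" "x \<in> carrier G" "u \<in> U"
 shows "f (x \<otimes> u) \<doteq> f x"
proof -
 have "x \<otimes> u \<otimes> inv x \<in> U" "u \<in> carrier G" using assms ons_conj ons_carrier by auto
 moreover have "x \<otimes> u = (x \<otimes> u \<otimes> inv x) \<otimes> x" using assms calculation by (simp add: m_assoc)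
 ultimately show ?thesis using invariantD[OF assms(1,3)] by metis
qed

lemma invariant_coset:
 assumes "invariant U f" "U \<in> \<U>" "x \<in> carrier G" "y \<in> U #> x"
 shows "f y \<doteq> f x"
 using assms invariantD by (auto simp: r_coset_def)

lemma invariant_rep:
 assumes "invariant U f" "U \<in> \<U>" "D \<in> rcosets U" "y \<in> D"
 shows "f y \<doteq> f (rep D)"
 using invariant_coset[OF assms(1,2), of "rep D" y] rep_coset[OF assms(2,3)] assms(4) by simp

lemma inv_cancel: "y \<in> carrier G ==> x \<in> carrier G ==> inv y \<otimes> (y \<otimes> x) = x"
 by (simp flip: m_assoc)

lemma invariant_translate:
 assumes "invariant U f" "U \<in> \<U>" "y \<in> carrier G"
 shows "invariant U (%z. f (y \<otimes> z))" "invariant U (%z. f (z \<otimes> y))"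
proof -
 show "invariant U (%z. f (z \<otimes> y))"
  unfolding invariant_def using assms invariantD[OF assms(1)] ons_carrier[OF assms(2)]
  by (simp add: m_assoc)
 show "invariant U (%z. f (y \<otimes> z))"
  unfolding invariant_def
 proof (intro ballI)
  fix x u assume x: "x \<in> carrier G" and u: "u \<in> U"
  have uG: "u \<in> carrier G" using u ons_carrier[OF assms(2)] by blast
  have "y \<otimes> (u \<otimes> x) = (y \<otimes> u \<otimes> inv y) \<otimes> (y \<otimes> x)"
   using assms(3) x uG by (simp add: m_assoc inv_cancel)
  thus "f (y \<otimes> (u \<otimes> x)) \<doteq> f (y \<otimes> x)"
   using invariantD[OF assms(1), of "y \<otimes> x" "y \<otimes> u \<otimes> inv y"] ons_conj(1)[OF assms(2) u assms(3)] x assms(3)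
   by simp
 qed
qed

lemma loc_const_translate:
 assumes "f \<in> loc_const" "y \<in> carrier G"
 shows "(%z. f (y \<otimes> z)) \<in> loc_const" "(%z. f (z \<otimes> y)) \<in> loc_const"
 using assms invariant_translate by (meson loc_constE loc_constI)+

lemma loc_const_add:
 assumes "f \<in> loc_const" "g \<in> loc_const"
 shows "(%x. f x + g x) \<in> loc_const"
proof -
 obtain U where U: "U \<in> \<U>" "invariant U f" using assms(1) by (rule loc_constE)
 obtain V where V: "V \<in> \<U>" "invariant V g" using assms(2) by (rule loc_constE)
 have "invariant (U \<inter> V) (%x. f x + g x)"
  using U V by (auto simp: invariant_def intro: meq_add)
 thus ?thesis by (rule loc_constI[OF ons_Int[OF U(1) V(1)]])
qed

lemma loc_const_scale: "f \<in> loc_const ==> (%x. c * f x) \<in> loc_const"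
 by (auto simp: loc_const_def invariant_def intro!: meq_scale_left)

lemma loc_const_const: "(%x. c) \<in> loc_const"
 using carrier_in_ons by (auto simp: loc_const_def invariant_def)

lemma loc_const_sum:
 "(!!i. i \<in> I ==> f i \<in> loc_const) ==> (%x. \<Sum>i\<in>I. f i x) \<in> loc_const"
proof (induction I rule: infinite_finite_induct)
 case (insert i I)
 thus ?case using loc_const_add[of "f i" "%x. \<Sum>i\<in>I. f i x"] by simp
qed (simp_all add: loc_const_const)

lemma loc_const_cong:
 assumes "f \<in> loc_const" "!!x. x \<in> carrier G ==> f x \<doteq> g x"
 shows "g \<in> loc_const"
proof -
 obtain U where U: "U \<in> \<U>" "invariant U f" using assms(1) by (rule loc_constE)
 have "invariant U g"
  unfolding invariant_def
 proof (intro ballI)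
  fix x u assume "x \<in> carrier G" "u \<in> U"
  thus "g (u \<otimes> x) \<doteq> g x"
   using assms(2)[of x] assms(2)[of "u \<otimes> x"] invariantD[OF U(2), of x u] ons_carrier[OF U(1), of u]
   by (metis meq_sym meq_trans m_closed)
 qed
 thus ?thesis by (rule loc_constI[OF U(1)])
qed

definition coset_ind :: "'a set => 'a => int" where "coset_ind D x = (if x \<in> D then 1 else 0)"

lemma invariant_coset_ind:
 assumes "U \<in> \<U>" "D \<in> rcosets U" shows "invariant U (coset_ind D)"
 unfolding invariant_def
proof (intro ballI)
 fix x u assume xu: "x \<in> carrier G" "u \<in> U"
 have "U #> (u \<otimes> x) = U #> x"
  using xu assms ons_subgroup[OF assms(1)] ons_carrier[OF assms(1)]
  by (metis coset_join2 coset_mult_assoc subgroup.subset)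
 thus "coset_ind D (u \<otimes> x) \<doteq> coset_ind D x"
  using mem_coset_iff[OF assms(1) _ assms(2)] xu ons_carrier[OF assms(1)] by (simp add: coset_ind_def)
qed

lemma coset_decomposition:
 assumes "U \<in> \<U>" "invariant U f" "x \<in> carrier G"
 shows "f x \<doteq> (\<Sum>D\<in>rcosets U. f (rep D) * coset_ind D x)"
proof -
 let ?X = "U #> x"
 have X: "?X \<in> rcosets U" by (rule coset_in_rcosets[OF assms(1,3)])
 have "(\<Sum>D\<in>rcosets U. f (rep D) * coset_ind D x) = (\<Sum>D\<in>rcosets U. if D = ?X then f (rep D) else 0)"
  using mem_coset_iff[OF assms(1,3)] by (intro sum.cong) (auto simp: coset_ind_def)
 also have "... = f (rep ?X)" using X ons_finite_index[OF assms(1)] by simp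
 finally show ?thesis
  using invariant_rep[OF assms(2,1) X] mem_coset_iff[OF assms(1,3) X] by simp
qed

text \<open>Modulo \<open>p\<close>, these correspond to the elements of the completed group algebra.\<close>

definition functional :: "(('a => int) => int) => bool" where
 "functional b \<longleftrightarrow>
   (\<forall>f\<in>loc_const. \<forall>g\<in>loc_const. b (%x. f x + g x) \<doteq> b f + b g) \<and>
   (\<forall>f\<in>loc_const. \<forall>g. (\<forall>x\<in>carrier G. f x \<doteq> g x) --> b f \<doteq> b g)"

lemma functional_add:
 "functional b ==> f \<in> loc_const ==> g \<in> loc_const ==> b (%x. f x + g x) \<doteq> b f + b g"
 by (simp add: functional_def)

lemma functional_cong:
 "functional b ==> f \<in> loc_const ==> (!!x. x \<in> carrier G ==> f x \<doteq> g x) ==> b f \<doteq> b g"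
 by (simp add: functional_def)

lemma functional_zero: "functional b ==> b (%x. 0) \<doteq> 0"
 using functional_add[OF _ loc_const_const loc_const_const, of b 0 0]
 by (simp add: meq_iff_dvd)

text \<open>Additivity alone gives homogeneity, because every scalar is congruent to a natural
  number.\<close>

lemma functional_scale:
 assumes b: "functional b" and f: "f \<in> loc_const"
 shows "b (%x. c * f x) \<doteq> c * b f"
proof -
 have nat: "b (%x. int n * f x) \<doteq> int n * b f" for n
 proof (induction n)
  case 0
  thus ?case using functional_zero[OF b] by simp
 next
  case (Suc n)
  have "b (%x. int (Suc n) * f x) = b (%x. f x + int n * f x)" by (simp add: algebra_simps)
  also have "... \<doteq> b f + b (%x. int n * f x)"
   by (rule functional_add[OF b f loc_const_scale[OF f]])
  also have "... \<doteq> b f + int n * b f" using Suc by (intro meq_add) auto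
  finally show ?case by (simp add: algebra_simps)
 qed
 define n where "n = nat (c mod int p)"
 have "int p > 0" using prime_p by (simp add: prime_gt_0_nat)
 hence n: "int n \<doteq> c" by (simp add: n_def mod_eq_def cong_def)
 have "b (%x. c * f x) \<doteq> b (%x. int n * f x)"
  by (rule functional_cong[OF b loc_const_scale[OF f]]) (use n in \<open>auto intro: meq_scale_right meq_sym\<close>)
 also have "... \<doteq> int n * b f" by (rule nat)
 also have "... \<doteq> c * b f" using n by (rule meq_scale_right)
 finally show ?thesis .
qed

lemma functional_sum:
 assumes b: "functional b" and f: "!!i. i \<in> I ==> f i \<in> loc_const"
 shows "b (%x. \<Sum>i\<in>I. f i x) \<doteq> (\<Sum>i\<in>I. b (f i))"
 using f
proof (induction I rule: infinite_finite_induct)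
 case (insert i I)
 have "b (%x. f i x + (\<Sum>i\<in>I. f i x)) \<doteq> b (f i) + b (%x. \<Sum>i\<in>I. f i x)"
  using insert by (intro functional_add[OF b] loc_const_sum) auto
 also have "... \<doteq> b (f i) + (\<Sum>i\<in>I. b (f i))" using insert by (intro meq_add) auto
 finally show ?case using insert by simp
qed (simp_all add: functional_zero[OF b])

text \<open>The indicator functions of the cosets of \<open>U\<close> span the
  \<open>U\<close>-invariant functions, so at each level a functional is given by finitely many
  coefficients. These become the coefficients in the group algebra of the quotient by
  \<open>U\<close>.\<close>

lemma functional_decomposition:
 assumes b: "functional b" and U: "U \<in> \<U>" "invariant U f"
 shows "b f \<doteq> (\<Sum>D\<in>rcosets U. f (rep D) * b (coset_ind D))"
proof -
 have ind: "coset_ind D \<in> loc_const" if "D \<in> rcosets U" for D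
  using loc_constI[OF U(1) invariant_coset_ind[OF U(1) that]] .
 have "b f \<doteq> b (%x. \<Sum>D\<in>rcosets U. f (rep D) * coset_ind D x)"
  by (intro functional_cong[OF b loc_constI[OF U]] coset_decomposition[OF U])
 also have "... \<doteq> (\<Sum>D\<in>rcosets U. b (%x. f (rep D) * coset_ind D x))"
  by (rule functional_sum[OF b loc_const_scale[OF ind]])
 also have "... \<doteq> (\<Sum>D\<in>rcosets U. f (rep D) * b (coset_ind D))"
  using functional_scale[OF b ind] by (rule meq_sum)
 finally show ?thesis .
qed

text \<open>Invariance under one \<open>U\<close> in both variables turns \<open>b\<close> into a
  finite linear combination of evaluations at coset representatives, so the exchange is that of
  \<open>a\<close> with a finite sum.\<close>

lemma functional_Fubini:
 assumes a: "functional a" and b: "functional b" and U: "U \<in> \<U>"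
  and F: "!!y. y \<in> carrier G ==> invariant U (%z. F y z)"
  and F': "!!z. z \<in> carrier G ==> invariant U (%y. F y z)"
 shows "a (%y. b (%z. F y z)) \<doteq> b (%z. a (%y. F y z))"
proof -
 have inv1: "invariant U (%y. b (%z. F y z))"
  unfolding invariant_def
 proof (intro ballI)
  fix x u assume xu: "x \<in> carrier G" "u \<in> U"
  show "b (%z. F (u \<otimes> x) z) \<doteq> b (%z. F x z)"
   using xu ons_carrier[OF U] invariantD[OF F'] F
   by (intro functional_cong[OF b loc_constI[OF U]]) auto
 qed
 have inv2: "invariant U (%z. a (%y. F y z))"
  unfolding invariant_def
 proof (intro ballI)
  fix x u assume xu: "x \<in> carrier G" "u \<in> U"
  show "a (%y. F y (u \<otimes> x)) \<doteq> a (%y. F y x)"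
   using xu ons_carrier[OF U] invariantD[OF F] F'
   by (intro functional_cong[OF a loc_constI[OF U]]) auto
 qed
 have r: "rep D \<in> carrier G" if "D \<in> rcosets U" for D using rep_coset[OF U that] by simp
 have lc: "(%y. F y (rep D)) \<in> loc_const" if "D \<in> rcosets U" for D
  using loc_constI[OF U F'[OF r[OF that]]] .
 have "a (%y. b (%z. F y z)) \<doteq> a (%y. \<Sum>D\<in>rcosets U. b (coset_ind D) * F y (rep D))"
 proof (rule functional_cong[OF a loc_constI[OF U inv1]])
  fix y assume "y \<in> carrier G"
  thus "b (%z. F y z) \<doteq> (\<Sum>D\<in>rcosets U. b (coset_ind D) * F y (rep D))"
   using functional_decomposition[OF b U F] by (simp add: mult.commute)
 qed
 also have "... \<doteq> (\<Sum>D\<in>rcosets U. a (%y. b (coset_ind D) * F y (rep D)))"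
  by (rule functional_sum[OF a loc_const_scale[OF lc]])
 also have "... \<doteq> (\<Sum>D\<in>rcosets U. b (coset_ind D) * a (%y. F y (rep D)))"
  using functional_scale[OF a lc] by (rule meq_sum)
 also have "... = (\<Sum>D\<in>rcosets U. a (%y. F y (rep D)) * b (coset_ind D))"
  by (simp add: mult.commute)
 also have "... \<doteq> b (%z. a (%y. F y z))"
  using functional_decomposition[OF b U inv2] by (rule meq_sym)
 finally show ?thesis .
qed

lemma functional_conv_Fubini:
 assumes a: "functional a" and b: "functional b" and f: "f \<in> loc_const"
 shows "a (%y. b (%z. f (y \<otimes> z))) \<doteq> b (%z. a (%y. f (y \<otimes> z)))"
proof -
 obtain U where U: "U \<in> \<U>" "invariant U f" using f by (rule loc_constE)
 show ?thesis by (rule functional_Fubini[OF a b U(1)]) (rule invariant_translate[OF U(2,1)], assumption)+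
qed

lemma invariant_functional_translate:
 assumes b: "functional b" and U: "U \<in> \<U>" "invariant U f"
 shows "invariant U (%y. b (%z. f (y \<otimes> z)))" "invariant U (%y. b (%z. f (z \<otimes> y)))"
 unfolding invariant_def
proof (intro ballI)
 fix x u assume xu: "x \<in> carrier G" "u \<in> U"
 show "b (%z. f (u \<otimes> x \<otimes> z)) \<doteq> b (%z. f (x \<otimes> z))"
  using xu ons_carrier[OF U(1)] invariantD[OF invariant_translate(2)[OF U(2,1)]]
  by (intro functional_cong[OF b] loc_const_translate loc_constI[OF U]) auto
next
 show "\<forall>x\<in>carrier G. \<forall>u\<in>U. b (%z. f (z \<otimes> (u \<otimes> x))) \<doteq> b (%z. f (z \<otimes> x))"
 proof (intro ballI)
  fix x u assume xu: "x \<in> carrier G" "u \<in> U"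
  show "b (%z. f (z \<otimes> (u \<otimes> x))) \<doteq> b (%z. f (z \<otimes> x))"
   using xu ons_carrier[OF U(1)] invariantD[OF invariant_translate(1)[OF U(2,1)]]
   by (intro functional_cong[OF b] loc_const_translate loc_constI[OF U]) auto
 qed
qed

end

section \<open>Sylvester domains\<close>

lemma matrices_iff:
 "A \<in> matrices S n m \<longleftrightarrow> dim_row A = n \<and> dim_col A = m \<and> (\<forall>i<n. \<forall>j<m. A $$ (i, j) \<in> carrier S)"
proof -
 have "elements_mat A = (\<Union>i\<in>{..<dim_row A}. \<Union>j\<in>{..<dim_col A}. {A $$ (i, j)})"
  unfolding elements_mat_def by (auto simp: atLeast0LessThan)
 hence "elements_mat A \<subseteq> carrier S \<longleftrightarrow>
   (\<forall>i<dim_row A. \<forall>j<dim_col A. A $$ (i, j) \<in> carrier S)"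
  by (simp add: UN_subset_iff Ball_def)
 thus ?thesis unfolding matrices_def carrier_mat_def by fastforce
qed

lemma mat_in_matrices:
 "(!!i j. i < n ==> j < m ==> f (i, j) \<in> carrier S) ==> mat n m f \<in> matrices S n m"
 by (simp add: matrices_iff)

lemma dim_matrix_mult [simp]:
 "dim_row (matrix_mult S A B) = dim_row A" "dim_col (matrix_mult S A B) = dim_col B"
 by (simp_all add: matrix_mult_def)

lemma dim_zero_matrix [simp]: "dim_row (zero_matrix S n m) = n" "dim_col (zero_matrix S n m) = m"
 by (simp_all add: zero_matrix_def)

lemma matrix_mult_index:
 "A \<in> matrices S n m ==> B \<in> matrices S m l ==> i < n ==> j < l ==>
  matrix_mult S A B $$ (i, j) = (\<Oplus>\<^bsub>S\<^esub>k\<in>{..<m}. A $$ (i, k) \<otimes>\<^bsub>S\<^esub> B $$ (k, j))"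
 by (simp add: matrix_mult_def matrices_iff)

lemma zero_matrix_index [simp]: "i < n ==> j < m ==> zero_matrix S n m $$ (i, j) = \<zero>\<^bsub>S\<^esub>"
 by (simp add: zero_matrix_def)

context ring
begin

lemma finsum_swap:
 assumes "finite A" "finite B" "!!i j. i \<in> A ==> j \<in> B ==> f i j \<in> carrier R"
 shows "(\<Oplus>i\<in>A. \<Oplus>j\<in>B. f i j) = (\<Oplus>j\<in>B. \<Oplus>i\<in>A. f i j)"
 using assms(1,3)
proof (induction A rule: finite_induct)
 case (insert a A)
 have "(\<Oplus>i\<in>insert a A. \<Oplus>j\<in>B. f i j) = (\<Oplus>j\<in>B. f a j) \<oplus> (\<Oplus>i\<in>A. \<Oplus>j\<in>B. f i j)"
  using insert by (intro finsum_insert) auto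
 also have "... = (\<Oplus>j\<in>B. f a j) \<oplus> (\<Oplus>j\<in>B. \<Oplus>i\<in>A. f i j)" using insert by simp
 also have "... = (\<Oplus>j\<in>B. f a j \<oplus> (\<Oplus>i\<in>A. f i j))"
  using insert by (intro finsum_addf[symmetric]) auto
 also have "... = (\<Oplus>j\<in>B. \<Oplus>i\<in>insert a A. f i j)"
  using insert by (intro finsum_cong' finsum_insert[symmetric]) auto
 finally show ?case .
qed simp

lemma zero_in_matrices: "zero_matrix R n m \<in> matrices R n m"
 by (simp add: matrices_iff)

lemma matrix_mult_closed:
 assumes "A \<in> matrices R n m" "B \<in> matrices R m l"
 shows "matrix_mult R A B \<in> matrices R n l"
 using assms unfolding matrices_iff
 by (auto simp: matrix_mult_def intro!: finsum_closed)

lemma matrix_mult_assoc: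
 assumes A: "A \<in> matrices R n m" and B: "B \<in> matrices R m l" and C: "C \<in> matrices R l k"
 shows "matrix_mult R (matrix_mult R A B) C = matrix_mult R A (matrix_mult R B C)"
proof (rule eq_matI)
 note AB = matrix_mult_closed[OF A B] and BC = matrix_mult_closed[OF B C]
 fix i j assume "i < dim_row (matrix_mult R A (matrix_mult R B C))"
  "j < dim_col (matrix_mult R A (matrix_mult R B C))"
 hence i: "i < n" and j: "j < k" using A C by (auto simp: matrices_iff)
 have a: "A $$ (i, x) \<in> carrier R" if "x < m" for x using A i that by (simp add: matrices_iff)
 have b: "B $$ (x, y) \<in> carrier R" if "x < m" "y < l" for x y using B that by (simp add: matrices_iff)
 have c: "C $$ (y, j) \<in> carrier R" if "y < l" for y using C j that by (simp add: matrices_iff)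
 have "matrix_mult R (matrix_mult R A B) C $$ (i, j)
   = (\<Oplus>y\<in>{..<l}. (\<Oplus>x\<in>{..<m}. A $$ (i, x) \<otimes> B $$ (x, y)) \<otimes> C $$ (y, j))"
  unfolding matrix_mult_index[OF AB C i j]
  using matrix_mult_index[OF A B i] a b c by (intro finsum_cong') auto
 also have "... = (\<Oplus>y\<in>{..<l}. \<Oplus>x\<in>{..<m}. A $$ (i, x) \<otimes> B $$ (x, y) \<otimes> C $$ (y, j))"
  using a b c by (intro finsum_cong' finsum_ldistr) auto
 also have "... = (\<Oplus>x\<in>{..<m}. \<Oplus>y\<in>{..<l}. A $$ (i, x) \<otimes> B $$ (x, y) \<otimes> C $$ (y, j))"
  using a b c by (intro finsum_swap) auto
 also have "... = (\<Oplus>x\<in>{..<m}. \<Oplus>y\<in>{..<l}. A $$ (i, x) \<otimes> (B $$ (x, y) \<otimes> C $$ (y, j)))"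
  using a b c by (intro finsum_cong') (auto simp: m_assoc intro!: finsum_cong')
 also have "... = (\<Oplus>x\<in>{..<m}. A $$ (i, x) \<otimes> (\<Oplus>y\<in>{..<l}. B $$ (x, y) \<otimes> C $$ (y, j)))"
  using a b c by (intro finsum_cong' finsum_rdistr[symmetric]) auto
 also have "... = matrix_mult R A (matrix_mult R B C) $$ (i, j)"
  unfolding matrix_mult_index[OF A BC i j]
  using matrix_mult_index[OF B C _ j] a b c by (intro finsum_cong') auto
 finally show "matrix_mult R (matrix_mult R A B) C $$ (i, j) = matrix_mult R A (matrix_mult R B C) $$ (i, j)" .
qed (use A B C in \<open>auto simp: matrices_iff\<close>)

lemma matrix_mult_zero_left:
 assumes "B \<in> matrices R m l"
 shows "matrix_mult R (zero_matrix R n m) B = zero_matrix R n l"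
proof (rule eq_matI)
 fix i j assume "i < dim_row (zero_matrix R n l)" "j < dim_col (zero_matrix R n l)"
 hence ij: "i < n" "j < l" by auto
 have "(\<Oplus>k\<in>{..<m}. zero_matrix R n m $$ (i, k) \<otimes> B $$ (k, j)) = (\<Oplus>k\<in>{..<m}. \<zero>)"
  using assms ij by (intro finsum_cong') (auto simp: matrices_iff)
 thus "matrix_mult R (zero_matrix R n m) B $$ (i, j) = zero_matrix R n l $$ (i, j)"
  using ij by (simp add: matrix_mult_index[OF zero_in_matrices assms])
qed (use assms in \<open>auto simp: matrices_iff\<close>)

lemma inner_rank_le:
 assumes "B \<in> matrices R n k" "C \<in> matrices R k m" "A = matrix_mult R B C"
 shows "inner_rank R A \<le> k"
proof -
 have d: "dim_row A = n" "dim_col A = m" using assms by (simp_all add: matrices_iff)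
 have "\<exists>B \<in> matrices R n k. \<exists>C \<in> matrices R k m. A = matrix_mult R B C"
  using assms by blast
 hence "(LEAST k. \<exists>B \<in> matrices R n k. \<exists>C \<in> matrices R k m. A = matrix_mult R B C) \<le> k"
  by (rule Least_le)
 thus ?thesis unfolding inner_rank_def d by simp
qed

lemma finsum_delta:
 fixes i m :: nat
 assumes "i < m" "!!k. k < m ==> f k \<in> carrier R"
 shows "(\<Oplus>k\<in>{..<m}. (if i = k then \<one> else \<zero>) \<otimes> f k) = f i"
  "(\<Oplus>k\<in>{..<m}. f k \<otimes> (if k = i then \<one> else \<zero>)) = f i"
proof -
 have "(\<Oplus>k\<in>{..<m}. (if i = k then \<one> else \<zero>) \<otimes> f k) = (\<Oplus>k\<in>{..<m}. if i = k then f k else \<zero>)"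
  by (rule finsum_cong') (simp_all add: assms(2))
 thus "(\<Oplus>k\<in>{..<m}. (if i = k then \<one> else \<zero>) \<otimes> f k) = f i"
  using finsum_singleton[of i "{..<m}" f] assms by (simp add: Pi_iff)
 have "(\<Oplus>k\<in>{..<m}. f k \<otimes> (if k = i then \<one> else \<zero>)) = (\<Oplus>k\<in>{..<m}. if i = k then f k else \<zero>)"
  by (rule finsum_cong') (simp_all add: assms(2))
 thus "(\<Oplus>k\<in>{..<m}. f k \<otimes> (if k = i then \<one> else \<zero>)) = f i"
  using finsum_singleton[of i "{..<m}" f] assms by (simp add: Pi_iff)
qed

text \<open>The factorization with the identity matrix shows that some inner dimension occurs, so
  the least one is attained. The zero matrix factors through dimension 0, where the empty sums are
  zero.\<close>

lemma inner_rank_factor: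
 assumes A: "A \<in> matrices R n m"
 obtains B C where "B \<in> matrices R n (inner_rank R A)" "C \<in> matrices R (inner_rank R A) m"
  "A = matrix_mult R B C"
proof (cases "A = zero_matrix R n m")
 case True
 have r: "inner_rank R A = 0" using True by (simp add: inner_rank_def)
 have "zero_matrix R n 0 \<in> matrices R n 0" "zero_matrix R 0 m \<in> matrices R 0 m"
  by (rule zero_in_matrices)+
 moreover have "A = matrix_mult R (zero_matrix R n 0) (zero_matrix R 0 m)"
  unfolding True using matrix_mult_zero_left[OF zero_in_matrices] by simp
 ultimately show thesis using that[of "zero_matrix R n 0" "zero_matrix R 0 m"] unfolding r by blast
next
 case False
 have d: "dim_row A = n" "dim_col A = m" using A by (auto simp: matrices_iff)
 define P where "P k \<longleftrightarrow> (\<exists>B \<in> matrices R n k. \<exists>C \<in> matrices R k m. A = matrix_mult R B C)" for k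
 have r: "inner_rank R A = (LEAST k. P k)" using False by (simp add: inner_rank_def d P_def)
 define J where "J = mat m m (%(k, j). if k = j then \<one> else \<zero>)"
 have J: "J \<in> matrices R m m" unfolding J_def by (rule mat_in_matrices) auto
 have "A = matrix_mult R A J"
 proof (rule eq_matI)
  fix i j assume "i < dim_row (matrix_mult R A J)" "j < dim_col (matrix_mult R A J)"
  hence ij: "i < n" "j < m" using d J by (auto simp: matrices_iff)
  have "matrix_mult R A J $$ (i, j) = (\<Oplus>k\<in>{..<m}. A $$ (i, k) \<otimes> (if k = j then \<one> else \<zero>))"
   unfolding matrix_mult_index[OF A J ij] using A ij by (intro finsum_cong') (auto simp: J_def matrices_iff)
  also have "... = A $$ (i, j)" using A ij by (intro finsum_delta(2)) (auto simp: matrices_iff)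
  finally show "A $$ (i, j) = matrix_mult R A J $$ (i, j)" by simp
 qed (use A J in \<open>auto simp: matrices_iff\<close>)
 hence "P m" unfolding P_def using A J by blast
 hence "P (inner_rank R A)" unfolding r by (rule LeastI)
 thus thesis unfolding P_def using that by blast
qed

lemma inner_rank_0_iff:
 assumes A: "A \<in> matrices R n m"
 shows "inner_rank R A = 0 \<longleftrightarrow> A = zero_matrix R n m"
proof
 assume r: "inner_rank R A = 0"
 obtain B C where BC: "B \<in> matrices R n (inner_rank R A)" "C \<in> matrices R (inner_rank R A) m"
  "A = matrix_mult R B C" using inner_rank_factor[OF A] .
 have "B = zero_matrix R n 0" using BC(1) r by (intro eq_matI) (auto simp: matrices_iff)
 thus "A = zero_matrix R n m" using BC r matrix_mult_zero_left[of C 0 m n] by simp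
next
 assume "A = zero_matrix R n m"
 thus "inner_rank R A = 0" by (simp add: inner_rank_def)
qed

text \<open>If \<open>X Y = 0\<close> then the block matrix with rows \<open>(Y, 1)\<close> and \<open>(0, X)\<close> is the product of the
 column \<open>(1, X)\<close> and the row \<open>(Y, 1)\<close>, so its inner rank is at most \<open>m\<close>.\<close>

lemma sylvester_nullity:
 assumes syl: "sylvester_domain R" and X: "X \<in> matrices R n m" and Y: "Y \<in> matrices R m k"
  and XY: "matrix_mult R X Y = zero_matrix R n k"
 shows "inner_rank R X + inner_rank R Y \<le> m"
proof -
 define J where "J = mat m m (%(i, j). if i = j then \<one> else \<zero>)"
 have J: "J \<in> matrices R m m" unfolding J_def by (rule mat_in_matrices) auto
 define P where "P = mat (m + n) m (%(i, j). if i < m then if i = j then \<one> else \<zero> else X $$ (i - m, j))"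
 define Q where "Q = mat m (k + m) (%(i, j). if j < k then Y $$ (i, j) else if i = j - k then \<one> else \<zero>)"
 have P: "P \<in> matrices R (m + n) m" unfolding P_def using X by (intro mat_in_matrices) (auto simp: matrices_iff)
 have Q: "Q \<in> matrices R m (k + m)" unfolding Q_def using Y by (intro mat_in_matrices) (auto simp: matrices_iff)
 let ?F = "four_block_mat Y J (zero_matrix R n k) X"
 have d: "dim_row X = n" "dim_col X = m" "dim_row Y = m" "dim_col Y = k" "dim_row J = m" "dim_col J = m"
  "dim_row P = m + n" "dim_col Q = k + m"
  using X Y J P Q by (auto simp: matrices_iff)
 have F: "?F = matrix_mult R P Q"
 proof (rule eq_matI)
  fix i j assume "i < dim_row (matrix_mult R P Q)" "j < dim_col (matrix_mult R P Q)"
  hence i: "i < m + n" and j: "j < k + m" using d by auto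
  have x: "X $$ (a, b) \<in> carrier R" if "a < n" "b < m" for a b using X that by (simp add: matrices_iff)
  have y: "Y $$ (a, b) \<in> carrier R" if "a < m" "b < k" for a b using Y that by (simp add: matrices_iff)
  have PQ: "matrix_mult R P Q $$ (i, j) = (\<Oplus>l\<in>{..<m}. P $$ (i, l) \<otimes> Q $$ (l, j))"
   by (rule matrix_mult_index[OF P Q i j])
  have q: "Q $$ (l, j) \<in> carrier R" if "l < m" for l using Q j that by (simp add: matrices_iff)
  show "?F $$ (i, j) = matrix_mult R P Q $$ (i, j)"
  proof (cases "i < m")
   case True
   have "matrix_mult R P Q $$ (i, j) = (\<Oplus>l\<in>{..<m}. (if i = l then \<one> else \<zero>) \<otimes> Q $$ (l, j))"
    unfolding PQ using True i q by (intro finsum_cong') (auto simp: P_def)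
   also have "... = Q $$ (i, j)" using True q by (intro finsum_delta(1)) auto
   also have "... = ?F $$ (i, j)" using True i j d by (auto simp: Q_def J_def)
   finally show ?thesis by simp
  next
   case False
   hence i': "i - m < n" using i by auto
   show ?thesis
   proof (cases "j < k")
    case True
    have "matrix_mult R P Q $$ (i, j) = (\<Oplus>l\<in>{..<m}. X $$ (i - m, l) \<otimes> Y $$ (l, j))"
     unfolding PQ using True False i j x y i' by (intro finsum_cong') (auto simp: P_def Q_def)
    also have "... = matrix_mult R X Y $$ (i - m, j)" using matrix_mult_index[OF X Y i' True] by simp
    also have "... = \<zero>" using XY i' True by simp
    finally show ?thesis using False True i j d i' by simp
   next
    case jF: False
    hence j': "j - k < m" using j by auto
    have "matrix_mult R P Q $$ (i, j) = (\<Oplus>l\<in>{..<m}. X $$ (i - m, l) \<otimes> (if l = j - k then \<one> else \<zero>))"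
     unfolding PQ using jF False i j x i' by (intro finsum_cong') (auto simp: P_def Q_def)
    also have "... = X $$ (i - m, j - k)" using x i' j' by (intro finsum_delta(2)) auto
    finally show ?thesis using False jF i j d by simp
   qed
  qed
 qed (use d in auto)
 have "inner_rank R ?F \<le> m" using inner_rank_le[OF P Q F] .
 \<comment> \<open>The last axiom of a Sylvester rank function, for block triangular
   matrices.\<close>
 moreover have "real (inner_rank R Y) + real (inner_rank R X) \<le> real (inner_rank R ?F)"
  using syl Y X J unfolding sylvester_domain_def sylvester_rank_function_def by blast
 ultimately show ?thesis by linarith
qed

text \<open>Let \<open>r\<close> be the inner rank of \<open>V\<close> and \<open>V = B E\<close> a
  factorization through \<open>r\<close>. The bound for the rank of a product forces
  \<open>B\<close> and \<open>E\<close> to have rank at least \<open>r\<close>, so the nullity bound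
  for \<open>(A B) E = 0\<close> gives \<open>A B = 0\<close>. If \<open>r < s\<close> this is the
  first alternative; otherwise the nullity bound for \<open>V u = 0\<close> leaves only rank 0 for
  \<open>u\<close>.\<close>

lemma sylvester_dichotomy:
 assumes syl: "sylvester_domain R" and A: "A \<in> matrices R n d" and V: "V \<in> matrices R d s"
  and AV: "matrix_mult R A V = zero_matrix R n s"
 shows "(\<exists>k<s. \<exists>B\<in>matrices R d k. \<exists>E\<in>matrices R k s.
      V = matrix_mult R B E \<and> matrix_mult R A B = zero_matrix R n k) \<or>
     (s \<le> d \<and> (\<forall>u\<in>matrices R s 1. matrix_mult R V u = zero_matrix R d 1 --> u = zero_matrix R s 1))"
proof -
 obtain B E where B: "B \<in> matrices R d (inner_rank R V)" and E: "E \<in> matrices R (inner_rank R V) s"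
  and VBE: "V = matrix_mult R B E" using inner_rank_factor[OF V] .
 note AB = matrix_mult_closed[OF A B]
 have "real (inner_rank R (matrix_mult R B E)) \<le> min (real (inner_rank R B)) (real (inner_rank R E))"
  using syl B E unfolding sylvester_domain_def sylvester_rank_function_def by blast
 hence "inner_rank R V \<le> inner_rank R B" "inner_rank R V \<le> inner_rank R E" using VBE by auto
 moreover have "matrix_mult R (matrix_mult R A B) E = zero_matrix R n s"
  using matrix_mult_assoc[OF A B E] VBE AV by simp
 ultimately have "inner_rank R (matrix_mult R A B) = 0"
  using sylvester_nullity[OF syl AB E] by linarith
 hence AB0: "matrix_mult R A B = zero_matrix R n (inner_rank R V)"
  using inner_rank_0_iff[OF AB] by simp
 show ?thesis
 proof (cases "inner_rank R V < s")
  case True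
  thus ?thesis using B E VBE AB0 by blast
 next
  case False
  \<comment> \<open>The nullity bound for a left factor without rows.\<close>
  have rd: "inner_rank R V \<le> d"
  proof -
   have "matrix_mult R (zero_matrix R 0 d) V = zero_matrix R 0 s"
    by (rule matrix_mult_zero_left[OF V])
   from sylvester_nullity[OF syl zero_in_matrices V this] show ?thesis by simp
  qed
  have "u = zero_matrix R s 1" if u: "u \<in> matrices R s 1" "matrix_mult R V u = zero_matrix R d 1" for u
  proof -
   have "inner_rank R u = 0" using sylvester_nullity[OF syl V u] False by simp
   thus ?thesis using inner_rank_0_iff[OF u(1)] by simp
  qed
  thus ?thesis using rd False by simp
 qed
qed

end

section \<open>The completed group algebra as the convolution algebra of functionals\<close>

context pro_p_group
begin

abbreviation kG :: "('a set => 'a set => int) ring" where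
 "kG \<equiv> completed_group_algebra (residue_ring (int p)) G T"

lemma residue_ring_simps [simp]:
 "carrier (residue_ring m) = {0..m - 1}" "x \<otimes>\<^bsub>residue_ring m\<^esub> y = (x * y) mod m"
 "x \<oplus>\<^bsub>residue_ring m\<^esub> y = (x + y) mod m" "\<one>\<^bsub>residue_ring m\<^esub> = 1" "\<zero>\<^bsub>residue_ring m\<^esub> = 0"
 by (simp_all add: residue_ring_def)

lemma mod_in_residues: "c mod int p \<in> {0..int p - 1}"
 using prime_p by (simp add: prime_gt_0_nat)

lemma proj_eq:
 assumes U: "U \<in> \<U>" and a: "!!C. C \<in> rcosets U ==> a C \<in> {0..int p - 1}"
 shows "group_algebra_proj (residue_ring (int p)) G U V a =
   (\<lambda>D\<in>rcosets V. (\<Sum>C\<in>{C \<in> rcosets U. C \<subseteq> D}. a C) mod int p)"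
proof -
 have "(\<Oplus>\<^bsub>residue_ring (int p)\<^esub>C\<in>{C \<in> rcosets U. C \<subseteq> D}. a C)
   = (\<Sum>C\<in>{C \<in> rcosets U. C \<subseteq> D}. a C) mod int p" for D
  using ons_finite_index[OF U] a by (intro finsum_residue_ring[OF prime_p]) auto
 thus ?thesis by (simp add: group_algebra_proj_def FactGroup_def)
qed

lemma kG_carrierD:
 assumes "a \<in> carrier kG"
 shows "a \<in> extensional \<U>"
  "U \<in> \<U> ==> a U \<in> rcosets U \<rightarrow>\<^sub>E {0..int p - 1}"
  "U \<in> \<U> ==> V \<in> \<U> ==> U \<subseteq> V ==> D \<in> rcosets V ==>
    a V D = (\<Sum>C\<in>{C \<in> rcosets U. C \<subseteq> D}. a U C) mod int p"
proof -
 have c: "a \<in> (\<Pi>\<^sub>E U\<in>\<U>. rcosets U \<rightarrow>\<^sub>E {0..int p - 1})"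
  "\<forall>U\<in>\<U>. \<forall>V\<in>\<U>. U \<subseteq> V --> group_algebra_proj (residue_ring (int p)) G U V (a U) = a V"
  using assms by (simp_all add: completed_group_algebra_def Let_def group_algebra_def FactGroup_def)
 show "a \<in> extensional \<U>" using c(1) by (simp add: PiE_def)
 show *: "a U \<in> rcosets U \<rightarrow>\<^sub>E {0..int p - 1}" if "U \<in> \<U>" for U
  using c(1) that by (rule PiE_mem)
 show "a V D = (\<Sum>C\<in>{C \<in> rcosets U. C \<subseteq> D}. a U C) mod int p"
  if UV: "U \<in> \<U>" "V \<in> \<U>" "U \<subseteq> V" "D \<in> rcosets V"
 proof -
  have "a V D = group_algebra_proj (residue_ring (int p)) G U V (a U) D" using c(2) UV by simp
  also have "... = (\<Sum>C\<in>{C \<in> rcosets U. C \<subseteq> D}. a U C) mod int p"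
   using proj_eq[OF UV(1), of "a U" V] PiE_mem[OF *[OF UV(1)]] UV(4) by simp
  finally show ?thesis .
 qed
qed

lemma kG_carrierI:
 assumes "a \<in> extensional \<U>"
  "!!U. U \<in> \<U> ==> a U \<in> rcosets U \<rightarrow>\<^sub>E {0..int p - 1}"
  "!!U V D. U \<in> \<U> ==> V \<in> \<U> ==> U \<subseteq> V ==> D \<in> rcosets V ==>
    a V D = (\<Sum>C\<in>{C \<in> rcosets U. C \<subseteq> D}. a U C) mod int p"
 shows "a \<in> carrier kG"
proof -
 have "group_algebra_proj (residue_ring (int p)) G U V (a U) = a V"
  if UV: "U \<in> \<U>" "V \<in> \<U>" "U \<subseteq> V" for U V
 proof -
  have "a V = (\<lambda>D\<in>rcosets V. a V D)"
   using assms(2)[OF UV(2)] by (simp add: PiE_restrict)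
  also have "... = (\<lambda>D\<in>rcosets V. (\<Sum>C\<in>{C \<in> rcosets U. C \<subseteq> D}. a U C) mod int p)"
   using assms(3)[OF UV] by (rule restrict_ext)
  finally show ?thesis using proj_eq[OF UV(1), of "a U" V] PiE_mem[OF assms(2)[OF UV(1)]] by simp
 qed
 moreover have "a \<in> (\<Pi>\<^sub>E U\<in>\<U>. rcosets U \<rightarrow>\<^sub>E {0..int p - 1})"
  using assms(1,2) unfolding PiE_def by auto
 ultimately show ?thesis
  by (simp add: completed_group_algebra_def Let_def group_algebra_def FactGroup_def)
qed

lemma kG_range:
 assumes "a \<in> carrier kG" "U \<in> \<U>" "D \<in> rcosets U" shows "a U D \<in> {0..int p - 1}"
 using PiE_mem[OF kG_carrierD(2)[OF assms(1,2)] assms(3)] .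

text \<open>The pairing of the component of \<open>a\<close> at level \<open>U\<close> with a
  \<open>U\<close>-invariant function; for other functions it depends on the chosen
  representatives.\<close>

definition eval_level :: "'a set => ('a set => 'a set => int) => ('a => int) => int" where
 "eval_level U a f = (\<Sum>D\<in>rcosets U. a U D * f (rep D))"

lemma coset_subset_iff:
 assumes "U \<in> \<U>" "V \<in> \<U>" "U \<subseteq> V" "C \<in> rcosets U" "D \<in> rcosets V"
 shows "C \<subseteq> D \<longleftrightarrow> V #> rep C = D"
proof
 assume "C \<subseteq> D"
 hence "rep C \<in> D" using rep_coset(1)[OF assms(1,4)] by blast
 thus "V #> rep C = D"
  using mem_coset_iff[OF assms(2) rep_coset(2)[OF assms(1,4)] assms(5)] by simp
next
 assume "V #> rep C = D"
 moreover have "U #> rep C \<subseteq> V #> rep C" using assms(3) by (auto simp: r_coset_def)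
 ultimately show "C \<subseteq> D" using rep_coset(3)[OF assms(1,4)] by simp
qed

text \<open>Compatibility of the family \<open>a\<close> makes the pairing independent of the level:
  the coefficient at a coset of \<open>V\<close> is the sum of the coefficients at the cosets of
  \<open>U\<close> inside it, and \<open>f\<close> is constant on the former.\<close>

lemma eval_level_mono:
 assumes a: "a \<in> carrier kG" and UV: "U \<in> \<U>" "V \<in> \<U>" "U \<subseteq> V" and f: "invariant V f"
 shows "eval_level V a f \<doteq> eval_level U a f"
proof -
 have "eval_level V a f \<doteq> (\<Sum>D\<in>rcosets V. (\<Sum>C\<in>{C \<in> rcosets U. V #> rep C = D}. a U C * f (rep C)))"
  unfolding eval_level_def
 proof (rule meq_sum)
  fix D assume D: "D \<in> rcosets V"
  have eq: "{C \<in> rcosets U. C \<subseteq> D} = {C \<in> rcosets U. V #> rep C = D}"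
   using coset_subset_iff[OF UV _ D] by blast
  have "a V D * f (rep D) \<doteq> (\<Sum>C\<in>{C \<in> rcosets U. C \<subseteq> D}. a U C) * f (rep D)"
   unfolding kG_carrierD(3)[OF a UV D] by (rule meq_scale_right) simp
  also have "... = (\<Sum>C\<in>{C \<in> rcosets U. V #> rep C = D}. a U C * f (rep D))"
   unfolding eq by (rule sum_distrib_right)
  also have "... \<doteq> (\<Sum>C\<in>{C \<in> rcosets U. V #> rep C = D}. a U C * f (rep C))"
  proof (rule meq_sum)
   fix C assume C: "C \<in> {C \<in> rcosets U. V #> rep C = D}"
   have "rep C \<in> D"
    using C mem_coset_iff[OF UV(2) _ D, of "rep C"] rep_coset(2)[OF UV(1), of C] by simp
   thus "a U C * f (rep D) \<doteq> a U C * f (rep C)"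
    using meq_sym[OF invariant_rep[OF f UV(2) D]] by (intro meq_scale_left)
  qed
  finally show "a V D * f (rep D) \<doteq> (\<Sum>C\<in>{C \<in> rcosets U. V #> rep C = D}. a U C * f (rep C))" .
 qed
 also have "... = eval_level U a f"
  unfolding eval_level_def
  using ons_finite_index UV coset_in_rcosets[OF UV(2)] rep_coset(2)[OF UV(1)]
  by (intro sum.group) auto
 finally show ?thesis .
qed

text \<open>The level is an arbitrary choice, which \<open>fun_of_eq\<close> shows to be irrelevant
  modulo \<open>p\<close>. The value is meaningful for locally constant functions only.\<close>

definition fun_of :: "('a set => 'a set => int) => ('a => int) => int" where
 "fun_of a f = eval_level (SOME U. U \<in> \<U> \<and> invariant U f) a f"

lemma fun_of_eq:
 assumes a: "a \<in> carrier kG" and U: "U \<in> \<U>" "invariant U f"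
 shows "fun_of a f \<doteq> eval_level U a f"
proof -
 define V where "V = (SOME U. U \<in> \<U> \<and> invariant U f)"
 have V: "V \<in> \<U>" "invariant V f"
  using someI[of "%U. U \<in> \<U> \<and> invariant U f" U] U by (auto simp: V_def)
 have W: "U \<inter> V \<in> \<U>" using ons_Int U V by simp
 have "fun_of a f = eval_level V a f" by (simp add: fun_of_def V_def)
 also have "... \<doteq> eval_level (U \<inter> V) a f" using eval_level_mono[OF a W V(1) _ V(2)] by simp
 also have "... \<doteq> eval_level U a f" using eval_level_mono[OF a W U(1) _ U(2)] meq_sym by simp
 finally show ?thesis .
qed

lemma functional_fun_of:
 assumes a: "a \<in> carrier kG" shows "functional (fun_of a)"
 unfolding functional_def
proof (intro conjI ballI allI impI)
 fix f g assume "f \<in> loc_const" "g \<in> loc_const"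
 obtain U where U: "U \<in> \<U>" "invariant U f" using \<open>f \<in> loc_const\<close> by (rule loc_constE)
 obtain V where V: "V \<in> \<U>" "invariant V g" using \<open>g \<in> loc_const\<close> by (rule loc_constE)
 define W where "W = U \<inter> V"
 have W: "W \<in> \<U>" "invariant W f" "invariant W g"
  using ons_Int U V invariant_subset unfolding W_def by auto
 have "invariant W (%x. f x + g x)" using W unfolding invariant_def by (auto intro: meq_add)
 hence "fun_of a (%x. f x + g x) \<doteq> eval_level W a (%x. f x + g x)" by (rule fun_of_eq[OF a W(1)])
 also have "... = eval_level W a f + eval_level W a g"
  by (simp add: eval_level_def algebra_simps sum.distrib)
 also have "... \<doteq> fun_of a f + fun_of a g"
  by (intro meq_add meq_sym[OF fun_of_eq[OF a W(1)]] W)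
 finally show "fun_of a (%x. f x + g x) \<doteq> fun_of a f + fun_of a g" .
next
 fix f g assume f: "f \<in> loc_const" and fg: "\<forall>x\<in>carrier G. f x \<doteq> g x"
 obtain U where U: "U \<in> \<U>" "invariant U f" using f by (rule loc_constE)
 have g: "invariant U g"
  unfolding invariant_def
 proof (intro ballI)
  fix x u assume "x \<in> carrier G" "u \<in> U"
  thus "g (u \<otimes> x) \<doteq> g x"
   using fg invariantD[OF U(2), of x u] ons_carrier[OF U(1), of u] by (meson m_closed meq_sym meq_trans)
 qed
 have "fun_of a f \<doteq> eval_level U a f" by (rule fun_of_eq[OF a U])
 also have "... \<doteq> eval_level U a g"
  unfolding eval_level_def using fg rep_coset(2)[OF U(1)] by (intro meq_sum meq_scale_left) simp
 also have "... \<doteq> fun_of a g" by (rule meq_sym[OF fun_of_eq[OF a U(1) g]])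
 finally show "fun_of a f \<doteq> fun_of a g" .
qed

lemma fun_of_coset_ind:
 assumes "a \<in> carrier kG" "U \<in> \<U>" "D \<in> rcosets U"
 shows "fun_of a (coset_ind D) \<doteq> a U D"
proof -
 have ind: "coset_ind D (rep C) = (if C = D then 1 else 0)" if "C \<in> rcosets U" for C
  using mem_coset_iff[OF assms(2) rep_coset(2)[OF assms(2) that] assms(3)] rep_coset(3)[OF assms(2) that]
  by (simp add: coset_ind_def)
 have "fun_of a (coset_ind D) \<doteq> (\<Sum>C\<in>rcosets U. a U C * coset_ind D (rep C))"
  using fun_of_eq[OF assms(1,2) invariant_coset_ind[OF assms(2,3)]] by (simp add: eval_level_def)
 also have "... = (\<Sum>C\<in>rcosets U. if C = D then a U C else 0)"
  using ind by (intro sum.cong) auto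
 also have "... = a U D" using assms(3) ons_finite_index[OF assms(2)] by simp
 finally show ?thesis .
qed

lemma fun_of_inject:
 assumes a: "a \<in> carrier kG" and b: "b \<in> carrier kG"
  and eq: "!!f. f \<in> loc_const ==> fun_of a f \<doteq> fun_of b f"
 shows "a = b"
proof (rule extensionalityI[OF kG_carrierD(1)[OF a] kG_carrierD(1)[OF b]])
 fix U assume U: "U \<in> \<U>"
 show "a U = b U"
 proof (rule PiE_ext[OF kG_carrierD(2)[OF a U] kG_carrierD(2)[OF b U]])
  fix D assume D: "D \<in> rcosets U"
  have "a U D \<doteq> fun_of a (coset_ind D)" by (rule meq_sym[OF fun_of_coset_ind[OF a U D]])
  also have "... \<doteq> fun_of b (coset_ind D)"
   by (rule eq[OF loc_constI[OF U invariant_coset_ind[OF U D]]])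
  also have "... \<doteq> b U D" by (rule fun_of_coset_ind[OF b U D])
  finally have "a U D mod int p = b U D mod int p" by (simp add: mod_eq_def cong_def)
  thus "a U D = b U D" using kG_range[OF a U D] kG_range[OF b U D] by simp
 qed
qed

text \<open>The inverse of \<open>fun_of\<close>: indicator functions of cosets recover the
  coefficients.\<close>

definition of_fun :: "(('a => int) => int) => ('a set => 'a set => int)" where
 "of_fun b = (\<lambda>U\<in>\<U>. \<lambda>D\<in>rcosets U. b (coset_ind D) mod int p)"

text \<open>The family is compatible because the indicator function of a coset of \<open>V\<close>
  is the sum of those of the cosets of \<open>U\<close> contained in it.\<close>

lemma of_fun_carrier:
 assumes b: "functional b" shows "of_fun b \<in> carrier kG"
proof (rule kG_carrierI)
 show "of_fun b \<in> extensional \<U>" by (simp add: of_fun_def)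
 show "of_fun b U \<in> rcosets U \<rightarrow>\<^sub>E {0..int p - 1}" if "U \<in> \<U>" for U
  using that mod_in_residues by (auto simp: of_fun_def)
 fix U V D assume UV: "U \<in> \<U>" "V \<in> \<U>" "U \<subseteq> V" and D: "D \<in> rcosets V"
 have ind: "coset_ind C \<in> loc_const" if "C \<in> rcosets U" for C
  using loc_constI[OF UV(1) invariant_coset_ind[OF UV(1) that]] .
 have dec: "coset_ind D x \<doteq> (\<Sum>C\<in>{C \<in> rcosets U. C \<subseteq> D}. coset_ind C x)" if x: "x \<in> carrier G" for x
 proof -
  have sub: "rep C \<in> D \<longleftrightarrow> C \<subseteq> D" if "C \<in> rcosets U" for C
   using coset_subset_iff[OF UV that D] mem_coset_iff[OF UV(2) rep_coset(2)[OF UV(1) that] D] by simp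
  have "coset_ind D x \<doteq> (\<Sum>C\<in>rcosets U. coset_ind D (rep C) * coset_ind C x)"
   using invariant_subset[OF invariant_coset_ind[OF UV(2) D] UV(3)]
   by (rule coset_decomposition[OF UV(1) _ x])
  also have "... = (\<Sum>C\<in>rcosets U. if C \<subseteq> D then coset_ind C x else 0)"
   using sub by (intro sum.cong) (auto simp: coset_ind_def)
  also have "... = (\<Sum>C\<in>{C \<in> rcosets U. C \<subseteq> D}. coset_ind C x)"
   using ons_finite_index[OF UV(1)] by (simp add: sum.inter_filter)
  finally show ?thesis .
 qed
 have "b (coset_ind D) \<doteq> b (%x. \<Sum>C\<in>{C \<in> rcosets U. C \<subseteq> D}. coset_ind C x)"
  using dec by (rule functional_cong[OF b loc_constI[OF UV(2) invariant_coset_ind[OF UV(2) D]]])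
 also have "... \<doteq> (\<Sum>C\<in>{C \<in> rcosets U. C \<subseteq> D}. b (coset_ind C))"
  using ind by (intro functional_sum[OF b]) auto
 also have "... \<doteq> (\<Sum>C\<in>{C \<in> rcosets U. C \<subseteq> D}. of_fun b U C)"
  using UV(1) by (intro meq_sum) (simp add: of_fun_def)
 finally show "of_fun b V D = (\<Sum>C\<in>{C \<in> rcosets U. C \<subseteq> D}. of_fun b U C) mod int p"
  using UV D by (simp add: of_fun_def mod_eq_def cong_def)
qed

lemma fun_of_of_fun:
 assumes b: "functional b" and f: "f \<in> loc_const"
 shows "fun_of (of_fun b) f \<doteq> b f"
proof -
 obtain U where U: "U \<in> \<U>" "invariant U f" using f by (rule loc_constE)
 have "fun_of (of_fun b) f \<doteq> eval_level U (of_fun b) f" by (rule fun_of_eq[OF of_fun_carrier[OF b] U])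
 also have "... \<doteq> (\<Sum>D\<in>rcosets U. f (rep D) * b (coset_ind D))"
  unfolding eval_level_def of_fun_def using U(1)
  by (intro meq_sum) (simp add: mult.commute[of "f _"] meq_scale_right)
 also have "... \<doteq> b f" by (rule meq_sym[OF functional_decomposition[OF b U]])
 finally show ?thesis .
qed

lemma fun_of_zero: "fun_of \<zero>\<^bsub>kG\<^esub> f \<doteq> 0" if "f \<in> loc_const"
proof -
 have "(SOME U. U \<in> \<U> \<and> invariant U f) \<in> \<U>"
  using someI_ex[of "%U. U \<in> \<U> \<and> invariant U f"] that by (auto elim: loc_constE)
 hence "fun_of \<zero>\<^bsub>kG\<^esub> f = 0"
  unfolding fun_of_def eval_level_def
  by (intro sum.neutral) (simp add: completed_group_algebra_def Let_def group_algebra_def FactGroup_def)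
 thus ?thesis by simp
qed

lemma fun_of_add:
 assumes "a \<in> carrier kG" "b \<in> carrier kG" "a \<oplus>\<^bsub>kG\<^esub> b \<in> carrier kG" "f \<in> loc_const"
 shows "fun_of (a \<oplus>\<^bsub>kG\<^esub> b) f \<doteq> fun_of a f + fun_of b f"
proof -
 obtain U where U: "U \<in> \<U>" "invariant U f" using assms(4) by (rule loc_constE)
 have "fun_of (a \<oplus>\<^bsub>kG\<^esub> b) f \<doteq> eval_level U (a \<oplus>\<^bsub>kG\<^esub> b) f" by (rule fun_of_eq[OF assms(3) U])
 also have "... \<doteq> (\<Sum>D\<in>rcosets U. (a U D + b U D) * f (rep D))"
  unfolding eval_level_def using U(1)
  by (intro meq_sum meq_scale_right)
    (simp add: completed_group_algebra_def Let_def group_algebra_def FactGroup_def)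
 also have "... = eval_level U a f + eval_level U b f"
  by (simp add: eval_level_def algebra_simps sum.distrib)
 also have "... \<doteq> fun_of a f + fun_of b f"
  by (intro meq_add meq_sym[OF fun_of_eq[OF _ U]] assms)
 finally show ?thesis .
qed

text \<open>The product of the group algebra becomes convolution of functionals: a group element of
  the product is a product \<open>y \<otimes> z\<close>, with \<open>a\<close> applied in
  \<open>y\<close> and \<open>b\<close> in \<open>z\<close>.\<close>

lemma fun_of_mult:
 assumes a: "a \<in> carrier kG" and b: "b \<in> carrier kG" and ab: "a \<otimes>\<^bsub>kG\<^esub> b \<in> carrier kG"
  and f: "f \<in> loc_const"
 shows "fun_of (a \<otimes>\<^bsub>kG\<^esub> b) f \<doteq> fun_of a (%y. fun_of b (%z. f (y \<otimes> z)))"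
proof -
 obtain U where U: "U \<in> \<U>" "invariant U f" using f by (rule loc_constE)
 interpret N: normal U G by (rule ons_normal[OF U(1)])
 interpret Q: group "G Mod U" by (rule N.factorgroup_is_group)
 have cQ: "carrier (G Mod U) = rcosets U" by (simp add: FactGroup_def)
 have fin: "finite (rcosets U)" by (rule ons_finite_index[OF U(1)])
 have closed: "inv\<^bsub>G Mod U\<^esub> x <#> z \<in> rcosets U" "x <#> z \<in> rcosets U"
  if "x \<in> rcosets U" "z \<in> rcosets U" for x z
  using Q.m_closed[of "inv\<^bsub>G Mod U\<^esub> x" z] Q.m_closed[of x z] Q.inv_closed[of x] that cQ by simp_all
 have prodQ: "(a \<otimes>\<^bsub>kG\<^esub> b) U E \<doteq> (\<Sum>x\<in>rcosets U. a U x * b U (inv\<^bsub>G Mod U\<^esub> x <#> E))"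
  if E: "E \<in> rcosets U" for E
 proof -
  have "(a \<otimes>\<^bsub>kG\<^esub> b) U E = (\<Oplus>\<^bsub>residue_ring (int p)\<^esub>x\<in>rcosets U.
    (a U x * b U (inv\<^bsub>G Mod U\<^esub> x <#> E)) mod int p)"
   using U(1) E cQ by (simp add: completed_group_algebra_def Let_def group_algebra_def)
  also have "... = (\<Sum>x\<in>rcosets U. (a U x * b U (inv\<^bsub>G Mod U\<^esub> x <#> E)) mod int p) mod int p"
   by (rule finsum_residue_ring[OF prime_p fin mod_in_residues])
  also have "... \<doteq> (\<Sum>x\<in>rcosets U. a U x * b U (inv\<^bsub>G Mod U\<^esub> x <#> E))"
   by (simp add: meq_sum)
  finally show ?thesis .
 qed
 have frep: "f (rep (x <#> D)) \<doteq> f (rep x \<otimes> rep D)" if "x \<in> rcosets U" "D \<in> rcosets U" for x D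
 proof -
  have "x <#> D = U #> (rep x \<otimes> rep D)"
   using N.rcos_sum[OF rep_coset(2)[OF U(1) that(1)] rep_coset(2)[OF U(1) that(2)]]
    rep_coset(3)[OF U(1) that(1)] rep_coset(3)[OF U(1) that(2)] by simp
  moreover have "rep (x <#> D) \<in> x <#> D" using rep_coset(1)[OF U(1) closed(2)[OF that]] .
  ultimately show ?thesis
   using invariant_coset[OF U(2,1)] rep_coset(2)[OF U(1)] that by simp
 qed
 have bf: "(\<Sum>D\<in>rcosets U. b U D * f (y \<otimes> rep D)) \<doteq> fun_of b (%z. f (y \<otimes> z))" if "y \<in> carrier G" for y
  using meq_sym[OF fun_of_eq[OF b U(1) invariant_translate(1)[OF U(2,1) that]]]
  by (simp add: eval_level_def)
 have "fun_of (a \<otimes>\<^bsub>kG\<^esub> b) f \<doteq> eval_level U (a \<otimes>\<^bsub>kG\<^esub> b) f" by (rule fun_of_eq[OF ab U])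
 also have "... \<doteq> (\<Sum>E\<in>rcosets U. (\<Sum>x\<in>rcosets U. a U x * b U (inv\<^bsub>G Mod U\<^esub> x <#> E)) * f (rep E))"
  unfolding eval_level_def using prodQ by (intro meq_sum meq_scale_right)
 also have "... = (\<Sum>E\<in>rcosets U. \<Sum>x\<in>rcosets U. a U x * (b U (inv\<^bsub>G Mod U\<^esub> x <#> E) * f (rep E)))"
  by (simp add: sum_distrib_right mult.assoc)
 also have "... = (\<Sum>x\<in>rcosets U. \<Sum>E\<in>rcosets U. a U x * (b U (inv\<^bsub>G Mod U\<^esub> x <#> E) * f (rep E)))"
  by (rule sum.swap)
 also have "... = (\<Sum>x\<in>rcosets U. a U x * (\<Sum>E\<in>rcosets U. b U (inv\<^bsub>G Mod U\<^esub> x <#> E) * f (rep E)))"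
  by (simp add: sum_distrib_left)
 \<comment> \<open>Substitution \<open>E = x <#> D\<close>, which permutes the cosets of
   \<open>U\<close>.\<close>
 also have "... = (\<Sum>x\<in>rcosets U. a U x * (\<Sum>D\<in>rcosets U. b U D * f (rep (x <#> D))))"
 proof (rule sum.cong[OF HOL.refl], rule arg_cong2[where f = "(*)", OF HOL.refl])
  fix x assume x: "x \<in> rcosets U"
  have xi: "inv\<^bsub>G Mod U\<^esub> x <#> (x <#> D) = D" "x <#> (inv\<^bsub>G Mod U\<^esub> x <#> D) = D" if "D \<in> rcosets U" for D
   using Q.m_assoc[of "inv\<^bsub>G Mod U\<^esub> x" x D] Q.m_assoc[of x "inv\<^bsub>G Mod U\<^esub> x" D] Q.l_inv[of x] Q.r_inv[of x]
    Q.l_one[of D] Q.inv_closed[of x] x that cQ by simp_all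
  show "(\<Sum>E\<in>rcosets U. b U (inv\<^bsub>G Mod U\<^esub> x <#> E) * f (rep E)) = (\<Sum>D\<in>rcosets U. b U D * f (rep (x <#> D)))"
   by (rule sum.reindex_bij_witness[where i = "%D. x <#> D" and j = "%E. inv\<^bsub>G Mod U\<^esub> x <#> E"])
     (use xi closed x in auto)
 qed
 also have "... \<doteq> (\<Sum>x\<in>rcosets U. a U x * (\<Sum>D\<in>rcosets U. b U D * f (rep x \<otimes> rep D)))"
  using frep by (intro meq_sum meq_scale_left)
 also have "... \<doteq> (\<Sum>x\<in>rcosets U. a U x * fun_of b (%z. f (rep x \<otimes> z)))"
  using bf rep_coset(2)[OF U(1)] by (intro meq_sum meq_scale_left) simp
 also have "... = eval_level U a (%y. fun_of b (%z. f (y \<otimes> z)))" by (simp add: eval_level_def)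
 also have "... \<doteq> fun_of a (%y. fun_of b (%z. f (y \<otimes> z)))"
  by (rule meq_sym[OF fun_of_eq[OF a U(1) invariant_functional_translate(1)[OF functional_fun_of[OF b] U]]])
 finally show ?thesis .
qed

lemma conv_cong:
 assumes a: "functional a" and b: "functional b" and f: "f \<in> loc_const"
  and aa: "!!f. f \<in> loc_const ==> a f \<doteq> a' f" and bb: "!!f. f \<in> loc_const ==> b f \<doteq> b' f"
  and a': "functional a'"
 shows "a (%y. b (%z. f (y \<otimes> z))) \<doteq> a' (%y. b' (%z. f (y \<otimes> z)))"
proof -
 obtain U where U: "U \<in> \<U>" "invariant U f" using f by (rule loc_constE)
 have lc: "(%y. b (%z. f (y \<otimes> z))) \<in> loc_const"
  by (rule loc_constI[OF U(1) invariant_functional_translate(1)[OF b U]])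
 have "a (%y. b (%z. f (y \<otimes> z))) \<doteq> a' (%y. b (%z. f (y \<otimes> z)))" by (rule aa[OF lc])
 also have "... \<doteq> a' (%y. b' (%z. f (y \<otimes> z)))"
  by (rule functional_cong[OF a' lc]) (rule bb[OF loc_const_translate(1)[OF f]])
 finally show ?thesis .
qed

context
 assumes ring_kG: "ring kG"
begin

interpretation S: ring kG by (rule ring_kG)

lemma fun_of_finsum:
 assumes "finite I" "!!i. i \<in> I ==> a i \<in> carrier kG" "f \<in> loc_const"
 shows "fun_of (\<Oplus>\<^bsub>kG\<^esub>i\<in>I. a i) f \<doteq> (\<Sum>i\<in>I. fun_of (a i) f)"
 using assms(1,2)
proof (induction I rule: finite_induct)
 case empty
 show ?case using fun_of_zero[OF assms(3)] by simp
next
 case (insert i I)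
 have c: "a i \<in> carrier kG" "(\<Oplus>\<^bsub>kG\<^esub>i\<in>I. a i) \<in> carrier kG"
  using insert by (auto intro!: S.finsum_closed)
 have "(\<Oplus>\<^bsub>kG\<^esub>i\<in>insert i I. a i) = a i \<oplus>\<^bsub>kG\<^esub> (\<Oplus>\<^bsub>kG\<^esub>i\<in>I. a i)"
  using insert by (intro S.finsum_insert) auto
 hence "fun_of (\<Oplus>\<^bsub>kG\<^esub>i\<in>insert i I. a i) f \<doteq> fun_of (a i) f + fun_of (\<Oplus>\<^bsub>kG\<^esub>i\<in>I. a i) f"
  using fun_of_add[OF c S.a_closed[OF c] assms(3)] by simp
 also have "... \<doteq> fun_of (a i) f + (\<Sum>i\<in>I. fun_of (a i) f)"
  using insert by (intro meq_add) auto
 finally show ?case using insert by simp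
qed

lemma fun_of_matrix_mult:
 assumes A: "A \<in> matrices kG n m" and B: "B \<in> matrices kG m k" and ij: "i < n" "j < k" and f: "f \<in> loc_const"
 shows "fun_of (matrix_mult kG A B $$ (i, j)) f
   \<doteq> (\<Sum>l<m. fun_of (A $$ (i, l)) (%y. fun_of (B $$ (l, j)) (%z. f (y \<otimes> z))))"
proof -
 have c: "A $$ (i, l) \<in> carrier kG" "B $$ (l, j) \<in> carrier kG" if "l < m" for l
  using A B ij that by (simp_all add: matrices_iff)
 have "fun_of (matrix_mult kG A B $$ (i, j)) f \<doteq> (\<Sum>l<m. fun_of (A $$ (i, l) \<otimes>\<^bsub>kG\<^esub> B $$ (l, j)) f)"
  unfolding matrix_mult_index[OF A B ij] using c f by (intro fun_of_finsum) auto
 also have "... \<doteq> (\<Sum>l<m. fun_of (A $$ (i, l)) (%y. fun_of (B $$ (l, j)) (%z. f (y \<otimes> z))))"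
  using c f by (intro meq_sum fun_of_mult) auto
 finally show ?thesis .
qed

definition mat_of :: "nat => nat => (nat => nat => ('a => int) => int) => ('a set => 'a set => int) mat" where
 "mat_of n m \<phi> = mat n m (%(i, j). of_fun (\<phi> i j))"

lemma mat_of_matrices:
 "(!!i j. i < n ==> j < m ==> functional (\<phi> i j)) ==> mat_of n m \<phi> \<in> matrices kG n m"
 unfolding mat_of_def by (rule mat_in_matrices) (simp add: of_fun_carrier)

lemma mat_of_index [simp]: "i < n ==> j < m ==> mat_of n m \<phi> $$ (i, j) = of_fun (\<phi> i j)"
 by (simp add: mat_of_def)

lemma mat_of_mult_zero_iff:
 assumes \<phi>: "!!i j. i < n ==> j < m ==> functional (\<phi> i j)"
  and \<psi>: "!!i j. i < m ==> j < k ==> functional (\<psi> i j)"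
 shows "matrix_mult kG (mat_of n m \<phi>) (mat_of m k \<psi>) = zero_matrix kG n k \<longleftrightarrow>
  (\<forall>i<n. \<forall>j<k. \<forall>f\<in>loc_const. (\<Sum>l<m. \<phi> i l (%y. \<psi> l j (%z. f (y \<otimes> z)))) \<doteq> 0)"
  (is "?L \<longleftrightarrow> ?R")
proof -
 note A = mat_of_matrices[OF \<phi>, of n m] and B = mat_of_matrices[OF \<psi>, of m k]
 have mult: "fun_of (matrix_mult kG (mat_of n m \<phi>) (mat_of m k \<psi>) $$ (i, j)) f
   \<doteq> (\<Sum>l<m. \<phi> i l (%y. \<psi> l j (%z. f (y \<otimes> z))))"
  if ij: "i < n" "j < k" and f: "f \<in> loc_const" for i j f
 proof -
  have "fun_of (matrix_mult kG (mat_of n m \<phi>) (mat_of m k \<psi>) $$ (i, j)) f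
    \<doteq> (\<Sum>l<m. fun_of (mat_of n m \<phi> $$ (i, l)) (%y. fun_of (mat_of m k \<psi> $$ (l, j)) (%z. f (y \<otimes> z))))"
   by (rule fun_of_matrix_mult[OF A B ij f])
  also have "... \<doteq> (\<Sum>l<m. \<phi> i l (%y. \<psi> l j (%z. f (y \<otimes> z))))"
  proof (rule meq_sum)
   fix l assume "l \<in> {..<m}"
   hence l: "l < m" by simp
   have "fun_of (of_fun (\<phi> i l)) (%y. fun_of (of_fun (\<psi> l j)) (%z. f (y \<otimes> z)))
     \<doteq> \<phi> i l (%y. \<psi> l j (%z. f (y \<otimes> z)))"
    by (rule conv_cong[OF functional_fun_of[OF of_fun_carrier[OF \<phi>[OF ij(1) l]]]
       functional_fun_of[OF of_fun_carrier[OF \<psi>[OF l ij(2)]]] f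
       fun_of_of_fun[OF \<phi>[OF ij(1) l]] fun_of_of_fun[OF \<psi>[OF l ij(2)]] \<phi>[OF ij(1) l]])
   thus "fun_of (mat_of n m \<phi> $$ (i, l)) (%y. fun_of (mat_of m k \<psi> $$ (l, j)) (%z. f (y \<otimes> z)))
     \<doteq> \<phi> i l (%y. \<psi> l j (%z. f (y \<otimes> z)))"
    using ij l by simp
  qed
  finally show ?thesis .
 qed
 show ?thesis
 proof
  assume ?L
  show ?R
  proof (intro allI impI ballI)
   fix i j f assume ij: "i < n" "j < k" and f: "f \<in> loc_const"
   have "(\<Sum>l<m. \<phi> i l (%y. \<psi> l j (%z. f (y \<otimes> z)))) \<doteq> fun_of \<zero>\<^bsub>kG\<^esub> f"
    using meq_sym[OF mult[OF ij f]] \<open>?L\<close> ij by simp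
   also have "... \<doteq> 0" by (rule fun_of_zero[OF f])
   finally show "(\<Sum>l<m. \<phi> i l (%y. \<psi> l j (%z. f (y \<otimes> z)))) \<doteq> 0" .
  qed
 next
  assume R: ?R
  note AB = S.matrix_mult_closed[OF A B]
  show ?L
  proof (rule eq_matI)
   fix i j assume "i < dim_row (zero_matrix kG n k)" "j < dim_col (zero_matrix kG n k)"
   hence ij: "i < n" "j < k" by auto
   have "matrix_mult kG (mat_of n m \<phi>) (mat_of m k \<psi>) $$ (i, j) = \<zero>\<^bsub>kG\<^esub>"
   proof (rule fun_of_inject)
    show "matrix_mult kG (mat_of n m \<phi>) (mat_of m k \<psi>) $$ (i, j) \<in> carrier kG"
     using AB ij by (simp add: matrices_iff)
    fix f assume f: "f \<in> loc_const"
    have "fun_of (matrix_mult kG (mat_of n m \<phi>) (mat_of m k \<psi>) $$ (i, j)) f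
      \<doteq> (\<Sum>l<m. \<phi> i l (%y. \<psi> l j (%z. f (y \<otimes> z))))" by (rule mult[OF ij f])
    also have "... \<doteq> 0" using R ij f by blast
    also have "0 \<doteq> fun_of \<zero>\<^bsub>kG\<^esub> f" by (rule meq_sym[OF fun_of_zero[OF f]])
    finally show "fun_of (matrix_mult kG (mat_of n m \<phi>) (mat_of m k \<psi>) $$ (i, j)) f \<doteq> fun_of \<zero>\<^bsub>kG\<^esub> f" .
   qed simp
   thus "matrix_mult kG (mat_of n m \<phi>) (mat_of m k \<psi>) $$ (i, j) = zero_matrix kG n k $$ (i, j)"
    using ij by simp
  qed (use A B in \<open>simp_all add: matrices_iff\<close>)
 qed
qed

lemma mat_of_fun_of:
 assumes M: "M \<in> matrices kG n m"
 shows "mat_of n m (%i j. fun_of (M $$ (i, j))) = M"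
proof (rule eq_matI)
 fix i j assume "i < dim_row M" "j < dim_col M"
 hence ij: "i < n" "j < m" and c: "M $$ (i, j) \<in> carrier kG" using M by (auto simp: matrices_iff)
 have "of_fun (fun_of (M $$ (i, j))) = M $$ (i, j)"
  using fun_of_inject[OF of_fun_carrier[OF functional_fun_of[OF c]] c fun_of_of_fun[OF functional_fun_of[OF c]]] .
 thus "mat_of n m (%i j. fun_of (M $$ (i, j))) $$ (i, j) = M $$ (i, j)" using ij by simp
qed (use M in \<open>simp_all add: matrices_iff mat_of_def\<close>)

end

text \<open>\<open>sylvester_dichotomy\<close> for the row \<open>\<alpha>\<close> and the matrix
  \<open>v\<close>, carried over by \<open>of_fun\<close> and \<open>fun_of\<close>: ring elements
  become functionals, products become convolutions, and equations become congruences at every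
  locally constant function.\<close>

lemma functional_dichotomy:
 fixes d s :: nat
 assumes syl: "sylvester_domain kG"
  and \<alpha>: "!!i. i < d ==> functional (\<alpha> i)" and v: "!!i j. i < d ==> j < s ==> functional (v i j)"
  and zero: "!!j f. j < s ==> f \<in> loc_const ==> (\<Sum>i<d. \<alpha> i (%y. v i j (%z. f (y \<otimes> z)))) \<doteq> 0"
 shows "(\<exists>k<s. \<exists>\<beta> \<epsilon>. (\<forall>i<d. \<forall>l<k. functional (\<beta> i l)) \<and> (\<forall>l<k. \<forall>j<s. functional (\<epsilon> l j)) \<and>
      (\<forall>i<d. \<forall>j<s. \<forall>f\<in>loc_const. v i j f \<doteq> (\<Sum>l<k. \<beta> i l (%y. \<epsilon> l j (%z. f (y \<otimes> z))))) \<and>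
      (\<forall>l<k. \<forall>f\<in>loc_const. (\<Sum>i<d. \<alpha> i (%y. \<beta> i l (%z. f (y \<otimes> z)))) \<doteq> 0))
  \<or> (s \<le> d \<and> (\<forall>u. (\<forall>j<s. functional (u j)) -->
      (\<forall>i<d. \<forall>f\<in>loc_const. (\<Sum>j<s. v i j (%y. u j (%z. f (y \<otimes> z)))) \<doteq> 0) -->
      (\<forall>j<s. \<forall>f\<in>loc_const. u j f \<doteq> 0)))"
proof -
 have rk: "ring kG" using syl by (simp add: sylvester_domain_def)
 interpret S: ring kG by (rule rk)
 let ?A = "mat_of 1 d (%_. \<alpha>)"
 let ?V = "mat_of d s v"
 have A: "?A \<in> matrices kG 1 d" and V: "?V \<in> matrices kG d s"
  using \<alpha> v by (auto intro!: mat_of_matrices[OF rk])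
 have "matrix_mult kG ?A ?V = zero_matrix kG 1 s"
  using zero \<alpha> v by (subst mat_of_mult_zero_iff[OF rk]) auto
 from S.sylvester_dichotomy[OF syl A V this]
 consider k B E where "k < s" "B \<in> matrices kG d k" "E \<in> matrices kG k s" "?V = matrix_mult kG B E"
   "matrix_mult kG ?A B = zero_matrix kG 1 k"
  | "s \<le> d" "\<forall>u\<in>matrices kG s 1. matrix_mult kG ?V u = zero_matrix kG d 1 --> u = zero_matrix kG s 1"
  by blast
 thus ?thesis
 proof cases
  case 1
  define \<beta> where "\<beta> i l = fun_of (B $$ (i, l))" for i l
  define \<epsilon> where "\<epsilon> l j = fun_of (E $$ (l, j))" for l j
  have \<beta>: "functional (\<beta> i l)" if "i < d" "l < k" for i l
   unfolding \<beta>_def using that 1(2) by (intro functional_fun_of) (simp add: matrices_iff)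
  have \<epsilon>: "functional (\<epsilon> l j)" if "l < k" "j < s" for l j
   unfolding \<epsilon>_def using that 1(3) by (intro functional_fun_of) (simp add: matrices_iff)
  have "v i j f \<doteq> (\<Sum>l<k. \<beta> i l (%y. \<epsilon> l j (%z. f (y \<otimes> z))))"
   if ij: "i < d" "j < s" and f: "f \<in> loc_const" for i j f
  proof -
   have "v i j f \<doteq> fun_of (?V $$ (i, j)) f"
    using meq_sym[OF fun_of_of_fun[OF v[OF ij] f]] ij by (simp add: mat_of_index[OF rk])
   also have "... \<doteq> (\<Sum>l<k. \<beta> i l (%y. \<epsilon> l j (%z. f (y \<otimes> z))))"
    unfolding 1(4) \<beta>_def \<epsilon>_def by (rule fun_of_matrix_mult[OF rk 1(2,3) ij f])
   finally show ?thesis .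
  qed
  moreover have "(\<Sum>i<d. \<alpha> i (%y. \<beta> i l (%z. f (y \<otimes> z)))) \<doteq> 0" if "l < k" "f \<in> loc_const" for l f
  proof -
   have "matrix_mult kG ?A (mat_of d k \<beta>) = zero_matrix kG 1 k"
    using 1(5) mat_of_fun_of[OF rk 1(2)] by (simp add: \<beta>_def[abs_def])
   thus ?thesis
    using that \<alpha> \<beta> by (subst (asm) mat_of_mult_zero_iff[OF rk]) auto
  qed
  ultimately have *: "\<forall>i<d. \<forall>j<s. \<forall>f\<in>loc_const. v i j f \<doteq> (\<Sum>l<k. \<beta> i l (%y. \<epsilon> l j (%z. f (y \<otimes> z))))"
   "\<forall>l<k. \<forall>f\<in>loc_const. (\<Sum>i<d. \<alpha> i (%y. \<beta> i l (%z. f (y \<otimes> z)))) \<doteq> 0"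
   by simp_all
  have **: "\<forall>i<d. \<forall>l<k. functional (\<beta> i l)" "\<forall>l<k. \<forall>j<s. functional (\<epsilon> l j)"
   using \<beta> \<epsilon> by simp_all
  show ?thesis
   by (rule disjI1, rule exI[of _ k], intro conjI 1(1) exI[of _ \<beta>] exI[of _ \<epsilon>] ** *)
 next
  case 2
  have "u j f \<doteq> 0"
   if u: "\<forall>j<s. functional (u j)"
    and vu: "\<forall>i<d. \<forall>f\<in>loc_const. (\<Sum>j<s. v i j (%y. u j (%z. f (y \<otimes> z)))) \<doteq> 0"
    and j: "j < s" and f: "f \<in> loc_const" for u j f
  proof -
   have U: "mat_of s 1 (%j _. u j) \<in> matrices kG s 1"
    using u by (intro mat_of_matrices[OF rk]) auto
   have "matrix_mult kG ?V (mat_of s 1 (%j _. u j)) = zero_matrix kG d 1"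
    using u vu v by (subst mat_of_mult_zero_iff[OF rk]) auto
   hence "mat_of s 1 (%j _. u j) = zero_matrix kG s 1" using 2(2) U by blast
   hence "mat_of s 1 (%j _. u j) $$ (j, 0) = zero_matrix kG s 1 $$ (j, 0)" by simp
   hence "of_fun (u j) = \<zero>\<^bsub>kG\<^esub>" using j by (simp add: mat_of_index[OF rk])
   thus ?thesis
    using meq_trans[OF meq_sym[OF fun_of_of_fun[OF _ f, of "u j"]]] fun_of_zero[OF f] u j by simp
  qed
  thus ?thesis using 2(1) by simp
 qed
qed

end

text \<open>Subspaces of a vector space of functions over the field with \<open>p\<close> elements are represented by
 additive groups of integer valued functions; the quotient by the multiples of \<open>p\<close> is implicit.\<close>

definition int_subspace :: "('b => int) set => bool" where
 "int_subspace W \<longleftrightarrow> (%_. 0) \<in> W \<and> (\<forall>f\<in>W. \<forall>g\<in>W. (%x. f x + g x) \<in> W) \<and> (\<forall>f\<in>W. \<forall>c. (%x. c * f x) \<in> W)"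

lemma int_subspaceD:
 assumes "int_subspace W"
 shows "(%_. 0) \<in> W" "f \<in> W ==> g \<in> W ==> (%x. f x + g x) \<in> W" "f \<in> W ==> (%x. c * f x) \<in> W"
  "f \<in> W ==> g \<in> W ==> (%x. f x - g x) \<in> W"
proof -
 show *: "(%_. 0) \<in> W" "!!f g. f \<in> W ==> g \<in> W ==> (%x. f x + g x) \<in> W"
  "!!f c. f \<in> W ==> (%x. c * f x) \<in> W"
  using assms by (auto simp: int_subspace_def)
 show "(%x. f x - g x) \<in> W" if "f \<in> W" "g \<in> W"
  using *(2)[OF that(1) *(3)[OF that(2), of "-1"]] by simp
qed

lemma int_subspace_sum:
 assumes "int_subspace W" "!!i. i \<in> I ==> f i \<in> W"
 shows "(%x. \<Sum>i\<in>I. f i x) \<in> W"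
 using assms(2)
proof (induction I rule: infinite_finite_induct)
 case (insert i I)
 thus ?case using int_subspaceD(2)[OF assms(1), of "f i" "%x. \<Sum>i\<in>I. f i x"] by simp
qed (use int_subspaceD(1)[OF assms(1)] in simp_all)

text \<open>A subspace \<open>X\<close> containing \<open>W\<close> and maximal among those without \<open>w\<close> has codimension one.\<close>

lemma separating_functional:
 fixes V W :: "('b => int) set"
 assumes p: "prime p" and V: "int_subspace V" and W: "int_subspace W" and WV: "W \<subseteq> V"
  and pV: "!!f. f \<in> V ==> (%x. int p * f x) \<in> W" and w: "w \<in> V" "w \<notin> W"
 obtains v :: "('b => int) => int" where
  "!!f g. f \<in> V ==> g \<in> V ==> mod_eq p (v (%x. f x + g x)) (v f + v g)"
  "!!f. f \<in> W ==> mod_eq p (v f) 0" "mod_eq p (v w) 1"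
proof -
 define \<A> where "\<A> = {X. int_subspace X \<and> W \<subseteq> X \<and> X \<subseteq> V \<and> w \<notin> X}"
 have "\<exists>X\<in>\<A>. \<forall>Y\<in>\<A>. X \<subseteq> Y --> Y = X"
 proof (rule subset_Zorn_nonempty)
  show "\<A> ~= {}" using W WV w by (auto simp: \<A>_def)
  fix \<C> assume ne: "\<C> ~= {}" and ch: "subset.chain \<A> \<C>"
  have sub: "\<C> \<subseteq> \<A>" using ch by (simp add: subset_chain_def)
  have "int_subspace (\<Union>\<C>)"
   unfolding int_subspace_def
  proof (intro conjI ballI allI)
   obtain X where X: "X \<in> \<C>" using ne by blast
   hence "int_subspace X" using sub by (auto simp: \<A>_def)
   thus "(%_. 0) \<in> \<Union>\<C>" using int_subspaceD(1) X by blast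
  next
   fix f g assume "f \<in> \<Union>\<C>" "g \<in> \<Union>\<C>"
   then obtain X Y where XY: "X \<in> \<C>" "f \<in> X" "Y \<in> \<C>" "g \<in> Y" by blast
   have "X \<subseteq> Y \<or> Y \<subseteq> X" using ch XY by (simp add: subset_chain_def)
   then obtain Z where Z: "Z \<in> \<C>" "f \<in> Z" "g \<in> Z"
    using XY by auto
   hence "int_subspace Z" using sub by (auto simp: \<A>_def)
   hence "(%x. f x + g x) \<in> Z" using Z by (intro int_subspaceD(2))
   thus "(%x. f x + g x) \<in> \<Union>\<C>" using Z by blast
  next
   fix f c assume "f \<in> \<Union>\<C>"
   then obtain X where X: "X \<in> \<C>" "f \<in> X" by blast
   hence "int_subspace X" using sub by (auto simp: \<A>_def)
   hence "(%x. c * f x) \<in> X" using X by (intro int_subspaceD(3))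
   thus "(%x. c * f x) \<in> \<Union>\<C>" using X by blast
  qed
  thus "\<Union>\<C> \<in> \<A>" using sub ne by (auto simp: \<A>_def)
 qed
 then obtain X where X: "X \<in> \<A>" "!!Y. Y \<in> \<A> ==> X \<subseteq> Y ==> Y = X" by blast
 have XS: "int_subspace X" and WX: "W \<subseteq> X" and XV: "X \<subseteq> V" and wX: "w \<notin> X"
  using X(1) by (auto simp: \<A>_def)
 note Xd = int_subspaceD[OF XS] and Vd = int_subspaceD[OF V]
 have ex: "\<exists>c. (%x. f x - c * w x) \<in> X" if f: "f \<in> V" for f
 proof (cases "f \<in> X")
  case True
  thus ?thesis by (intro exI[of _ 0]) simp
 next
  case False
  define Y where "Y = {%x. g x + c * f x | g c. g \<in> X}"
  have YI: "(%x. g x + c * f x) \<in> Y" if "g \<in> X" for g c using that Y_def by blast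
  have "int_subspace Y"
   unfolding int_subspace_def
  proof (intro conjI ballI allI)
   show "(%_. 0) \<in> Y" using YI[OF Xd(1), of 0] by simp
  next
   fix a b assume "a \<in> Y" "b \<in> Y"
   then obtain g c g' c' where "a = (%x. g x + c * f x)" "g \<in> X" "b = (%x. g' x + c' * f x)" "g' \<in> X"
    unfolding Y_def by blast
   thus "(%x. a x + b x) \<in> Y"
    using YI[OF Xd(2)[of g g'], of "c + c'"] by (simp add: algebra_simps)
  next
   fix a k assume "a \<in> Y"
   then obtain g c where "a = (%x. g x + c * f x)" "g \<in> X" unfolding Y_def by blast
   thus "(%x. k * a x) \<in> Y"
    using YI[OF Xd(3)[of g k], of "k * c"] by (simp add: algebra_simps)
  qed
  moreover have XY: "X \<subseteq> Y"
  proof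
   fix g assume "g \<in> X" thus "g \<in> Y" using YI[of g 0] by simp
  qed
  moreover have "f \<in> Y" using YI[OF Xd(1), of 1] by simp
  moreover have "Y \<subseteq> V"
   unfolding Y_def using XV f Vd(2,3) by auto
  \<comment> \<open>\<open>Y\<close> is strictly larger than \<open>X\<close>, so by maximality it
    contains \<open>w\<close>. The coefficient \<open>c\<close> of \<open>f\<close> is then
    invertible modulo \<open>p\<close>, and with an inverse \<open>a\<close> of \<open>c\<close> the
    function \<open>f - a w\<close> lies in \<open>X\<close>.\<close>
  ultimately have "w \<in> Y" using X(2)[of Y] False WX unfolding \<A>_def by blast
  then obtain g c where gc: "w = (%x. g x + c * f x)" "g \<in> X" unfolding Y_def by blast
  have "coprime c (int p)"
  proof (rule ccontr)
   assume "\<not> coprime c (int p)"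
   hence "int p dvd c" using prime_imp_coprime[of "int p" c] p by (auto simp: coprime_commute)
   then obtain k where "c = int p * k" by (auto elim: dvdE)
   hence "w = (%x. g x + int p * (k * f x))" using gc by (simp add: algebra_simps)
   moreover have "(%x. int p * (k * f x)) \<in> X" using pV[OF Vd(3)[OF f]] WX by blast
   ultimately have "w \<in> X" using Xd(2)[OF gc(2)] by simp
   thus False using wX by simp
  qed
  then obtain a b where ab: "a * c + b * int p = 1" by (metis bezout_int coprime_iff_gcd_eq_1)
  have "(%x. int p * (b * f x)) \<in> X" using pV[OF Vd(3)[OF f]] WX by blast
  hence "(%x. int p * (b * f x) + (-a) * g x) \<in> X" using Xd(2) Xd(3)[OF gc(2)] by blast
  moreover have "int p * (b * f x) + (-a) * g x = f x - a * w x" for x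
  proof -
   have "f x = (a * c + b * int p) * f x" using ab by simp
   thus ?thesis using gc(1) by (simp add: algebra_simps)
  qed
  ultimately show ?thesis by auto
 qed
 \<comment> \<open>The coordinate along \<open>w\<close> modulo \<open>X\<close>;
   \<open>multw\<close> makes it unique modulo \<open>p\<close>.\<close>
 define v where "v f = (SOME c. (%x. f x - c * w x) \<in> X)" for f
 have v: "(%x. f x - v f * w x) \<in> X" if "f \<in> V" for f
  unfolding v_def using ex[OF that] by (rule someI_ex)
 have multw: "int p dvd c" if c: "(%x. c * w x) \<in> X" for c
 proof (rule ccontr)
  assume "\<not> int p dvd c"
  hence "coprime c (int p)" using prime_imp_coprime[of "int p" c] p by (auto simp: coprime_commute)
  then obtain a b where ab: "a * c + b * int p = 1" by (metis bezout_int coprime_iff_gcd_eq_1)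
  have "(%x. int p * (b * w x)) \<in> X" using pV[OF Vd(3)[OF w(1)]] WX by blast
  hence "(%x. a * (c * w x) + int p * (b * w x)) \<in> X" using Xd(2) Xd(3)[OF c] by blast
  moreover have "a * (c * w x) + int p * (b * w x) = w x" for x
  proof -
   have "w x = (a * c + b * int p) * w x" using ab by simp
   thus ?thesis by (simp add: algebra_simps)
  qed
  ultimately show False using wX by simp
 qed
 have uniq: "mod_eq p c c'" if "(%x. f x - c * w x) \<in> X" "(%x. f x - c' * w x) \<in> X" for f c c'
 proof -
  have "(%x. (c - c') * w x) \<in> X" using Xd(4)[OF that(2,1)] by (simp add: algebra_simps)
  thus ?thesis using multw by (simp add: meq_iff_dvd)
 qed
 show thesis
 proof (rule that[of v])
  show "mod_eq p (v (%x. f x + g x)) (v f + v g)" if "f \<in> V" "g \<in> V" for f g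
   using Xd(2)[OF v[OF that(1)] v[OF that(2)]] v[OF Vd(2)[OF that]]
   by (intro uniq[of "%x. f x + g x"]) (simp_all add: algebra_simps)
  show "mod_eq p (v f) 0" if "f \<in> W" for f
   using v[of f] that WX WV by (intro uniq[of f]) auto
  show "mod_eq p (v w) 1"
   using v[OF w(1)] Xd(1) by (intro uniq[of w]) auto
 qed
qed

section \<open>The resolution\<close>

text \<open>Back substitution: modulo \<open>p\<close>, row \<open>j\<close> involves only the
  coordinates from \<open>j\<close> on. The induction shows that the last \<open>n\<close>
  coordinates vanish.\<close>

lemma unitriangular_kernel:
 fixes s m :: nat and M :: "nat => nat => int"
 assumes low: "!!j m. m < j ==> j < s ==> mod_eq p (M j m) 0" and diag: "!!j. j < s ==> mod_eq p (M j j) 1"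
  and ker: "!!j. j < s ==> mod_eq p (\<Sum>m<s. M j m * c m) 0" and m: "m < s"
 shows "mod_eq p (c m) 0"
proof -
 have "\<forall>m<s. s - n \<le> m --> mod_eq p (c m) 0" for n
 proof (induction n)
  case (Suc n)
  show ?case
  proof (intro allI impI)
   fix j assume j: "j < s" "s - Suc n \<le> j"
   show "mod_eq p (c j) 0"
   proof (cases "s - n \<le> j")
    case False
    have "mod_eq p (\<Sum>m<s. M j m * c m) (\<Sum>m<s. if m = j then c m else 0)"
    proof (rule meq_sum)
     fix m assume m: "m \<in> {..<s}"
     consider "m < j" | "m = j" | "j < m" by linarith
     thus "mod_eq p (M j m * c m) (if m = j then c m else 0)"
     proof cases
      case 1
      thus ?thesis using meq_scale_right[OF low[OF _ j(1)], of m "c m"] by simp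
     next
      case 2
      thus ?thesis using meq_scale_right[OF diag[OF j(1)], of "c j"] by simp
     next
      case 3
      hence "s - n \<le> m" using False j by linarith
      hence "mod_eq p (c m) 0" using Suc m by simp
      thus ?thesis using meq_scale_left[of p "c m" 0 "M j m"] 3 by simp
     qed
    qed
    hence "mod_eq p (\<Sum>m<s. M j m * c m) (c j)" using j by simp
    thus ?thesis using ker[OF j(1)] meq_sym meq_trans by blast
   qed (use Suc j in simp)
  qed
 qed simp
 from this[of s] show ?thesis using m by simp
qed

text \<open>A matrix that is unitriangular modulo \<open>p\<close> is invertible, so it cannot
  factor through a smaller dimension. Counting takes the place of rank: the factor \<open>b\<close>
  would inject \<open>p ^ s\<close> vectors into \<open>p ^ k\<close>.\<close>

lemma unitriangular_no_factorization:
 fixes k s :: nat and M b e :: "nat => nat => int"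
 assumes p: "prime p" and k: "k < s"
  and low: "!!j m. m < j ==> j < s ==> mod_eq p (M j m) 0" and diag: "!!j. j < s ==> mod_eq p (M j j) 1"
  and fac: "!!j m. j < s ==> m < s ==> mod_eq p (M j m) (\<Sum>l<k. b l m * e l j)"
 shows False
proof -
 have p1: "1 < p" using p by (rule prime_gt_1_nat)
 define C where "C = ({..<s} \<rightarrow>\<^sub>E {0..<int p})"
 define D where "D = ({..<k} \<rightarrow>\<^sub>E {0..<int p})"
 define \<phi> where "\<phi> c = (\<lambda>l\<in>{..<k}. (\<Sum>m<s. b l m * c m) mod int p)" for c :: "nat => int"
 have img: "\<phi> ` C \<subseteq> D"
  unfolding \<phi>_def D_def using p1 by (intro image_subsetI restrict_PiE_iff[THEN iffD2]) auto
 have inj: "inj_on \<phi> C"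
 proof (rule inj_onI)
  fix c c' assume c: "c \<in> C" "c' \<in> C" and eq: "\<phi> c = \<phi> c'"
  have bl: "mod_eq p (\<Sum>m<s. b l m * (c m - c' m)) 0" if "l < k" for l
  proof -
   have "(\<Sum>m<s. b l m * c m) mod int p = (\<Sum>m<s. b l m * c' m) mod int p"
    using fun_cong[OF eq, of l] that unfolding \<phi>_def by (simp only: restrict_apply lessThan_iff if_True)
   hence "mod_eq p (\<Sum>m<s. b l m * c m) (\<Sum>m<s. b l m * c' m)" by (simp add: mod_eq_def cong_def)
   hence "mod_eq p ((\<Sum>m<s. b l m * c m) - (\<Sum>m<s. b l m * c' m)) 0"
    by (rule meq_iff_diff[THEN iffD1])
   thus ?thesis by (simp add: right_diff_distrib sum_subtractf)
  qed
  have ker: "mod_eq p (\<Sum>m<s. M j m * (c m - c' m)) 0" if j: "j < s" for j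
  proof -
   have "mod_eq p (\<Sum>m<s. M j m * (c m - c' m)) (\<Sum>m<s. (\<Sum>l<k. b l m * e l j) * (c m - c' m))"
    using fac[OF j] by (intro meq_sum meq_scale_right) simp
   also have "(\<Sum>m<s. (\<Sum>l<k. b l m * e l j) * (c m - c' m)) = (\<Sum>m<s. \<Sum>l<k. e l j * (b l m * (c m - c' m)))"
    by (simp add: sum_distrib_left mult_ac)
   also have "... = (\<Sum>l<k. \<Sum>m<s. e l j * (b l m * (c m - c' m)))" by (rule sum.swap)
   also have "... = (\<Sum>l<k. e l j * (\<Sum>m<s. b l m * (c m - c' m)))" by (simp add: sum_distrib_left)
   also have "mod_eq p ... (\<Sum>l<k. e l j * 0)" using bl by (intro meq_sum meq_scale_left) simp
   finally show ?thesis by simp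
  qed
  have mm: "c m mod int p = c' m mod int p" if m: "m < s" for m
  proof -
   have "mod_eq p (c m - c' m) 0"
    by (rule unitriangular_kernel[where M = M and c = "%m. c m - c' m", OF low diag ker m])
   hence "mod_eq p (c m) (c' m)" by (rule meq_iff_diff[THEN iffD2])
   thus ?thesis by (simp add: mod_eq_def cong_def)
  qed
  show "c = c'"
  proof (rule PiE_ext[OF c[unfolded C_def]])
   fix m assume m: "m \<in> {..<s}"
   have "c m \<in> {0..<int p}" by (rule PiE_mem[OF c(1)[unfolded C_def] m])
   moreover have "c' m \<in> {0..<int p}" by (rule PiE_mem[OF c(2)[unfolded C_def] m])
   ultimately show "c m = c' m" using mm[of m] m by simp
  qed
 qed
 have fin: "finite D" unfolding D_def by (rule finite_PiE) auto
 have "card C \<le> card D" by (rule card_inj_on_le[OF inj img fin])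
 hence "p ^ s \<le> p ^ k" by (simp add: C_def D_def card_PiE)
 thus False using p1 k by (simp add: power_increasing_iff)
qed

locale generated_pro_p = pro_p_group +
 fixes d :: nat and x :: "nat => 'a"
 assumes x_closed: "i < d ==> x i \<in> carrier G"
  and x_generate: "T closure_of (generate G (x ` {..<d})) = carrier G"
begin

text \<open>Exactness at \<open>C\<close>: the kernel of \<open>\<delta>\<close> consists of the
  constants. The elements whose left translation preserves \<open>h\<close> form a subgroup that
  contains the generators and, as \<open>h\<close> is locally constant, an open subgroup.\<close>

lemma translation_invariant_const:
 assumes h: "h \<in> loc_const" and inv: "!!i z. i < d ==> z \<in> carrier G ==> h (x i \<otimes> z) \<doteq> h z"
  and z: "z \<in> carrier G"
 shows "h z \<doteq> h \<one>"
proof -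
 obtain U where U: "U \<in> \<U>" "invariant U h" using h by (rule loc_constE)
 define H where "H = {g \<in> carrier G. \<forall>z\<in>carrier G. h (g \<otimes> z) \<doteq> h z}"
 have "subgroup H G"
 proof (rule subgroupI)
  show "H \<subseteq> carrier G" by (auto simp: H_def)
  show "H ~= {}" unfolding H_def using one_closed by force
  show "inv a \<in> H" if a: "a \<in> H" for a
  proof -
   have aG: "a \<in> carrier G" using a by (simp add: H_def)
   have "h (inv a \<otimes> z) \<doteq> h z" if z: "z \<in> carrier G" for z
   proof -
    have "h (a \<otimes> (inv a \<otimes> z)) \<doteq> h (inv a \<otimes> z)" using a z aG unfolding H_def by simp
    moreover have "a \<otimes> (inv a \<otimes> z) = z" using z aG by (simp flip: m_assoc)
    ultimately show ?thesis using meq_sym by simp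
   qed
   thus ?thesis using aG by (simp add: H_def)
  qed
  show "a \<otimes> b \<in> H" if ab: "a \<in> H" "b \<in> H" for a b
  proof -
   have abG: "a \<in> carrier G" "b \<in> carrier G" using ab by (auto simp: H_def)
   have "h (a \<otimes> b \<otimes> z) \<doteq> h z" if z: "z \<in> carrier G" for z
   proof -
    have "h (a \<otimes> (b \<otimes> z)) \<doteq> h (b \<otimes> z)" using ab z abG unfolding H_def by simp
    also have "h (b \<otimes> z) \<doteq> h z" using ab z abG unfolding H_def by simp
    finally show ?thesis using z abG by (simp add: m_assoc)
   qed
   thus ?thesis using abG by (simp add: H_def)
  qed
 qed
 moreover have "x ` {..<d} \<subseteq> H" using inv x_closed by (auto simp: H_def)
 moreover have "U \<subseteq> H" using invariantD[OF U(2)] ons_carrier[OF U(1)] by (auto simp: H_def)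
 ultimately have "H = carrier G"
  using dense_open_subgroup[of "x ` {..<d}" H U] x_generate x_closed U(1) by auto
 hence "z \<in> H" using z by simp
 hence "h (z \<otimes> \<one>) \<doteq> h \<one>" unfolding H_def by blast
 thus ?thesis using z by simp
qed

end

locale sylvester_pro_p = generated_pro_p +
 assumes sylvester: "sylvester_domain kG"
begin

text \<open>The module \<open>C\<^sup>n\<close>. Tuples are functions on pairs so that
  \<open>int_subspace\<close> and \<open>separating_functional\<close> apply to them; only indices
  below \<open>n\<close> and arguments in the carrier count, which \<open>vec_eq\<close>
  expresses.\<close>

definition vec :: "nat => (nat \<times> 'a => int) set" where
 "vec n = {w. \<forall>i<n. (%z. w (i, z)) \<in> loc_const}"

definition vec_eq :: "nat => (nat \<times> 'a => int) => (nat \<times> 'a => int) => bool" where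
 "vec_eq n w w' \<longleftrightarrow> (\<forall>i<n. \<forall>z\<in>carrier G. w (i, z) \<doteq> w' (i, z))"

text \<open>The value off the carrier is fixed so that \<open>shift\<close> is an action.\<close>

definition shift :: "'a => (nat \<times> 'a => int) => (nat \<times> 'a => int)" where
 "shift y w = (%(i, z). if z \<in> carrier G then w (i, z \<otimes> y) else 0)"

text \<open>The image of \<open>\<delta>\<close>. The left translations in it commute with the right
  translations of \<open>shift\<close>, which makes it a submodule.\<close>

definition im :: "(nat \<times> 'a => int) set" where
 "im = {w. \<exists>h\<in>loc_const. \<forall>i<d. \<forall>z\<in>carrier G. w (i, z) \<doteq> h (x i \<otimes> z) - h z}"

definition vec_functional :: "nat => ((nat \<times> 'a => int) => int) => bool" where
 "vec_functional n v \<longleftrightarrow>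
   (\<forall>w\<in>vec n. \<forall>w'\<in>vec n. v (%k. w k + w' k) \<doteq> v w + v w') \<and>
   (\<forall>w\<in>vec n. \<forall>w'. vec_eq n w w' --> v w \<doteq> v w')"

definition entry :: "nat => ('a => int) => (nat \<times> 'a => int)" where
 "entry i f = (%(j, z). if j = i then f z else 0)"

lemma vec_eq_refl [simp]: "vec_eq n w w"
 by (simp add: vec_eq_def)

lemma vec_eq_sym: "vec_eq n w w' ==> vec_eq n w' w"
 by (simp add: vec_eq_def meq_sym)

lemma vec_cong: "w \<in> vec n ==> vec_eq n w w' ==> w' \<in> vec n"
 unfolding vec_def vec_eq_def
proof (intro CollectI allI impI, elim CollectE)
 fix i assume w: "\<forall>i<n. (%z. w (i, z)) \<in> loc_const" and e: "\<forall>i<n. \<forall>z\<in>carrier G. w (i, z) \<doteq> w' (i, z)" and i: "i < n"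
 show "(%z. w' (i, z)) \<in> loc_const"
  by (rule loc_const_cong[of "%z. w (i, z)"]) (use w e i in auto)
qed

lemma int_subspace_vec: "int_subspace (vec n)"
 unfolding int_subspace_def vec_def by (simp add: loc_const_const loc_const_add loc_const_scale)

lemmas vec_add = int_subspaceD(2)[OF int_subspace_vec]
 and vec_scale = int_subspaceD(3)[OF int_subspace_vec]
 and vec_diff = int_subspaceD(4)[OF int_subspace_vec]
 and vec_sum = int_subspace_sum[OF int_subspace_vec]

lemma shift_vec: "w \<in> vec n ==> y \<in> carrier G ==> shift y w \<in> vec n"
 unfolding vec_def shift_def
proof (intro CollectI allI impI, elim CollectE, simp)
 fix i assume w: "\<forall>i<n. (%z. w (i, z)) \<in> loc_const" and y: "y \<in> carrier G" and i: "i < n"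
 show "(%z. if z \<in> carrier G then w (i, z \<otimes> y) else 0) \<in> loc_const"
  by (rule loc_const_cong[of "%z. w (i, z \<otimes> y)"]) (use w y i loc_const_translate(2) in auto)
qed

lemma shift_shift: "y \<in> carrier G ==> y' \<in> carrier G ==> shift (y \<otimes> y') w = shift y (shift y' w)"
 by (auto simp: shift_def fun_eq_iff m_assoc)

lemma shift_one: "vec_eq n (shift \<one> w) w"
 by (simp add: vec_eq_def shift_def)

lemma shift_add: "shift y (%k. w k + w' k) = (%k. shift y w k + shift y w' k)"
 by (auto simp: shift_def fun_eq_iff)

lemma shift_diff: "shift y (%k. w k - w' k) = (%k. shift y w k - shift y w' k)"
 by (auto simp: shift_def fun_eq_iff)

lemma shift_scale: "shift y (%k. c * w k) = (%k. c * shift y w k)"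
 by (auto simp: shift_def fun_eq_iff)

lemma shift_cong: "vec_eq n w w' ==> y \<in> carrier G ==> vec_eq n (shift y w) (shift y w')"
 by (auto simp: vec_eq_def shift_def)

lemma imI:
 assumes "h \<in> loc_const" "!!i z. i < d ==> z \<in> carrier G ==> w (i, z) \<doteq> h (x i \<otimes> z) - h z"
 shows "w \<in> im"
 unfolding im_def by (intro CollectI bexI[of _ h] allI impI ballI assms)

lemma imE:
 assumes "w \<in> im"
 obtains h where "h \<in> loc_const" "\<forall>i<d. \<forall>z\<in>carrier G. w (i, z) \<doteq> h (x i \<otimes> z) - h z"
 using assms[unfolded im_def, THEN CollectD] by (rule bexE)

lemma int_subspace_im: "int_subspace im"
 unfolding int_subspace_def
proof (intro conjI ballI allI)
 show "(%_. 0) \<in> im" by (rule imI[OF loc_const_const[of 0]]) simp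
next
 fix f g assume "f \<in> im"
 then obtain h where h: "h \<in> loc_const" "\<forall>i<d. \<forall>z\<in>carrier G. f (i, z) \<doteq> h (x i \<otimes> z) - h z"
  by (rule imE)
 assume "g \<in> im"
 then obtain h' where h': "h' \<in> loc_const" "\<forall>i<d. \<forall>z\<in>carrier G. g (i, z) \<doteq> h' (x i \<otimes> z) - h' z"
  by (rule imE)
 show "(%k. f k + g k) \<in> im"
 proof (rule imI[OF loc_const_add[OF h(1) h'(1)]])
  fix i z assume "i < d" "z \<in> carrier G"
  from meq_add[OF h(2)[rule_format, OF this] h'(2)[rule_format, OF this]]
  show "f (i, z) + g (i, z) \<doteq> h (x i \<otimes> z) + h' (x i \<otimes> z) - (h z + h' z)"
   by (simp add: algebra_simps)
 qed
next
 fix f c assume "f \<in> im"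
 then obtain h where h: "h \<in> loc_const" "\<forall>i<d. \<forall>z\<in>carrier G. f (i, z) \<doteq> h (x i \<otimes> z) - h z"
  by (rule imE)
 show "(%k. c * f k) \<in> im"
 proof (rule imI[OF loc_const_scale[OF h(1), of c]])
  fix i z assume "i < d" "z \<in> carrier G"
  from meq_scale_left[OF h(2)[rule_format, OF this], of c]
  show "c * f (i, z) \<doteq> c * h (x i \<otimes> z) - c * h z" by (simp add: algebra_simps)
 qed
qed

lemma im_cong: "w \<in> im ==> vec_eq d w w' ==> w' \<in> im"
proof -
 assume w: "w \<in> im" and e: "vec_eq d w w'"
 obtain h where h: "h \<in> loc_const" "\<forall>i<d. \<forall>z\<in>carrier G. w (i, z) \<doteq> h (x i \<otimes> z) - h z"
  using w by (rule imE)
 show "w' \<in> im"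
 proof (rule imI[OF h(1)])
  fix i z assume iz: "i < d" "z \<in> carrier G"
  have "w' (i, z) \<doteq> w (i, z)" using e iz by (simp add: vec_eq_def meq_sym)
  also have "... \<doteq> h (x i \<otimes> z) - h z" by (rule h(2)[rule_format, OF iz])
  finally show "w' (i, z) \<doteq> h (x i \<otimes> z) - h z" .
 qed
qed

lemma im_zero: "vec_eq d w (%_. 0) ==> w \<in> im"
 using im_cong[OF int_subspaceD(1)[OF int_subspace_im] vec_eq_sym] .

lemma im_vec: "im \<subseteq> vec d"
proof
 fix w assume "w \<in> im"
 then obtain h where h: "h \<in> loc_const" "\<forall>i<d. \<forall>z\<in>carrier G. w (i, z) \<doteq> h (x i \<otimes> z) - h z"
  by (rule imE)
 have "(%z. w (i, z)) \<in> loc_const" if i: "i < d" for i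
 proof (rule loc_const_cong)
  show "(%z. h (x i \<otimes> z) + (-1) * h z) \<in> loc_const"
   by (rule loc_const_add[OF loc_const_translate(1)[OF h(1) x_closed[OF i]] loc_const_scale[OF h(1)]])
  show "h (x i \<otimes> z) + (-1) * h z \<doteq> w (i, z)" if "z \<in> carrier G" for z
   using meq_sym[OF h(2)[rule_format, OF i that]] by simp
 qed
 thus "w \<in> vec d" by (simp add: vec_def)
qed

lemma im_shift: "w \<in> im ==> y \<in> carrier G ==> shift y w \<in> im"
proof -
 assume w: "w \<in> im" and y: "y \<in> carrier G"
 obtain h where h: "h \<in> loc_const" "\<forall>i<d. \<forall>z\<in>carrier G. w (i, z) \<doteq> h (x i \<otimes> z) - h z"
  using w by (rule imE)
 show ?thesis
 proof (rule imI[OF loc_const_translate(2)[OF h(1) y]])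
  fix i z assume iz: "i < d" "z \<in> carrier G"
  show "shift y w (i, z) \<doteq> h (x i \<otimes> z \<otimes> y) - h (z \<otimes> y)"
   using h(2)[rule_format, OF iz(1), of "z \<otimes> y"] iz y x_closed[OF iz(1)] by (simp add: shift_def m_assoc)
 qed
qed

lemma vf_add: "vec_functional n v ==> w \<in> vec n ==> w' \<in> vec n ==> v (%k. w k + w' k) \<doteq> v w + v w'"
 by (simp add: vec_functional_def)

lemma vf_cong: "vec_functional n v ==> w \<in> vec n ==> vec_eq n w w' ==> v w \<doteq> v w'"
 by (simp add: vec_functional_def)

lemma vf_zero: "vec_functional n v ==> v (%_. 0) \<doteq> 0"
 using vf_add[of n v "%_. 0" "%_. 0"] int_subspaceD(1)[OF int_subspace_vec] by (simp add: meq_iff_dvd)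

lemma vf_sum:
 assumes v: "vec_functional n v" and w: "!!i. i \<in> I ==> w i \<in> vec n"
 shows "v (%k. \<Sum>i\<in>I. w i k) \<doteq> (\<Sum>i\<in>I. v (w i))"
 using w
proof (induction I rule: infinite_finite_induct)
 case (insert i I)
 have "v (%k. w i k + (\<Sum>i\<in>I. w i k)) \<doteq> v (w i) + v (%k. \<Sum>i\<in>I. w i k)"
  using insert by (intro vf_add[OF v] vec_sum) auto
 also have "... \<doteq> v (w i) + (\<Sum>i\<in>I. v (w i))" using insert by (intro meq_add) auto
 finally show ?case using insert by simp
qed (simp_all add: vf_zero[OF v])

lemma vf_diff:
 assumes v: "vec_functional n v" and w: "w \<in> vec n" "w' \<in> vec n"
 shows "v (%k. w k - w' k) \<doteq> v w - v w'"
proof -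
 have "v (%k. (w k - w' k) + w' k) \<doteq> v (%k. w k - w' k) + v w'"
  by (rule vf_add[OF v vec_diff[OF w] w(2)])
 hence "int p dvd v w - (v (%k. w k - w' k) + v w')" by (simp add: meq_iff_dvd)
 thus ?thesis by (simp add: meq_iff_dvd dvd_diff_commute algebra_simps)
qed

lemma entry_vec: "f \<in> loc_const ==> entry i f \<in> vec n"
proof -
 assume f: "f \<in> loc_const"
 have "(%z. if j = i then f z else 0) \<in> loc_const" for j
  using f by (cases "j = i") (simp_all add: loc_const_const)
 thus ?thesis by (simp add: vec_def entry_def)
qed

lemma functional_entry:
 assumes v: "vec_functional n v" shows "functional (%f. v (entry i f))"
 unfolding functional_def
proof (intro conjI ballI allI impI)
 fix f g assume "f \<in> loc_const" "g \<in> loc_const"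
 moreover have "entry i (%x. f x + g x) = (%k. entry i f k + entry i g k)" by (auto simp: entry_def)
 ultimately show "v (entry i (%x. f x + g x)) \<doteq> v (entry i f) + v (entry i g)"
  using vf_add[OF v entry_vec entry_vec] by simp
next
 fix f g assume "f \<in> loc_const" "\<forall>x\<in>carrier G. f x \<doteq> g x"
 thus "v (entry i f) \<doteq> v (entry i g)"
  by (intro vf_cong[OF v entry_vec]) (auto simp: vec_eq_def entry_def)
qed

text \<open>Through this a functional on \<open>C\<^sup>n\<close> becomes a column of
  \<open>n\<close> functionals on \<open>C\<close>, that is, of \<open>n\<close> elements of the
  group algebra.\<close>

lemma vf_decomposition:
 assumes v: "vec_functional n v" and w: "w \<in> vec n"
 shows "v w \<doteq> (\<Sum>i<n. v (entry i (%z. w (i, z))))"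
proof -
 have e: "entry i (%z. w (i, z)) \<in> vec n" if "i < n" for i
  using w that by (intro entry_vec) (simp add: vec_def)
 have "(\<Sum>i<n. entry i (%z. w (i, z)) (j, z)) = w (j, z)" if "j < n" for j z
  using that by (simp add: entry_def if_distrib cong: if_cong)
 hence "vec_eq n w (%k. \<Sum>i<n. entry i (%z. w (i, z)) k)" by (simp add: vec_eq_def)
 hence "v w \<doteq> v (%k. \<Sum>i<n. entry i (%z. w (i, z)) k)" by (rule vf_cong[OF v w])
 also have "... \<doteq> (\<Sum>i<n. v (entry i (%z. w (i, z))))" using e by (intro vf_sum[OF v]) auto
 finally show ?thesis .
qed

text \<open>Multiples of \<open>p\<close> are zero in the sense of \<open>vec_eq\<close>, so closure
  of \<open>W\<close> under \<open>vec_eq\<close> supplies the hypothesis on such multiples in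
  \<open>separating_functional\<close>; it also makes the resulting functional respect
  \<open>vec_eq\<close>.\<close>

lemma vec_separation:
 assumes W: "int_subspace W" "W \<subseteq> vec n" and cong: "!!w w'. w \<in> W ==> vec_eq n w w' ==> w' \<in> W"
  and w: "w \<in> vec n" "w \<notin> W"
 obtains v where "vec_functional n v" "!!a. a \<in> W ==> v a \<doteq> 0" "v w \<doteq> 1"
proof -
 have z: "w \<in> W" if "vec_eq n w (%_. 0)" for w
  using cong[OF int_subspaceD(1)[OF W(1)] vec_eq_sym[OF that]] .
 have pW: "(%x. int p * f x) \<in> W" if "f \<in> vec n" for f
  by (rule z) (simp add: vec_eq_def meq_iff_dvd)
 obtain v where v: "!!f g. f \<in> vec n ==> g \<in> vec n ==> v (%x. f x + g x) \<doteq> v f + v g"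
  "!!f. f \<in> W ==> v f \<doteq> 0" "v w \<doteq> 1"
  using separating_functional[OF prime_p int_subspace_vec W pW w] by blast
 have "v w \<doteq> v w'" if "w \<in> vec n" "vec_eq n w w'" for w w'
 proof -
  have w': "w' \<in> vec n" using that by (rule vec_cong)
  have "(%k. w k - w' k) \<in> W"
   using that(2) by (intro z) (auto simp: vec_eq_def meq_iff_diff[symmetric])
  hence "v (%k. w k - w' k) \<doteq> 0" by (rule v(2))
  have "v (%k. (w k - w' k) + w' k) \<doteq> v (%k. w k - w' k) + v w'"
   using v(1)[OF vec_diff[OF that(1) w'] w'] .
  also have "... \<doteq> 0 + v w'" using \<open>v (%k. w k - w' k) \<doteq> 0\<close> by (intro meq_add) auto
  finally show ?thesis by simp
 qed
 hence "vec_functional n v" using v(1) by (simp add: vec_functional_def)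
 thus thesis by (rule that[of v, OF _ v(2) v(3)])
qed

end

section \<open>The dimension of the fixed space of the cokernel\<close>

context sylvester_pro_p
begin

lemma functional_diff:
 assumes b: "functional b" and f: "f \<in> loc_const" and g: "g \<in> loc_const"
 shows "b (%z. f z - g z) \<doteq> b f - b g"
proof -
 have "b (%z. f z + (-1) * g z) \<doteq> b f + b (%z. (-1) * g z)"
  by (rule functional_add[OF b f loc_const_scale[OF g]])
 also have "... \<doteq> b f + (-1) * b g"
  by (intro meq_add meq_refl functional_scale[OF b g])
 finally show ?thesis by simp
qed

text \<open>The preimage in \<open>C\<^sup>d\<close> of the fixed space of the cokernel of
  \<open>\<delta>\<close>.\<close>

definition fixed_vecs :: "(nat \<times> 'a => int) set" where
 "fixed_vecs = {w \<in> vec d. \<forall>g\<in>carrier G. (%k. shift g w k - w k) \<in> im}"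

text \<open>Linear independence modulo \<open>im\<close>, stated one vector at a time so that a
  system can be extended at its end.\<close>

definition indep :: "nat => (nat => nat \<times> 'a => int) => bool" where
 "indep s w \<longleftrightarrow> (\<forall>j<s. w j \<in> fixed_vecs \<and> (\<forall>c. (%k. w j k - (\<Sum>i<j. c i * w i k)) \<notin> im))"

text \<open>Only half of the orthogonality relations: \<open>v j\<close> vanishes on the earlier
  vectors and is unconstrained on the later ones. Each \<open>v j\<close> can then be chosen by
  itself, and the matrix of values is still unitriangular.\<close>

definition dual :: "nat => (nat => nat \<times> 'a => int) => (nat => (nat \<times> 'a => int) => int) => bool" where
 "dual s w v \<longleftrightarrow> (\<forall>j<s. vec_functional d (v j) \<and> (\<forall>a\<in>im. v j a \<doteq> 0) \<and>
   (\<forall>i<j. v j (w i) \<doteq> 0) \<and> v j (w j) \<doteq> 1)"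

text \<open>Each \<open>v j\<close> separates \<open>w j\<close> from the subspace \<open>W\<close>
  spanned by \<open>im\<close> and the earlier vectors.\<close>

lemma indep_dual:
 assumes ind: "indep s w" obtains v where "dual s w v"
proof -
 have "\<exists>v. vec_functional d v \<and> (\<forall>a\<in>im. v a \<doteq> 0) \<and> (\<forall>i<j. v (w i) \<doteq> 0) \<and> v (w j) \<doteq> 1" if j: "j < s" for j
 proof -
  have wv: "w i \<in> vec d" if "i \<le> j" for i
   using ind j that by (auto simp: indep_def fixed_vecs_def)
  define W where "W = {u. \<exists>c. (%k. u k - (\<Sum>i<j. c i * w i k)) \<in> im}"
  have WI: "u \<in> W" if "(%k. u k - (\<Sum>i<j. c i * w i k)) \<in> im" for u c using that by (auto simp: W_def)
  note id = int_subspaceD[OF int_subspace_im]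
  have sub: "int_subspace W"
   unfolding int_subspace_def
  proof (intro conjI ballI allI)
   show "(%_. 0) \<in> W" using id(1) by (intro WI[of _ "%_. 0"]) simp
  next
   fix f g assume "f \<in> W" "g \<in> W"
   then obtain c c' where "(%k. f k - (\<Sum>i<j. c i * w i k)) \<in> im" "(%k. g k - (\<Sum>i<j. c' i * w i k)) \<in> im"
    by (auto simp: W_def)
   from id(2)[OF this] show "(%k. f k + g k) \<in> W"
    by (intro WI[of _ "%i. c i + c' i"]) (simp add: algebra_simps sum.distrib)
  next
   fix f a assume "f \<in> W"
   then obtain c where "(%k. f k - (\<Sum>i<j. c i * w i k)) \<in> im" by (auto simp: W_def)
   from id(3)[OF this, of a] show "(%k. a * f k) \<in> W"
    by (intro WI[of _ "%i. a * c i"]) (simp add: algebra_simps sum_distrib_left)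
  qed
  have "W \<subseteq> vec d"
  proof
   fix u assume "u \<in> W"
   then obtain c where c: "(%k. u k - (\<Sum>i<j. c i * w i k)) \<in> im" by (auto simp: W_def)
   have "(%k. (u k - (\<Sum>i<j. c i * w i k)) + (\<Sum>i<j. c i * w i k)) \<in> vec d"
    using c im_vec wv by (intro vec_add vec_sum vec_scale) auto
   thus "u \<in> vec d" by simp
  qed
  moreover have "w' \<in> W" if "u \<in> W" "vec_eq d u w'" for u w'
  proof -
   obtain c where c: "(%k. u k - (\<Sum>i<j. c i * w i k)) \<in> im" using \<open>u \<in> W\<close> by (auto simp: W_def)
   have "vec_eq d (%k. u k - (\<Sum>i<j. c i * w i k)) (%k. w' k - (\<Sum>i<j. c i * w i k))"
    using that(2) by (simp add: vec_eq_def meq_diff)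
   from im_cong[OF c this] show ?thesis by (rule WI)
  qed
  moreover have "w j \<notin> W" using ind j by (simp add: W_def indep_def)
  ultimately obtain v where v: "vec_functional d v" "!!a. a \<in> W ==> v a \<doteq> 0" "v (w j) \<doteq> 1"
   using vec_separation[OF sub, of d "w j"] wv by blast
  have "a \<in> W" if "a \<in> im" for a using that by (intro WI[of _ "%_. 0"]) simp
  moreover have "w i \<in> W" if "i < j" for i
  proof (rule WI[of _ "%l. if l = i then 1 else 0"])
   have "(\<Sum>l<j. (if l = i then 1 else 0) * w l k) = w i k" for k
    using that by (simp add: if_distrib[of "%c. c * _"] cong: if_cong)
   thus "(%k. w i k - (\<Sum>l<j. (if l = i then 1 else 0) * w l k)) \<in> im" using id(1) by simp
  qed
  ultimately show ?thesis using v by blast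
 qed
 hence "\<exists>v. \<forall>j<s. vec_functional d (v j) \<and> (\<forall>a\<in>im. v j a \<doteq> 0) \<and> (\<forall>i<j. v j (w i) \<doteq> 0) \<and> v j (w j) \<doteq> 1"
  by metis
 thus thesis using that by (auto simp: dual_def)
qed

text \<open>This is the functional of the group algebra element \<open>x i - 1\<close>.\<close>

lemma alpha_functional:
 assumes "i < d" shows "functional (%f. f (x i) - f \<one>)"
 unfolding functional_def
proof (intro conjI ballI allI impI)
 fix f g :: "'a => int"
 show "f (x i) + g (x i) - (f \<one> + g \<one>) \<doteq> f (x i) - f \<one> + (g (x i) - g \<one>)"
  by (simp add: meq_iff_dvd)
 assume "\<forall>y\<in>carrier G. f y \<doteq> g y"
 hence "f (x i) \<doteq> g (x i)" "f \<one> \<doteq> g \<one>" using x_closed[OF assms] by simp_all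
 thus "f (x i) - f \<one> \<doteq> g (x i) - g \<one>" by (rule meq_diff)
qed

text \<open>The left side is the product of the row \<open>(x i - 1)\<close> and the column
  \<open>\<phi>\<close>, evaluated at \<open>f\<close>; the right side is \<open>\<phi>\<close>
  evaluated on \<open>\<delta> f\<close>. So the row annihilates a column exactly if the column
  vanishes on \<open>im\<close>.\<close>

lemma alpha_sum:
 assumes \<phi>: "!!i. i < d ==> functional (\<phi> i)" and f: "f \<in> loc_const"
 shows "(\<Sum>i<d. \<phi> i (%z. f (x i \<otimes> z)) - \<phi> i (%z. f (\<one> \<otimes> z))) \<doteq> (\<Sum>i<d. \<phi> i (%z. f (x i \<otimes> z) - f z))"
proof (rule meq_sum)
 fix i assume "i \<in> {..<d}"
 hence i: "i < d" by simp
 have "\<phi> i (%z. f (x i \<otimes> z) - f z) \<doteq> \<phi> i (%z. f (x i \<otimes> z)) - \<phi> i f"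
  by (rule functional_diff[OF \<phi>[OF i] loc_const_translate(1)[OF f x_closed[OF i]] f])
 also have "... \<doteq> \<phi> i (%z. f (x i \<otimes> z)) - \<phi> i (%z. f (\<one> \<otimes> z))"
  by (intro meq_diff meq_refl functional_cong[OF \<phi>[OF i] f]) simp
 finally show "\<phi> i (%z. f (x i \<otimes> z)) - \<phi> i (%z. f (\<one> \<otimes> z)) \<doteq> \<phi> i (%z. f (x i \<otimes> z) - f z)"
  by (rule meq_sym)
qed

lemma boundary_im: "f \<in> loc_const ==> (%(i, z). f (x i \<otimes> z) - f z) \<in> im"
 by (rule imI[of f]) simp_all

text \<open>The row \<open>(x i - 1)\<close> annihilates the matrix \<open>vv\<close> of the
  functionals \<open>v j\<close>, as these vanish on \<open>im\<close>. A factorization through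
  \<open>k < s\<close> with a left factor that the row also annihilates is impossible: the columns
  of this factor vanish on \<open>im\<close>, hence take the same value on all translates of a fixed
  vector \<open>w m\<close>, and the unitriangular matrix of the values \<open>v j (w m)\<close>
  would factor through \<open>k\<close>. The other alternative gives both claims.\<close>

lemma indep_dual_dichotomy:
 assumes ind: "indep s w" and du: "dual s w v"
 shows "s \<le> d" and "!!u j f. (!!j. j < s ==> functional (u j)) ==>
   (!!i f. i < d ==> f \<in> loc_const ==> (\<Sum>j<s. v j (entry i (%y. u j (%z. f (y \<otimes> z))))) \<doteq> 0) ==>
   j < s ==> f \<in> loc_const ==> u j f \<doteq> 0"
proof -
 have v: "vec_functional d (v j)" "!!a. a \<in> im ==> v j a \<doteq> 0" "!!i. i < j ==> v j (w i) \<doteq> 0" "v j (w j) \<doteq> 1"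
  if "j < s" for j
  using du that by (auto simp: dual_def)
 have wv: "w j \<in> vec d" "!!g. g \<in> carrier G ==> (%k. shift g (w j) k - w j k) \<in> im" if "j < s" for j
  using ind that by (auto simp: indep_def fixed_vecs_def)
 define \<alpha> where "\<alpha> i = (%f :: 'a => int. f (x i) - f \<one>)" for i
 define vv where "vv i j = (%f. v j (entry i f))" for i j
 have zero: "(\<Sum>i<d. \<alpha> i (%y. vv i j (%z. f (y \<otimes> z)))) \<doteq> 0" if j: "j < s" and f: "f \<in> loc_const" for j f
 proof -
  have "(\<Sum>i<d. \<alpha> i (%y. vv i j (%z. f (y \<otimes> z)))) \<doteq> (\<Sum>i<d. vv i j (%z. f (x i \<otimes> z) - f z))"
   unfolding \<alpha>_def vv_def by (rule alpha_sum[OF functional_entry[OF v(1)[OF j]] f])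
  also have "... = (\<Sum>i<d. v j (entry i (%z. (%(i, z). f (x i \<otimes> z) - f z) (i, z))))" by (simp add: vv_def)
  also have "... \<doteq> v j (%(i, z). f (x i \<otimes> z) - f z)"
   using boundary_im[OF f] im_vec by (intro meq_sym[OF vf_decomposition[OF v(1)[OF j]]]) auto
  also have "... \<doteq> 0" using v(2)[OF j boundary_im[OF f]] .
  finally show ?thesis .
 qed
 note dich = functional_dichotomy[OF sylvester, of d \<alpha> s vv]
 have no: False if k: "k < s" and \<beta>: "\<forall>i<d. \<forall>l<k. functional (\<beta> i l)" and \<epsilon>: "\<forall>l<k. \<forall>j<s. functional (\<epsilon> l j)"
  and fac: "\<forall>i<d. \<forall>j<s. \<forall>f\<in>loc_const. vv i j f \<doteq> (\<Sum>l<k. \<beta> i l (%y. \<epsilon> l j (%z. f (y \<otimes> z))))"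
  and ab: "\<forall>l<k. \<forall>f\<in>loc_const. (\<Sum>i<d. \<alpha> i (%y. \<beta> i l (%z. f (y \<otimes> z)))) \<doteq> 0"
  for k \<beta> \<epsilon>
 proof -
  \<comment> \<open>Column \<open>l\<close> of the left factor as a functional on
    \<open>C\<^sup>d\<close>.\<close>
  define B where "B l w = (\<Sum>i<d. \<beta> i l (%z. w (i, z)))" for l and w :: "nat \<times> 'a => int"
  have B_im: "B l a \<doteq> 0" if l: "l < k" and a: "a \<in> im" for l a
  proof -
   obtain h where h: "h \<in> loc_const" "\<forall>i<d. \<forall>z\<in>carrier G. a (i, z) \<doteq> h (x i \<otimes> z) - h z"
    using a by (rule imE)
   have al: "(%z. a (i, z)) \<in> loc_const" if "i < d" for i using a im_vec that by (auto simp: vec_def)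
   have "B l a \<doteq> (\<Sum>i<d. \<beta> i l (%z. h (x i \<otimes> z) - h z))"
    unfolding B_def using h(2) \<beta> l al by (intro meq_sum functional_cong[of "\<beta> _ l"]) auto
   also have "... \<doteq> (\<Sum>i<d. \<beta> i l (%z. h (x i \<otimes> z)) - \<beta> i l (%z. h (\<one> \<otimes> z)))"
    using \<beta> l by (intro meq_sym[OF alpha_sum[OF _ h(1)]]) auto
   also have "... \<doteq> 0" using ab l h(1) unfolding \<alpha>_def by blast
   finally show ?thesis .
  qed
  have B_shift: "B l (shift g (w m)) \<doteq> B l (w m)" if l: "l < k" and m: "m < s" and g: "g \<in> carrier G" for l m g
  proof -
   have lc: "(%z. shift g (w m) (i, z)) \<in> loc_const" "(%z. w m (i, z)) \<in> loc_const" if "i < d" for i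
    using shift_vec[OF wv(1)[OF m] g] wv(1)[OF m] that by (auto simp: vec_def)
   have "B l (%k. shift g (w m) k - w m k) \<doteq> (\<Sum>i<d. \<beta> i l (%z. shift g (w m) (i, z)) - \<beta> i l (%z. w m (i, z)))"
    unfolding B_def using \<beta> l lc by (intro meq_sum functional_diff) auto
   hence "B l (%k. shift g (w m) k - w m k) \<doteq> B l (shift g (w m)) - B l (w m)"
    by (simp add: B_def sum_subtractf)
   hence "B l (shift g (w m)) - B l (w m) \<doteq> 0"
    using B_im[OF l wv(2)[OF m g]] meq_sym meq_trans by blast
   thus ?thesis using meq_iff_diff by blast
  qed
  show False
  proof (rule unitriangular_no_factorization[OF prime_p k,
     of "%j m. v j (w m)" "%l m. B l (w m)" "%l j. \<epsilon> l j (%_. 1)"])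
   show "v j (w m) \<doteq> 0" if "m < j" "j < s" for j m using v(3) that by blast
   show "v j (w j) \<doteq> 1" if "j < s" for j using v(4) that by blast
   fix j m assume j: "j < s" and m: "m < s"
   have wl: "(%z. w m (i, z)) \<in> loc_const" if "i < d" for i using wv(1)[OF m] that by (simp add: vec_def)
   have "v j (w m) \<doteq> (\<Sum>i<d. vv i j (%z. w m (i, z)))"
    unfolding vv_def by (rule vf_decomposition[OF v(1)[OF j] wv(1)[OF m]])
   also have "... \<doteq> (\<Sum>i<d. \<Sum>l<k. \<beta> i l (%y. \<epsilon> l j (%z. w m (i, y \<otimes> z))))"
    using fac wl j by (intro meq_sum) auto
   \<comment> \<open>After the exchange the inner expression, summed over \<open>i\<close>, is
     \<open>B l\<close> at the translate of \<open>w m\<close> by \<open>z\<close>. This does not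
     depend on \<open>z\<close>, so the outer functional is evaluated at a constant.\<close>
   also have "... \<doteq> (\<Sum>i<d. \<Sum>l<k. \<epsilon> l j (%z. \<beta> i l (%y. w m (i, y \<otimes> z))))"
    using \<beta> \<epsilon> j wl by (intro meq_sum functional_conv_Fubini[of _ _ "%z. w m (_, z)"]) auto
   also have "... = (\<Sum>l<k. \<Sum>i<d. \<epsilon> l j (%z. \<beta> i l (%y. w m (i, y \<otimes> z))))" by (rule sum.swap)
   also have "... \<doteq> (\<Sum>l<k. B l (w m) * \<epsilon> l j (%_. 1))"
   proof (rule meq_sum)
    fix l assume "l \<in> {..<k}"
    hence l: "l < k" by simp
    have \<epsilon>': "functional (\<epsilon> l j)" using \<epsilon> l j by blast
    have lc: "(%z. \<beta> i l (%y. w m (i, y \<otimes> z))) \<in> loc_const" if i: "i < d" for i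
    proof -
     obtain U where U: "U \<in> \<U>" "invariant U (%z. w m (i, z))" using wl[OF i] by (rule loc_constE)
     show ?thesis
      using invariant_functional_translate(2)[OF _ U, of "\<beta> i l"] \<beta> i l by (intro loc_constI[OF U(1)]) blast
    qed
    have "(\<Sum>i<d. \<epsilon> l j (%z. \<beta> i l (%y. w m (i, y \<otimes> z)))) \<doteq> \<epsilon> l j (%z. \<Sum>i<d. \<beta> i l (%y. w m (i, y \<otimes> z)))"
     using lc by (intro meq_sym[OF functional_sum[OF \<epsilon>']]) auto
    also have "... \<doteq> \<epsilon> l j (%z. B l (w m) * 1)"
    proof (rule functional_cong[OF \<epsilon>'])
     show "(%z. \<Sum>i<d. \<beta> i l (%y. w m (i, y \<otimes> z))) \<in> loc_const" using lc by (intro loc_const_sum) auto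
     fix z assume z: "z \<in> carrier G"
     have "(\<Sum>i<d. \<beta> i l (%y. w m (i, y \<otimes> z))) \<doteq> B l (shift z (w m))"
      unfolding B_def
     proof (rule meq_sum)
      fix i assume "i \<in> {..<d}"
      hence i: "i < d" by simp
      show "\<beta> i l (%y. w m (i, y \<otimes> z)) \<doteq> \<beta> i l (%y. shift z (w m) (i, y))"
       using \<beta> i l loc_const_translate(2)[OF wl[OF i] z] by (intro functional_cong[of "\<beta> i l"]) (auto simp: shift_def)
     qed
     also have "... \<doteq> B l (w m)" by (rule B_shift[OF l m z])
     finally show "(\<Sum>i<d. \<beta> i l (%y. w m (i, y \<otimes> z))) \<doteq> B l (w m) * 1" by simp
    qed
    also have "... \<doteq> B l (w m) * \<epsilon> l j (%_. 1)" by (rule functional_scale[OF \<epsilon>' loc_const_const])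
    finally show "(\<Sum>i<d. \<epsilon> l j (%z. \<beta> i l (%y. w m (i, y \<otimes> z)))) \<doteq> B l (w m) * \<epsilon> l j (%_. 1)" .
   qed
   finally show "v j (w m) \<doteq> (\<Sum>l<k. B l (w m) * \<epsilon> l j (%_. 1))" .
  qed
 qed
 have \<alpha>f: "functional (\<alpha> i)" if "i < d" for i unfolding \<alpha>_def by (rule alpha_functional[OF that])
 have vf: "functional (vv i j)" if "i < d" "j < s" for i j
  unfolding vv_def by (rule functional_entry[OF v(1)[OF that(2)]])
 have main: "s \<le> d \<and> (\<forall>u. (\<forall>j<s. functional (u j)) -->
      (\<forall>i<d. \<forall>f\<in>loc_const. (\<Sum>j<s. vv i j (%y. u j (%z. f (y \<otimes> z)))) \<doteq> 0) -->
      (\<forall>j<s. \<forall>f\<in>loc_const. u j f \<doteq> 0))"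
  using dich[OF \<alpha>f vf zero]
 proof (rule disjE)
  assume "\<exists>k<s. \<exists>\<beta> \<epsilon>. (\<forall>i<d. \<forall>l<k. functional (\<beta> i l)) \<and> (\<forall>l<k. \<forall>j<s. functional (\<epsilon> l j)) \<and>
      (\<forall>i<d. \<forall>j<s. \<forall>f\<in>loc_const. vv i j f \<doteq> (\<Sum>l<k. \<beta> i l (%y. \<epsilon> l j (%z. f (y \<otimes> z))))) \<and>
      (\<forall>l<k. \<forall>f\<in>loc_const. (\<Sum>i<d. \<alpha> i (%y. \<beta> i l (%z. f (y \<otimes> z)))) \<doteq> 0)"
  hence False by (elim exE conjE) (rule no)
  thus ?thesis ..
 qed assumption
 show "s \<le> d" using main by (rule conjunct1)
 show "u j f \<doteq> 0"
  if u: "!!j. j < s ==> functional (u j)"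
   and vu: "!!i f. i < d ==> f \<in> loc_const ==> (\<Sum>j<s. v j (entry i (%y. u j (%z. f (y \<otimes> z))))) \<doteq> 0"
   and jf: "j < s" "f \<in> loc_const" for u j f
  by (rule main[THEN conjunct2, rule_format, OF u _ jf]) (simp_all add: vv_def vu)
qed

lemma indep_bound: "indep s w ==> s \<le> d"
 using indep_dual indep_dual_dichotomy(1) by metis

text \<open>By \<open>indep_bound\<close> there is a system of greatest length. A fixed vector
  outside \<open>im\<close> that all \<open>v j\<close> kill would extend it: in a relation with the
  \<open>w i\<close> modulo \<open>im\<close>, applying the \<open>v j\<close> shows that all
  coefficients vanish modulo \<open>p\<close>.\<close>

lemma maximal_indep:
 obtains s w v where "indep s w" "dual s w v"
  "!!a. a \<in> fixed_vecs ==> (!!j. j < s ==> v j a \<doteq> 0) ==> a \<in> im"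
proof -
 define s where "s = (GREATEST s. \<exists>w. indep s w)"
 have "\<exists>w. indep 0 w" by (simp add: indep_def)
 hence "\<exists>w. indep s w"
  unfolding s_def by (rule GreatestI_nat[where b = d]) (auto dest: indep_bound)
 then obtain w where w: "indep s w" by blast
 obtain v where v: "dual s w v" using indep_dual[OF w] .
 have vj: "vec_functional d (v j)" "!!a. a \<in> im ==> v j a \<doteq> 0" if "j < s" for j
  using v that by (auto simp: dual_def)
 have wv: "w j \<in> vec d" if "j < s" for j using w that by (auto simp: indep_def fixed_vecs_def)
 have "a \<in> im" if a: "a \<in> fixed_vecs" and va: "!!j. j < s ==> v j a \<doteq> 0" for a
 proof (rule ccontr)
  assume na: "a \<notin> im"
  have av: "a \<in> vec d" using a by (simp add: fixed_vecs_def)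
  have new: "(%k. a k - (\<Sum>i<s. c i * w i k)) \<notin> im" for c
  proof
   assume im: "(%k. a k - (\<Sum>i<s. c i * w i k)) \<in> im"
   have cw: "(%k. c i * w i k) \<in> vec d" if "i < s" for i using wv[OF that] by (rule vec_scale)
   have sv: "(%k. \<Sum>i<s. c i * w i k) \<in> vec d" using cw by (intro vec_sum) auto
   have "(\<Sum>i<s. v j (w i) * c i) \<doteq> 0" if j: "j < s" for j
   proof -
    have scal: "v j (%k. c i * w i k) \<doteq> v j (w i) * c i" if i: "i < s" for i
    proof -
     have "v j (%k. c i * w i k) \<doteq> (\<Sum>l<d. v j (entry l (%z. c i * w i (l, z))))"
      by (rule vf_decomposition[OF vj(1)[OF j] cw[OF i]])
     also have "... \<doteq> (\<Sum>l<d. c i * v j (entry l (%z. w i (l, z))))"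
      using wv[OF i] by (intro meq_sum functional_scale[OF functional_entry[OF vj(1)[OF j]]]) (simp add: vec_def)
     also have "... = c i * (\<Sum>l<d. v j (entry l (%z. w i (l, z))))" by (simp add: sum_distrib_left)
     also have "... \<doteq> c i * v j (w i)"
      by (rule meq_scale_left[OF meq_sym[OF vf_decomposition[OF vj(1)[OF j] wv[OF i]]]])
     finally show ?thesis by (simp add: mult.commute)
    qed
    have "(\<Sum>i<s. v j (w i) * c i) \<doteq> (\<Sum>i<s. v j (%k. c i * w i k))"
     using meq_sym[OF scal] by (intro meq_sum) simp
    also have "... \<doteq> v j (%k. \<Sum>i<s. c i * w i k)"
     using cw by (intro meq_sym[OF vf_sum[OF vj(1)[OF j]]]) simp
    also have "... = v j (%k. \<Sum>i<s. c i * w i k) - 0" by simp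
    also have "... \<doteq> v j (%k. \<Sum>i<s. c i * w i k) - v j a"
     by (intro meq_diff meq_refl meq_sym[OF va[OF j]])
    also have "... = - (v j a - v j (%k. \<Sum>i<s. c i * w i k))" by simp
    also have "... \<doteq> - v j (%k. a k - (\<Sum>i<s. c i * w i k))"
     using meq_diff[OF meq_refl[of p 0] meq_sym[OF vf_diff[OF vj(1)[OF j] av sv]]] by simp
    also have "... \<doteq> 0" using meq_diff[OF meq_refl[of p 0] vj(2)[OF j im]] by simp
    finally show ?thesis .
   qed
   hence c0: "c i \<doteq> 0" if "i < s" for i
    using unitriangular_kernel[of s p "%j m. v j (w m)" c i] v that by (auto simp: dual_def)
   have "vec_eq d (%k. a k - (\<Sum>i<s. c i * w i k)) a"
    unfolding vec_eq_def
   proof (intro allI impI ballI)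
    fix l z
    have "(\<Sum>i<s. c i * w i (l, z)) \<doteq> (\<Sum>i<s. 0 * w i (l, z))" using c0 by (intro meq_sum meq_scale_right) simp
    thus "a (l, z) - (\<Sum>i<s. c i * w i (l, z)) \<doteq> a (l, z)"
     using meq_diff[OF meq_refl[of p "a (l, z)"]] by fastforce
   qed
   thus False using im_cong[OF im] na by blast
  qed
  have "indep (Suc s) (w(s := a))"
   unfolding indep_def
  proof (intro allI impI)
   fix j assume "j < Suc s"
   then consider "j < s" | "j = s" by linarith
   thus "(w(s := a)) j \<in> fixed_vecs \<and> (\<forall>c. (%k. (w(s := a)) j k - (\<Sum>i<j. c i * (w(s := a)) i k)) \<notin> im)"
   proof cases
    case 1
    hence "(\<Sum>i<j. c i * (w(s := a)) i k) = (\<Sum>i<j. c i * w i k)" for c k by (intro sum.cong) auto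
    thus ?thesis using w 1 by (simp add: indep_def)
   next
    case 2
    have "(\<Sum>i<s. c i * (w(s := a)) i k) = (\<Sum>i<s. c i * w i k)" for c k by (intro sum.cong) auto
    thus ?thesis using 2 a new by simp
   qed
  qed
  hence "\<exists>w. indep (Suc s) w" by blast
  hence "Suc s \<le> s"
   unfolding s_def by (rule Greatest_le_nat[where b = d]) (auto dest: indep_bound)
  thus False by simp
 qed
 thus thesis using that w v by blast
qed

end

section \<open>Exactness of the resolution\<close>

context sylvester_pro_p
begin

text \<open>A functional on a module gives a homomorphism into the coinduced module, and this
  function of \<open>y\<close> is the image of \<open>w\<close>. The functionals \<open>v j\<close>
  together thus define the map from \<open>C\<^sup>d\<close> to \<open>C\<^sup>s\<close>.\<close>

lemma vf_shift_invariant: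
 assumes v: "vec_functional n v" and w: "w \<in> vec n"
 shows "(%y. v (shift y w)) \<in> loc_const"
proof -
 have "\<exists>U\<in>\<U>. invariant U (%z. w (i, z))" if "i < n" for i
  using w that by (auto simp: vec_def loc_const_def)
 then obtain U where U: "!!i. i < n ==> U i \<in> \<U> \<and> invariant (U i) (%z. w (i, z))" by metis
 obtain V where V: "V \<in> \<U>" "!!i. i \<in> {..<n} ==> V \<subseteq> U i"
  using ons_INT[of "{..<n}" U] U by (metis finite_lessThan lessThan_iff)
 have wV: "invariant V (%z. w (i, z))" if "i < n" for i
  using U[OF that] V(2)[of i] that invariant_subset by blast
 have "invariant V (%y. v (shift y w))"
  unfolding invariant_def
 proof (intro ballI)
  fix y u assume yu: "y \<in> carrier G" "u \<in> V"
  hence u: "u \<in> carrier G" using ons_carrier[OF V(1)] by blast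
  have "vec_eq n (shift (u \<otimes> y) w) (shift y w)"
   unfolding vec_eq_def
  proof (intro allI impI ballI)
   fix i z assume iz: "i < n" "z \<in> carrier G"
   have "w (i, (z \<otimes> u) \<otimes> y) \<doteq> w (i, z \<otimes> y)"
    using invariant_right[OF invariant_translate(2)[OF wV[OF iz(1)] V(1) yu(1)] V(1) iz(2) yu(2)] .
   thus "shift (u \<otimes> y) w (i, z) \<doteq> shift y w (i, z)"
    using iz yu u by (simp add: shift_def m_assoc)
  qed
  thus "v (shift (u \<otimes> y) w) \<doteq> v (shift y w)"
   using yu u by (intro vf_cong[OF v] shift_vec[OF w]) auto
 qed
 thus ?thesis by (rule loc_constI[OF V(1)])
qed

lemma vec_common_level:
 assumes w: "w \<in> vec n"
 obtains U where "U \<in> \<U>" "!!i. i < n ==> invariant U (%z. w (i, z))"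
proof -
 have "\<exists>U\<in>\<U>. invariant U (%z. w (i, z))" if "i < n" for i
  using w that by (auto simp: vec_def loc_const_def)
 then obtain U where U: "!!i. i < n ==> U i \<in> \<U> \<and> invariant (U i) (%z. w (i, z))" by metis
 obtain V where V: "V \<in> \<U>" "!!i. i \<in> {..<n} ==> V \<subseteq> U i"
  using ons_INT[of "{..<n}" U] U by (metis finite_lessThan lessThan_iff)
 have "invariant V (%z. w (i, z))" if "i < n" for i
  using U[OF that] V(2)[of i] that invariant_subset by blast
 thus thesis using that V(1) by blast
qed

text \<open>A nonzero class in the kernel would generate a finite module of \<open>p\<close>-power order, and a fixed
 vector of the latter would contradict the maximality of the system.\<close>

lemma kernel_eq_im:
 assumes v: "!!j. j < s ==> vec_functional d (v j)" "!!j a. j < s ==> a \<in> im ==> v j a \<doteq> 0"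
  and max: "!!a. a \<in> fixed_vecs ==> (!!j. j < s ==> v j a \<doteq> 0) ==> a \<in> im"
  and w: "w \<in> vec d" and vw: "!!j y. j < s ==> y \<in> carrier G ==> v j (shift y w) \<doteq> 0"
 shows "w \<in> im"
proof (rule ccontr)
 assume nim: "w \<notin> im"
 obtain U where U: "U \<in> \<U>" "!!i. i < d ==> invariant U (%z. w (i, z))"
  using vec_common_level[OF w] by blast
 \<comment> \<open>Vectors in the kernel of the map to \<open>C\<^sup>s\<close> that are
   \<open>U\<close>-invariant up to an element of \<open>im\<close>. They include \<open>w\<close>
   and \<open>im\<close>, are stable under \<open>shift\<close>, and form a finite group modulo
   \<open>im\<close>.\<close>
 define X where "X = {m \<in> vec d. (\<forall>y\<in>carrier G. \<forall>j<s. v j (shift y m) \<doteq> 0) \<and>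
   (\<exists>a\<in>im. \<forall>i<d. invariant U (%z. m (i, z) - a (i, z)))}"
 have XI: "m \<in> X" if "m \<in> vec d" "!!y j. y \<in> carrier G ==> j < s ==> v j (shift y m) \<doteq> 0" "a \<in> im"
   "!!i. i < d ==> invariant U (%z. m (i, z) - a (i, z))" for m a
  using that by (auto simp: X_def)
 have Xv: "m \<in> vec d" "!!y j. y \<in> carrier G ==> j < s ==> v j (shift y m) \<doteq> 0" if "m \<in> X" for m
  using that by (auto simp: X_def)
 have Xa: "\<exists>a. a \<in> im \<and> (\<forall>i<d. invariant U (%z. m (i, z) - a (i, z)))" if "m \<in> X" for m
  using that by (auto simp: X_def)
 note ims = int_subspaceD[OF int_subspace_im]
 have imX: "a \<in> X" if a: "a \<in> im" for a
  using im_vec a v(2) im_shift by (intro XI[OF _ _ a]) (auto simp: invariant_def)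
 have wX: "w \<in> X" using vw U(2) by (intro XI[OF w _ ims(1)]) auto
 have addX: "(%k. m k + m' k) \<in> X" if m: "m \<in> X" "m' \<in> X" for m m'
 proof -
  obtain a where a: "a \<in> im" "\<forall>i<d. invariant U (%z. m (i, z) - a (i, z))" using Xa[OF m(1)] by blast
  obtain a' where a': "a' \<in> im" "\<forall>i<d. invariant U (%z. m' (i, z) - a' (i, z))" using Xa[OF m(2)] by blast
  show ?thesis
  proof (rule XI[OF vec_add[OF Xv(1)[OF m(1)] Xv(1)[OF m(2)]] _ ims(2)[OF a(1) a'(1)]])
   fix y j assume yj: "y \<in> carrier G" "j < s"
   have "v j (shift y (%k. m k + m' k)) \<doteq> v j (shift y m) + v j (shift y m')"
    unfolding shift_add using yj m Xv(1) by (intro vf_add[OF v(1)] shift_vec) auto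
   also have "... \<doteq> 0 + 0" using Xv(2) m yj by (intro meq_add) auto
   finally show "v j (shift y (%k. m k + m' k)) \<doteq> 0" by simp
  next
   fix i assume i: "i < d"
   show "invariant U (%z. m (i, z) + m' (i, z) - (a (i, z) + a' (i, z)))"
    unfolding invariant_def
   proof (intro ballI)
    fix z u assume zu: "z \<in> carrier G" "u \<in> U"
    from meq_add[OF invariantD[OF a(2)[rule_format, OF i] zu] invariantD[OF a'(2)[rule_format, OF i] zu]]
    show "m (i, u \<otimes> z) + m' (i, u \<otimes> z) - (a (i, u \<otimes> z) + a' (i, u \<otimes> z))
      \<doteq> m (i, z) + m' (i, z) - (a (i, z) + a' (i, z))"
     by (simp add: algebra_simps)
   qed
  qed
 qed
 have uminusX: "(%k. - m k) \<in> X" if m: "m \<in> X" for m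
 proof -
  obtain a where a: "a \<in> im" "\<forall>i<d. invariant U (%z. m (i, z) - a (i, z))" using Xa[OF m] by blast
  have mv: "(%k. - m k) \<in> vec d" using vec_scale[OF Xv(1)[OF m], of "-1"] by simp
  have ai: "(%k. - a k) \<in> im" using ims(3)[OF a(1), of "-1"] by simp
  show ?thesis
  proof (rule XI[OF mv _ ai])
   fix y j assume yj: "y \<in> carrier G" "j < s"
   have e: "shift y (%k. - m k) = (%k. 0 - shift y m k)" by (auto simp: shift_def fun_eq_iff)
   have "v j (shift y (%k. - m k)) \<doteq> v j (%_. 0) - v j (shift y m)"
    unfolding e using yj m Xv(1) int_subspaceD(1)[OF int_subspace_vec]
    by (intro vf_diff[OF v(1), where w = "%_. 0"] shift_vec) auto
   also have "... \<doteq> 0 - 0" using Xv(2) m yj vf_zero[OF v(1)] by (intro meq_diff) auto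
   finally show "v j (shift y (%k. - m k)) \<doteq> 0" by simp
  next
   fix i assume i: "i < d"
   show "invariant U (%z. - m (i, z) - - a (i, z))"
    unfolding invariant_def
   proof (intro ballI)
    fix z u assume zu: "z \<in> carrier G" "u \<in> U"
    from meq_diff[OF meq_refl[of p 0] invariantD[OF a(2)[rule_format, OF i] zu]]
    show "- m (i, u \<otimes> z) - - a (i, u \<otimes> z) \<doteq> - m (i, z) - - a (i, z)"
     by (simp add: algebra_simps)
   qed
  qed
 qed
 define M :: "(nat \<times> 'a => int) monoid" where "M = \<lparr>carrier = X, monoid.mult = (%f g k. f k + g k), one = (%_. 0)\<rparr>"
 have cM: "carrier M = X" "!!f g. f \<otimes>\<^bsub>M\<^esub> g = (%k. f k + g k)" "\<one>\<^bsub>M\<^esub> = (%_. 0)" by (simp_all add: M_def)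
 interpret M: comm_group M
 proof (rule comm_groupI)
  show "\<one>\<^bsub>M\<^esub> \<in> carrier M" using imX[OF ims(1)] by (simp add: cM)
  show "\<exists>y\<in>carrier M. y \<otimes>\<^bsub>M\<^esub> x = \<one>\<^bsub>M\<^esub>" if "x \<in> carrier M" for x
   using that uminusX by (intro bexI[of _ "%k. - x k"]) (auto simp: cM)
 qed (auto simp: cM addX algebra_simps)
 have inv: "inv\<^bsub>M\<^esub> m = (%k. - m k)" if "m \<in> X" for m
  using that uminusX by (intro M.inv_equality) (auto simp: cM)
 have pow: "m [^]\<^bsub>M\<^esub> (n::nat) = (%k. int n * m k)" if "m \<in> X" for m n
  by (induction n) (auto simp: cM algebra_simps)
 have sub: "subgroup im M"
  by (rule M.subgroupI) (use imX ims inv in \<open>auto simp: cM dest: ims(3)[of _ "-1"]\<close>)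
 have normal: "im \<lhd> M" by (rule M.subgroup_imp_normal[OF sub])
 interpret im: normal im M by fact
 have shiftX: "shift g m \<in> X" if g: "g \<in> carrier G" and m: "m \<in> X" for g m
 proof -
  obtain a where a: "a \<in> im" "\<forall>i<d. invariant U (%z. m (i, z) - a (i, z))" using Xa[OF m] by blast
  show ?thesis
  proof (rule XI[OF shift_vec[OF Xv(1)[OF m] g] _ im_shift[OF a(1) g]])
   fix y j assume yj: "y \<in> carrier G" "j < s"
   show "v j (shift y (shift g m)) \<doteq> 0"
    using Xv(2)[OF m, of "y \<otimes> g" j] yj g by (simp add: shift_shift)
  next
   fix i assume i: "i < d"
   show "invariant U (%z. shift g m (i, z) - shift g a (i, z))"
    using invariant_translate(2)[OF a(2)[rule_format, OF i] U(1) g] ons_carrier[OF U(1)]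
    by (auto simp: invariant_def shift_def)
  qed
 qed
 have shiftU: "(%k. shift u m k - m k) \<in> im" if u: "u \<in> U" and m: "m \<in> X" for u m
 proof -
  have uG: "u \<in> carrier G" using u ons_carrier[OF U(1)] by blast
  obtain a where a: "a \<in> im" "\<forall>i<d. invariant U (%z. m (i, z) - a (i, z))" using Xa[OF m] by blast
  have "vec_eq d (%k. shift u a k - a k) (%k. shift u m k - m k)"
   unfolding vec_eq_def
  proof (intro allI impI ballI)
   fix i z assume iz: "i < d" "z \<in> carrier G"
   have "m (i, z \<otimes> u) - a (i, z \<otimes> u) \<doteq> m (i, z) - a (i, z)"
    using invariant_right[OF a(2)[rule_format, OF iz(1)] U(1) iz(2) u] .
   thus "shift u a (i, z) - a (i, z) \<doteq> shift u m (i, z) - m (i, z)"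
    using iz by (simp add: shift_def meq_iff_dvd algebra_simps dvd_diff_commute)
  qed
  thus ?thesis using im_cong[OF ims(4)[OF im_shift[OF a(1) uG] a(1)]] by blast
 qed
 obtain k where k: "card (rcosets U) = p ^ k" using ons_index[OF U(1)] .
 have fin: "finite (rcosets\<^bsub>M\<^esub> im)"
 proof -
  \<comment> \<open>Finiteness: \<open>m\<close> minus the chosen element of \<open>im\<close> is
    \<open>U\<close>-invariant, hence determined modulo \<open>p\<close> by its values at finitely
    many coset representatives, which \<open>\<kappa>\<close> records.\<close>
  define sect where "sect m = (SOME a. a \<in> im \<and> (\<forall>i<d. invariant U (%z. m (i, z) - a (i, z))))" for m
  have sect: "sect m \<in> im" "!!i. i < d ==> invariant U (%z. m (i, z) - sect m (i, z))" if "m \<in> X" for m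
   using someI_ex[OF Xa[OF that]] by (auto simp: sect_def)
  define \<kappa> where "\<kappa> m = (\<lambda>(i, D)\<in>{..<d} \<times> rcosets U. (m (i, rep D) - sect m (i, rep D)) mod int p)" for m
  have \<kappa>im: "im #>\<^bsub>M\<^esub> m = im #>\<^bsub>M\<^esub> m'" if m: "m \<in> X" "m' \<in> X" and eq: "\<kappa> m = \<kappa> m'" for m m'
  proof -
   have "vec_eq d (%k. sect m k - sect m' k) (%k. m k - m' k)"
    unfolding vec_eq_def
   proof (intro allI impI ballI)
    fix i z assume iz: "i < d" "z \<in> carrier G"
    define D where "D = U #> z"
    have D: "D \<in> rcosets U" "z \<in> D"
     using coset_in_rcosets[OF U(1) iz(2)] mem_coset_iff[OF U(1) iz(2)] by (auto simp: D_def)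
    have "m (i, z) - sect m (i, z) \<doteq> m (i, rep D) - sect m (i, rep D)"
     using invariant_rep[OF sect(2)[OF m(1) iz(1)] U(1) D] .
    also have "... \<doteq> m' (i, rep D) - sect m' (i, rep D)"
     using fun_cong[OF eq, of "(i, D)"] iz D by (simp add: \<kappa>_def mod_eq_def cong_def)
    also have "... \<doteq> m' (i, z) - sect m' (i, z)"
     using meq_sym[OF invariant_rep[OF sect(2)[OF m(2) iz(1)] U(1) D]] .
    finally show "sect m (i, z) - sect m' (i, z) \<doteq> m (i, z) - m' (i, z)"
     by (simp add: meq_iff_dvd algebra_simps dvd_diff_commute)
   qed
   hence "(%k. m k - m' k) \<in> im" using im_cong[OF ims(4)[OF sect(1)[OF m(1)] sect(1)[OF m(2)]]] by blast
   hence "m \<otimes>\<^bsub>M\<^esub> inv\<^bsub>M\<^esub> m' \<in> im" using m by (simp add: cM inv)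
   hence "m \<in> im #>\<^bsub>M\<^esub> m'" using im.rcos_module[OF M.is_group] m by (simp add: cM)
   thus ?thesis using M.repr_independence[OF _ _ sub, of m m'] m by (simp add: cM)
  qed
  define srep where "srep C = (SOME m. m \<in> X \<and> C = im #>\<^bsub>M\<^esub> m)" for C
  have srep: "srep C \<in> X" "C = im #>\<^bsub>M\<^esub> srep C" if "C \<in> rcosets\<^bsub>M\<^esub> im" for C
   using someI_ex[of "%m. m \<in> X \<and> C = im #>\<^bsub>M\<^esub> m"] that by (auto simp: srep_def RCOSETS_def cM)
  have "inj_on (%C. \<kappa> (srep C)) (rcosets\<^bsub>M\<^esub> im)"
  proof (rule inj_onI)
   fix C C' assume C: "C \<in> rcosets\<^bsub>M\<^esub> im" "C' \<in> rcosets\<^bsub>M\<^esub> im" and eq: "\<kappa> (srep C) = \<kappa> (srep C')"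
   thus "C = C'" using \<kappa>im[OF srep(1)[OF C(1)] srep(1)[OF C(2)] eq] srep(2)[OF C(1)] srep(2)[OF C(2)] by simp
  qed
  moreover have "(%C. \<kappa> (srep C)) ` (rcosets\<^bsub>M\<^esub> im) \<subseteq> {..<d} \<times> rcosets U \<rightarrow>\<^sub>E {0..int p - 1}"
   unfolding \<kappa>_def using mod_in_residues
   by (intro image_subsetI restrict_PiE_iff[THEN iffD2]) auto
  moreover have "finite ({..<d} \<times> rcosets U \<rightarrow>\<^sub>E {0..int p - 1})"
   using ons_finite_index[OF U(1)] by (intro finite_PiE) auto
  ultimately show ?thesis using inj_on_finite by blast
 qed
 interpret act: p_action_mod p M im G U k shift
 proof (rule p_action_mod.intro)
  show "prime p" by (rule prime_p)
  show "finite (rcosets\<^bsub>M\<^esub> im)" by (rule fin)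
  show "im ~= carrier M" using wX nim by (auto simp: cM)
  show "\<exists>j. m [^]\<^bsub>M\<^esub> (p ^ j :: nat) \<in> im" if "m \<in> carrier M" for m
  proof -
   have "(%k. int p * m k) \<in> im" by (rule im_zero) (simp add: vec_eq_def meq_iff_dvd)
   thus ?thesis using that pow[of m p] by (intro exI[of _ 1]) (simp add: cM)
  qed
  show "U \<lhd> G" by (rule ons_normal[OF U(1)])
  show "card (rcosets U) = p ^ k" by (rule k)
  show "shift g \<in> hom M M" if "g \<in> carrier G" for g
   by (rule homI) (use that shiftX in \<open>auto simp: cM shift_add\<close>)
  show "shift (g \<otimes> h) m = shift g (shift h m)" if "g \<in> carrier G" "h \<in> carrier G" for g h m
   using shift_shift that .
  show "shift g l \<in> im" if "g \<in> carrier G" "l \<in> im" for g l using im_shift that by blast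
  show "shift u m \<otimes>\<^bsub>M\<^esub> inv\<^bsub>M\<^esub> m \<in> im" if "u \<in> U" "m \<in> carrier M" for u m
   using shiftU[OF that(1)] that(2) by (simp add: cM inv)
  show "im \<lhd> M" by (rule normal)
 qed
 obtain m where m: "act.fixed m" "m \<notin> im" using act.fixed_coset by blast
 have mX: "m \<in> X" using m(1) by (simp add: act.fixed_def cM)
 have "m \<in> fixed_vecs"
  unfolding fixed_vecs_def using m(1) mX Xv(1) by (auto simp: act.fixed_def cM inv)
 moreover have "v j m \<doteq> 0" if j: "j < s" for j
 proof -
  have "v j m \<doteq> v j (shift \<one> m)" using vec_eq_sym[OF shift_one] by (intro vf_cong[OF v(1)[OF j] Xv(1)[OF mX]])
  also have "... \<doteq> 0" using Xv(2)[OF mX] j by simp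
  finally show ?thesis .
 qed
 ultimately show False using max m(2) by blast
qed

text \<open>Dual to the absence of a right kernel: if the image \<open>B\<close> were proper, a
  functional \<open>u\<close> on \<open>C\<^sup>s\<close> with \<open>u F\<close> equal to 1 would
  vanish on it. As a column, \<open>u\<close> is then annihilated by the matrix of the
  \<open>v j\<close>, so it is zero.\<close>

lemma resolution_surjective:
 assumes ind: "indep s w" and du: "dual s w v" and F: "F \<in> vec s"
 shows "\<exists>b\<in>vec d. \<forall>j<s. \<forall>y\<in>carrier G. v j (shift y b) \<doteq> F (j, y)"
proof (rule ccontr)
 assume no: "\<not> ?thesis"
 have v: "vec_functional d (v j)" if "j < s" for j using du that by (auto simp: dual_def)
 define B where "B = {F \<in> vec s. \<exists>b\<in>vec d. \<forall>j<s. \<forall>y\<in>carrier G. v j (shift y b) \<doteq> F (j, y)}"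
 have BI: "F \<in> B" if "b \<in> vec d" "F \<in> vec s" "!!j y. j < s ==> y \<in> carrier G ==> v j (shift y b) \<doteq> F (j, y)" for b F
  using that by (auto simp: B_def)
 have BE: "\<exists>b. b \<in> vec d \<and> F \<in> vec s \<and> (\<forall>j<s. \<forall>y\<in>carrier G. v j (shift y b) \<doteq> F (j, y))" if "F \<in> B" for F
  using that by (auto simp: B_def)
 note vs = int_subspaceD[OF int_subspace_vec]
 have vscale: "v j (%k. c * b k) \<doteq> c * v j b" if j: "j < s" and b: "b \<in> vec d" for j c b
 proof -
  have "v j (%k. c * b k) \<doteq> (\<Sum>l<d. v j (entry l (%z. c * b (l, z))))"
   by (rule vf_decomposition[OF v[OF j] vec_scale[OF b]])
  also have "... \<doteq> (\<Sum>l<d. c * v j (entry l (%z. b (l, z))))"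
   using b by (intro meq_sum functional_scale[OF functional_entry[OF v[OF j]]]) (simp add: vec_def)
  also have "... = c * (\<Sum>l<d. v j (entry l (%z. b (l, z))))" by (simp add: sum_distrib_left)
  also have "... \<doteq> c * v j b"
   by (rule meq_scale_left[OF meq_sym[OF vf_decomposition[OF v[OF j] b]]])
  finally show ?thesis .
 qed
 have "int_subspace B"
  unfolding int_subspace_def
 proof (intro conjI ballI allI)
  have sz: "shift y (%_. 0) = (%_. 0)" for y by (auto simp: shift_def)
  show "(%_. 0) \<in> B" using vf_zero[OF v] by (intro BI[OF vs(1) vs(1)]) (simp add: sz)
 next
  fix f g assume "f \<in> B" "g \<in> B"
  then obtain b c where b: "b \<in> vec d" "f \<in> vec s" "\<forall>j<s. \<forall>y\<in>carrier G. v j (shift y b) \<doteq> f (j, y)"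
   and c: "c \<in> vec d" "g \<in> vec s" "\<forall>j<s. \<forall>y\<in>carrier G. v j (shift y c) \<doteq> g (j, y)"
   using BE by meson
  show "(%k. f k + g k) \<in> B"
  proof (rule BI[OF vs(2)[OF b(1) c(1)] vs(2)[OF b(2) c(2)]])
   fix j y assume jy: "j < s" "y \<in> carrier G"
   have "v j (shift y (%k. b k + c k)) \<doteq> v j (shift y b) + v j (shift y c)"
    unfolding shift_add by (rule vf_add[OF v[OF jy(1)] shift_vec[OF b(1) jy(2)] shift_vec[OF c(1) jy(2)]])
   also have "... \<doteq> f (j, y) + g (j, y)" using b(3) c(3) jy by (intro meq_add) auto
   finally show "v j (shift y (%k. b k + c k)) \<doteq> f (j, y) + g (j, y)" .
  qed
 next
  fix f c assume "f \<in> B"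
  then obtain b where b: "b \<in> vec d" "f \<in> vec s" "\<forall>j<s. \<forall>y\<in>carrier G. v j (shift y b) \<doteq> f (j, y)"
   using BE by meson
  show "(%k. c * f k) \<in> B"
  proof (rule BI[OF vs(3)[OF b(1)] vs(3)[OF b(2)]])
   fix j y assume jy: "j < s" "y \<in> carrier G"
   have "v j (shift y (%k. c * b k)) \<doteq> c * v j (shift y b)"
    unfolding shift_scale by (rule vscale[OF jy(1) shift_vec[OF b(1) jy(2)]])
   also have "... \<doteq> c * f (j, y)" using b(3) jy by (intro meq_scale_left) auto
   finally show "v j (shift y (%k. c * b k)) \<doteq> c * f (j, y)" .
  qed
 qed
 moreover have "B \<subseteq> vec s" by (auto simp: B_def)
 moreover have "F' \<in> B" if fB: "f \<in> B" and fF: "vec_eq s f F'" for f F'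
 proof -
  obtain b where b: "b \<in> vec d" "f \<in> vec s" "\<forall>j<s. \<forall>y\<in>carrier G. v j (shift y b) \<doteq> f (j, y)"
   using BE[OF fB] by blast
  show ?thesis
  proof (rule BI[OF b(1) vec_cong[OF b(2) fF]])
   fix j y assume jy: "j < s" "y \<in> carrier G"
   have "v j (shift y b) \<doteq> f (j, y)" using b(3) jy by blast
   also have "... \<doteq> F' (j, y)" using fF jy by (simp add: vec_eq_def)
   finally show "v j (shift y b) \<doteq> F' (j, y)" .
  qed
 qed
 moreover have "F \<notin> B" using no by (auto simp: B_def)
 ultimately obtain u where u: "vec_functional s u" "!!b. b \<in> B ==> u b \<doteq> 0" "u F \<doteq> 1"
  using vec_separation[of B s F] F by blast
 have uj: "functional (%f. u (entry j f))" for j by (rule functional_entry[OF u(1)])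
 have "(\<Sum>j<s. v j (entry i (%y. u (entry j (%z. f (y \<otimes> z)))))) \<doteq> 0"
  if i: "i < d" and f: "f \<in> loc_const" for i f
 proof -
  \<comment> \<open>The map to \<open>C\<^sup>s\<close> sends \<open>entry i f\<close> to
    \<open>H\<close>, an element of \<open>B\<close>. Up to a Fubini exchange, \<open>u H\<close>
    expanded over the \<open>s\<close> components is entry \<open>i\<close> of the product of the
    matrix and the column \<open>u\<close>, evaluated at \<open>f\<close>.\<close>
  define b where "b = entry i f"
  have b: "b \<in> vec d" unfolding b_def by (rule entry_vec[OF f])
  define H where "H = (%(j, z). v j (shift z b))"
  have H: "H \<in> vec s"
   unfolding vec_def H_def using vf_shift_invariant[OF v b] by simp
  have HB: "H \<in> B" by (rule BI[OF b H]) (simp add: H_def)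
  have "(\<Sum>j<s. v j (entry i (%y. u (entry j (%z. f (y \<otimes> z))))))
    \<doteq> (\<Sum>j<s. u (entry j (%z. v j (entry i (%y. f (y \<otimes> z))))))"
   using functional_conv_Fubini[OF functional_entry[OF v] uj f] by (intro meq_sum) simp
  also have "... \<doteq> (\<Sum>j<s. u (entry j (%z. H (j, z))))"
  proof (rule meq_sum)
   fix j assume "j \<in> {..<s}"
   hence j: "j < s" by simp
   have Hlc: "(%z. H (j, z)) \<in> loc_const" using H j by (simp add: vec_def)
   show "u (entry j (%z. v j (entry i (%y. f (y \<otimes> z))))) \<doteq> u (entry j (%z. H (j, z)))"
   proof (rule meq_sym[OF functional_cong[OF uj Hlc]])
    fix z assume z: "z \<in> carrier G"
    show "H (j, z) \<doteq> v j (entry i (%y. f (y \<otimes> z)))"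
     unfolding H_def prod.case
     by (rule vf_cong[OF v[OF j] shift_vec[OF b z]]) (auto simp: vec_eq_def shift_def b_def entry_def)
   qed
  qed
  also have "... \<doteq> u H" by (rule meq_sym[OF vf_decomposition[OF u(1) H]])
  also have "... \<doteq> 0" by (rule u(2)[OF HB])
  finally show ?thesis .
 qed
 hence u0: "u (entry j f) \<doteq> 0" if "j < s" "f \<in> loc_const" for j f
  using indep_dual_dichotomy(2)[OF ind du, of "%j f. u (entry j f)" j f] uj that by simp
 have "u F \<doteq> (\<Sum>j<s. u (entry j (%z. F (j, z))))" by (rule vf_decomposition[OF u(1) F])
 also have "... \<doteq> (\<Sum>j<s. 0)" using F by (intro meq_sum u0) (auto simp: vec_def)
 finally have "1 \<doteq> 0" using meq_trans[OF meq_sym[OF u(3)]] by simp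
 thus False using prime_p by (simp add: meq_iff_dvd prime_nat_iff)
qed

end

section \<open>The bar complex\<close>

text \<open>All terms of the inhomogeneous coboundary of \<open>e\<close> except the first one, up to sign; the recursion splits off
 the first factor of the remaining terms.\<close>

fun bar :: "('g, 'b) monoid_scheme => ('m, 'c) monoid_scheme => ('g list => 'm) => 'g list => 'm" where
 "bar G A e [] = \<one>\<^bsub>A\<^esub>"
| "bar G A e [y] = e []"
| "bar G A e (y # x # xs) =
   e ((y \<otimes>\<^bsub>G\<^esub> x) # xs) \<otimes>\<^bsub>A\<^esub> inv\<^bsub>A\<^esub> (bar G A (%l. e (y # l)) (x # xs))"

definition tuples :: "('g, 'b) monoid_scheme => nat => 'g list set" where
 "tuples G n = {l. set l \<subseteq> carrier G \<and> length l = n}"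

lemma tuples_Cons [simp]: "x # l \<in> tuples G (Suc n) \<longleftrightarrow> x \<in> carrier G \<and> l \<in> tuples G n"
 by (auto simp: tuples_def)

lemma tuples_0 [simp]: "l \<in> tuples G 0 \<longleftrightarrow> l = []"
 by (auto simp: tuples_def)

lemma tuples_SucE:
 assumes "l \<in> tuples G (Suc n)"
 obtains x l' where "l = x # l'" "x \<in> carrier G" "l' \<in> tuples G n"
 using assms by (cases l) (auto simp: tuples_def)

locale bar_complex = G: group G + A: comm_group A
 for G :: "('g, 'b) monoid_scheme" and A :: "('m, 'c) monoid_scheme" (structure)
begin

lemma bar_induct [consumes 1, case_names single Cons]:
 assumes "l \<in> tuples G (Suc n)"
  and "!!e y. y \<in> carrier G ==> P 0 e [y]"
  and "!!n e y x xs. y \<in> carrier G ==> x \<in> carrier G ==> xs \<in> tuples G n ==>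
      (!!e. P n e (x # xs)) ==> P (Suc n) e (y # x # xs)"
 shows "P n (e :: 'e) l"
 using assms(1)
proof (induction n arbitrary: e l)
 case 0
 thus ?case using assms(2) by (auto elim!: tuples_SucE)
next
 case (Suc n)
 then obtain y x xs where "l = y # x # xs" "y \<in> carrier G" "x \<in> carrier G" "xs \<in> tuples G n"
  by (auto elim!: tuples_SucE)
 thus ?case using assms(3) Suc.IH by simp
qed

lemma bar_closed:
 assumes "l \<in> tuples G (Suc n)" "!!l. l \<in> tuples G n ==> e l \<in> carrier A"
 shows "bar G A e l \<in> carrier A"
 using assms by (induction n e l rule: bar_induct) auto

lemma bar_cong:
 assumes "l \<in> tuples G (Suc n)" "!!l. l \<in> tuples G n ==> e l = e' l"
 shows "bar G A e l = bar G A e' l"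
proof -
 have "\<forall>e'. (\<forall>l \<in> tuples G n. e l = e' l) --> bar G A e l = bar G A e' l"
  using assms(1)
 proof (induction n e l rule: bar_induct)
  case (Cons n e y x xs)
  show ?case
  proof (intro allI impI)
   fix e' assume e': "\<forall>l\<in>tuples G (Suc n). e l = e' l"
   hence "\<forall>l\<in>tuples G n. e (y # l) = e' (y # l)" using Cons.hyps by simp
   hence "bar G A (%l. e (y # l)) (x # xs) = bar G A (%l. e' (y # l)) (x # xs)"
    using Cons.IH[rule_format, of "%l. e (y # l)" "%l. e' (y # l)"] by blast
   moreover have "e ((y \<otimes>\<^bsub>G\<^esub> x) # xs) = e' ((y \<otimes>\<^bsub>G\<^esub> x) # xs)" using e' Cons.hyps by simp
   ultimately show "bar G A e (y # x # xs) = bar G A e' (y # x # xs)" by simp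
  qed
 qed auto
 thus ?thesis using assms(2) by blast
qed

lemma bar_mult:
 assumes "l \<in> tuples G (Suc n)" "!!l. l \<in> tuples G n ==> e l \<in> carrier A"
  "!!l. l \<in> tuples G n ==> e' l \<in> carrier A"
 shows "bar G A (%l. e l \<otimes> e' l) l = bar G A e l \<otimes> bar G A e' l"
proof -
 have "\<forall>e'. (\<forall>l \<in> tuples G n. e l \<in> carrier A) --> (\<forall>l \<in> tuples G n. e' l \<in> carrier A) -->
   bar G A (%l. e l \<otimes> e' l) l = bar G A e l \<otimes> bar G A e' l"
  using assms(1)
 proof (induction n e l rule: bar_induct)
  case (Cons n e y x xs)
  show ?case
  proof (intro allI impI)
   fix e' assume e: "\<forall>l\<in>tuples G (Suc n). e l \<in> carrier A" and e': "\<forall>l\<in>tuples G (Suc n). e' l \<in> carrier A"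
   define b where "b = bar G A (%l. e (y # l)) (x # xs)"
   define b' where "b' = bar G A (%l. e' (y # l)) (x # xs)"
   have bc: "b \<in> carrier A" "b' \<in> carrier A"
    unfolding b_def b'_def using Cons.hyps e e' by (auto intro!: bar_closed[where n = n])
   have "bar G A (%l. e (y # l) \<otimes> e' (y # l)) (x # xs) = b \<otimes> b'"
    unfolding b_def b'_def using Cons e e' by simp
   moreover have "e ((y \<otimes>\<^bsub>G\<^esub> x) # xs) \<in> carrier A" "e' ((y \<otimes>\<^bsub>G\<^esub> x) # xs) \<in> carrier A"
    using e e' Cons.hyps by auto
   ultimately show "bar G A (%l. e l \<otimes> e' l) (y # x # xs)
     = bar G A e (y # x # xs) \<otimes> bar G A e' (y # x # xs)"
    using bc by (simp flip: b_def b'_def add: A.inv_mult A.m_ac)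
  qed
 qed auto
 thus ?thesis using assms(2,3) by blast
qed

lemma bar_one: "l \<in> tuples G (Suc n) ==> bar G A (%_. \<one>) l = \<one>"
proof -
 assume "l \<in> tuples G (Suc n)"
 hence "\<forall>x::unit. bar G A (%_. \<one>) l = \<one>"
  by (induction n "()" l rule: bar_induct) auto
 thus ?thesis by simp
qed

lemma bar_inv:
 assumes l: "l \<in> tuples G (Suc n)" and e: "!!l. l \<in> tuples G n ==> e l \<in> carrier A"
 shows "bar G A (%l. inv (e l)) l = inv (bar G A e l)"
proof -
 have "bar G A (%l. inv (e l)) l \<otimes> bar G A e l = bar G A (%l. inv (e l) \<otimes> e l) l"
  using assms by (intro bar_mult[symmetric]) auto
 also have "... = bar G A (%_. \<one>) l" using assms by (intro bar_cong) auto
 also have "... = \<one>" by (rule bar_one[OF l])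
 finally show ?thesis
  using assms bar_closed[of l n e] bar_closed[of l n "%l. inv (e l)"] by (intro A.inv_equality[symmetric]) auto
qed

lemma bar_hom:
 assumes l: "l \<in> tuples G (Suc n)" and e: "!!l. l \<in> tuples G n ==> e l \<in> carrier A"
  and h: "h \<in> hom A A"
 shows "bar G A (%l. h (e l)) l = h (bar G A e l)"
proof -
 interpret h: group_hom A A h using h by (simp add: group_hom_def group_hom_axioms_def A.is_group)
 have "(\<forall>l \<in> tuples G n. e l \<in> carrier A) --> bar G A (%l. h (e l)) l = h (bar G A e l)"
  using l
 proof (induction n e l rule: bar_induct)
  case (Cons n e y x xs)
  show ?case
  proof
   assume e: "\<forall>l\<in>tuples G (Suc n). e l \<in> carrier A"
   have "bar G A (%l. e (y # l)) (x # xs) \<in> carrier A"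
    using Cons.hyps e by (auto intro!: bar_closed[where n = n])
   moreover have "bar G A (%l. h (e (y # l))) (x # xs) = h (bar G A (%l. e (y # l)) (x # xs))"
    using Cons e by simp
   ultimately show "bar G A (%l. h (e l)) (y # x # xs) = h (bar G A e (y # x # xs))"
    using e Cons.hyps by simp
  qed
 qed auto
 thus ?thesis using e by blast
qed

text \<open>On \<open>y # l\<close> the recursion writes \<open>bar e\<close> as the merged term
  \<open>?t\<close> minus \<open>bar\<close> of \<open>?e\<close>. Under a second application the
  part with \<open>?e\<close> vanishes by induction, and the part with \<open>?t\<close> equals the
  leading term of the outer \<open>bar\<close>, with which it cancels.\<close>

lemma bar_bar:
 assumes "l \<in> tuples G (Suc (Suc n))" "!!l. l \<in> tuples G n ==> e l \<in> carrier A"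
 shows "bar G A (bar G A e) l = \<one>"
 using assms
proof (induction n arbitrary: e l)
 case 0
 then obtain y x where l: "l = [y, x]" "y \<in> carrier G" "x \<in> carrier G" by (auto elim!: tuples_SucE)
 thus ?case using 0 by simp
next
 case (Suc n)
 then obtain y x z zs where l: "l = y # x # z # zs" "y \<in> carrier G" "x \<in> carrier G" "z \<in> carrier G"
   "zs \<in> tuples G n"
  by (auto elim!: tuples_SucE)
 have c: "e l \<in> carrier A" if "l \<in> tuples G (Suc n)" for l using Suc.prems(2) that .
 let ?e = "%l. e (y # l)"
 let ?t = "%l. e ((y \<otimes>\<^bsub>G\<^esub> hd l) # tl l)"
 have tc: "?t l \<in> carrier A" if "l \<in> tuples G (Suc n)" for l
  using that l(2) by (auto elim!: tuples_SucE intro!: c)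
 have ec: "?e l \<in> carrier A" if "l \<in> tuples G n" for l using that l(2) by (auto intro!: c)
 have xz: "x # z # zs \<in> tuples G (Suc (Suc n))" using l by simp
 have bc: "bar G A ?e l \<in> carrier A" if "l \<in> tuples G (Suc n)" for l using that ec by (rule bar_closed)
 have "bar G A (%l. bar G A e (y # l)) (x # z # zs)
   = bar G A (%l. ?t l \<otimes> inv (bar G A ?e l)) (x # z # zs)"
  using xz by (rule bar_cong) (auto elim!: tuples_SucE)
 also have "... = bar G A ?t (x # z # zs) \<otimes> bar G A (%l. inv (bar G A ?e l)) (x # z # zs)"
  using xz tc bc by (intro bar_mult) auto
 also have "bar G A (%l. inv (bar G A ?e l)) (x # z # zs) = inv (bar G A (bar G A ?e) (x # z # zs))"
  using xz bc by (rule bar_inv)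
 also have "bar G A (bar G A ?e) (x # z # zs) = \<one>"
  using xz ec by (rule Suc.IH)
 also have "bar G A ?t (x # z # zs) \<otimes> inv \<one> = bar G A ?t (x # z # zs)"
  using bar_closed[OF xz tc] by (simp del: bar.simps)
 also have "... = bar G A e ((y \<otimes>\<^bsub>G\<^esub> x) # z # zs)"
  using l by (simp add: G.m_assoc)
 finally have "bar G A (%l. bar G A e (y # l)) (x # z # zs) = bar G A e ((y \<otimes>\<^bsub>G\<^esub> x) # z # zs)" .
 moreover have "bar G A e ((y \<otimes>\<^bsub>G\<^esub> x) # z # zs) \<in> carrier A"
  using l c by (intro bar_closed[of _ "Suc n"]) auto
 ultimately show ?case unfolding l(1) bar.simps(3)[of G A "bar G A e"] by simp
qed

end

section \<open>Locally constant cochains modulo p and coinduced coefficients\<close>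

context pro_p_group
begin

interpretation B: bar_complex G integer_group
 by (simp add: bar_complex_def is_group abelian_integer_group)

definition ibar :: "('a list => int) => 'a list => int" where
 "ibar = bar G integer_group"

lemma ibar_simps [simp]:
 "ibar e [y] = e []"
 "ibar e (y # x # xs) = e ((y \<otimes> x) # xs) - ibar (%l. e (y # l)) (x # xs)"
 by (simp_all add: ibar_def)

lemma ibar_diff: "l \<in> tuples G (Suc n) ==> ibar (%l. e l - e' l) l = ibar e l - ibar e' l"
proof -
 assume l: "l \<in> tuples G (Suc n)"
 have "ibar (%l. e l + - e' l) l = ibar e l + ibar (%l. - e' l) l"
  using B.bar_mult[OF l, of e "%l. - e' l"] by (simp add: ibar_def)
 also have "ibar (%l. - e' l) l = - ibar e' l"
  using B.bar_inv[OF l, of e'] by (simp add: ibar_def)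
 finally show ?thesis by simp
qed

lemma ibar_ibar: "l \<in> tuples G (Suc (Suc n)) ==> ibar (ibar e) l = 0"
 using B.bar_bar[of l n e] by (simp add: ibar_def)

lemma ibar_meq:
 assumes "l \<in> tuples G (Suc n)" "!!l. l \<in> tuples G n ==> e l \<doteq> e' l"
 shows "ibar e l \<doteq> ibar e' l"
proof -
 have "\<forall>e'. (\<forall>l\<in>tuples G n. e l \<doteq> e' l) --> ibar e l \<doteq> ibar e' l"
  using assms(1)
 proof (induction n e l rule: B.bar_induct)
  case (Cons n e y x xs)
  show ?case
  proof (intro allI impI)
   fix e' assume e': "\<forall>l\<in>tuples G (Suc n). e l \<doteq> e' l"
   hence "\<forall>l\<in>tuples G n. e (y # l) \<doteq> e' (y # l)" using Cons.hyps by simp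
   hence "ibar (%l. e (y # l)) (x # xs) \<doteq> ibar (%l. e' (y # l)) (x # xs)"
    using Cons.IH[rule_format, of "%l. e (y # l)" "%l. e' (y # l)"] by simp
   moreover have "e ((y \<otimes> x) # xs) \<doteq> e' ((y \<otimes> x) # xs)" using e' Cons.hyps by simp
   ultimately show "ibar e (y # x # xs) \<doteq> ibar e' (y # x # xs)" by (simp add: meq_diff)
  qed
 qed simp
 thus ?thesis using assms(2) by simp
qed

definition near :: "'a set => 'a list => 'a list => bool" where
 "near U = list_all2 (%x y. y \<in> U #> x)"

lemma near_Cons [simp]: "near U (x # xs) (y # ys) \<longleftrightarrow> y \<in> U #> x \<and> near U xs ys"
 by (simp add: near_def)

lemma near_Nil [simp]: "near U [] []"
 by (simp add: near_def)

lemma near_self: "U \<in> \<U> ==> xs \<in> tuples G n ==> near U xs xs"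
proof (induction n arbitrary: xs)
 case (Suc n)
 thus ?case using rcos_self ons_subgroup by (auto elim!: tuples_SucE)
qed simp

lemma near_mono: "near U xs ys ==> U \<subseteq> V ==> near V xs ys"
 unfolding near_def by (erule list_all2_mono) (auto simp: r_coset_def)

lemma coset_mult_mem:
 assumes U: "U \<in> \<U>" and x: "x \<in> carrier G" "x' \<in> U #> x" and y: "y \<in> carrier G" "y' \<in> U #> y"
 shows "x' \<otimes> y' \<in> U #> (x \<otimes> y)"
proof -
 interpret N: normal U G by (rule ons_normal[OF U])
 have "x' \<otimes> y' \<in> (U #> x) <#> (U #> y)" using x y by (auto simp: set_mult_def)
 thus ?thesis using N.rcos_sum x y by simp
qed

definition tuple_invariant :: "'a set => nat => ('a list => int) => bool" where
 "tuple_invariant U n e \<longleftrightarrow> (\<forall>xs\<in>tuples G n. \<forall>ys\<in>tuples G n. near U xs ys --> e ys \<doteq> e xs)"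

lemma tuple_invariantD:
 "tuple_invariant U n e ==> xs \<in> tuples G n ==> ys \<in> tuples G n ==> near U xs ys ==> e ys \<doteq> e xs"
 by (simp add: tuple_invariant_def)

lemma tuple_invariant_Cons:
 assumes "U \<in> \<U>" "tuple_invariant U (Suc n) e" "y \<in> carrier G"
 shows "tuple_invariant U n (%l. e (y # l))"
 unfolding tuple_invariant_def
 using assms rcos_self[OF assms(3) ons_subgroup[OF assms(1)]] by (auto intro!: tuple_invariantD[OF assms(2)])

lemma tuple_invariant_ibar:
 assumes U: "U \<in> \<U>" and e: "tuple_invariant U n e"
 shows "tuple_invariant U (Suc n) (ibar e)"
 using e
proof (induction n arbitrary: e)
 case 0
 show ?case unfolding tuple_invariant_def by (auto elim!: tuples_SucE)
next
 case (Suc n)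
 show ?case
  unfolding tuple_invariant_def
 proof (intro ballI impI)
  fix xs ys assume "xs \<in> tuples G (Suc (Suc n))" "ys \<in> tuples G (Suc (Suc n))" and near: "near U xs ys"
  then obtain y x l y' x' l' where l: "xs = y # x # l" "y \<in> carrier G" "x \<in> carrier G" "l \<in> tuples G n"
   and l': "ys = y' # x' # l'" "y' \<in> carrier G" "x' \<in> carrier G" "l' \<in> tuples G n"
   by (auto elim!: tuples_SucE)
  have n: "y' \<in> U #> y" "x' \<in> U #> x" "near U l l'" using near l l' by auto
  have "e ((y' \<otimes> x') # l') \<doteq> e ((y \<otimes> x) # l)"
   using l l' n coset_mult_mem[OF U] by (intro tuple_invariantD[OF Suc.prems]) auto
  moreover have "ibar (%l. e (y' # l)) (x' # l') \<doteq> ibar (%l. e (y # l)) (x # l)"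
  proof -
   have "ibar (%l. e (y' # l)) (x' # l') \<doteq> ibar (%l. e (y # l)) (x' # l')"
    using l l' n near_self[OF U]
    by (intro ibar_meq[of _ n] tuple_invariantD[OF Suc.prems]) auto
   also have "... \<doteq> ibar (%l. e (y # l)) (x # l)"
    using l l' n by (intro tuple_invariantD[OF Suc.IH[OF tuple_invariant_Cons[OF U Suc.prems l(2)]]]) auto
   finally show ?thesis .
  qed
  ultimately show "ibar e ys \<doteq> ibar e xs" using l l' by (simp add: meq_diff)
 qed
qed

text \<open>The differential for cochains with values in functions on \<open>G\<close>, on which \<open>G\<close> acts by right translations; the last
 argument is the argument of the value.\<close>

definition dcob :: "('a list => 'a => int) => 'a list => 'a => int" where
 "dcob c xs z = c (tl xs) (z \<otimes> hd xs) - ibar (%l. c l z) xs"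

lemma dcob_meq:
 assumes "xs \<in> tuples G (Suc n)" "z \<in> carrier G"
  "!!l z. l \<in> tuples G n ==> z \<in> carrier G ==> c l z \<doteq> c' l z"
 shows "dcob c xs z \<doteq> dcob c' xs z"
proof -
 obtain x l where "xs = x # l" "x \<in> carrier G" "l \<in> tuples G n" using assms(1) by (rule tuples_SucE)
 thus ?thesis unfolding dcob_def using assms by (intro meq_diff ibar_meq[OF assms(1)]) auto
qed

lemma dcob_diff:
 assumes "xs \<in> tuples G (Suc n)"
 shows "dcob (%l z. c l z - c' l z) xs z = dcob c xs z - dcob c' xs z"
 unfolding dcob_def using ibar_diff[OF assms, of "%l. c l z" "%l. c' l z"] by simp

lemma dcob_translate:
 assumes "xs \<in> tuples G (Suc n)" "a \<in> carrier G" "z \<in> carrier G"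
 shows "dcob (%l z. c l (a \<otimes> z)) xs z = dcob c xs (a \<otimes> z)"
 using assms by (auto simp: dcob_def m_assoc elim!: tuples_SucE)

lemma dcob_dcob:
 assumes "xs \<in> tuples G (Suc (Suc n))" "z \<in> carrier G"
 shows "dcob (dcob c) xs z = 0"
proof -
 obtain y x l where l: "xs = y # x # l" "y \<in> carrier G" "x \<in> carrier G" "l \<in> tuples G n"
  using assms(1) by (auto elim!: tuples_SucE)
 have "ibar (%m. dcob c m z) xs = ibar (%m. c (tl m) (z \<otimes> hd m)) xs - ibar (ibar (%m. c m z)) xs"
  unfolding dcob_def by (rule ibar_diff[OF assms(1)])
 also have "ibar (ibar (%m. c m z)) xs = 0" by (rule ibar_ibar[OF assms(1)])
 finally show ?thesis
  using l assms(2) by (simp add: dcob_def[of "dcob c"] dcob_def[of c "x # l"] m_assoc)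
qed

text \<open>The contracting homotopy of a coinduced module: the argument of the value moves to the
  front of the tuple. The defect is the differential of \<open>c\<close> at the tuple
  \<open>z # xs\<close> with value argument \<open>\<one>\<close>.\<close>

lemma dcob_contract:
 assumes xs: "xs \<in> tuples G (Suc n)" and z: "z \<in> carrier G"
  and c: "!!l. l \<in> tuples G (Suc (Suc n)) ==> dcob c l \<one> \<doteq> 0"
 shows "dcob (%l z. c (z # l) \<one>) xs z \<doteq> c xs z"
proof -
 obtain x l where l: "xs = x # l" "x \<in> carrier G" "l \<in> tuples G n" using xs by (rule tuples_SucE)
 have "c xs z - dcob (%l z. c (z # l) \<one>) xs z = dcob c (z # xs) \<one>"
  using l z by (simp add: dcob_def)
 also have "... \<doteq> 0" using xs z by (intro c) simp
 finally show ?thesis using meq_iff_diff meq_sym by blast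
qed

text \<open>Continuity in the entries of the tuple and in the argument of the value together; the
  contracting homotopy turns one into the other.\<close>

definition joint_invariant :: "'a set => nat => ('a list => 'a => int) => bool" where
 "joint_invariant U n c \<longleftrightarrow> (\<forall>xs\<in>tuples G n. \<forall>ys\<in>tuples G n. \<forall>z\<in>carrier G. \<forall>z'\<in>carrier G.
   near U xs ys --> z' \<in> U #> z --> c ys z' \<doteq> c xs z)"

lemma joint_invariantD:
 "joint_invariant U n c ==> xs \<in> tuples G n ==> ys \<in> tuples G n ==> z \<in> carrier G ==> z' \<in> carrier G ==>
  near U xs ys ==> z' \<in> U #> z ==> c ys z' \<doteq> c xs z"
 by (simp add: joint_invariant_def)

lemma joint_invariant_mono: "joint_invariant U n c ==> V \<subseteq> U ==> joint_invariant V n c"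
proof -
 assume c: "joint_invariant U n c" and VU: "V \<subseteq> U"
 have "V #> z \<subseteq> U #> z" for z using VU by (auto simp: r_coset_def)
 thus ?thesis
  unfolding joint_invariant_def using near_mono[OF _ VU] by (auto intro!: joint_invariantD[OF c])
qed

lemma coset_self: "U \<in> \<U> ==> z \<in> carrier G ==> z \<in> U #> z"
 by (rule rcos_self[OF _ ons_subgroup])

lemma joint_invariant_dcob:
 assumes U: "U \<in> \<U>" and c: "joint_invariant U n c"
 shows "joint_invariant U (Suc n) (dcob c)"
 unfolding joint_invariant_def
proof (intro ballI impI)
 fix xs ys z z' assume xs: "xs \<in> tuples G (Suc n)" and ys: "ys \<in> tuples G (Suc n)"
  and z: "z \<in> carrier G" "z' \<in> carrier G" and near: "near U xs ys" and zz: "z' \<in> U #> z"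
 obtain x l where l: "xs = x # l" "x \<in> carrier G" "l \<in> tuples G n" using xs by (rule tuples_SucE)
 obtain x' l' where l': "ys = x' # l'" "x' \<in> carrier G" "l' \<in> tuples G n" using ys by (rule tuples_SucE)
 have n: "x' \<in> U #> x" "near U l l'" using near l l' by auto
 have "c l' (z' \<otimes> x') \<doteq> c l (z \<otimes> x)"
  using l l' n z zz coset_mult_mem[OF U] by (intro joint_invariantD[OF c]) auto
 moreover have "ibar (%l. c l z') ys \<doteq> ibar (%l. c l z) ys"
  using z zz near_self[OF U] by (intro ibar_meq[OF ys] joint_invariantD[OF c]) auto
 moreover have "ibar (%l. c l z) ys \<doteq> ibar (%l. c l z) xs"
 proof (rule tuple_invariantD[OF tuple_invariant_ibar[OF U] xs ys near])
  show "tuple_invariant U n (%l. c l z)"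
   unfolding tuple_invariant_def using z coset_self[OF U] by (auto intro!: joint_invariantD[OF c])
 qed
 ultimately show "dcob c ys z' \<doteq> dcob c xs z"
  unfolding dcob_def using l l' by (auto intro!: meq_diff intro: meq_trans)
qed

lemma joint_invariant_invariant:
 assumes U: "U \<in> \<U>" and c: "joint_invariant U n c" and xs: "xs \<in> tuples G n"
 shows "invariant U (c xs)"
 unfolding invariant_def
proof (intro ballI)
 fix z u assume zu: "z \<in> carrier G" "u \<in> U"
 hence "u \<otimes> z \<in> U #> z" by (auto simp: r_coset_def)
 thus "c xs (u \<otimes> z) \<doteq> c xs z"
  using zu ons_carrier[OF U] near_self[OF U xs] xs by (intro joint_invariantD[OF c]) auto
qed

text \<open>A choice that depends only on the cosets of the entries of a tuple takes finitely many
 values.\<close>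

lemma tuple_choice:
 assumes U: "U \<in> \<U>" and ex: "!!l. l \<in> tuples G n ==> \<exists>w. Q l w \<and> (\<exists>V\<in>\<U>. R V w)"
  and mono: "!!V V' w. R V w ==> V' \<subseteq> V ==> R V' w"
  and inv: "!!l l' w. l \<in> tuples G n ==> l' \<in> tuples G n ==> near U l l' ==> Q l' w ==> Q l w"
 shows "\<exists>W. \<exists>V\<in>\<U>. V \<subseteq> U \<and> (\<forall>l\<in>tuples G n. Q l (W l) \<and> R V (W l)) \<and>
  (\<forall>l\<in>tuples G n. \<forall>l'\<in>tuples G n. near V l l' --> W l' = W l)"
proof -
 define nrm where "nrm l = map (%x. rep (U #> x)) l" for l
 define ch where "ch l = (SOME w. Q l w \<and> (\<exists>V\<in>\<U>. R V w))" for l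
 have ch: "Q l (ch l) \<and> (\<exists>V\<in>\<U>. R V (ch l))" if "l \<in> tuples G n" for l
  unfolding ch_def by (rule someI_ex[OF ex[OF that]])
 have repU: "rep (U #> x) \<in> U #> x" "rep (U #> x) \<in> carrier G" if "x \<in> carrier G" for x
  using rep_coset[OF U coset_in_rcosets[OF U that]] by auto
 have nrm: "nrm l \<in> tuples G n" "near U l (nrm l)" if "l \<in> tuples G n" for l
  using that repU unfolding nrm_def near_def tuples_def
  by (auto simp: list_all2_map2 list.rel_refl_strong list_all2_same)
 have nrm_eq: "nrm l' = nrm l" if "near U l l'" "l \<in> tuples G n" "l' \<in> tuples G n" for l l'
  using that
 proof (induction n arbitrary: l l')
  case (Suc n)
  then obtain x m x' m' where "l = x # m" "x \<in> carrier G" "m \<in> tuples G n"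
    "l' = x' # m'" "x' \<in> carrier G" "m' \<in> tuples G n" by (auto elim!: tuples_SucE)
  moreover have "U #> x' = U #> x"
   using calculation Suc.prems(1) repr_independence[OF _ _ ons_subgroup[OF U], of x' x] by simp
  ultimately show ?case using Suc by (simp add: nrm_def)
 qed simp
 have "finite {xs. set xs \<subseteq> rep ` (rcosets U) \<and> length xs = n}"
  using ons_finite_index[OF U] by (intro finite_lists_length_eq) simp
 moreover have "nrm ` tuples G n \<subseteq> {xs. set xs \<subseteq> rep ` (rcosets U) \<and> length xs = n}"
 proof
  fix m assume "m \<in> nrm ` tuples G n"
  then obtain l where l: "l \<in> tuples G n" "m = nrm l" by blast
  hence "set m \<subseteq> (%x. rep (U #> x)) ` carrier G" by (auto simp: nrm_def tuples_def)
  also have "... = rep ` ((%x. U #> x) ` carrier G)" by (rule image_image[symmetric])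
  also have "... \<subseteq> rep ` (rcosets U)" using coset_in_rcosets[OF U] by (intro image_mono) auto
  finally show "m \<in> {xs. set xs \<subseteq> rep ` (rcosets U) \<and> length xs = n}"
   using l by (simp add: nrm_def tuples_def)
 qed
 ultimately have fin: "finite (nrm ` tuples G n)" by (rule rev_finite_subset)
 have "\<exists>V. V \<in> \<U> \<and> R V (ch m)" if m: "m \<in> nrm ` tuples G n" for m
 proof -
  have "m \<in> tuples G n" using m nrm(1) by auto
  hence "\<exists>V\<in>\<U>. R V (ch m)" using ch by simp
  thus ?thesis by auto
 qed
 then obtain V where V: "!!m. m \<in> nrm ` tuples G n ==> V m \<in> \<U> \<and> R (V m) (ch m)" by metis
 obtain V0 where V0: "V0 \<in> \<U>" "!!m. m \<in> nrm ` tuples G n ==> V0 \<subseteq> V m"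
  using ons_INT[OF fin, of V] V by blast
 show ?thesis
 proof (intro exI[of _ "%l. ch (nrm l)"] bexI[of _ "U \<inter> V0"] conjI ballI impI)
  show "U \<inter> V0 \<in> \<U>" using ons_Int U V0 by blast
  show "Q l (ch (nrm l))" if l: "l \<in> tuples G n" for l
   by (rule inv[OF l nrm[OF l] conjunct1[OF ch[OF nrm(1)[OF l]]]])
  show "R (U \<inter> V0) (ch (nrm l))" if l: "l \<in> tuples G n" for l
  proof (rule mono)
   show "R (V (nrm l)) (ch (nrm l))" using V[of "nrm l"] l by simp
   show "U \<inter> V0 \<subseteq> V (nrm l)" using V0(2)[of "nrm l"] l by auto
  qed
  show "ch (nrm l') = ch (nrm l)" if "l \<in> tuples G n" "l' \<in> tuples G n" "near (U \<inter> V0) l l'" for l l'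
   using nrm_eq[OF near_mono[OF that(3)] that(1,2)] by simp
 qed simp
qed

end

section \<open>Vanishing of the cohomology with coefficients in the prime field\<close>

context sylvester_pro_p
begin

lemma ibar_vec_functional:
 assumes v: "vec_functional m v" and xs: "xs \<in> tuples G (Suc n)"
  and C: "!!l. l \<in> tuples G n ==> C l \<in> vec m"
 shows "(%k. ibar (%l. C l k) xs) \<in> vec m \<and> v (%k. ibar (%l. C l k) xs) \<doteq> ibar (%l. v (C l)) xs"
 using xs C
proof (induction n arbitrary: C xs)
 case 0
 thus ?case by (auto elim!: tuples_SucE)
next
 case (Suc n)
 obtain y x l where l: "xs = y # x # l" "y \<in> carrier G" "x \<in> carrier G" "l \<in> tuples G n"
  using Suc.prems(1) by (auto elim!: tuples_SucE)
 have IH: "(%k. ibar (%l. C (y # l) k) (x # l)) \<in> vec m"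
  "v (%k. ibar (%l. C (y # l) k) (x # l)) \<doteq> ibar (%l. v (C (y # l))) (x # l)"
  using Suc.IH[of "x # l" "%l. C (y # l)"] Suc.prems(2) l by auto
 have c: "C ((y \<otimes> x) # l) \<in> vec m" using Suc.prems(2) l by simp
 have "v (%k. C ((y \<otimes> x) # l) k - ibar (%l. C (y # l) k) (x # l))
   \<doteq> v (C ((y \<otimes> x) # l)) - v (%k. ibar (%l. C (y # l) k) (x # l))"
  by (rule vf_diff[OF v c IH(1)])
 also have "... \<doteq> v (C ((y \<otimes> x) # l)) - ibar (%l. v (C (y # l))) (x # l)"
  by (intro meq_diff meq_refl IH(2))
 finally show ?case using vec_diff[OF c IH(1)] l by simp
qed

text \<open>The map that a functional induces into the coinduced module is a homomorphism for right
  translations, so it commutes with the differentials.\<close>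

lemma dcob_vec_functional:
 assumes v: "vec_functional m v" and xs: "xs \<in> tuples G (Suc n)" and y: "y \<in> carrier G"
  and C: "!!l. l \<in> tuples G n ==> C l \<in> vec m"
 shows "v (shift y (%(i, z). dcob (%l z. C l (i, z)) xs z)) \<doteq> dcob (%l y. v (shift y (C l))) xs y"
proof -
 obtain x l where l: "xs = x # l" "x \<in> carrier G" "l \<in> tuples G n" using xs by (rule tuples_SucE)
 have s1: "shift (y \<otimes> x) (C l) \<in> vec m" using C l y by (intro shift_vec) auto
 have s2: "shift y (C l) \<in> vec m" if "l \<in> tuples G n" for l using C[OF that] y by (rule shift_vec)
 note ib = ibar_vec_functional[OF v xs, of "%l. shift y (C l)", OF s2]
 have "v (%k. shift (y \<otimes> x) (C l) k - ibar (%l. shift y (C l) k) xs)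
   \<doteq> v (shift (y \<otimes> x) (C l)) - v (%k. ibar (%l. shift y (C l) k) xs)"
  using ib by (intro vf_diff[OF v s1]) blast
 also have "... \<doteq> v (shift (y \<otimes> x) (C l)) - ibar (%l. v (shift y (C l))) xs"
  using ib by (intro meq_diff meq_refl) blast
 also have "... = dcob (%l y. v (shift y (C l))) xs y" by (simp add: dcob_def l)
 finally have *: "v (%k. shift (y \<otimes> x) (C l) k - ibar (%l. shift y (C l) k) xs) \<doteq> ..." .
 have "vec_eq m (%k. shift (y \<otimes> x) (C l) k - ibar (%l. shift y (C l) k) xs)
   (shift y (%(i, z). dcob (%l z. C l (i, z)) xs z))"
  unfolding vec_eq_def using l y by (auto simp: shift_def dcob_def m_assoc)
 hence "v (%k. shift (y \<otimes> x) (C l) k - ibar (%l. shift y (C l) k) xs)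
   \<doteq> v (shift y (%(i, z). dcob (%l z. C l (i, z)) xs z))"
  using ib by (intro vf_cong[OF v] vec_diff s1) blast+
 thus ?thesis using * meq_sym meq_trans by blast
qed

text \<open>Dimension shifting along the resolution with explicit cochains. Contraction in
  \<open>C\<close>, \<open>C\<^sup>d\<close> and \<open>C\<^sup>s\<close> yields \<open>g0\<close>,
  \<open>g1\<close> and \<open>g2\<close>, whose differentials are \<open>f\<close>,
  \<open>\<delta> g0\<close> and the image of \<open>g1\<close> in \<open>C\<^sup>s\<close>. Each
  contraction lowers the degree by one, so the argument starts in degree 3. Surjectivity onto
  \<open>C\<^sup>s\<close> and exactness at \<open>C\<^sup>d\<close> then permit correcting first
  \<open>g1\<close> and next \<open>g0\<close> by a differential, after which the latter takes
  constant values.\<close>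

theorem cocycle_mod_p_is_coboundary:
 assumes U: "U \<in> \<U>" and f: "tuple_invariant U (Suc (Suc (Suc n))) f"
  and cocycle: "!!xs. xs \<in> tuples G (Suc (Suc (Suc (Suc n)))) ==> ibar f xs \<doteq> f (tl xs)"
 shows "\<exists>e. \<exists>V\<in>\<U>. tuple_invariant V (Suc (Suc n)) e \<and>
   (\<forall>xs\<in>tuples G (Suc (Suc (Suc n))). f xs \<doteq> e (tl xs) - ibar e xs)"
proof -
 obtain s b v where ind: "indep s b" and du: "dual s b v"
  and max: "!!a. a \<in> fixed_vecs ==> (!!j. j < s ==> v j a \<doteq> 0) ==> a \<in> im"
  using maximal_indep by blast
 have v: "vec_functional d (v j)" and v0: "!!a. a \<in> im ==> v j a \<doteq> 0" if "j < s" for j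
  using du that by (auto simp: dual_def)
 have ker: "w \<in> im" if "w \<in> vec d" "!!j y. j < s ==> y \<in> carrier G ==> v j (shift y w) \<doteq> 0" for w
  by (rule kernel_eq_im[where s = s and v = v]) (auto intro: v v0 max that)
 note surj = resolution_surjective[OF ind du]
 define g0 where "g0 l z = f (z # l)" for l z
 have g0_inv: "joint_invariant U (Suc (Suc n)) g0"
  unfolding joint_invariant_def g0_def by (auto intro!: tuple_invariantD[OF f])
 have g0_lc: "g0 l \<in> loc_const" if "l \<in> tuples G (Suc (Suc n))" for l
  by (rule loc_constI[OF U joint_invariant_invariant[OF U g0_inv that]])
 \<comment> \<open>With constants embedded in \<open>C\<close>, the cocycle \<open>f\<close> is a
   differential: this is the cocycle condition at \<open>z # xs\<close>.\<close>
 have D0: "dcob g0 xs z \<doteq> f xs" if xs: "xs \<in> tuples G (Suc (Suc (Suc n)))" and z: "z \<in> carrier G" for xs z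
 proof -
  obtain x l where l: "xs = x # l" using xs by (rule tuples_SucE)
  have "dcob g0 xs z = ibar f (z # xs)" by (simp add: dcob_def g0_def l)
  thus ?thesis using cocycle[of "z # xs"] xs z by simp
 qed
 define w0 where "w0 l = (%(i, z). g0 l (x i \<otimes> z) - g0 l z)" for l
 have w0_im: "w0 l \<in> im" if "l \<in> tuples G (Suc (Suc n))" for l
  unfolding w0_def by (rule boundary_im[OF g0_lc[OF that]])
 \<comment> \<open>\<open>\<delta>\<close> kills constants, and the differential of
   \<open>g0\<close> has constant values.\<close>
 have Dw0: "dcob (%l z. w0 l (i, z)) xs z \<doteq> 0"
  if xs: "xs \<in> tuples G (Suc (Suc (Suc n)))" and z: "z \<in> carrier G" and i: "i < d" for xs z i
 proof -
  have "dcob (%l z. w0 l (i, z)) xs z = dcob g0 xs (x i \<otimes> z) - dcob g0 xs z"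
   using dcob_diff[OF xs, of "%l z. g0 l (x i \<otimes> z)" g0 z] dcob_translate[OF xs x_closed[OF i] z, of g0]
   by (simp add: w0_def)
  also have "... \<doteq> f xs - f xs" using D0[OF xs] z x_closed[OF i] by (intro meq_diff) auto
  finally show ?thesis by simp
 qed
 define g1 where "g1 l = (%(i, z). w0 (z # l) (i, \<one>))" for l
 have Dg1: "dcob (%l z. g1 l (i, z)) xs z \<doteq> w0 xs (i, z)"
  if "xs \<in> tuples G (Suc (Suc n))" "z \<in> carrier G" "i < d" for xs z i
  using dcob_contract[OF that(1,2), of "%l z. w0 l (i, z)"] Dw0 that(3) by (simp add: g1_def)
 have g1_inv: "joint_invariant U (Suc n) (%l z. g1 l (i, z))" if i: "i < d" for i
  unfolding joint_invariant_def g1_def w0_def g0_def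
  using x_closed[OF i] coset_self[OF U] by (auto intro!: meq_diff tuple_invariantD[OF f])
 have g1_vec: "g1 l \<in> vec d" if "l \<in> tuples G (Suc n)" for l
  unfolding vec_def using loc_constI[OF U joint_invariant_invariant[OF U g1_inv that]] by simp
 define k1 where "k1 j l y = v j (shift y (g1 l))" for j l y
 have Dk1: "dcob (k1 j) xs y \<doteq> 0" if xs: "xs \<in> tuples G (Suc (Suc n))" and y: "y \<in> carrier G" and j: "j < s" for j xs y
 proof -
  have "dcob (k1 j) xs y \<doteq> v j (shift y (%(i, z). dcob (%l z. g1 l (i, z)) xs z))"
   unfolding k1_def by (rule meq_sym[OF dcob_vec_functional[OF v[OF j] xs y g1_vec]])
  also have "... \<doteq> v j (shift y (w0 xs))"
  proof (rule meq_sym[OF vf_cong[OF v[OF j] shift_vec[OF _ y] shift_cong[OF _ y]]])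
   show "w0 xs \<in> vec d" using w0_im[OF xs] im_vec by blast
   show "vec_eq d (w0 xs) (%(i, z). dcob (%l z. g1 l (i, z)) xs z)"
    unfolding vec_eq_def using meq_sym[OF Dg1[OF xs]] by simp
  qed
  also have "... \<doteq> 0" by (rule v0[OF j im_shift[OF w0_im[OF xs] y]])
  finally show ?thesis .
 qed
 \<comment> \<open>The image \<open>k1\<close> of \<open>g1\<close> in \<open>C\<^sup>s\<close> is a
   cocycle, because the differential of \<open>g1\<close> has values in \<open>im\<close>. Its
   contraction lives in degree \<open>n\<close>.\<close>
 define g2 where "g2 l = (%(j, y). k1 j (y # l) \<one>)" for l
 have Dg2: "dcob (%l y. g2 l (j, y)) xs y \<doteq> k1 j xs y"
  if "xs \<in> tuples G (Suc n)" "y \<in> carrier G" "j < s" for xs y j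
  using dcob_contract[OF that(1,2), of "k1 j"] Dk1 that(3) by (simp add: g2_def)
 have g2_inv: "joint_invariant U n (%l y. g2 l (j, y))" if j: "j < s" for j
  unfolding joint_invariant_def
 proof (intro ballI impI)
  fix xs ys z z' assume xs: "xs \<in> tuples G n" "ys \<in> tuples G n" "z \<in> carrier G" "z' \<in> carrier G"
   "near U xs ys" "z' \<in> U #> z"
  have "vec_eq d (g1 (z' # ys)) (g1 (z # xs))"
   unfolding vec_eq_def using xs coset_self[OF U] by (auto intro!: joint_invariantD[OF g1_inv])
  thus "g2 ys (j, z') \<doteq> g2 xs (j, z)"
   unfolding g2_def k1_def using xs g1_vec
   by (auto intro!: vf_cong[OF v[OF j]] shift_vec shift_cong)
 qed
 have g2_vec: "g2 l \<in> vec s" if "l \<in> tuples G n" for l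
  unfolding vec_def using loc_constI[OF U joint_invariant_invariant[OF U g2_inv that]] by simp
 \<comment> \<open>The preimages in \<open>C\<^sup>d\<close> have to depend on the tuple in a
   locally constant way, with a common level; this is what \<open>tuple_choice\<close>
   provides.\<close>
 have "\<exists>W. \<exists>V\<in>\<U>. V \<subseteq> U \<and>
   (\<forall>l\<in>tuples G n. (W l \<in> vec d \<and> (\<forall>j<s. \<forall>y\<in>carrier G. v j (shift y (W l)) \<doteq> g2 l (j, y))) \<and>
    (\<forall>i<d. invariant V (%z. W l (i, z)))) \<and>
   (\<forall>l\<in>tuples G n. \<forall>l'\<in>tuples G n. near V l l' --> W l' = W l)"
 proof (rule tuple_choice[OF U, of n
    "%l w. w \<in> vec d \<and> (\<forall>j<s. \<forall>y\<in>carrier G. v j (shift y w) \<doteq> g2 l (j, y))"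
    "%V w. \<forall>i<d. invariant V (%z. w (i, z))"])
  fix l assume l: "l \<in> tuples G n"
  obtain w where w: "w \<in> vec d" "\<forall>j<s. \<forall>y\<in>carrier G. v j (shift y w) \<doteq> g2 l (j, y)"
   using surj[OF g2_vec[OF l]] by blast
  obtain V where "V \<in> \<U>" "!!i. i < d ==> invariant V (%z. w (i, z))" using vec_common_level[OF w(1)] by blast
  thus "\<exists>w. (w \<in> vec d \<and> (\<forall>j<s. \<forall>y\<in>carrier G. v j (shift y w) \<doteq> g2 l (j, y))) \<and>
    (\<exists>V\<in>\<U>. \<forall>i<d. invariant V (%z. w (i, z)))" using w by blast
 next
  fix l l' w assume l: "l \<in> tuples G n" "l' \<in> tuples G n" "near U l l'"
   and w: "w \<in> vec d \<and> (\<forall>j<s. \<forall>y\<in>carrier G. v j (shift y w) \<doteq> g2 l' (j, y))"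
  have "g2 l' (j, y) \<doteq> g2 l (j, y)" if "j < s" "y \<in> carrier G" for j y
   using l that coset_self[OF U] by (intro joint_invariantD[OF g2_inv]) auto
  thus "w \<in> vec d \<and> (\<forall>j<s. \<forall>y\<in>carrier G. v j (shift y w) \<doteq> g2 l (j, y))"
   using w meq_trans by blast
 qed (auto intro: invariant_subset)
 then obtain g1' V1 where V1: "V1 \<in> \<U>" "V1 \<subseteq> U"
  and g1'_all: "\<forall>l\<in>tuples G n. (g1' l \<in> vec d \<and> (\<forall>j<s. \<forall>y\<in>carrier G. v j (shift y (g1' l)) \<doteq> g2 l (j, y))) \<and>
    (\<forall>i<d. invariant V1 (%z. g1' l (i, z)))"
  and g1'_near: "\<forall>l\<in>tuples G n. \<forall>l'\<in>tuples G n. near V1 l l' --> g1' l' = g1' l"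
  by (elim exE bexE conjE)
 have g1'_vec: "g1' l \<in> vec d" if "l \<in> tuples G n" for l using g1'_all that by simp
 have g1'_eq: "v j (shift y (g1' l)) \<doteq> g2 l (j, y)" if "l \<in> tuples G n" "j < s" "y \<in> carrier G" for l j y
  using g1'_all that by simp
 have g1'_inv: "invariant V1 (%z. g1' l (i, z))" if "l \<in> tuples G n" "i < d" for l i
  using g1'_all that by simp
 have g1'_joint: "joint_invariant V1 n (%l z. g1' l (i, z))" if i: "i < d" for i
  unfolding joint_invariant_def
 proof (intro ballI impI)
  fix xs ys z z' assume xs: "xs \<in> tuples G n" "ys \<in> tuples G n" "z \<in> carrier G" "z' \<in> carrier G"
   "near V1 xs ys" "z' \<in> V1 #> z"
  show "g1' ys (i, z') \<doteq> g1' xs (i, z)"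
   using g1'_near[rule_format, OF xs(1,2,5)] invariant_coset[OF g1'_inv[OF xs(1) i] V1(1) xs(3,6)] by simp
 qed
 \<comment> \<open>In \<open>C\<^sup>s\<close> the image of \<open>w1\<close> is that of
   \<open>g1\<close> minus the differential of \<open>g2\<close>, hence zero; so \<open>w1\<close>
   has values in \<open>im\<close>.\<close>
 define w1 where "w1 l = (%(i, z). g1 l (i, z) - dcob (%l z. g1' l (i, z)) l z)" for l
 have w1_inv: "joint_invariant V1 (Suc n) (%l z. w1 l (i, z))" if i: "i < d" for i
  unfolding joint_invariant_def w1_def
  using joint_invariantD[OF joint_invariant_mono[OF g1_inv[OF i] V1(2)]]
   joint_invariantD[OF joint_invariant_dcob[OF V1(1) g1'_joint[OF i]]]
  by (auto intro!: meq_diff)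
 have w1_vec: "w1 l \<in> vec d" if "l \<in> tuples G (Suc n)" for l
  unfolding vec_def using loc_constI[OF V1(1) joint_invariant_invariant[OF V1(1) w1_inv that]] by simp
 have w1_im: "w1 l \<in> im" if l: "l \<in> tuples G (Suc n)" for l
 proof (rule ker[OF w1_vec[OF l]])
  fix j y assume j: "j < s" and y: "y \<in> carrier G"
  have Dvec: "(%(i, z). dcob (%l z. g1' l (i, z)) l z) \<in> vec d"
   unfolding vec_def
   using loc_constI[OF V1(1) joint_invariant_invariant[OF V1(1) joint_invariant_dcob[OF V1(1) g1'_joint] l]] by simp
  have "w1 l = (%k. g1 l k - (%(i, z). dcob (%l z. g1' l (i, z)) l z) k)"
   by (auto simp: w1_def)
  hence "shift y (w1 l) = (%k. shift y (g1 l) k - shift y (%(i, z). dcob (%l z. g1' l (i, z)) l z) k)"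
   by (simp only: shift_diff)
  hence "v j (shift y (w1 l)) \<doteq> k1 j l y - v j (shift y (%(i, z). dcob (%l z. g1' l (i, z)) l z))"
   unfolding k1_def using vf_diff[OF v[OF j] shift_vec[OF g1_vec[OF l] y] shift_vec[OF Dvec y]] by simp
  also have "... \<doteq> k1 j l y - dcob (%l y. v j (shift y (g1' l))) l y"
   by (intro meq_diff meq_refl dcob_vec_functional[OF v[OF j] l y g1'_vec])
  also have "... \<doteq> k1 j l y - dcob (%l y. g2 l (j, y)) l y"
   by (intro meq_diff meq_refl dcob_meq[OF l y] g1'_eq[OF _ j])
  also have "... \<doteq> k1 j l y - k1 j l y" by (intro meq_diff meq_refl Dg2[OF l y j])
  finally show "v j (shift y (w1 l)) \<doteq> 0" by simp
 qed
 have "\<exists>W. \<exists>V\<in>\<U>. V \<subseteq> V1 \<and>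
   (\<forall>l\<in>tuples G (Suc n). (W l \<in> loc_const \<and> (\<forall>i<d. \<forall>z\<in>carrier G. w1 l (i, z) \<doteq> W l (x i \<otimes> z) - W l z)) \<and>
    invariant V (W l)) \<and>
   (\<forall>l\<in>tuples G (Suc n). \<forall>l'\<in>tuples G (Suc n). near V l l' --> W l' = W l)"
 proof (rule tuple_choice[OF V1(1), of "Suc n"
    "%l h. h \<in> loc_const \<and> (\<forall>i<d. \<forall>z\<in>carrier G. w1 l (i, z) \<doteq> h (x i \<otimes> z) - h z)" invariant])
  fix l assume l: "l \<in> tuples G (Suc n)"
  obtain h where h: "h \<in> loc_const" "\<forall>i<d. \<forall>z\<in>carrier G. w1 l (i, z) \<doteq> h (x i \<otimes> z) - h z"
   using w1_im[OF l] by (rule imE)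
  obtain V where "V \<in> \<U>" "invariant V h" using h(1) by (rule loc_constE)
  thus "\<exists>h. (h \<in> loc_const \<and> (\<forall>i<d. \<forall>z\<in>carrier G. w1 l (i, z) \<doteq> h (x i \<otimes> z) - h z)) \<and>
    (\<exists>V\<in>\<U>. invariant V h)" using h by blast
 next
  fix l l' h assume l: "l \<in> tuples G (Suc n)" "l' \<in> tuples G (Suc n)" "near V1 l l'"
   and h: "h \<in> loc_const \<and> (\<forall>i<d. \<forall>z\<in>carrier G. w1 l' (i, z) \<doteq> h (x i \<otimes> z) - h z)"
  have "w1 l (i, z) \<doteq> w1 l' (i, z)" if "i < d" "z \<in> carrier G" for i z
   using l that coset_self[OF V1(1)] by (intro meq_sym[OF joint_invariantD[OF w1_inv]]) auto
  thus "h \<in> loc_const \<and> (\<forall>i<d. \<forall>z\<in>carrier G. w1 l (i, z) \<doteq> h (x i \<otimes> z) - h z)"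
   using h meq_trans by blast
 qed (rule invariant_subset)
 then obtain g0' V2 where V2: "V2 \<in> \<U>" "V2 \<subseteq> V1"
  and g0'_all: "\<forall>l\<in>tuples G (Suc n).
    (g0' l \<in> loc_const \<and> (\<forall>i<d. \<forall>z\<in>carrier G. w1 l (i, z) \<doteq> g0' l (x i \<otimes> z) - g0' l z)) \<and> invariant V2 (g0' l)"
  and g0'_near: "\<forall>l\<in>tuples G (Suc n). \<forall>l'\<in>tuples G (Suc n). near V2 l l' --> g0' l' = g0' l"
  by (elim exE bexE conjE)
 have g0'_eq: "w1 l (i, z) \<doteq> g0' l (x i \<otimes> z) - g0' l z" if "l \<in> tuples G (Suc n)" "i < d" "z \<in> carrier G" for l i z
  using g0'_all that by simp
 have g0'_inv: "invariant V2 (g0' l)" if "l \<in> tuples G (Suc n)" for l using g0'_all that by simp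
 have g0'_joint: "joint_invariant V2 (Suc n) g0'"
  unfolding joint_invariant_def
 proof (intro ballI impI)
  fix xs ys z z' assume xs: "xs \<in> tuples G (Suc n)" "ys \<in> tuples G (Suc n)" "z \<in> carrier G" "z' \<in> carrier G"
   "near V2 xs ys" "z' \<in> V2 #> z"
  show "g0' ys z' \<doteq> g0' xs z"
   using g0'_near[rule_format, OF xs(1,2,5)] invariant_coset[OF g0'_inv[OF xs(1)] V2(1) xs(3,6)] by simp
 qed
 \<comment> \<open>\<open>\<delta>\<close> maps this cochain to \<open>w0\<close> minus the
   differential of \<open>w1\<close>. The latter is the differential of \<open>g1\<close>, which is
   \<open>w0\<close>, so the values are constants.\<close>
 define e' where "e' l z = g0 l z - dcob g0' l z" for l z
 have e'_inv: "joint_invariant V2 (Suc (Suc n)) e'"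
  unfolding joint_invariant_def e'_def
  using joint_invariantD[OF joint_invariant_mono[OF g0_inv subset_trans[OF V2(2) V1(2)]]]
   joint_invariantD[OF joint_invariant_dcob[OF V2(1) g0'_joint]]
  by (auto intro!: meq_diff)
 have e'_const: "e' l z \<doteq> e' l \<one>" if l: "l \<in> tuples G (Suc (Suc n))" and z: "z \<in> carrier G" for l z
 proof (rule translation_invariant_const[OF _ _ z])
  show "e' l \<in> loc_const" by (rule loc_constI[OF V2(1) joint_invariant_invariant[OF V2(1) e'_inv l]])
  fix i z assume i: "i < d" and z: "z \<in> carrier G"
  have "e' l (x i \<otimes> z) - e' l z = w0 l (i, z) - (dcob g0' l (x i \<otimes> z) - dcob g0' l z)"
   by (simp add: e'_def w0_def)
  also have "dcob g0' l (x i \<otimes> z) - dcob g0' l z = dcob (%l z. g0' l (x i \<otimes> z) - g0' l z) l z"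
   using dcob_diff[OF l, of "%l z. g0' l (x i \<otimes> z)" g0' z] dcob_translate[OF l x_closed[OF i] z, of g0'] by simp
  also have "w0 l (i, z) - dcob (%l z. g0' l (x i \<otimes> z) - g0' l z) l z \<doteq> w0 l (i, z) - dcob (%l z. w1 l (i, z)) l z"
   by (intro meq_diff meq_refl dcob_meq[OF l z] meq_sym[OF g0'_eq[OF _ i]])
  also have "dcob (%l z. w1 l (i, z)) l z = dcob (%l z. g1 l (i, z)) l z - dcob (dcob (%l z. g1' l (i, z))) l z"
   using dcob_diff[OF l, of "%l z. g1 l (i, z)" "dcob (%l z. g1' l (i, z))" z] by (simp add: w1_def)
  also have "dcob (dcob (%l z. g1' l (i, z))) l z = 0" by (rule dcob_dcob[OF l z])
  also have "w0 l (i, z) - (dcob (%l z. g1 l (i, z)) l z - 0) \<doteq> w0 l (i, z) - w0 l (i, z)"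
   using Dg1[OF l z i] by (intro meq_diff meq_refl) simp
  finally have "e' l (x i \<otimes> z) - e' l z \<doteq> 0" by simp
  thus "e' l (x i \<otimes> z) \<doteq> e' l z" using meq_iff_diff by blast
 qed
 define e where "e l = e' l \<one>" for l
 have "tuple_invariant V2 (Suc (Suc n)) e"
  unfolding tuple_invariant_def e_def using coset_self[OF V2(1)] by (auto intro!: joint_invariantD[OF e'_inv])
 moreover have "f xs \<doteq> e (tl xs) - ibar e xs" if xs: "xs \<in> tuples G (Suc (Suc (Suc n)))" for xs
 proof -
  obtain x l where l: "xs = x # l" "x \<in> carrier G" "l \<in> tuples G (Suc (Suc n))" using xs by (rule tuples_SucE)
  have "f xs \<doteq> dcob g0 xs \<one>" using meq_sym[OF D0[OF xs]] by simp
  also have "dcob g0 xs \<one> = dcob g0 xs \<one> - dcob (dcob g0') xs \<one>" using dcob_dcob[OF xs, of \<one>] by simp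
  also have "... = dcob e' xs \<one>" using dcob_diff[OF xs, of g0 "dcob g0'" \<one>] by (simp add: e'_def[abs_def])
  also have "... = e' l x - ibar e xs" using l by (simp add: dcob_def e_def[abs_def])
  also have "... \<doteq> e l - ibar e xs" unfolding e_def using l by (intro meq_diff meq_refl e'_const)
  finally show ?thesis using l by simp
 qed
 ultimately show ?thesis using V2(1) by blast
qed

end

section \<open>Cochains with values in a torsion module\<close>

lemma (in comm_group) finite_generate_torsion:
 assumes "finite Y" "Y \<subseteq> carrier G" "!!y. y \<in> Y ==> \<exists>n>0. y [^] (n::nat) = \<one>"
 shows "finite (generate G Y)"
 using assms
proof (induction Y rule: finite_induct)
 case empty
 have "generate G {} = {\<one>}" using generate_empty by simp
 thus ?case by simp
next
 case (insert y Y)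
 have yc: "y \<in> carrier G" and Yc: "Y \<subseteq> carrier G" using insert.prems by auto
 obtain n where n: "n > 0" "y [^] (n::nat) = \<one>" using insert.prems(2)[of y] by auto
 define H where "H = generate G Y"
 have H: "subgroup H G" unfolding H_def by (rule generate_is_subgroup[OF Yc])
 have Hc: "a \<in> carrier G" if "a \<in> H" for a using subgroup.mem_carrier[OF H that] .
 \<comment> \<open>Adding a generator \<open>y\<close> of finite order keeps the group finite:
   exponents of \<open>y\<close> are reduced modulo \<open>n\<close>, and \<open>S\<close> is a
   subgroup.\<close>
 define S where "S = (%(a, k). a \<otimes> y [^] (k::nat)) ` (H \<times> {..<n})"
 have mod: "y [^] k = y [^] (k mod n)" for k :: nat
 proof -
  have "y [^] k = y [^] (n * (k div n) + k mod n)" by simp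
  also have "... = (y [^] n) [^] (k div n) \<otimes> y [^] (k mod n)"
   using yc by (simp only: nat_pow_mult[symmetric] nat_pow_pow)
  finally show ?thesis using n yc by simp
 qed
 have SI: "a \<otimes> y [^] k \<in> S" if "a \<in> H" for a and k :: nat
  unfolding S_def using that n(1) by (subst mod) (auto intro!: image_eqI[of _ _ "(a, k mod n)"])
 have "subgroup S G"
 proof (rule subgroupI)
  show "S \<subseteq> carrier G" unfolding S_def using Hc yc by auto
  show "S ~= {}" using SI[OF subgroup.one_closed[OF H]] by auto
  show "inv s \<in> S" if "s \<in> S" for s
  proof -
   obtain a and k :: nat where s: "s = a \<otimes> y [^] k" "a \<in> H" "k < n" using \<open>s \<in> S\<close> unfolding S_def by auto
   have "y [^] (n - k) \<otimes> y [^] k = \<one>" using s(3) n yc by (simp add: nat_pow_mult)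
   hence "inv (y [^] k) = y [^] (n - k)" using yc by (intro inv_equality) auto
   hence "inv s = inv a \<otimes> y [^] (n - k)" using s Hc yc by (simp add: inv_mult)
   thus ?thesis using SI subgroup.m_inv_closed[OF H s(2)] by simp
  qed
  show "s \<otimes> t \<in> S" if "s \<in> S" "t \<in> S" for s t
  proof -
   obtain a and k :: nat where s: "s = a \<otimes> y [^] k" "a \<in> H" using \<open>s \<in> S\<close> unfolding S_def by auto
   obtain b and l :: nat where t: "t = b \<otimes> y [^] l" "b \<in> H" using \<open>t \<in> S\<close> unfolding S_def by auto
   have "s \<otimes> t = (a \<otimes> b) \<otimes> y [^] (k + l)"
    using s t Hc yc by (simp add: m_ac flip: nat_pow_mult)
   thus ?thesis using SI subgroup.m_closed[OF H s(2) t(2)] by simp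
  qed
 qed
 moreover have "insert y Y \<subseteq> S"
 proof
  fix z assume "z \<in> insert y Y"
  then consider "z = y" | "z \<in> Y" by blast
  thus "z \<in> S"
  proof cases
   case 1
   thus ?thesis using SI[OF subgroup.one_closed[OF H], of 1] yc by simp
  next
   case 2
   hence "z \<in> H" unfolding H_def by (rule generate.incl)
   thus ?thesis using SI[of z 0] Hc by simp
  qed
 qed
 ultimately have "generate G (insert y Y) \<subseteq> S" using generate_subgroup_incl by blast
 moreover have "finite S" unfolding S_def H_def using insert by auto
 ultimately show ?case by (rule finite_subset)
qed

locale sylvester_torsion_module =
 sylvester_pro_p p G T d x + M: discrete_torsion_module G T A \<phi>
 for p :: nat and G :: "('a, 'b) monoid_scheme" (structure) and T :: "'a topology"
  and d :: nat and x :: "nat => 'a" and A :: "('m, 'c) monoid_scheme" and \<phi> :: "'a => 'm => 'm"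
begin

abbreviation multA (infixl \<open>\<cdot>\<close> 70) where "a \<cdot> b \<equiv> a \<otimes>\<^bsub>A\<^esub> b"
abbreviation oneA (\<open>\<e>\<close>) where "\<e> \<equiv> \<one>\<^bsub>A\<^esub>"
abbreviation invA where "invA a \<equiv> inv\<^bsub>A\<^esub> a"
abbreviation powA (infixr \<open>\<up>\<close> 75) where "a \<up> n \<equiv> a [^]\<^bsub>A\<^esub> n"

sublocale B: bar_complex G A
 by (simp add: bar_complex_def is_group M.A.comm_group_axioms)

lemma act_closed [simp]: "g \<in> carrier G ==> a \<in> carrier A ==> \<phi> g a \<in> carrier A"
 using M.element_image by blast

lemma act_mult: "g \<in> carrier G ==> h \<in> carrier G ==> a \<in> carrier A ==> \<phi> (g \<otimes> h) a = \<phi> g (\<phi> h a)"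
 using M.composition_rule[of a g h] by simp

lemma act_one [simp]: "a \<in> carrier A ==> \<phi> \<one> a = a"
 using M.id_eq_one by (metis restrict_apply')

lemma act_inv [simp]: "g \<in> carrier G ==> a \<in> carrier A ==> \<phi> (inv g) (\<phi> g a) = a"
 using act_mult[of "inv g" g a] by simp

lemma act_group_hom: "g \<in> carrier G ==> group_hom A A (\<phi> g)"
 using M.action_hom by (simp add: group_hom_def group_hom_axioms_def M.A.is_group)

lemma act_hom_mult [simp]: "g \<in> carrier G ==> a \<in> carrier A ==> b \<in> carrier A ==> \<phi> g (a \<cdot> b) = \<phi> g a \<cdot> \<phi> g b"
 by (rule hom_mult[OF M.action_hom])

lemma act_hom_inv: "g \<in> carrier G ==> a \<in> carrier A ==> \<phi> g (invA a) = invA (\<phi> g a)"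
 by (rule group_hom.hom_inv[OF act_group_hom])

lemma act_hom_one [simp]: "g \<in> carrier G ==> \<phi> g \<e> = \<e>"
 by (rule group_hom.hom_one[OF act_group_hom])

lemma stabilizer_open:
 assumes a: "a \<in> carrier A"
 obtains U where "U \<in> \<U>" "!!u. u \<in> U ==> \<phi> u a = a"
proof -
 have "continuous_map T (prod_topology T (discrete_topology (carrier A))) (%g. (g, a))"
  using a by (simp add: continuous_map_pairwise o_def)
 from continuous_map_compose[OF this M.continuous_action]
 have "continuous_map T (discrete_topology (carrier A)) (%g. \<phi> g a)" by (simp add: o_def)
 from openin_continuous_map_preimage[OF this, of "{a}"] a
 have "openin T {g \<in> carrier G. \<phi> g a = a}" by (simp add: topspace_eq)
 moreover have "\<one> \<in> {g \<in> carrier G. \<phi> g a = a}" using a by simp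
 ultimately obtain U where "U \<in> \<U>" "U \<subseteq> {g \<in> carrier G. \<phi> g a = a}" by (rule open_normal_subgroup_basis)
 thus thesis by (intro that[of U]) auto
qed

text \<open>Continuity in the uniform form of \<open>continuous_map_discrete_iff\<close>, with lists
  in place of extensional functions.\<close>

definition cochain :: "nat => ('a list => 'm) => bool" where
 "cochain q c \<longleftrightarrow> (\<forall>l\<in>tuples G q. c l \<in> carrier A) \<and>
   (\<exists>U\<in>\<U>. \<forall>xs\<in>tuples G q. \<forall>ys\<in>tuples G q. near U xs ys --> c ys = c xs)"

lemma cochain_closed: "cochain q c ==> l \<in> tuples G q ==> c l \<in> carrier A"
 by (simp add: cochain_def)

lemma cochainE:
 assumes "cochain q c"
 obtains U where "U \<in> \<U>" "\<forall>xs\<in>tuples G q. \<forall>ys\<in>tuples G q. near U xs ys --> c ys = c xs"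
 using assms[unfolded cochain_def, THEN conjunct2] by (rule bexE)

lemma finite_tuple_image:
 assumes U: "U \<in> \<U>" and c: "\<forall>xs\<in>tuples G q. \<forall>ys\<in>tuples G q. near U xs ys --> c ys = c xs"
 shows "finite (c ` tuples G q)"
 using c
proof (induction q arbitrary: c)
 case 0
 have "tuples G 0 = {[]}" by auto
 thus ?case by simp
next
 case (Suc q)
 have "c ` tuples G (Suc q) \<subseteq> (\<Union>D\<in>rcosets U. (%l. c (rep D # l)) ` tuples G q)"
 proof
  fix a assume "a \<in> c ` tuples G (Suc q)"
  then obtain xs where xs: "xs \<in> tuples G (Suc q)" "a = c xs" by blast
  obtain x l where l: "xs = x # l" "x \<in> carrier G" "l \<in> tuples G q" using xs(1) by (rule tuples_SucE)
  define D where "D = U #> x"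
  have D: "D \<in> rcosets U" unfolding D_def by (rule coset_in_rcosets[OF U l(2)])
  have "near U xs (rep D # l)"
   using l near_self[OF U l(3)] rep_coset(1)[OF U D] by (simp add: D_def)
  hence "c (rep D # l) = c xs" using Suc.prems xs(1) rep_coset(2)[OF U D] l by simp
  thus "a \<in> (\<Union>D\<in>rcosets U. (%l. c (rep D # l)) ` tuples G q)" using D l(3) xs(2) by force
 qed
 moreover have "finite (\<Union>D\<in>rcosets U. (%l. c (rep D # l)) ` tuples G q)"
 proof (intro finite_UN_I ons_finite_index[OF U] Suc.IH ballI impI)
  fix D xs ys assume D: "D \<in> rcosets U" and xs: "xs \<in> tuples G q" "ys \<in> tuples G q" "near U xs ys"
  show "c (rep D # ys) = c (rep D # xs)"
   using Suc.prems D xs rep_coset(2)[OF U D] coset_self[OF U rep_coset(2)[OF U D]] by simp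
 qed
 ultimately show ?case by (rule finite_subset)
qed

definition submodule :: "'m set => bool" where
 "submodule N \<longleftrightarrow> subgroup N A \<and> (\<forall>g\<in>carrier G. \<forall>a\<in>N. \<phi> g a \<in> N)"

lemma finite_trivial_level:
 assumes "finite N" "N \<subseteq> carrier A"
 obtains U where "U \<in> \<U>" "!!u a. u \<in> U ==> a \<in> N ==> \<phi> u a = a"
proof -
 have "\<exists>U. U \<in> \<U> \<and> (\<forall>u\<in>U. \<phi> u a = a)" if a: "a \<in> N" for a
 proof -
  have "a \<in> carrier A" using a assms(2) by auto
  then obtain U where "U \<in> \<U>" "!!u. u \<in> U ==> \<phi> u a = a" using stabilizer_open by metis
  thus ?thesis by auto
 qed
 then obtain U where U: "!!a. a \<in> N ==> U a \<in> \<U> \<and> (\<forall>u\<in>U a. \<phi> u a = a)" by metis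
 have U1: "U a \<in> \<U>" if "a \<in> N" for a using U[OF that] by simp
 obtain V where V: "V \<in> \<U>" "!!a. a \<in> N ==> V \<subseteq> U a" using ons_INT[OF assms(1), of U] U1 by blast
 show thesis
 proof (rule that[OF V(1)])
  fix u a assume "u \<in> V" "a \<in> N"
  thus "\<phi> u a = a" using U[of a] V(2)[of a] by auto
 qed
qed

lemma finite_orbit:
 assumes a: "a \<in> carrier A" shows "finite ((%g. \<phi> g a) ` carrier G)"
proof -
 obtain U where U: "U \<in> \<U>" "!!u. u \<in> U ==> \<phi> u a = a" using stabilizer_open[OF a] by metis
 have "(%g. \<phi> g a) ` carrier G \<subseteq> (%D. \<phi> (rep D) a) ` (rcosets U)"
 proof (rule image_subsetI)
  fix g assume g: "g \<in> carrier G"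
  define D where "D = U #> g"
  have D: "D \<in> rcosets U" unfolding D_def by (rule coset_in_rcosets[OF U(1) g])
  obtain u where u: "u \<in> U" "rep D = u \<otimes> g"
   using rep_coset(1)[OF U(1) D] unfolding D_def by (auto simp: r_coset_def)
  have uG: "u \<in> carrier G" using ons_carrier[OF U(1) u(1)] .
  have "rep D = g \<otimes> (inv g \<otimes> u \<otimes> g)" using u g uG by (simp add: m_assoc[symmetric])
  hence "\<phi> (rep D) a = \<phi> g (\<phi> (inv g \<otimes> u \<otimes> g) a)" using g uG a by (simp add: act_mult)
  also have "... = \<phi> g a" using U(2)[OF ons_conj(2)[OF U(1) u(1) g]] by simp
  finally show "\<phi> g a \<in> (%D. \<phi> (rep D) a) ` (rcosets U)" using D by (intro image_eqI[of _ _ D]) simp_all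
 qed
 thus ?thesis using ons_finite_index[OF U(1)] by (meson finite_imageI finite_subset)
qed

text \<open>A cochain takes finitely many values, each value has a finite orbit, and finitely many
  torsion elements generate a finite group. This reduces torsion modules to finite ones.\<close>

lemma finite_submodule:
 assumes c: "cochain q c"
 obtains N where "finite N" "submodule N" "!!l. l \<in> tuples G q ==> c l \<in> N"
proof -
 obtain U where U: "U \<in> \<U>" "\<forall>xs\<in>tuples G q. \<forall>ys\<in>tuples G q. near U xs ys --> c ys = c xs"
  using c by (rule cochainE)
 define Y where "Y = (\<Union>a\<in>c ` tuples G q. (%g. \<phi> g a) ` carrier G)"
 have img: "c ` tuples G q \<subseteq> carrier A" using cochain_closed[OF c] by auto
 have finY: "finite Y" unfolding Y_def
  using finite_tuple_image[OF U] finite_orbit img by (intro finite_UN_I) auto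
 have Yc: "Y \<subseteq> carrier A" unfolding Y_def using img by auto
 have YG: "\<phi> g ` Y \<subseteq> Y" if g: "g \<in> carrier G" for g
 proof (rule image_subsetI)
  fix y assume "y \<in> Y"
  then obtain a h where ah: "a \<in> c ` tuples G q" "h \<in> carrier G" "y = \<phi> h a" unfolding Y_def by auto
  hence "\<phi> g y = \<phi> (g \<otimes> h) a" using act_mult[OF g ah(2), of a] img by auto
  thus "\<phi> g y \<in> Y" unfolding Y_def using ah g by auto
 qed
 define N where "N = generate A Y"
 have "finite N" unfolding N_def
  by (rule M.A.finite_generate_torsion[OF finY Yc]) (use M.torsion Yc in auto)
 moreover have "submodule N"
  unfolding submodule_def N_def
 proof (intro conjI ballI)
  show "subgroup (generate A Y) A" by (rule M.A.generate_is_subgroup[OF Yc])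
  fix g a assume g: "g \<in> carrier G" and a: "a \<in> generate A Y"
  have "\<phi> g ` generate A Y = generate A (\<phi> g ` Y)" by (rule group_hom.generate_img[OF act_group_hom[OF g] Yc, symmetric])
  also have "... \<subseteq> generate A Y" by (rule M.A.mono_generate[OF YG[OF g]])
  finally show "\<phi> g a \<in> generate A Y" using a by auto
 qed
 moreover have "c l \<in> N" if l: "l \<in> tuples G q" for l
 proof -
  have "c l \<in> carrier A" by (rule cochain_closed[OF c l])
  hence "c l \<in> Y" unfolding Y_def using l by (auto intro!: bexI[of _ l] image_eqI[of _ _ "\<one>"])
  thus ?thesis unfolding N_def by (rule generate.incl)
 qed
 ultimately show thesis by (rule that)
qed

definition cob :: "('a list => 'm) => 'a list => 'm" where
 "cob c l = \<phi> (hd l) (c (tl l)) \<cdot> invA (bar G A c l)"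

lemma cob_closed:
 assumes "!!l. l \<in> tuples G q ==> c l \<in> carrier A" "l \<in> tuples G (Suc q)"
 shows "cob c l \<in> carrier A"
 using assms B.bar_closed[OF assms(2,1)] unfolding cob_def by (auto elim!: tuples_SucE)

lemma submodule_carrier: "submodule N ==> a \<in> N ==> a \<in> carrier A"
 unfolding submodule_def using subgroup.mem_carrier by metis

lemma bar_submodule:
 assumes N: "submodule N" and c: "!!l. l \<in> tuples G q ==> c l \<in> N" and l: "l \<in> tuples G (Suc q)"
 shows "bar G A c l \<in> N"
proof -
 have s: "subgroup N A" using N by (simp add: submodule_def)
 have "(\<forall>l \<in> tuples G q. c l \<in> N) --> bar G A c l \<in> N"
  using l
 proof (induction q c l rule: B.bar_induct)
  case (Cons n e y x xs)
  thus ?case using subgroup.m_closed[OF s] subgroup.m_inv_closed[OF s] by simp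
 qed simp
 thus ?thesis using c by blast
qed

lemma cob_submodule:
 assumes N: "submodule N" and c: "!!l. l \<in> tuples G q ==> c l \<in> N" and l: "l \<in> tuples G (Suc q)"
 shows "cob c l \<in> N"
proof -
 obtain x t where t: "l = x # t" "x \<in> carrier G" "t \<in> tuples G q" using l by (rule tuples_SucE)
 have s: "subgroup N A" and i: "\<phi> x (c t) \<in> N" using N c t by (auto simp: submodule_def)
 show ?thesis
  unfolding cob_def
  using subgroup.m_closed[OF s] subgroup.m_inv_closed[OF s] bar_submodule[OF N c l] i t by simp
qed

lemma cob_cong:
 assumes "l \<in> tuples G (Suc q)" "!!l. l \<in> tuples G q ==> c l = c' l"
 shows "cob c l = cob c' l"
 using assms B.bar_cong[OF assms] unfolding cob_def by (auto elim!: tuples_SucE)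

lemma cob_mult:
 assumes l: "l \<in> tuples G (Suc q)" and c: "!!l. l \<in> tuples G q ==> c l \<in> carrier A"
  and c': "!!l. l \<in> tuples G q ==> c' l \<in> carrier A"
 shows "cob (%l. c l \<cdot> c' l) l = cob c l \<cdot> cob c' l"
proof -
 obtain x t where t: "l = x # t" "x \<in> carrier G" "t \<in> tuples G q" using l by (rule tuples_SucE)
 have b: "bar G A c l \<in> carrier A" "bar G A c' l \<in> carrier A"
  using B.bar_closed[OF l, of c] B.bar_closed[OF l, of c'] c c' by auto
 have bm: "bar G A (%l. c l \<cdot> c' l) l = bar G A c l \<cdot> bar G A c' l"
  by (rule B.bar_mult[OF l]) (use c c' in auto)
 have hd: "hd l = x" "tl l = t" using t by simp_all
 show ?thesis
  unfolding cob_def bm hd using b t(2) c[OF t(3)] c'[OF t(3)] by (simp add: M.A.inv_mult M.A.m_ac)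
qed

lemma cob_one: "l \<in> tuples G (Suc q) ==> cob (%_. \<e>) l = \<e>"
 unfolding cob_def by (auto simp: B.bar_one elim!: tuples_SucE)

lemma cob_inv:
 assumes l: "l \<in> tuples G (Suc q)" and c: "!!l. l \<in> tuples G q ==> c l \<in> carrier A"
 shows "cob (%l. invA (c l)) l = invA (cob c l)"
proof -
 have "cob (%l. invA (c l)) l \<cdot> cob c l = cob (%l. invA (c l) \<cdot> c l) l"
  by (rule cob_mult[OF l, symmetric]) (use c in auto)
 also have "... = cob (%_. \<e>) l" by (rule cob_cong[OF l]) (use c in auto)
 also have "... = \<e>" by (rule cob_one[OF l])
 finally show ?thesis
  using cob_closed[OF _ l, of c] cob_closed[OF _ l, of "%l. invA (c l)"] c
  by (intro M.A.inv_equality[symmetric]) auto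
qed

text \<open>Since \<open>bar (bar c)\<close> vanishes and \<open>bar\<close> commutes with the
  homomorphism \<open>\<phi> y\<close>, the \<open>bar\<close> of \<open>cob c\<close> reduces to
  \<open>\<phi> y\<close> applied to \<open>cob c\<close> at the tail, which is the leading term of
  the outer \<open>cob\<close>.\<close>

lemma cob_cob:
 assumes c: "!!l. l \<in> tuples G q ==> c l \<in> carrier A" and l: "l \<in> tuples G (Suc (Suc q))"
 shows "cob (cob c) l = \<e>"
proof -
 obtain y x t where t: "l = y # x # t" "y \<in> carrier G" "x \<in> carrier G" "t \<in> tuples G q"
  using l by (auto elim!: tuples_SucE)
 have xt: "x # t \<in> tuples G (Suc q)" using t by simp
 let ?h = "%m. \<phi> (hd m) (c (tl m))"
 have hc: "?h m \<in> carrier A" if "m \<in> tuples G (Suc q)" for m using that c by (auto elim!: tuples_SucE)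
 have bc: "bar G A c m \<in> carrier A" if "m \<in> tuples G (Suc q)" for m by (rule B.bar_closed[OF that c])
 have "bar G A (cob c) l = bar G A ?h l \<cdot> bar G A (%m. invA (bar G A c m)) l"
  unfolding cob_def by (rule B.bar_mult[OF l]) (use hc bc in auto)
 also have "bar G A (%m. invA (bar G A c m)) l = invA (bar G A (bar G A c) l)"
  by (rule B.bar_inv[OF l bc])
 also have "bar G A (bar G A c) l = \<e>" by (rule B.bar_bar[OF l c])
 also have "bar G A ?h l = \<phi> (y \<otimes> x) (c t) \<cdot> invA (bar G A (%m. \<phi> y (c m)) (x # t))"
  unfolding t(1) by simp
 also have "bar G A (%m. \<phi> y (c m)) (x # t) = \<phi> y (bar G A c (x # t))"
  by (rule B.bar_hom[OF xt c M.action_hom[OF t(2)]])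
 finally have b: "bar G A (cob c) l = \<phi> (y \<otimes> x) (c t) \<cdot> invA (\<phi> y (bar G A c (x # t)))"
  using t c bc[OF xt] by simp
 have "\<phi> y (cob c (x # t)) = bar G A (cob c) l"
  unfolding b using t c[OF t(4)] bc[OF xt] by (simp add: cob_def act_mult act_hom_inv)
 moreover have "bar G A (cob c) l \<in> carrier A" by (rule B.bar_closed[OF l cob_closed[OF c]])
 ultimately show ?thesis unfolding cob_def[of "cob c"] using t(1) by simp
qed

lemma cochain_mult:
 assumes c: "cochain q c" and c': "cochain q c'"
 shows "cochain q (%l. c l \<cdot> c' l)"
proof -
 obtain U where U: "U \<in> \<U>" "\<forall>xs\<in>tuples G q. \<forall>ys\<in>tuples G q. near U xs ys --> c ys = c xs"
  using c by (rule cochainE)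
 obtain V where V: "V \<in> \<U>" "\<forall>xs\<in>tuples G q. \<forall>ys\<in>tuples G q. near V xs ys --> c' ys = c' xs"
  using c' by (rule cochainE)
 have "c ys \<cdot> c' ys = c xs \<cdot> c' xs"
  if "xs \<in> tuples G q" "ys \<in> tuples G q" "near (U \<inter> V) xs ys" for xs ys
  using U(2) V(2) that near_mono[OF that(3), of U] near_mono[OF that(3), of V] by simp
 thus ?thesis
  unfolding cochain_def using cochain_closed[OF c] cochain_closed[OF c'] ons_Int[OF U(1) V(1)] by auto
qed

lemma cochain_comp:
 assumes c: "cochain q c" and h: "!!a. a \<in> carrier A ==> h a \<in> carrier A"
 shows "cochain q (%l. h (c l))"
proof -
 obtain U where U: "U \<in> \<U>" "\<forall>xs\<in>tuples G q. \<forall>ys\<in>tuples G q. near U xs ys --> c ys = c xs"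
  using c by (rule cochainE)
 have "\<forall>xs\<in>tuples G q. \<forall>ys\<in>tuples G q. near U xs ys --> h (c ys) = h (c xs)"
  using U(2) by simp
 thus ?thesis unfolding cochain_def using U(1) h cochain_closed[OF c] by auto
qed

lemma cochain_one: "cochain q (%_. \<e>)"
 unfolding cochain_def using carrier_in_ons by auto

lemma cochain_finprod:
 assumes "finite I" "!!i. i \<in> I ==> cochain q (c i)"
 shows "cochain q (%l. finprod A (%i. c i l) I)"
 using assms
proof (induction I rule: finite_induct)
 case empty
 thus ?case using cochain_one by simp
next
 case (insert i I)
 have "cochain q (%l. c i l \<cdot> finprod A (%i. c i l) I)" using insert by (intro cochain_mult) auto
 moreover have "finprod A (%i. c i l) (insert i I) = c i l \<cdot> finprod A (%i. c i l) I" if "l \<in> tuples G q" for l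
  using insert that cochain_closed by (intro M.A.finprod_insert) auto
 ultimately show ?case unfolding cochain_def by simp
qed

lemma bar_near:
 assumes U: "U \<in> \<U>"
  and c: "\<forall>xs\<in>tuples G q. \<forall>ys\<in>tuples G q. near U xs ys --> c ys = c xs"
  and xs: "xs \<in> tuples G (Suc q)" "ys \<in> tuples G (Suc q)" "near U xs ys"
 shows "bar G A c ys = bar G A c xs"
 using c xs
proof (induction q arbitrary: c xs ys)
 case 0
 thus ?case by (auto elim!: tuples_SucE)
next
 case (Suc q)
 obtain y x l y' x' l' where l: "xs = y # x # l" "y \<in> carrier G" "x \<in> carrier G" "l \<in> tuples G q"
  and l': "ys = y' # x' # l'" "y' \<in> carrier G" "x' \<in> carrier G" "l' \<in> tuples G q"
  using Suc.prems(2,3) by (auto elim!: tuples_SucE)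
 have n: "y' \<in> U #> y" "x' \<in> U #> x" "near U l l'" using Suc.prems(4) l l' by auto
 have cD: "c m' = c m" if "m \<in> tuples G (Suc q)" "m' \<in> tuples G (Suc q)" "near U m m'" for m m'
  using Suc.prems(1) that by blast
 have "c ((y' \<otimes> x') # l') = c ((y \<otimes> x) # l)"
  using l l' n coset_mult_mem[OF U] by (intro cD) auto
 moreover have "bar G A (%l. c (y' # l)) (x' # l') = bar G A (%l. c (y # l)) (x' # l')"
  using l l' n near_self[OF U] by (intro B.bar_cong[of _ q] cD) auto
 moreover have "bar G A (%l. c (y # l)) (x' # l') = bar G A (%l. c (y # l)) (x # l)"
  using l l' n coset_self[OF U l(2)] by (intro Suc.IH ballI impI cD) auto
 ultimately show ?case using l l' by simp
qed

text \<open>The term with the action is the one whose continuity is not formal. All values of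
  \<open>c\<close> lie in a finite submodule, on which some open normal subgroup \<open>V\<close>
  acts trivially, so this term depends on the first entry only through its coset of
  \<open>V\<close>.\<close>

lemma cochain_cob:
 assumes c: "cochain q c" shows "cochain (Suc q) (cob c)"
proof -
 obtain N where N: "finite N" "submodule N" "!!l. l \<in> tuples G q ==> c l \<in> N" using finite_submodule[OF c] by metis
 have Nc: "N \<subseteq> carrier A" using submodule_carrier[OF N(2)] by auto
 obtain V where V: "V \<in> \<U>" "!!u a. u \<in> V ==> a \<in> N ==> \<phi> u a = a" using finite_trivial_level[OF N(1) Nc] by metis
 obtain U where U: "U \<in> \<U>" "\<forall>xs\<in>tuples G q. \<forall>ys\<in>tuples G q. near U xs ys --> c ys = c xs"
  using c by (rule cochainE)
 have W: "U \<inter> V \<in> \<U>" by (rule ons_Int[OF U(1) V(1)])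
 have "cob c ys = cob c xs" if xs: "xs \<in> tuples G (Suc q)" "ys \<in> tuples G (Suc q)" "near (U \<inter> V) xs ys" for xs ys
 proof -
  obtain x l where l: "xs = x # l" "x \<in> carrier G" "l \<in> tuples G q" using xs(1) by (rule tuples_SucE)
  obtain x' l' where l': "ys = x' # l'" "x' \<in> carrier G" "l' \<in> tuples G q" using xs(2) by (rule tuples_SucE)
  have n: "x' \<in> (U \<inter> V) #> x" "near U l l'" using xs(3) l l' near_mono[of "U \<inter> V" l l' U] by auto
  obtain u where u: "u \<in> V" "x' = u \<otimes> x" using n(1) by (auto simp: r_coset_def)
  have uG: "u \<in> carrier G" by (rule ons_carrier[OF V(1) u(1)])
  have cN: "c l \<in> N" "\<phi> x (c l) \<in> N" using N l by (auto simp: submodule_def)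
  have "c l' = c l" using U(2) l l' n(2) by simp
  hence "\<phi> x' (c l') = \<phi> u (\<phi> x (c l))" using u uG l cN Nc by (auto simp: act_mult)
  also have "... = \<phi> x (c l)" by (rule V(2)[OF u(1) cN(2)])
  finally have "\<phi> x' (c l') = \<phi> x (c l)" .
  moreover have "bar G A c ys = bar G A c xs"
   by (rule bar_near[OF U(1,2) xs(1,2) near_mono[OF xs(3)]]) simp
  ultimately show ?thesis by (simp add: cob_def l(1) l'(1))
 qed
 thus ?thesis
  unfolding cochain_def by (intro conjI ballI bexI[OF _ W] impI cob_closed[OF cochain_closed[OF c]])
qed

end

section \<open>Vanishing of the cohomology of torsion modules\<close>

context sylvester_torsion_module
begin

abbreviation cocycle :: "nat => ('a list => 'm) => bool" where
 "cocycle q c \<equiv> cochain q c \<and> (\<forall>l\<in>tuples G (Suc q). cob c l = \<e>)"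

abbreviation bounds :: "nat => ('a list => 'm) => bool" where
 "bounds q c \<equiv> \<exists>e. cochain q e \<and> (\<forall>l\<in>tuples G (Suc q). c l = cob e l)"

lemma cob_int_pow:
 assumes l: "l \<in> tuples G (Suc q)" and c: "!!l. l \<in> tuples G q ==> c l \<in> carrier A"
 shows "cob (%l. c l \<up> (z::int)) l = cob c l \<up> z"
proof -
 have h: "(%a. a \<up> z) \<in> hom A A"
  by (rule homI) (auto simp: M.A.int_pow_mult_distrib M.A.m_comm)
 have b: "bar G A (%l. c l \<up> z) l = bar G A c l \<up> z"
  by (rule B.bar_hom[OF l c h])
 have bc: "bar G A c l \<in> carrier A" by (rule B.bar_closed[OF l c])
 obtain x t where t: "l = x # t" "x \<in> carrier G" "t \<in> tuples G q" using l by (rule tuples_SucE)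
 have ht: "hd l = x" "tl l = t" using t by simp_all
 show ?thesis
  unfolding cob_def b ht using c[OF t(3)] t(2) bc group_hom.hom_int_pow[OF act_group_hom[OF t(2)]]
  by (simp add: M.A.int_pow_mult_distrib M.A.m_comm M.A.int_pow_inv)
qed

lemma bounds_int_pow:
 assumes "bounds q c" shows "bounds q (%l. c l \<up> (z::int))"
proof -
 obtain e where e: "cochain q e" "!!l. l \<in> tuples G (Suc q) ==> c l = cob e l" using assms by auto
 have "cochain q (%l. e l \<up> z)" by (rule cochain_comp[OF e(1)]) simp
 moreover have "c l \<up> z = cob (%l. e l \<up> z) l" if "l \<in> tuples G (Suc q)" for l
  using cob_int_pow[OF that cochain_closed[OF e(1)]] e(2)[OF that] by simp
 ultimately show ?thesis by auto
qed

lemma bounds_mult: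
 assumes "bounds q c" "bounds q c'" shows "bounds q (%l. c l \<cdot> c' l)"
proof -
 obtain e where e: "cochain q e" "!!l. l \<in> tuples G (Suc q) ==> c l = cob e l" using assms(1) by auto
 obtain e' where e': "cochain q e'" "!!l. l \<in> tuples G (Suc q) ==> c' l = cob e' l" using assms(2) by auto
 have "c l \<cdot> c' l = cob (%l. e l \<cdot> e' l) l" if "l \<in> tuples G (Suc q)" for l
  using cob_mult[OF that cochain_closed[OF e(1)] cochain_closed[OF e'(1)]] e(2)[OF that] e'(2)[OF that] by simp
 thus ?thesis using cochain_mult[OF e(1) e'(1)] by auto
qed

lemma bounds_cong:
 "bounds q c ==> (!!l. l \<in> tuples G (Suc q) ==> c' l = c l) ==> bounds q c'"
 by auto

lemma cocycle_comp:
 assumes c: "cocycle q c" and z: "c' = (%l. c l \<up> (z::int))"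
 shows "cocycle q c'"
proof -
 have "cochain q c'" unfolding z by (rule cochain_comp) (use c in auto)
 moreover have "cob c' l = \<e>" if "l \<in> tuples G (Suc q)" for l
  unfolding z using cob_int_pow[OF that cochain_closed[OF conjunct1[OF c]], where z = z] c that by simp
 ultimately show ?thesis by simp
qed

text \<open>Induction on the order of the module: a maximal submodule has a quotient of order \<open>p\<close> with trivial action,
 and the image of the cocycle in this quotient is a coboundary.\<close>

lemma p_primary_cocycle_bounds:
 assumes "finite N" "submodule N" "!!a. a \<in> N ==> \<exists>j. a \<up> (p ^ j :: nat) = \<e>"
  and "cocycle (Suc (Suc (Suc n))) c" "!!l. l \<in> tuples G (Suc (Suc (Suc n))) ==> c l \<in> N"
 shows "bounds (Suc (Suc n)) c"
 using assms
proof (induction "card N" arbitrary: N c rule: less_induct)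
 case less
 let ?n2 = "Suc (Suc n)" and ?n3 = "Suc (Suc (Suc n))"
 have sN: "subgroup N A" using less.prems(2) by (simp add: submodule_def)
 have NA: "a \<in> carrier A" if "a \<in> N" for a by (rule subgroup.mem_carrier[OF sN that])
 have oneN: "\<e> \<in> N" by (rule subgroup.one_closed[OF sN])
 have actN: "\<phi> g a \<in> N" if "g \<in> carrier G" "a \<in> N" for g a using less.prems(2) that by (simp add: submodule_def)
 have cN: "c l \<in> N" if "l \<in> tuples G ?n3" for l by (rule less.prems(5)[OF that])
 show ?case
 proof (cases "N = {\<e>}")
  case True
  have "c l = cob (%_. \<e>) l" if "l \<in> tuples G ?n3" for l
   using cob_one[OF that] cN[OF that] True by simp
  thus ?thesis using cochain_one by blast
 next
  case False
  \<comment> \<open>A maximal member \<open>L\<close> is a maximal invariant subgroup in the sense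
    of \<open>p_action_mod_maximal\<close>: commutativity gives \<open>fixed_central\<close>, and an
    open normal \<open>V\<close> that fixes \<open>N\<close> pointwise plays the part of
    \<open>U\<close>.\<close>
  define F where "F = {L. submodule L \<and> L \<subset> N}"
  have "finite F" by (rule finite_subset[of _ "Pow N"]) (use less.prems(1) in \<open>auto simp: F_def\<close>)
  moreover have "{\<e>} \<in> F"
   using False oneN M.A.triv_subgroup by (auto simp: F_def submodule_def)
  ultimately obtain L where L: "L \<in> F" "!!L'. L' \<in> F ==> L \<subseteq> L' ==> L = L'"
   using finite_has_maximal[of F] by blast
  have LN: "L \<subset> N" and subL: "submodule L" using L(1) by (simp_all add: F_def)
  have sL: "subgroup L A" using subL by (simp add: submodule_def)
  have LNs: "L \<subseteq> N" using LN by blast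
  define M where "M = A\<lparr>carrier := N\<rparr>"
  have Mc: "carrier M = N" and Mm: "mult M = mult A" and Mo: "\<one>\<^bsub>M\<^esub> = \<e>" by (simp_all add: M_def)
  have gM: "comm_group M" unfolding M_def
   by (rule group.group_comm_groupI[OF M.A.subgroup_imp_group[OF sN]]) (use NA in \<open>simp add: M.A.m_comm\<close>)
  interpret MG: comm_group M by (rule gM)
  have Mp: "a [^]\<^bsub>M\<^esub> (k::nat) = a \<up> k" for a k unfolding M_def by (rule M.A.nat_pow_consistent[symmetric])
  have sub_iff: "L' \<lhd> M \<longleftrightarrow> subgroup L' A \<and> L' \<subseteq> N" for L'
  proof
   assume "L' \<lhd> M"
   hence s: "subgroup L' M" by (rule normal_imp_subgroup)
   thus "subgroup L' A \<and> L' \<subseteq> N"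
    using M.A.incl_subgroup[OF sN] subgroup.subset[OF s] Mc by (simp add: M_def)
  next
   assume "subgroup L' A \<and> L' \<subseteq> N"
   hence "subgroup L' M" unfolding M_def using M.A.subgroup_incl[OF _ sN] by blast
   thus "L' \<lhd> M" by (rule MG.subgroup_imp_normal)
  qed
  obtain V where V: "V \<in> \<U>" "!!u a. u \<in> V ==> a \<in> N ==> \<phi> u a = a"
   using finite_trivial_level[OF less.prems(1)] NA by blast
  obtain k where k: "card (rcosets V) = p ^ k" using ons_index[OF V(1)] .
  interpret P: p_action_mod_maximal p M L G V k \<phi>
  proof (rule p_action_mod_maximal.intro)
   show pam: "p_action_mod p M L G V k \<phi>"
   proof (rule p_action_mod.intro)
    show "prime p" by (rule prime_p)
    show "L \<lhd> M" using sub_iff sL LNs by simp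
    have "rcosets\<^bsub>M\<^esub> L \<subseteq> Pow N" using LNs subgroup.m_closed[OF sN] Mc Mm by (auto simp: RCOSETS_def r_coset_def)
    thus "finite (rcosets\<^bsub>M\<^esub> L)" using less.prems(1) by (simp add: finite_subset)
    show "L ~= carrier M" using LN Mc by simp
    show "\<exists>j. m [^]\<^bsub>M\<^esub> (p ^ j :: nat) \<in> L" if m: "m \<in> carrier M" for m
    proof -
     obtain j where "m \<up> (p ^ j :: nat) = \<e>" using less.prems(3) m Mc by blast
     hence "m [^]\<^bsub>M\<^esub> (p ^ j :: nat) \<in> L" using Mp subgroup.one_closed[OF sL] by simp
     thus ?thesis by (rule exI)
    qed
    show "V \<lhd> G" by (rule ons_normal[OF V(1)])
    show "card (rcosets V) = p ^ k" by (rule k)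
    show "\<phi> g \<in> hom M M" if g: "g \<in> carrier G" for g
     by (rule homI) (use actN[OF g] act_hom_mult[OF g] NA Mc Mm in auto)
    show "\<phi> (g \<otimes> h) m = \<phi> g (\<phi> h m)" if "g \<in> carrier G" "h \<in> carrier G" "m \<in> carrier M" for g h m
     using act_mult that NA Mc by simp
    show "\<phi> g l \<in> L" if "g \<in> carrier G" "l \<in> L" for g l using subL that by (simp add: submodule_def)
    show "\<phi> u m \<otimes>\<^bsub>M\<^esub> inv\<^bsub>M\<^esub> m \<in> L" if u: "u \<in> V" and m: "m \<in> carrier M" for u m
     using V(2)[OF u] m Mc MG.r_inv[OF m] Mo subgroup.one_closed[OF sL] by simp
   qed
   interpret P: p_action_mod p M L G V k \<phi> by (rule pam)
   show "p_action_mod_maximal_axioms M L G \<phi>"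
   proof (rule p_action_mod_maximal_axioms.intro)
    fix m y assume "P.fixed m" and y: "y \<in> carrier M"
    hence m: "m \<in> carrier M" by (simp add: P.fixed_iff)
    have "y \<otimes>\<^bsub>M\<^esub> m \<otimes>\<^bsub>M\<^esub> inv\<^bsub>M\<^esub> y \<otimes>\<^bsub>M\<^esub> inv\<^bsub>M\<^esub> m = \<one>\<^bsub>M\<^esub>"
     using m y by (simp add: MG.m_comm[OF y m] MG.m_assoc)
    thus "y \<otimes>\<^bsub>M\<^esub> m \<otimes>\<^bsub>M\<^esub> inv\<^bsub>M\<^esub> y \<otimes>\<^bsub>M\<^esub> inv\<^bsub>M\<^esub> m \<in> L"
     using Mo subgroup.one_closed[OF sL] by simp
   next
    fix L' assume L': "L' \<lhd> M" "L \<subseteq> L'" "L' ~= L" "!!g l. g \<in> carrier G ==> l \<in> L' ==> \<phi> g l \<in> L'"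
    have "submodule L'" "L' \<subseteq> N" using L'(1,4) sub_iff by (auto simp: submodule_def)
    thus "L' = carrier M" using L(2)[of L'] L'(2,3) Mc by (auto simp: F_def)
   qed
  qed
  from P.invariant_character obtain m0 and \<xi> :: "'m => int" where m0: "m0 \<in> N"
   and add: "!!a b. a \<in> N ==> b \<in> N ==> \<xi> (a \<cdot> b) \<doteq> \<xi> a + \<xi> b"
   and ker: "!!a. a \<in> N ==> a \<in> L \<longleftrightarrow> \<xi> a \<doteq> 0" and m01: "\<xi> m0 \<doteq> 1"
   and inv: "!!g a. g \<in> carrier G ==> a \<in> N ==> \<xi> (\<phi> g a) \<doteq> \<xi> a"
   unfolding Mc Mm mod_eq_def by blast
  have \<xi>1: "\<xi> \<e> \<doteq> 0" using ker[OF oneN] subgroup.one_closed[OF sL] by simp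
  have \<xi>inv: "\<xi> (invA a) \<doteq> - \<xi> a" if a: "a \<in> N" for a
  proof -
   have "\<xi> (a \<cdot> invA a) \<doteq> \<xi> a + \<xi> (invA a)"
    by (rule add[OF a subgroup.m_inv_closed[OF sN a]])
   hence "\<xi> a + \<xi> (invA a) \<doteq> 0"
    using meq_trans[OF meq_sym \<xi>1] M.A.r_inv[OF NA[OF a]] by simp
   thus ?thesis by (simp add: meq_iff_dvd algebra_simps)
  qed
  have \<xi>pow: "\<xi> (m0 \<up> k) \<doteq> int k \<and> m0 \<up> k \<in> N" for k :: nat
  proof (induction k)
   case 0
   thus ?case using \<xi>1 oneN by simp
  next
   case (Suc k)
   have "\<xi> (m0 \<up> k \<cdot> m0) \<doteq> \<xi> (m0 \<up> k) + \<xi> m0" using Suc m0 by (intro add) auto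
   also have "... \<doteq> int k + 1" using Suc m01 by (intro meq_add) auto
   finally show ?case using Suc m0 subgroup.m_closed[OF sN] by (simp add: add.commute)
  qed
  have \<xi>bar: "\<xi> (bar G A e l) \<doteq> ibar (%l. \<xi> (e l)) l"
   if "!!l. l \<in> tuples G q ==> e l \<in> N" and l: "l \<in> tuples G (Suc q)" for q :: nat and e l
  proof -
   have "(\<forall>l\<in>tuples G q. e l \<in> N) --> \<xi> (bar G A e l) \<doteq> ibar (%l. \<xi> (e l)) l"
    using l
   proof (induction q e l rule: B.bar_induct)
    case (Cons q e y x xs)
    show ?case
    proof
     assume e: "\<forall>l\<in>tuples G (Suc q). e l \<in> N"
     have bN: "bar G A (%l. e (y # l)) (x # xs) \<in> N"
      by (rule bar_submodule[OF less.prems(2), of q]) (use e Cons in auto)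
     have eN: "e ((y \<otimes> x) # xs) \<in> N" using e Cons by simp
     have IH: "\<xi> (bar G A (%l. e (y # l)) (x # xs)) \<doteq> ibar (%l. \<xi> (e (y # l))) (x # xs)"
      using Cons e by simp
     have "\<xi> (bar G A e (y # x # xs)) \<doteq> \<xi> (e ((y \<otimes> x) # xs)) + \<xi> (invA (bar G A (%l. e (y # l)) (x # xs)))"
      using add[OF eN subgroup.m_inv_closed[OF sN bN]] by simp
     also have "... \<doteq> \<xi> (e ((y \<otimes> x) # xs)) + - \<xi> (bar G A (%l. e (y # l)) (x # xs))"
      by (intro meq_add meq_refl \<xi>inv bN)
     also have "... = \<xi> (e ((y \<otimes> x) # xs)) - \<xi> (bar G A (%l. e (y # l)) (x # xs))" by simp
     also have "... \<doteq> ibar (%l. \<xi> (e l)) (y # x # xs)"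
      unfolding ibar_simps by (intro meq_diff meq_refl IH)
     finally show "\<xi> (bar G A e (y # x # xs)) \<doteq> ibar (%l. \<xi> (e l)) (y # x # xs)" .
    qed
   qed simp
   thus ?thesis using that(1) by blast
  qed
  \<comment> \<open>Invariance of the character removes the action from the first term, so
    \<open>cob\<close> becomes the differential for trivial coefficients modulo
    \<open>p\<close>.\<close>
  have \<xi>cob: "\<xi> (cob e l) \<doteq> \<xi> (e (tl l)) - ibar (%l. \<xi> (e l)) l"
   if e: "!!l. l \<in> tuples G q ==> e l \<in> N" and l: "l \<in> tuples G (Suc q)" for q :: nat and e l
  proof -
   have bN: "bar G A e l \<in> N" by (rule bar_submodule[OF less.prems(2) e l])
   have tl: "hd l \<in> carrier G" "tl l \<in> tuples G q" using l by (auto elim!: tuples_SucE)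
   have "\<xi> (cob e l) \<doteq> \<xi> (\<phi> (hd l) (e (tl l))) + \<xi> (invA (bar G A e l))"
    unfolding cob_def by (intro add actN e tl subgroup.m_inv_closed[OF sN bN])
   also have "... \<doteq> \<xi> (e (tl l)) + - \<xi> (bar G A e l)"
    by (intro meq_add \<xi>inv bN inv tl e)
   also have "... = \<xi> (e (tl l)) - \<xi> (bar G A e l)" by simp
   also have "... \<doteq> \<xi> (e (tl l)) - ibar (%l. \<xi> (e l)) l"
    by (intro meq_diff meq_refl \<xi>bar[OF e l])
   finally show ?thesis .
  qed
  define f where "f = (%l. \<xi> (c l))"
  obtain U where U: "U \<in> \<U>" "\<forall>xs\<in>tuples G ?n3. \<forall>ys\<in>tuples G ?n3. near U xs ys --> c ys = c xs"
   using less.prems(4) cochainE by blast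
  have "tuple_invariant U ?n3 f" unfolding tuple_invariant_def f_def using U(2) by simp
  moreover have "ibar f l \<doteq> f (tl l)" if l: "l \<in> tuples G (Suc ?n3)" for l
  proof -
   have "\<xi> (cob c l) \<doteq> f (tl l) - ibar f l" unfolding f_def by (rule \<xi>cob[OF cN l])
   moreover have "cob c l = \<e>" using less.prems(4) l by simp
   ultimately have "f (tl l) - ibar f l \<doteq> 0" using meq_trans[OF meq_sym \<xi>1] by simp
   hence "f (tl l) \<doteq> ibar f l" by (simp add: meq_iff_dvd)
   thus ?thesis by (rule meq_sym)
  qed
  ultimately obtain e V' where V': "V' \<in> \<U>" and e: "tuple_invariant V' ?n2 e"
   and fe: "!!xs. xs \<in> tuples G ?n3 ==> f xs \<doteq> e (tl xs) - ibar e xs"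
   using cocycle_mod_p_is_coboundary[OF U(1), of n f] by blast
  \<comment> \<open>A lift of \<open>e\<close> to \<open>N\<close>: a power of \<open>m0\<close> has
    its exponent as character. Reducing the exponent modulo \<open>p\<close> makes it a natural
    number that depends only on the class of \<open>e l\<close>, so that \<open>h\<close> is locally
    constant along with \<open>e\<close>.\<close>
  define h where "h = (%l. m0 \<up> nat (e l mod int p))"
  have hN: "h l \<in> N" for l using \<xi>pow by (simp add: h_def)
  have \<xi>h: "\<xi> (h l) \<doteq> e l" for l
   using \<xi>pow[of "nat (e l mod int p)"] prime_gt_0_nat[OF prime_p] by (simp add: h_def)
  have ch: "cochain ?n2 h"
  proof -
   have "h ys = h xs" if "xs \<in> tuples G ?n2" "ys \<in> tuples G ?n2" "near V' xs ys" for xs ys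
    using tuple_invariantD[OF e that] by (simp add: h_def mod_eq_def cong_def)
   thus ?thesis unfolding cochain_def using V' hN NA by blast
  qed
  \<comment> \<open>By the choice of \<open>e\<close> the corrected cocycle has character zero, so
    it takes its values in the smaller submodule \<open>L\<close>.\<close>
  define c' where "c' = (%l. c l \<cdot> invA (cob h l))"
  have hcN: "cob h l \<in> N" if "l \<in> tuples G ?n3" for l by (rule cob_submodule[OF less.prems(2) hN that])
  have c'L: "c' l \<in> L" if l: "l \<in> tuples G ?n3" for l
  proof -
   have "\<xi> (cob h l) \<doteq> \<xi> (h (tl l)) - ibar (%l. \<xi> (h l)) l" by (rule \<xi>cob[OF hN l])
   also have "... \<doteq> e (tl l) - ibar e l" by (intro meq_diff \<xi>h ibar_meq[OF l])
   also have "... \<doteq> f l" by (rule meq_sym[OF fe[OF l]])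
   finally have 1: "\<xi> (cob h l) \<doteq> f l" .
   have "\<xi> (c' l) \<doteq> \<xi> (c l) + \<xi> (invA (cob h l))"
    unfolding c'_def by (intro add cN l subgroup.m_inv_closed[OF sN hcN[OF l]])
   also have "... \<doteq> \<xi> (c l) + - \<xi> (cob h l)" by (intro meq_add meq_refl \<xi>inv hcN l)
   also have "... = \<xi> (c l) - \<xi> (cob h l)" by simp
   also have "... \<doteq> \<xi> (c l) - f l" by (intro meq_diff meq_refl 1)
   finally have "\<xi> (c' l) \<doteq> 0" by (simp add: f_def)
   moreover have "c' l \<in> N" unfolding c'_def
    by (intro subgroup.m_closed[OF sN] subgroup.m_inv_closed[OF sN] cN hcN l)
   ultimately show ?thesis using ker by simp
  qed
  have cobh: "cochain ?n3 (cob h)" by (rule cochain_cob[OF ch])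
  have coc': "cocycle ?n3 c'"
  proof
   show "cochain ?n3 c'" unfolding c'_def
    by (rule cochain_mult) (use less.prems(4) cochain_comp[OF cobh, of "m_inv A"] in auto)
   show "\<forall>l\<in>tuples G (Suc ?n3). cob c' l = \<e>"
   proof
    fix l assume l: "l \<in> tuples G (Suc ?n3)"
    have cA: "c l \<in> carrier A" if "l \<in> tuples G ?n3" for l using cN NA that by simp
    have hA: "cob h l \<in> carrier A" if "l \<in> tuples G ?n3" for l using hcN NA that by simp
    have "cob c' l = cob c l \<cdot> cob (%l. invA (cob h l)) l"
     unfolding c'_def by (rule cob_mult[OF l]) (use cA hA in auto)
    also have "cob (%l. invA (cob h l)) l = invA (cob (cob h) l)" by (rule cob_inv[OF l hA])
    also have "cob (cob h) l = \<e>" by (rule cob_cob[OF _ l]) (use hN NA in auto)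
    finally show "cob c' l = \<e>" using less.prems(4) l by simp
   qed
  qed
  have "card L < card N" by (rule psubset_card_mono[OF less.prems(1) LN])
  moreover have "\<exists>j. a \<up> (p ^ j :: nat) = \<e>" if "a \<in> L" for a
   using less.prems(3) LNs that by blast
  ultimately have "bounds ?n2 c'"
   using less.hyps[of L c'] finite_subset[OF LNs less.prems(1)] subL coc' c'L by blast
  moreover have "bounds ?n2 (cob h)" using ch by blast
  ultimately have "bounds ?n2 (%l. c' l \<cdot> cob h l)" by (rule bounds_mult)
  moreover have "c l = c' l \<cdot> cob h l" if "l \<in> tuples G ?n3" for l
   using cN[OF that] hcN[OF that] NA by (simp add: c'_def M.A.m_assoc)
  ultimately show ?thesis by (rule bounds_cong)
 qed
qed

lemma act_finprod:
 assumes "finite I" "!!i. i \<in> I ==> a i \<in> carrier A" "g \<in> carrier G"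
 shows "\<phi> g (finprod A a I) = finprod A (%i. \<phi> g (a i)) I"
 using assms
proof (induction I rule: finite_induct)
 case (insert i I)
 have "\<phi> g (finprod A a (insert i I)) = \<phi> g (a i \<cdot> finprod A a I)"
  using insert by (subst M.A.finprod_insert) auto
 also have "... = finprod A (%i. \<phi> g (a i)) (insert i I)"
  using insert by (subst M.A.finprod_insert) auto
 finally show ?case .
qed simp

lemma bar_finprod:
 assumes I: "finite I" and c: "!!i l. i \<in> I ==> l \<in> tuples G q ==> c i l \<in> carrier A"
  and l: "l \<in> tuples G (Suc q)"
 shows "bar G A (%l. finprod A (%i. c i l) I) l = finprod A (%i. bar G A (c i) l) I"
 using I c
proof (induction I rule: finite_induct)
 case empty
 thus ?case using B.bar_one[OF l] by simp
next
 case (insert i I)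
 have b: "bar G A (c j) l \<in> carrier A" if "j \<in> insert i I" for j by (rule B.bar_closed[OF l insert.prems[OF that]])
 have "bar G A (%l. finprod A (%i. c i l) (insert i I)) l = bar G A (%l. c i l \<cdot> finprod A (%i. c i l) I) l"
  by (rule B.bar_cong[OF l]) (use insert in \<open>auto intro!: M.A.finprod_insert\<close>)
 also have "... = bar G A (c i) l \<cdot> bar G A (%l. finprod A (%i. c i l) I) l"
  by (rule B.bar_mult[OF l]) (use insert in auto)
 also have "... = finprod A (%i. bar G A (c i) l) (insert i I)"
  using insert b by (subst M.A.finprod_insert) auto
 finally show ?case .
qed

lemma rcoset_translate_bij:
 assumes U: "U \<in> \<U>" and g: "g \<in> carrier G"
 shows "bij_betw (%D. D #> g) (rcosets U) (rcosets U)"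
proof (rule bij_betwI[where g = "%D. D #> inv g"])
 have Us: "U \<subseteq> carrier G" using ons_carrier[OF U] by auto
 have cl: "D #> y \<in> rcosets U" if D: "D \<in> rcosets U" and y: "y \<in> carrier G" for D y
 proof -
  have "D #> y = U #> (rep D \<otimes> y)"
   by (subst rep_coset(3)[OF U D]) (rule coset_mult_assoc[OF Us rep_coset(2)[OF U D] y])
  thus ?thesis using coset_in_rcosets[OF U, of "rep D \<otimes> y"] rep_coset(2)[OF U D] y by simp
 qed
 show "(%D. D #> g) \<in> rcosets U \<rightarrow> rcosets U" "(%D. D #> inv g) \<in> rcosets U \<rightarrow> rcosets U"
  using cl g by auto
 have sub: "D \<subseteq> carrier G" if "D \<in> rcosets U" for D
  using rcosets_part_G[OF ons_subgroup[OF U]] that by auto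
 show "D #> g #> inv g = D" "D #> inv g #> g = D" if "D \<in> rcosets U" for D
  using sub[OF that] g by (simp_all add: coset_mult_assoc)
qed

text \<open>The norm over the quotient by an open normal subgroup, as in the proof that the order of a finite group
 annihilates its cohomology.\<close>

lemma cocycle_index_power_bounds:
 assumes c: "cocycle (Suc q) c"
 shows "\<exists>K. bounds q (%l. c l \<up> (p ^ K :: nat))"
proof -
 obtain N where N: "finite N" "submodule N" "!!l. l \<in> tuples G (Suc q) ==> c l \<in> N"
  using finite_submodule c by metis
 have NA: "a \<in> carrier A" if "a \<in> N" for a by (rule submodule_carrier[OF N(2) that])
 have actN: "\<phi> g a \<in> N" if "g \<in> carrier G" "a \<in> N" for g a using N(2) that by (simp add: submodule_def)
 obtain V where V: "V \<in> \<U>" "!!u a. u \<in> V ==> a \<in> N ==> \<phi> u a = a"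
  using finite_trivial_level[OF N(1)] NA by blast
 obtain W where W: "W \<in> \<U>" "\<forall>xs\<in>tuples G (Suc q). \<forall>ys\<in>tuples G (Suc q). near W xs ys --> c ys = c xs"
  using c cochainE by blast
 define U where "U = W \<inter> V"
 have U: "U \<in> \<U>" unfolding U_def by (rule ons_Int[OF W(1) V(1)])
 obtain K where K: "card (rcosets U) = p ^ K" using ons_index[OF U] .
 have fin: "finite (rcosets U)" by (rule ons_finite_index[OF U])
 \<comment> \<open>The value at \<open>g # l\<close> transported back by \<open>g\<close>. It
   depends on \<open>g\<close> only through its coset of \<open>U\<close>, because \<open>c\<close>
   is constant on cosets of \<open>W\<close> and \<open>V\<close> acts trivially on its
   values.\<close>
 define F where "F = (%g l. \<phi> (inv g) (c (g # l)))"
 have FN: "F g l \<in> N" if "g \<in> carrier G" "l \<in> tuples G q" for g l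
  unfolding F_def using actN N(3) that by simp
 have Fc: "F g' l = F g l" if g: "g \<in> carrier G" and g': "g' \<in> U #> g" and l: "l \<in> tuples G q" for g g' l
 proof -
  obtain u where u: "u \<in> U" "g' = u \<otimes> g" using g' by (auto simp: r_coset_def)
  have uG: "u \<in> carrier G" by (rule ons_carrier[OF U u(1)])
  have uV: "inv u \<in> V" using u(1) subgroup.m_inv_closed[OF ons_subgroup[OF V(1)]] by (simp add: U_def)
  have "near W (g # l) (g' # l)"
   using g' near_self[OF W(1) l] by (auto simp: U_def r_coset_def)
  hence "c (g' # l) = c (g # l)" using W(2) g uG u(2) l by simp
  moreover have "\<phi> (inv g') a = \<phi> (inv g) a" if a: "a \<in> N" for a
   using u uG g V(2)[OF uV a] NA[OF a] by (simp add: inv_mult_group act_mult)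
  ultimately show ?thesis unfolding F_def using N(3) g l by simp
 qed
 define h where "h = (%l. finprod A (%D. F (rep D) l) (rcosets U))"
 have repG: "rep D \<in> carrier G" if "D \<in> rcosets U" for D by (rule rep_coset(2)[OF U that])
 have FA: "F (rep D) l \<in> carrier A" if "D \<in> rcosets U" "l \<in> tuples G q" for D l
  using FN NA repG that by simp
 have "cochain q (%l. F (rep D) l)" if D: "D \<in> rcosets U" for D
 proof -
  have "F (rep D) ys = F (rep D) xs" if "xs \<in> tuples G q" "ys \<in> tuples G q" "near W xs ys" for xs ys
   unfolding F_def
   by (rule arg_cong[where f = "\<phi> (inv (rep D))"], rule W(2)[rule_format])
    (use that repG[OF D] coset_self[OF W(1) repG[OF D]] in simp_all)
  thus ?thesis unfolding cochain_def using W(1) FA[OF D] by blast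
 qed
 hence ch: "cochain q h" unfolding h_def using fin by (intro cochain_finprod) auto
 have "c l \<up> (p ^ K :: nat) = cob h l" if l: "l \<in> tuples G (Suc q)" for l
 proof -
  obtain x t where t: "l = x # t" "x \<in> carrier G" "t \<in> tuples G q" using l by (rule tuples_SucE)
  have cl: "c l \<in> carrier A" using N(3) NA l by simp
  have bA: "bar G A (F (rep D)) l \<in> carrier A" if "D \<in> rcosets U" for D
   by (rule B.bar_closed[OF l FA[OF that]])
  \<comment> \<open>The cocycle identity at \<open>rep D # l\<close> with the action of
    \<open>rep D\<close> undone. In the product over all cosets \<open>D\<close> the left side
    contributes \<open>c l\<close> to the power \<open>card (rcosets U)\<close>, which is the
    exponent \<open>p ^ K\<close>.\<close>
  have key: "c l = \<phi> x (F (rep (D #> x)) t) \<cdot> invA (bar G A (F (rep D)) l)" if D: "D \<in> rcosets U" for D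
  proof -
   let ?y = "rep D"
   have y: "?y \<in> carrier G" by (rule repG[OF D])
   have yl: "?y # l \<in> tuples G (Suc (Suc q))" using y l by simp
   have DU: "D #> x = U #> (?y \<otimes> x)"
    by (subst rep_coset(3)[OF U D]) (rule coset_mult_assoc[OF _ y t(2)], use ons_carrier[OF U] in auto)
   have yx: "?y \<otimes> x \<in> carrier G" using y t by simp
   have E: "D #> x \<in> rcosets U" unfolding DU by (rule coset_in_rcosets[OF U yx])
   have b1: "bar G A (%m. c (?y # m)) l \<in> carrier A"
    by (rule B.bar_closed[OF l]) (use N(3) NA y in auto)
   have ca: "c ((?y \<otimes> x) # t) \<in> carrier A" using N(3) NA yx t by simp
   have "cob c (?y # l) = \<e>" using c yl by simp
   moreover have bA': "bar G A c (?y # l) \<in> carrier A" by (rule B.bar_closed[OF yl]) (use N(3) NA in auto)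
   ultimately have "\<phi> ?y (c l) = bar G A c (?y # l)"
    using y cl unfolding cob_def by (metis M.A.inv_solve_right M.A.l_one M.A.one_closed act_closed list.sel(1) list.sel(3))
   also have "... = c ((?y \<otimes> x) # t) \<cdot> invA (bar G A (%m. c (?y # m)) l)" by (simp add: t(1))
   finally have "\<phi> (inv ?y) (\<phi> ?y (c l)) = \<phi> (inv ?y) (c ((?y \<otimes> x) # t) \<cdot> invA (bar G A (%m. c (?y # m)) l))"
    by simp
   hence "c l = \<phi> (inv ?y) (c ((?y \<otimes> x) # t)) \<cdot> invA (\<phi> (inv ?y) (bar G A (%m. c (?y # m)) l))"
    using y cl b1 ca by (simp add: act_hom_inv)
   also have "\<phi> (inv ?y) (bar G A (%m. c (?y # m)) l) = bar G A (F ?y) l"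
    unfolding F_def
    by (rule B.bar_hom[OF l _ M.action_hom, symmetric]) (use y N(3) NA in auto)
   also have "\<phi> (inv ?y) (c ((?y \<otimes> x) # t)) = \<phi> x (F (?y \<otimes> x) t)"
    using y t ca by (simp add: F_def act_mult[symmetric] inv_mult_group m_assoc[symmetric])
   also have "F (?y \<otimes> x) t = F (rep (D #> x)) t"
    by (rule Fc[OF yx _ t(3), symmetric]) (use rep_coset(1)[OF U E] DU in simp)
   finally show ?thesis .
  qed
  have tr: "D #> x \<in> rcosets U" if "D \<in> rcosets U" for D
   using bij_betw_apply[OF rcoset_translate_bij[OF U t(2)] that] .
  have "\<phi> x (h t) = finprod A (%D. \<phi> x (F (rep D) t)) (rcosets U)"
   unfolding h_def using t by (intro act_finprod fin FA) auto
  \<comment> \<open>Right translation by \<open>x\<close> permutes the cosets of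
    \<open>U\<close>.\<close>
  also have "... = finprod A (%D. \<phi> x (F (rep (D #> x)) t)) (rcosets U)"
  proof -
   have im: "(%D. D #> x) ` (rcosets U) = rcosets U" "inj_on (%D. D #> x) (rcosets U)"
    using rcoset_translate_bij[OF U t(2)] by (auto simp: bij_betw_def)
   have "finprod A (%D. \<phi> x (F (rep D) t)) ((%D. D #> x) ` (rcosets U)) =
     finprod A (%D. \<phi> x (F (rep (D #> x)) t)) (rcosets U)"
    by (rule M.A.finprod_reindex[OF _ im(2)]) (use im(1) FA t in auto)
   thus ?thesis unfolding im(1) .
  qed
  finally have 1: "\<phi> x (h t) = finprod A (%D. \<phi> x (F (rep (D #> x)) t)) (rcosets U)" .
  have 2: "bar G A h l = finprod A (%D. bar G A (F (rep D)) l) (rcosets U)"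
   unfolding h_def by (rule bar_finprod[OF fin FA l])
  have xF: "\<phi> x (F (rep (D #> x)) t) \<in> carrier A" if "D \<in> rcosets U" for D
   using FA[OF tr[OF that] t(3)] t(2) by simp
  have "c l \<up> (p ^ K :: nat) = finprod A (%D. c l) (rcosets U)"
   using M.A.finprod_const[OF cl, of "rcosets U"] K by simp
  hence "c l \<up> (p ^ K :: nat) \<cdot> bar G A h l =
    finprod A (%D. c l \<cdot> bar G A (F (rep D)) l) (rcosets U)"
   unfolding 2 using cl bA by (subst M.A.finprod_multf) auto
  also have "... = finprod A (%D. \<phi> x (F (rep (D #> x)) t)) (rcosets U)"
  proof (rule M.A.finprod_cong')
   fix D assume D: "D \<in> rcosets U"
   show "c l \<cdot> bar G A (F (rep D)) l = \<phi> x (F (rep (D #> x)) t)"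
    by (subst key[OF D]) (use bA[OF D] xF[OF D] in \<open>simp add: M.A.m_assoc\<close>)
  qed (use xF in auto)
  finally have "c l \<up> (p ^ K :: nat) \<cdot> bar G A h l = \<phi> x (h t)" unfolding 1 .
  moreover have "bar G A h l \<in> carrier A" by (rule B.bar_closed[OF l cochain_closed[OF ch]])
  moreover have "\<phi> x (h t) \<in> carrier A" using cochain_closed[OF ch t(3)] t(2) by simp
  ultimately show ?thesis unfolding cob_def using cl t(1)
   by (metis M.A.inv_solve_right M.A.nat_pow_closed list.sel(1) list.sel(3))
 qed
 thus ?thesis using ch by blast
qed

text \<open>Write the order of a finite submodule containing the values as \<open>p ^ a * m\<close>
  with \<open>m\<close> prime to \<open>p\<close>. In additive terms, the multiple of
  \<open>c\<close> by some power of \<open>p\<close> is a coboundary by the norm argument, the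
  multiple by \<open>m\<close> is one because its values are p-primary, and a Bezout relation
  combines the two.\<close>

theorem cocycle_bounds:
 assumes c: "cocycle (Suc (Suc (Suc n))) c"
 shows "bounds (Suc (Suc n)) c"
proof -
 let ?n3 = "Suc (Suc (Suc n))"
 obtain N where N: "finite N" "submodule N" "!!l. l \<in> tuples G ?n3 ==> c l \<in> N"
  using finite_submodule c by metis
 have sN: "subgroup N A" using N(2) by (simp add: submodule_def)
 have NA: "a \<in> carrier A" if "a \<in> N" for a by (rule submodule_carrier[OF N(2) that])
 obtain K where K: "bounds (Suc (Suc n)) (%l. c l \<up> (p ^ K :: nat))"
  using cocycle_index_power_bounds[OF c] by blast
 have "card N > 0" using N(1) subgroup.one_closed[OF sN] by (auto simp: card_gt_0_iff)
 then obtain a m where am: "card N = p ^ a * m" "\<not> p dvd m"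
  using multiplicity_decompose'[of "card N" p] not_prime_unit prime_p by (metis less_numeral_extra(3))
 have exponent: "b \<up> (p ^ a * m) = \<e>" if b: "b \<in> N" for b
 proof -
  interpret S: group "A\<lparr>carrier := N\<rparr>" by (rule M.A.subgroup_imp_group[OF sN])
  have "b [^]\<^bsub>A\<lparr>carrier := N\<rparr>\<^esub> order (A\<lparr>carrier := N\<rparr>) = \<one>\<^bsub>A\<lparr>carrier := N\<rparr>\<^esub>"
   by (rule S.pow_order_eq_1) (use b in simp)
  thus ?thesis using am(1) by (simp add: order_def flip: M.A.nat_pow_consistent)
 qed
 \<comment> \<open>The p-primary part of \<open>N\<close>. The \<open>m\<close>-th power of an
   element of \<open>N\<close> lies in it, since \<open>p ^ a * m\<close> is the order of
   \<open>N\<close>.\<close>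
 define N' where "N' = {b \<in> N. b \<up> (p ^ a) = \<e>}"
 have N': "submodule N'"
  unfolding submodule_def
 proof (intro conjI ballI)
  show "subgroup N' A"
  proof (rule M.A.subgroupI)
   show "N' \<subseteq> carrier A" using NA by (auto simp: N'_def)
   show "N' ~= {}" using subgroup.one_closed[OF sN] by (auto simp: N'_def)
   show "invA b \<in> N'" if "b \<in> N'" for b
    using that NA subgroup.m_inv_closed[OF sN] by (simp add: N'_def M.A.nat_pow_inv)
   show "b \<cdot> b' \<in> N'" if "b \<in> N'" "b' \<in> N'" for b b'
    using that NA subgroup.m_closed[OF sN] by (simp add: N'_def M.A.nat_pow_distrib)
  qed
  fix g b assume g: "g \<in> carrier G" and b: "b \<in> N'"
  have "\<phi> g b \<up> (p ^ a) = \<phi> g (b \<up> (p ^ a))"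
   by (rule group_hom.hom_nat_pow[OF act_group_hom[OF g], symmetric]) (use b NA in \<open>simp add: N'_def\<close>)
  thus "\<phi> g b \<in> N'" using b g N(2) by (simp add: N'_def submodule_def)
 qed
 define c1 where "c1 = (%l. c l \<up> int m)"
 have c1: "bounds (Suc (Suc n)) c1"
 proof (rule p_primary_cocycle_bounds[OF _ N'])
  show "finite N'" unfolding N'_def using N(1) by simp
  show "\<exists>j. b \<up> (p ^ j :: nat) = \<e>" if "b \<in> N'" for b using that by (auto simp: N'_def)
  show "cocycle ?n3 c1" by (rule cocycle_comp[OF c c1_def])
  fix l assume l: "l \<in> tuples G ?n3"
  have "c l \<up> m \<in> N" using M.A.subgroup_int_pow_closed[OF sN N(3)[OF l], of "int m"] by (simp add: int_pow_int)
  moreover have "(c l \<up> m) \<up> (p ^ a) = \<e>"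
   using exponent[OF N(3)[OF l]] NA[OF N(3)[OF l]] by (simp add: M.A.nat_pow_pow mult.commute)
  ultimately show "c1 l \<in> N'" by (simp add: c1_def N'_def int_pow_int)
 qed
 have "coprime (int (p ^ K)) (int m)"
  using am(2) prime_p by (simp add: coprime_int_iff prime_imp_coprime)
 then obtain \<alpha> \<beta> where ab: "\<alpha> * int (p ^ K) + \<beta> * int m = 1"
  by (metis bezout_int coprime_iff_gcd_eq_1)
 have "bounds (Suc (Suc n)) (%l. (c l \<up> (p ^ K :: nat)) \<up> \<alpha> \<cdot> c1 l \<up> \<beta>)"
  by (intro bounds_mult bounds_int_pow K c1)
 moreover have "c l = (c l \<up> (p ^ K :: nat)) \<up> \<alpha> \<cdot> c1 l \<up> \<beta>" if l: "l \<in> tuples G ?n3" for l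
 proof -
  have cA: "c l \<in> carrier A" using N(3)[OF l] NA by simp
  have "(c l \<up> (p ^ K :: nat)) \<up> \<alpha> \<cdot> c1 l \<up> \<beta> = c l \<up> (int (p ^ K) * \<alpha> + int m * \<beta>)"
   using cA by (simp add: c1_def M.A.int_pow_pow M.A.int_pow_mult flip: int_pow_int)
  also have "int (p ^ K) * \<alpha> + int m * \<beta> = 1" using ab by (simp add: mult.commute)
  finally show ?thesis using cA by simp
 qed
 ultimately show ?thesis by (rule bounds_cong)
qed

end

section \<open>Cohomological dimension\<close>

text \<open>The inner faces of the bar resolution. The last equation is a default for lists that are
  too short.\<close>

fun face :: "('g, 'b) monoid_scheme => nat => 'g list => 'g list" where
 "face G 0 (y # x # l) = (y \<otimes>\<^bsub>G\<^esub> x) # l"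
| "face G (Suc i) (y # l) = y # face G i l"
| "face G i l = []"

lemma length_face: "length l = Suc q ==> i < q ==> length (face G i l) = q"
proof (induction i arbitrary: l q)
 case 0
 then obtain y x t where "l = y # x # t" by (metis Suc_length_conv gr0_implies_Suc)
 thus ?case using 0 by simp
next
 case (Suc i)
 then obtain y t q' where "l = y # t" "q = Suc q'" "length t = q" by (metis Suc_length_conv less_imp_Suc_add)
 thus ?case using Suc by simp
qed

lemma nth_face:
 "length l = Suc q ==> i < q ==> j < q ==>
  face G i l ! j = (if j < i then l ! j else if j = i then l ! i \<otimes>\<^bsub>G\<^esub> l ! Suc i else l ! Suc j)"
proof (induction i arbitrary: l q j)
 case 0
 then obtain y x t where "l = y # x # t" by (metis Suc_length_conv gr0_implies_Suc)
 thus ?case using 0 by (cases j) simp_all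
next
 case (Suc i)
 then obtain y t q' where l: "l = y # t" "q = Suc q'" "length t = Suc q'"
  by (metis Suc_length_conv less_imp_Suc_add)
 thus ?case using Suc by (cases j) simp_all
qed

lemma (in comm_monoid) finprod_lessThan_Suc:
 assumes "f \<in> {..<Suc q} \<rightarrow> carrier G"
 shows "finprod G f {..<Suc q} = f 0 \<otimes> finprod G (%i. f (Suc i)) {..<q}"
proof -
 have "finprod G f {..<Suc q} = finprod G f (insert 0 (Suc ` {..<q}))"
  by (simp add: lessThan_Suc_eq_insert_0)
 also have "... = f 0 \<otimes> finprod G f (Suc ` {..<q})"
  using assms by (intro finprod_insert) auto
 also have "finprod G f (Suc ` {..<q}) = finprod G (%i. f (Suc i)) {..<q}"
  using assms by (intro finprod_reindex) auto
 finally show ?thesis .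
qed

lemma (in group) face_tuples:
 assumes "l \<in> tuples G (Suc q)" "i < q" shows "face G i l \<in> tuples G q"
 using assms
proof (induction i arbitrary: l q)
 case 0
 then obtain q' where "q = Suc q'" by (metis gr0_implies_Suc)
 thus ?case using 0 by (auto elim!: tuples_SucE)
next
 case (Suc i)
 then obtain q' where "q = Suc q'" "i < q'" by (metis Suc_less_eq less_imp_Suc_add Suc_lessE)
 thus ?case using Suc by (auto elim!: tuples_SucE)
qed

lemma butlast_tuples: "l \<in> tuples G (Suc q) ==> butlast l \<in> tuples G q"
 by (auto simp: tuples_def dest: in_set_butlastD)

text \<open>The exponent \<open>\<epsilon>\<close> serves the induction, which passes to
  \<open>- \<epsilon>\<close> when the first entry is split off.\<close>

lemma (in bar_complex) bar_explicit:
 assumes "l \<in> tuples G (Suc q)" "!!l. l \<in> tuples G q ==> c l \<in> carrier A"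
 shows "bar G A c l [^] (\<epsilon>::int) =
  finprod A (%i. c (face G i l) [^] (\<epsilon> * (-1) ^ i)) {..<q} \<otimes> c (butlast l) [^] (\<epsilon> * (-1) ^ q)"
proof -
 have "(\<forall>l \<in> tuples G q. c l \<in> carrier A) --> (\<forall>\<epsilon>::int. bar G A c l [^] \<epsilon> =
  finprod A (%i. c (face G i l) [^] (\<epsilon> * (-1) ^ i)) {..<q} \<otimes> c (butlast l) [^] (\<epsilon> * (-1) ^ q))"
  using assms(1)
 proof (induction q c l rule: bar_induct)
  case (Cons q c y x xs)
  show ?case
  proof (intro impI allI)
   fix \<epsilon> :: int
   assume c: "\<forall>l\<in>tuples G (Suc q). c l \<in> carrier A"
   let ?m = "x # xs" and ?b = "bar G A (%l. c (y # l)) (x # xs)"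
   have m: "?m \<in> tuples G (Suc q)" using Cons by simp
   have bA: "?b \<in> carrier A" by (rule bar_closed[OF m]) (use c Cons in auto)
   have h: "c ((y \<otimes>\<^bsub>G\<^esub> x) # xs) \<in> carrier A" using c Cons by simp
   have fA: "c (y # face G i ?m) \<in> carrier A" if "i < q" for i
    using G.face_tuples[OF m that] c Cons(1) by simp
   have lA: "c (y # butlast ?m) \<in> carrier A" using butlast_tuples[OF m] c Cons(1) by simp
   have "bar G A c (y # ?m) [^] \<epsilon> = c ((y \<otimes>\<^bsub>G\<^esub> x) # xs) [^] \<epsilon> \<otimes> ?b [^] (- \<epsilon>)"
    using bA h by (simp add: A.int_pow_mult_distrib A.m_comm A.int_pow_inv A.int_pow_neg)
   also have "?b [^] (- \<epsilon>) = finprod A (%i. c (y # face G i ?m) [^] (- \<epsilon> * (-1) ^ i)) {..<q} \<otimes>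
     c (y # butlast ?m) [^] (- \<epsilon> * (-1) ^ q)"
    by (rule Cons.IH[rule_format]) (use c Cons(1) in simp)
   also have "c ((y \<otimes>\<^bsub>G\<^esub> x) # xs) [^] \<epsilon> \<otimes> ... = finprod A (%i. c (face G i (y # ?m)) [^] (\<epsilon> * (-1) ^ i)) {..<Suc q} \<otimes>
     c (butlast (y # ?m)) [^] (\<epsilon> * (-1) ^ Suc q)"
   proof -
    have "finprod A (%i. c (face G i (y # ?m)) [^] (\<epsilon> * (-1) ^ i)) {..<Suc q} =
     c (face G 0 (y # ?m)) [^] (\<epsilon> * (-1) ^ 0) \<otimes> finprod A (%i. c (face G (Suc i) (y # ?m)) [^] (\<epsilon> * (-1) ^ Suc i)) {..<q}"
     by (rule A.finprod_lessThan_Suc) (use c Cons m G.face_tuples[of "y # ?m" "Suc q"] in auto)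
    also have "... = c ((y \<otimes>\<^bsub>G\<^esub> x) # xs) [^] \<epsilon> \<otimes> finprod A (%i. c (y # face G i ?m) [^] (- \<epsilon> * (-1) ^ i)) {..<q}"
     by simp
    finally have e: "finprod A (%i. c (face G i (y # ?m)) [^] (\<epsilon> * (-1) ^ i)) {..<Suc q} =
     c ((y \<otimes>\<^bsub>G\<^esub> x) # xs) [^] \<epsilon> \<otimes> finprod A (%i. c (y # face G i ?m) [^] (- \<epsilon> * (-1) ^ i)) {..<q}" .
    have "finprod A (%i. c (y # face G i ?m) [^] (- \<epsilon> * (-1) ^ i)) {..<q} \<in> carrier A"
     by (rule A.finprod_closed) (use fA in auto)
    moreover have "butlast (y # ?m) = y # butlast ?m" "\<epsilon> * (-1) ^ Suc q = - \<epsilon> * (-1) ^ q" by simp_all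
    ultimately show ?thesis unfolding e using h lA by (simp only: A.m_assoc A.int_pow_closed)
   qed
   finally show "bar G A c (y # ?m) [^] \<epsilon> = finprod A (%i. c (face G i (y # ?m)) [^] (\<epsilon> * (-1) ^ i)) {..<Suc q} \<otimes>
     c (butlast (y # ?m)) [^] (\<epsilon> * (-1) ^ Suc q)" .
  qed
 qed simp
 thus ?thesis using assms(2) by blast
qed

definition vec_of :: "'g list => nat => 'g" where
 "vec_of l = (\<lambda>j\<in>{..<length l}. l ! j)"

definition list_of :: "nat => (nat => 'g) => 'g list" where
 "list_of q x = map x [0..<q]"

lemma vec_of_PiE: "l \<in> tuples G q ==> vec_of l \<in> {..<q} \<rightarrow>\<^sub>E carrier G"
 by (auto simp: vec_of_def tuples_def)

lemma list_of_tuples: "x \<in> {..<q} \<rightarrow>\<^sub>E carrier G ==> list_of q x \<in> tuples G q"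
proof -
 assume x: "x \<in> {..<q} \<rightarrow>\<^sub>E carrier G"
 have "x j \<in> carrier G" if "j < q" for j using PiE_mem[OF x, of j] that by simp
 thus ?thesis by (auto simp: list_of_def tuples_def)
qed

lemma list_of_vec_of: "l \<in> tuples G q ==> list_of q (vec_of l) = l"
 by (auto simp: list_of_def vec_of_def tuples_def intro: nth_equalityI)

lemma vec_of_list_of: "x \<in> {..<q} \<rightarrow>\<^sub>E carrier G ==> vec_of (list_of q x) = x"
proof -
 assume x: "x \<in> {..<q} \<rightarrow>\<^sub>E carrier G"
 have "vec_of (list_of q x) j = x j" for j
  using PiE_arb[OF x, of j] by (cases "j < q") (simp_all add: list_of_def vec_of_def)
 thus ?thesis by (rule ext)
qed

section \<open>Comparison with the groups of continuous cochains\<close>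

context sylvester_torsion_module
begin

lemma near_list_of: "near U (list_of q y) (list_of q z) \<longleftrightarrow> (\<forall>i\<in>{..<q}. z i \<in> U #> y i)"
 by (auto simp: near_def list_of_def list_all2_conv_all_nth)

abbreviation C where "C q \<equiv> cochain_group G T A q"

lemma cochain_cong: "cochain q c ==> (!!l. l \<in> tuples G q ==> c' l = c l) ==> cochain q c'"
 unfolding cochain_def by simp

text \<open>The bridge from continuity for the product topology to \<open>cochain\<close>, through
  \<open>continuous_map_discrete_iff\<close> for the finite set of coordinates.\<close>

lemma carrier_C:
 "f \<in> carrier (C q) \<longleftrightarrow> f \<in> extensional ({..<q} \<rightarrow>\<^sub>E carrier G) \<and> cochain q (%l. f (vec_of l))"
  (is "_ \<longleftrightarrow> ?r")
proof -
 let ?E = "{..<q} \<rightarrow>\<^sub>E carrier G"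
 have *: "(\<forall>x\<in>?E. P x) \<longleftrightarrow> (\<forall>l\<in>tuples G q. P (vec_of l))" for P
  using vec_of_PiE list_of_tuples vec_of_list_of by metis
 have n: "near U l m \<longleftrightarrow> (\<forall>i\<in>{..<q}. vec_of m i \<in> U #> vec_of l i)" if "l \<in> tuples G q" "m \<in> tuples G q" for U l m
  using near_list_of[of U q "vec_of l" "vec_of m"] list_of_vec_of[OF that(1)] list_of_vec_of[OF that(2)] by simp
 have "f \<in> carrier (C q) \<longleftrightarrow> f \<in> extensional ?E \<and> (\<forall>x\<in>?E. f x \<in> carrier A) \<and>
   (\<exists>U\<in>\<U>. \<forall>x\<in>?E. \<forall>y\<in>?E. (\<forall>i\<in>{..<q}. y i \<in> U #> x i) --> f y = f x)"
  unfolding cochain_group_def continuous_map_discrete_iff[OF finite_lessThan] by (auto simp: PiE_iff)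
 also have "... \<longleftrightarrow> ?r"
  unfolding cochain_def * using n by simp
 finally show ?thesis .
qed

lemma C_simps:
 "mult (C q) f h = (\<lambda>x\<in>{..<q} \<rightarrow>\<^sub>E carrier G. f x \<cdot> h x)"
 "\<one>\<^bsub>C q\<^esub> = (\<lambda>x\<in>{..<q} \<rightarrow>\<^sub>E carrier G. \<e>)"
 by (simp_all add: cochain_group_def)

lemma C_restrictI:
 assumes "cochain q (%l. h (vec_of l))"
 shows "(\<lambda>x\<in>{..<q} \<rightarrow>\<^sub>E carrier G. h x) \<in> carrier (C q)"
 unfolding carrier_C by (rule conjI, simp, rule cochain_cong[OF assms]) (simp add: vec_of_PiE)

lemma C_list_of:
 assumes "cochain q e"
 shows "(\<lambda>x\<in>{..<q} \<rightarrow>\<^sub>E carrier G. e (list_of q x)) \<in> carrier (C q)"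
 by (rule C_restrictI, rule cochain_cong[OF assms]) (simp add: list_of_vec_of)

lemma C_closed: "f \<in> carrier (C q) ==> y \<in> {..<q} \<rightarrow>\<^sub>E carrier G ==> f y \<in> carrier A"
 by (auto simp: cochain_group_def)

lemma C_eqI:
 assumes "f \<in> extensional ({..<q} \<rightarrow>\<^sub>E carrier G)" "h \<in> extensional ({..<q} \<rightarrow>\<^sub>E carrier G)"
  and "!!x. x \<in> {..<q} \<rightarrow>\<^sub>E carrier G ==> f x = h x"
 shows "f = h"
 using assms by (rule extensionalityI)

lemma group_C: "group (C q)"
proof (rule groupI)
 fix f g assume f: "f \<in> carrier (C q)" and g: "g \<in> carrier (C q)"
 show "mult (C q) f g \<in> carrier (C q)"
  unfolding C_simps by (rule C_restrictI, rule cochain_mult) (use f g in \<open>simp_all add: carrier_C\<close>)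
next
 show "\<one>\<^bsub>C q\<^esub> \<in> carrier (C q)" unfolding C_simps by (rule C_restrictI, rule cochain_one)
next
 fix f g h assume f: "f \<in> carrier (C q)" and g: "g \<in> carrier (C q)" and h: "h \<in> carrier (C q)"
 show "mult (C q) (mult (C q) f g) h = mult (C q) f (mult (C q) g h)"
  unfolding C_simps using C_closed[OF f] C_closed[OF g] C_closed[OF h]
  by (intro restrict_ext) (simp add: M.A.m_assoc)
next
 fix f assume f: "f \<in> carrier (C q)"
 show "mult (C q) \<one>\<^bsub>C q\<^esub> f = f"
  unfolding C_simps using C_closed[OF f] f by (intro C_eqI[of _ q]) (auto simp: carrier_C)
 let ?i = "\<lambda>x\<in>{..<q} \<rightarrow>\<^sub>E carrier G. invA (f x)"
 have "?i \<in> carrier (C q)"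
  by (rule C_restrictI, rule cochain_comp) (use f in \<open>simp_all add: carrier_C\<close>)
 moreover have "mult (C q) ?i f = \<one>\<^bsub>C q\<^esub>"
  unfolding C_simps using C_closed[OF f] by (intro restrict_ext) simp
 ultimately show "\<exists>g\<in>carrier (C q). mult (C q) g f = \<one>\<^bsub>C q\<^esub>" by blast
qed

lemma coboundary_eq:
 assumes f: "f \<in> carrier (C q)" and y: "y \<in> {..<Suc q} \<rightarrow>\<^sub>E carrier G"
 shows "coboundary G A \<phi> q f y = cob (%l. f (vec_of l)) (list_of (Suc q) y)"
proof -
 let ?l = "list_of (Suc q) y" and ?c = "%l. f (vec_of l)"
 have l: "?l \<in> tuples G (Suc q)" by (rule list_of_tuples[OF y])
 have len: "length ?l = Suc q" by (simp add: list_of_def)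
 have nth: "?l ! j = y j" if "j < Suc q" for j using that by (simp add: list_of_def del: upt_Suc)
 have c: "?c l \<in> carrier A" if "l \<in> tuples G q" for l using C_closed[OF f vec_of_PiE[OF that]] .
 have bA: "bar G A ?c ?l \<in> carrier A" by (rule B.bar_closed[OF l c])
 have hd: "hd ?l = y 0" by (simp add: list_of_def upt_rec)
 have y0: "y 0 \<in> carrier G" using y by auto
 have tl: "vec_of (tl ?l) = (\<lambda>j\<in>{..<q}. y (Suc j))"
  unfolding vec_of_def using len nth by (auto simp: nth_tl intro!: restrict_ext)
 have bl: "vec_of (butlast ?l) = restrict y {..<q}"
  unfolding vec_of_def using len nth by (auto simp: nth_butlast intro!: restrict_ext)
 have fc: "vec_of (face G i ?l) =
   (\<lambda>j\<in>{..<q}. if j < i then y j else if j = i then y i \<otimes> y (Suc i) else y (Suc j))" if i: "i < q" for i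
  unfolding vec_of_def length_face[OF len i] using nth i
  by (intro restrict_ext) (simp add: nth_face[OF len i])
 have tlt: "tl ?l \<in> tuples G q" using l by (auto elim!: tuples_SucE)
 have ft: "?c (face G i ?l) \<in> carrier A" if "i < q" for i by (rule c[OF face_tuples[OF l that]])
 have "cob ?c ?l = \<phi> (hd ?l) (?c (tl ?l)) \<cdot> bar G A ?c ?l \<up> (- 1 :: int)"
  unfolding cob_def using bA M.A.int_pow_neg[OF bA, of 1] by simp
 \<comment> \<open>At exponent \<open>-1\<close> the signs of \<open>bar\<close> shift by one and
   become those of \<open>coboundary\<close>.\<close>
 also have "bar G A ?c ?l \<up> (- 1 :: int) =
   finprod A (%i. ?c (face G i ?l) \<up> ((- 1) * (-1) ^ i :: int)) {..<q} \<cdot> ?c (butlast ?l) \<up> ((- 1) * (-1) ^ q :: int)"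
  by (rule B.bar_explicit[OF l c])
 also have "\<phi> (hd ?l) (?c (tl ?l)) \<cdot> ... = \<phi> (hd ?l) (?c (tl ?l)) \<cdot>
   finprod A (%i. ?c (face G i ?l) \<up> ((- 1) ^ Suc i :: int)) {..<q} \<cdot> ?c (butlast ?l) \<up> ((- 1) ^ Suc q :: int)"
  unfolding power_Suc
  by (rule M.A.m_assoc[symmetric])
   (use c[OF tlt] c[OF butlast_tuples[OF l]] hd y0 ft in \<open>auto intro!: M.A.finprod_closed\<close>)
 also have "... = coboundary G A \<phi> q f y"
 proof -
  have "finprod A (%i. ?c (face G i ?l) \<up> ((- 1) ^ Suc i :: int)) {..<q} =
   finprod A (%i. f (\<lambda>j\<in>{..<q}. if j < i then y j else if j = i then y i \<otimes> y (Suc i) else y (Suc j))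
    \<up> ((- 1) ^ Suc i :: int)) {..<q}"
   by (rule M.A.finprod_cong') (use fc ft in auto)
  thus ?thesis unfolding coboundary_def hd tl bl using y by simp
 qed
 finally show ?thesis by (rule HOL.sym)
qed

lemma coboundary_closed:
 assumes f: "f \<in> carrier (C q)" shows "coboundary G A \<phi> q f \<in> carrier (C (Suc q))"
proof -
 let ?c = "%l. f (vec_of l)"
 have "cochain (Suc q) (cob ?c)" by (rule cochain_cob) (use f in \<open>simp add: carrier_C\<close>)
 from C_list_of[OF this]
 have "(\<lambda>x\<in>{..<Suc q} \<rightarrow>\<^sub>E carrier G. cob ?c (list_of (Suc q) x)) \<in> carrier (C (Suc q))" .
 also have "(\<lambda>x\<in>{..<Suc q} \<rightarrow>\<^sub>E carrier G. cob ?c (list_of (Suc q) x)) = coboundary G A \<phi> q f"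
  by (rule C_eqI[of _ "Suc q"]) (use coboundary_eq[OF f] in \<open>auto simp: coboundary_def\<close>)
 finally show ?thesis .
qed

lemma coboundary_hom: "coboundary G A \<phi> q \<in> hom (C q) (C (Suc q))"
proof (rule homI)
 fix f assume "f \<in> carrier (C q)" thus "coboundary G A \<phi> q f \<in> carrier (C (Suc q))"
  by (rule coboundary_closed)
next
 fix f g assume f: "f \<in> carrier (C q)" and g: "g \<in> carrier (C q)"
 have fg: "mult (C q) f g \<in> carrier (C q)" using group.is_monoid[OF group_C] f g by (rule monoid.m_closed)
 show "coboundary G A \<phi> q (mult (C q) f g) = mult (C (Suc q)) (coboundary G A \<phi> q f) (coboundary G A \<phi> q g)"
 proof (rule C_eqI[of _ "Suc q"])
  fix x assume x: "x \<in> {..<Suc q} \<rightarrow>\<^sub>E carrier G"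
  have l: "list_of (Suc q) x \<in> tuples G (Suc q)" by (rule list_of_tuples[OF x])
  have c: "f (vec_of l) \<in> carrier A" "g (vec_of l) \<in> carrier A" if "l \<in> tuples G q" for l
   using C_closed[OF f vec_of_PiE[OF that]] C_closed[OF g vec_of_PiE[OF that]] .
  have "coboundary G A \<phi> q (mult (C q) f g) x = cob (%l. mult (C q) f g (vec_of l)) (list_of (Suc q) x)"
   by (rule coboundary_eq[OF fg x])
  also have "... = cob (%l. f (vec_of l) \<cdot> g (vec_of l)) (list_of (Suc q) x)"
   by (rule cob_cong[OF l]) (simp add: C_simps vec_of_PiE)
  also have "... = coboundary G A \<phi> q f x \<cdot> coboundary G A \<phi> q g x"
   unfolding coboundary_eq[OF f x] coboundary_eq[OF g x] by (rule cob_mult[OF l c])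
  finally show "coboundary G A \<phi> q (mult (C q) f g) x =
    mult (C (Suc q)) (coboundary G A \<phi> q f) (coboundary G A \<phi> q g) x"
   using x by (simp add: C_simps)
 qed (simp_all add: coboundary_def C_simps)
qed

lemma coboundary_group_hom: "group_hom (C q) (C (Suc q)) (coboundary G A \<phi> q)"
 using coboundary_hom group_C by (simp add: group_hom_def group_hom_axioms_def)

lemma cocycle_vec_of:
 assumes f: "f \<in> carrier (C q)"
 shows "f \<in> cocycles G T A \<phi> q \<longleftrightarrow> (\<forall>l\<in>tuples G (Suc q). cob (%l. f (vec_of l)) l = \<e>)"
  (is "_ \<longleftrightarrow> ?r")
proof -
 have "f \<in> cocycles G T A \<phi> q \<longleftrightarrow> coboundary G A \<phi> q f = \<one>\<^bsub>C (Suc q)\<^esub>"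
  using f by (simp add: cocycles_def kernel_def)
 also have "... \<longleftrightarrow> (\<forall>x\<in>{..<Suc q} \<rightarrow>\<^sub>E carrier G. coboundary G A \<phi> q f x = \<e>)"
 proof
  assume "\<forall>x\<in>{..<Suc q} \<rightarrow>\<^sub>E carrier G. coboundary G A \<phi> q f x = \<e>"
  thus "coboundary G A \<phi> q f = \<one>\<^bsub>C (Suc q)\<^esub>"
   by (intro C_eqI[of _ "Suc q"]) (simp_all add: C_simps coboundary_def)
 qed (simp add: C_simps)
 also have "... \<longleftrightarrow> ?r"
 proof
  assume *: "\<forall>x\<in>{..<Suc q} \<rightarrow>\<^sub>E carrier G. coboundary G A \<phi> q f x = \<e>"
  show ?r
  proof
   fix l assume l: "l \<in> tuples G (Suc q)"
   show "cob (%l. f (vec_of l)) l = \<e>"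
    using coboundary_eq[OF f vec_of_PiE[OF l]] * vec_of_PiE[OF l] list_of_vec_of[OF l] by simp
  qed
 next
  assume ?r
  thus "\<forall>x\<in>{..<Suc q} \<rightarrow>\<^sub>E carrier G. coboundary G A \<phi> q f x = \<e>"
   by (simp add: coboundary_eq[OF f] list_of_tuples)
 qed
 finally show ?thesis .
qed

text \<open>\<open>vec_of\<close> and \<open>list_of\<close> exchange extensional functions and
  lists, and \<open>cocycle_bounds\<close> applies from degree 3 on.\<close>

lemma coboundaries_eq_cocycles: "coboundaries G T A \<phi> (Suc (Suc (Suc n))) = cocycles G T A \<phi> (Suc (Suc (Suc n)))"
proof
 let ?n2 = "Suc (Suc n)" and ?n3 = "Suc (Suc (Suc n))"
 show "coboundaries G T A \<phi> ?n3 \<subseteq> cocycles G T A \<phi> ?n3"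
 proof
  fix f assume "f \<in> coboundaries G T A \<phi> ?n3"
  then obtain g where g: "g \<in> carrier (C ?n2)" "f = coboundary G A \<phi> ?n2 g" by auto
  have f: "f \<in> carrier (C ?n3)" unfolding g(2) by (rule coboundary_closed[OF g(1)])
  have gA: "g (vec_of l) \<in> carrier A" if "l \<in> tuples G ?n2" for l using C_closed[OF g(1) vec_of_PiE[OF that]] .
  have fe: "f (vec_of l) = cob (%l. g (vec_of l)) l" if "l \<in> tuples G ?n3" for l
   unfolding g(2) using coboundary_eq[OF g(1) vec_of_PiE[OF that]] list_of_vec_of[OF that] by simp
  have "cob (%l. f (vec_of l)) l = \<e>" if l: "l \<in> tuples G (Suc ?n3)" for l
   using cob_cong[OF l fe] cob_cob[OF gA l] by simp
  thus "f \<in> cocycles G T A \<phi> ?n3" using cocycle_vec_of[OF f] by blast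
 qed
 show "cocycles G T A \<phi> ?n3 \<subseteq> coboundaries G T A \<phi> ?n3"
 proof
  fix f assume fz: "f \<in> cocycles G T A \<phi> ?n3"
  hence f: "f \<in> carrier (C ?n3)" by (simp add: cocycles_def kernel_def)
  have "cocycle ?n3 (%l. f (vec_of l))" using f fz cocycle_vec_of[OF f] by (simp add: carrier_C)
  from cocycle_bounds[OF this] obtain e where e: "cochain ?n2 e"
   and fe: "!!l. l \<in> tuples G ?n3 ==> f (vec_of l) = cob e l" by blast
  define g where "g = (\<lambda>x\<in>{..<?n2} \<rightarrow>\<^sub>E carrier G. e (list_of ?n2 x))"
  have g: "g \<in> carrier (C ?n2)" unfolding g_def by (rule C_list_of[OF e])
  have "f = coboundary G A \<phi> ?n2 g"
  proof (rule C_eqI[of _ ?n3])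
   fix x assume x: "x \<in> {..<?n3} \<rightarrow>\<^sub>E carrier G"
   have l: "list_of ?n3 x \<in> tuples G ?n3" by (rule list_of_tuples[OF x])
   have "coboundary G A \<phi> ?n2 g x = cob (%l. g (vec_of l)) (list_of ?n3 x)" by (rule coboundary_eq[OF g x])
   also have "... = cob e (list_of ?n3 x)"
    by (rule cob_cong[OF l]) (simp add: g_def list_of_vec_of vec_of_PiE)
   also have "... = f x" using fe[OF l] vec_of_list_of[OF x] by simp
   finally show "f x = coboundary G A \<phi> ?n2 g x" by (rule HOL.sym)
  qed (use f in \<open>simp_all add: carrier_C coboundary_def\<close>)
  thus "f \<in> coboundaries G T A \<phi> ?n3" using g by simp
 qed
qed

lemma cohomology_trivial: "trivial_group (cohomology_group G T A \<phi> (Suc (Suc (Suc n))))"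
proof -
 let ?q = "Suc (Suc (Suc n))" and ?Z = "cocycles G T A \<phi> (Suc (Suc (Suc n)))"
 define H where "H = (C ?q)\<lparr>carrier := ?Z\<rparr>"
 have "subgroup ?Z (C ?q)"
  unfolding cocycles_def by (rule group_hom.subgroup_kernel[OF coboundary_group_hom])
 then interpret H: group H unfolding H_def by (rule group.subgroup_imp_group[OF group_C])
 have HZ: "carrier H = ?Z" by (simp add: H_def)
 have sub: "subgroup (carrier H) H" by (rule H.subgroup_self)
 have "carrier H \<lhd> H" by (rule H.normal_invI[OF sub]) simp
 then interpret N: normal "carrier H" H .
 have "carrier (H Mod carrier H) \<subseteq> {carrier H}"
  using H.coset_join2[OF _ sub] by (auto simp: FactGroup_def RCOSETS_def)
 hence "trivial_group (H Mod carrier H)" using group.trivial_group_alt[OF N.factorgroup_is_group] by blast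
 thus ?thesis unfolding cohomology_group_def coboundaries_eq_cocycles using HZ by (simp add: H_def)
qed

end

lemma (in sylvester_pro_p) cohomological_dimension_le_2: "cohomological_dimension TYPE('m) G T \<le> 2"
proof -
 have "trivial_group (cohomology_group G T A \<phi> q)"
  if A: "discrete_torsion_module G T A \<phi>" and q: "q > 2" for A :: "'m monoid" and \<phi> q
 proof -
  interpret S: sylvester_torsion_module p G T d x A \<phi>
   using A sylvester_pro_p_axioms by (simp add: sylvester_torsion_module_def)
  have "q = Suc (Suc (Suc (q - 3)))" using q by simp
  thus ?thesis using S.cohomology_trivial[of "q - 3"] by simp
 qed
 hence "enat 2 \<in> {enat n | n. \<forall>(A :: 'm monoid) \<phi>. discrete_torsion_module G T A \<phi> -->
   (\<forall>q>n. trivial_group (cohomology_group G T A \<phi> q))}"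
  by (intro CollectI exI[of _ 2] conjI HOL.refl allI impI)
 hence "cohomological_dimension TYPE('m) G T \<le> enat 2"
  unfolding cohomological_dimension_def by (rule Inf_lower)
 thus ?thesis by (simp add: numeral_eq_enat)
qed

section \<open>Free groups\<close>

abbreviation words :: "'x set => ('x \<times> bool) list set" where "words X \<equiv> lists (X \<times> UNIV)"

lemma free_group_rel_words: "(u, v) \<in> free_group_rel X ==> u \<in> words X \<and> v \<in> words X"
 by (induction rule: free_group_rel.induct) auto

lemma equiv_free_group_rel: "equiv (words X) (free_group_rel X)"
proof (rule equivI)
 show "free_group_rel X \<subseteq> words X \<times> words X" using free_group_rel_words by fast
 show "refl_on (words X) (free_group_rel X)" by (rule refl_onI) (rule free_group_rel.refl)
 show "sym (free_group_rel X)" by (rule symI) (rule free_group_rel.sym)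
 show "trans (free_group_rel X)" by (rule transI) (rule free_group_rel.trans)
qed

lemma free_group_rel_append:
 "(u, v) \<in> free_group_rel X ==> a \<in> words X ==> b \<in> words X ==> (a @ u @ b, a @ v @ b) \<in> free_group_rel X"
proof (induction rule: free_group_rel.induct)
 case (refl w)
 thus ?case by (intro free_group_rel.refl append_in_lists_conv[THEN iffD2] conjI)
next
 case (sym v w)
 show ?case by (rule free_group_rel.sym[OF sym.IH[OF sym.prems]])
next
 case (trans u v w)
 show ?case by (rule free_group_rel.trans[OF trans.IH(1)[OF trans.prems] trans.IH(2)[OF trans.prems]])
next
 case (cancel u v x c)
 have "a @ u \<in> words X" "v @ b \<in> words X"
  using cancel by (simp_all only: append_in_lists_conv simp_thms)
 from free_group_rel.cancel[OF this cancel.hyps(3), of c] show ?case by simp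
qed

abbreviation word_class :: "'x set => ('x \<times> bool) list => ('x \<times> bool) list set" where
 "word_class X w \<equiv> free_group_rel X `` {w}"

lemma word_class_eq_iff:
 "u \<in> words X ==> v \<in> words X ==> word_class X u = word_class X v \<longleftrightarrow> (u, v) \<in> free_group_rel X"
 by (rule eq_equiv_class_iff[OF equiv_free_group_rel])

lemma free_group_carrierE:
 assumes "A \<in> carrier (free_group X)" obtains w where "w \<in> words X" "A = word_class X w"
proof -
 have "A \<in> words X // free_group_rel X" using assms by (simp add: free_group_def)
 then obtain w where "A = word_class X w" "w \<in> words X" by (rule quotientE)
 thus thesis using that by simp
qed

lemma word_class_carrier: "w \<in> words X ==> word_class X w \<in> carrier (free_group X)"
 by (simp add: free_group_def quotientI)

lemma word_class_mult:
 assumes u: "u \<in> words X" and v: "v \<in> words X"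
 shows "mult (free_group X) (word_class X u) (word_class X v) = word_class X (u @ v)"
proof -
 have "word_class X (u' @ v') = word_class X (u @ v)"
  if "(u, u') \<in> free_group_rel X" "(v, v') \<in> free_group_rel X" for u' v'
 proof -
  have w: "u' \<in> words X" "v' \<in> words X"
   by (rule conjunct2[OF free_group_rel_words[OF that(1)]], rule conjunct2[OF free_group_rel_words[OF that(2)]])
  have "(u @ v, u' @ v) \<in> free_group_rel X" using free_group_rel_append[OF that(1), of "[]" v] v by simp
  moreover have "(u' @ v, u' @ v') \<in> free_group_rel X" using free_group_rel_append[OF that(2), of u' "[]"] w by simp
  ultimately have "(u @ v, u' @ v') \<in> free_group_rel X" by (rule free_group_rel.trans)
  thus ?thesis using u v w word_class_eq_iff[of "u @ v" X "u' @ v'"] by simp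
 qed
 hence "mult (free_group X) (word_class X u) (word_class X v) =
   (\<Union>u'\<in>word_class X u. \<Union>v'\<in>word_class X v. word_class X (u @ v))"
  by (simp add: free_group_def)
 also have "... = word_class X (u @ v)"
 proof -
  have "u \<in> word_class X u" "v \<in> word_class X v"
   using free_group_rel.refl[OF u] free_group_rel.refl[OF v] by simp_all
  hence "word_class X u ~= {}" "word_class X v ~= {}" by blast+
  thus ?thesis by (simp only: UN_constant if_False)
 qed
 finally show ?thesis .
qed

definition inv_word :: "('x \<times> bool) list => ('x \<times> bool) list" where
 "inv_word w = rev (map (%(x, b). (x, \<not> b)) w)"

lemma inv_word_words: "w \<in> words X ==> inv_word w \<in> words X"
 by (auto simp: inv_word_def)

lemma inv_word_cancel: "w \<in> words X ==> (inv_word w @ w, []) \<in> free_group_rel X"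
proof (induction w)
 case Nil
 thus ?case by (simp add: inv_word_def free_group_rel.refl)
next
 case (Cons l w)
 obtain x b where l: "l = (x, b)" by (cases l)
 have w: "w \<in> words X" "x \<in> X" using Cons.prems l by auto
 have "(inv_word w @ [(x, \<not> b), (x, \<not> \<not> b)] @ w, inv_word w @ w) \<in> free_group_rel X"
  by (rule free_group_rel.cancel[OF inv_word_words[OF w(1)] w])
 hence "(inv_word (l # w) @ l # w, inv_word w @ w) \<in> free_group_rel X" by (simp add: inv_word_def l)
 thus ?case using Cons.IH[OF w(1)] by (rule free_group_rel.trans)
qed

lemma group_free_group: "group (free_group X)"
proof (rule groupI)
 have one: "\<one>\<^bsub>free_group X\<^esub> = word_class X []" by (simp add: free_group_def)
 show "\<one>\<^bsub>free_group X\<^esub> \<in> carrier (free_group X)" unfolding one by (rule word_class_carrier) simp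
 fix A assume "A \<in> carrier (free_group X)"
 then obtain u where u: "u \<in> words X" "A = word_class X u" by (rule free_group_carrierE)
 show "mult (free_group X) \<one>\<^bsub>free_group X\<^esub> A = A" unfolding one u(2) by (simp add: word_class_mult u(1))
 have "mult (free_group X) (word_class X (inv_word u)) A = \<one>\<^bsub>free_group X\<^esub>"
  unfolding u(2) one word_class_mult[OF inv_word_words[OF u(1)] u(1)]
  using inv_word_cancel[OF u(1)] inv_word_words[OF u(1)] u(1)
  by (subst word_class_eq_iff) auto
 thus "\<exists>B\<in>carrier (free_group X). mult (free_group X) B A = \<one>\<^bsub>free_group X\<^esub>"
  using word_class_carrier[OF inv_word_words[OF u(1)]] by blast
 fix B assume "B \<in> carrier (free_group X)"
 then obtain v where v: "v \<in> words X" "B = word_class X v" by (rule free_group_carrierE)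
 have uv: "u @ v \<in> words X" using u(1) v(1) by simp
 show "mult (free_group X) A B \<in> carrier (free_group X)"
  unfolding u(2) v(2) word_class_mult[OF u(1) v(1)] by (rule word_class_carrier[OF uv])
 fix C assume "C \<in> carrier (free_group X)"
 then obtain w where w: "w \<in> words X" "C = word_class X w" by (rule free_group_carrierE)
 have vw: "v @ w \<in> words X" using w(1) v(1) by simp
 show "mult (free_group X) (mult (free_group X) A B) C = mult (free_group X) A (mult (free_group X) B C)"
  unfolding u(2) v(2) w(2) word_class_mult[OF u(1) v(1)] word_class_mult[OF v(1) w(1)]
   word_class_mult[OF uv w(1)] word_class_mult[OF u(1) vw] by simp
qed

abbreviation free_gen :: "'x set => 'x => ('x \<times> bool) list set" where
 "free_gen X i \<equiv> word_class X [(i, True)]"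

lemma free_gen_carrier: "i \<in> X ==> free_gen X i \<in> carrier (free_group X)"
 by (rule word_class_carrier) simp

lemma free_group_generate: "generate (free_group X) (free_gen X ` X) = carrier (free_group X)"
proof
 interpret group "free_group X" by (rule group_free_group)
 have sub: "free_gen X ` X \<subseteq> carrier (free_group X)" using free_gen_carrier by auto
 show "generate (free_group X) (free_gen X ` X) \<subseteq> carrier (free_group X)" by (rule generate_incl[OF sub])
 note gs = generate_is_subgroup[OF sub]
 have "word_class X w \<in> generate (free_group X) (free_gen X ` X)" if "w \<in> words X" for w
  using that
 proof (induction w rule: list.induct)
  case Nil
  have "\<one>\<^bsub>free_group X\<^esub> = word_class X []" by (simp add: free_group_def)
  thus ?case using subgroup.one_closed[OF gs] by simp
 next
  case (Cons l w)
  obtain x b where l: "l = (x, b)" by (cases l)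
  have x: "x \<in> X" and w: "w \<in> words X" using Cons.prems unfolding l by simp_all
  have g: "free_gen X x \<in> generate (free_group X) (free_gen X ` X)" using x by (intro generate.incl) simp
  have "word_class X [(x, False)] = inv\<^bsub>free_group X\<^esub> free_gen X x"
  proof (rule inv_equality[symmetric])
   have "mult (free_group X) (word_class X [(x, False)]) (free_gen X x) = word_class X ([(x, False)] @ [(x, True)])"
    by (rule word_class_mult) (use x in auto)
   also have "... = word_class X []"
    using free_group_rel.cancel[of "[]" X "[]" x False] x by (subst word_class_eq_iff) auto
   finally show "mult (free_group X) (word_class X [(x, False)]) (free_gen X x) = \<one>\<^bsub>free_group X\<^esub>"
    by (simp add: free_group_def)
  qed (use x in \<open>auto intro!: word_class_carrier\<close>)
  hence "word_class X [l] \<in> generate (free_group X) (free_gen X ` X)"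
   using g subgroup.m_inv_closed[OF gs g] by (cases b) (simp_all add: l)
  moreover have "word_class X (l # w) = mult (free_group X) (word_class X [l]) (word_class X w)"
   using word_class_mult[of "[l]" X w] x w l by simp
  ultimately show ?case using Cons.IH[OF w] subgroup.m_closed[OF gs] by simp
 qed
 thus "carrier (free_group X) \<subseteq> generate (free_group X) (free_gen X ` X)"
  by (auto elim!: free_group_carrierE)
qed

fun (in monoid) eval_word :: "('x => 'a) => ('x \<times> bool) list => 'a" where
 "eval_word g [] = \<one>"
| "eval_word g ((i, b) # w) = (if b then g i else inv (g i)) \<otimes> eval_word g w"

lemma (in group) eval_word_closed: "g ` X \<subseteq> carrier G ==> w \<in> words X ==> eval_word g w \<in> carrier G"
 by (induction g w rule: eval_word.induct) auto

lemma (in group) eval_word_append: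
 assumes "g ` X \<subseteq> carrier G" "u \<in> words X" "v \<in> words X"
 shows "eval_word g (u @ v) = eval_word g u \<otimes> eval_word g v"
 using assms(2)
proof (induction u rule: list.induct)
 case Nil
 thus ?case using eval_word_closed[OF assms(1,3)] by simp
next
 case (Cons l u)
 obtain x b where l: "l = (x, b)" by (cases l)
 have "x \<in> X" "u \<in> words X" using Cons.prems unfolding l by simp_all
 hence x: "g x \<in> carrier G" "u \<in> words X" using assms(1) by auto
 show ?case
  using Cons x l eval_word_closed[OF assms(1) x(2)] eval_word_closed[OF assms(1,3)] by (simp add: m_assoc)
qed

lemma (in group) eval_word_rel:
 assumes "(u, v) \<in> free_group_rel X" "g ` X \<subseteq> carrier G"
 shows "eval_word g u = eval_word g v"
 using assms(1)
proof (induction rule: free_group_rel.induct)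
 case (cancel u v x b)
 have x: "g x \<in> carrier G" using cancel assms(2) by auto
 have w: "[(x, b), (x, \<not> b)] \<in> words X" using cancel by simp
 have "eval_word g [(x, b), (x, \<not> b)] = \<one>" using x by simp
 hence "eval_word g ([(x, b), (x, \<not> b)] @ v) = eval_word g v"
  using eval_word_append[OF assms(2) w cancel(2)] eval_word_closed[OF assms(2) cancel(2)] by simp
 moreover have "[(x, b), (x, \<not> b)] @ v \<in> words X" using w cancel(2) by simp
 ultimately show ?case using eval_word_append[OF assms(2) cancel(1)] cancel(2) by simp
qed simp_all

text \<open>The value on a class is computed from a chosen word in it; \<open>eval_word_rel\<close>
  makes the choice irrelevant.\<close>

lemma (in group) free_group_universal:
 assumes g: "g ` X \<subseteq> carrier G"
 obtains \<psi> where "\<psi> \<in> hom (free_group X) G" "\<forall>i\<in>X. \<psi> (free_gen X i) = g i"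
proof -
 define \<psi> where "\<psi> = (%A. eval_word g (SOME w. w \<in> A))"
 have \<psi>: "\<psi> (word_class X w) = eval_word g w" if w: "w \<in> words X" for w
 proof -
  have "w \<in> word_class X w" using free_group_rel.refl[OF w] by simp
  hence "(SOME u. u \<in> word_class X w) \<in> word_class X w" by (rule someI)
  hence "(w, SOME u. u \<in> word_class X w) \<in> free_group_rel X" by simp
  from eval_word_rel[OF this g] show ?thesis by (simp add: \<psi>_def)
 qed
 show thesis
 proof (rule that)
  show "\<psi> \<in> hom (free_group X) G"
  proof (rule homI)
   fix A assume "A \<in> carrier (free_group X)"
   then obtain u where u: "u \<in> words X" "A = word_class X u" by (rule free_group_carrierE)
   show "\<psi> A \<in> carrier G" unfolding u(2) \<psi>[OF u(1)] by (rule eval_word_closed[OF g u(1)])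
   fix B assume "B \<in> carrier (free_group X)"
   then obtain v where v: "v \<in> words X" "B = word_class X v" by (rule free_group_carrierE)
   have uv: "u @ v \<in> words X" using u(1) v(1) by simp
   show "\<psi> (mult (free_group X) A B) = \<psi> A \<otimes> \<psi> B"
    unfolding u(2) v(2) word_class_mult[OF u(1) v(1)] \<psi>[OF u(1)] \<psi>[OF v(1)] \<psi>[OF uv]
    by (rule eval_word_append[OF g u(1) v(1)])
  qed
  show "\<forall>i\<in>X. \<psi> (free_gen X i) = g i"
  proof
   fix i assume i: "i \<in> X"
   hence "g i \<in> carrier G" using g by auto
   thus "\<psi> (free_gen X i) = g i" using \<psi>[of "[(i, True)]"] i by simp
  qed
 qed
qed

section \<open>Pro-p completions\<close>

text \<open>The cosets of the kernel are the fibres of \<open>h\<close>.\<close>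

lemma (in group_hom) card_rcosets_kernel: "card (rcosets\<^bsub>G\<^esub> (kernel G H h)) = card (h ` carrier G)"
proof -
 let ?f = "%y. {z \<in> carrier G. h z = y}"
 have cos: "kernel G H h #>\<^bsub>G\<^esub> a = ?f (h a)" if a: "a \<in> carrier G" for a
 proof
  show "kernel G H h #>\<^bsub>G\<^esub> a \<subseteq> ?f (h a)" using a by (auto simp: r_coset_def kernel_def)
  show "?f (h a) \<subseteq> kernel G H h #>\<^bsub>G\<^esub> a"
  proof
   fix z assume z: "z \<in> ?f (h a)"
   have "(z \<otimes>\<^bsub>G\<^esub> inv\<^bsub>G\<^esub> a) \<otimes>\<^bsub>G\<^esub> a \<in> kernel G H h #>\<^bsub>G\<^esub> a"
    by (rule G.rcosI) (use z a in \<open>auto simp: kernel_def\<close>)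
   thus "z \<in> kernel G H h #>\<^bsub>G\<^esub> a" using z a by (simp add: G.m_assoc)
  qed
 qed
 have "rcosets\<^bsub>G\<^esub> (kernel G H h) = ?f ` h ` carrier G"
  unfolding RCOSETS_def using cos by (auto simp: image_image)
 moreover have "inj_on ?f (h ` carrier G)"
 proof (rule inj_onI)
  fix y z assume y: "y \<in> h ` carrier G" and e: "?f y = ?f z"
  obtain a where "y = h a" "a \<in> carrier G" using y by (rule imageE)
  hence "a \<in> ?f z" unfolding e[symmetric] by simp
  thus "y = z" using \<open>y = h a\<close> by simp
 qed
 ultimately show ?thesis by (simp add: card_image)
qed

lemma (in group_hom) kernel_index_prime_power:
 assumes p: "prime p" and o: "order H = p ^ k"
 shows "\<exists>j. card (rcosets\<^bsub>G\<^esub> (kernel G H h)) = p ^ j"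
proof -
 have "subgroup (h ` carrier G) H" by (rule img_is_subgroup)
 from H.lagrange[OF this] have "card (h ` carrier G) dvd p ^ k" unfolding o by (metis dvd_triv_right)
 thus ?thesis unfolding card_rcosets_kernel using divides_primepow_nat[OF p] by blast
qed

lemma (in group_hom) surj_order_prime_power:
 assumes p: "prime p" and o: "order G = p ^ k" and s: "h ` carrier G = carrier H"
 shows "\<exists>j. order H = p ^ j"
proof -
 have "card (rcosets\<^bsub>G\<^esub> (kernel G H h)) dvd p ^ k"
  using G.lagrange[OF subgroup_kernel] unfolding o by (metis dvd_triv_left)
 thus ?thesis using s divides_primepow_nat[OF p] by (auto simp: card_rcosets_kernel order_def)
qed

locale pro_p_completed = group \<Gamma> for \<Gamma> :: "('a, 'b) monoid_scheme" (structure) +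
 fixes p :: nat
 assumes prime_p: "prime p"
begin

abbreviation NN ("\<N>") where "\<N> \<equiv> normal_subgroups_p_power_index p \<Gamma>"
abbreviation FF ("\<F>") where "\<F> \<equiv> pro_p_completion p \<Gamma>"
abbreviation TT where "TT \<equiv> pro_p_completion_topology p \<Gamma>"

lemma N_normal: "N \<in> \<N> ==> N \<lhd> \<Gamma>" by (simp add: normal_subgroups_p_power_index_def)
lemma N_subgroup: "N \<in> \<N> ==> subgroup N \<Gamma>" using N_normal normal_imp_subgroup by blast
lemma N_sub: "N \<in> \<N> ==> N \<subseteq> carrier \<Gamma>" using N_subgroup subgroup.subset by blast
lemma N_group: "N \<in> \<N> ==> group (\<Gamma> Mod N)" by (rule normal.factorgroup_is_group[OF N_normal])

lemma N_order: assumes "N \<in> \<N>" obtains k where "order (\<Gamma> Mod N) = p ^ k"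
 using assms by (auto simp: normal_subgroups_p_power_index_def order_def FactGroup_def)

lemma N_finite: assumes "N \<in> \<N>" shows "finite (carrier (\<Gamma> Mod N))"
proof -
 obtain k where "order (\<Gamma> Mod N) = p ^ k" using N_order[OF assms] .
 hence "card (carrier (\<Gamma> Mod N)) > 0" using prime_p by (simp add: order_def prime_gt_0_nat)
 thus ?thesis by (rule card_ge_0_finite)
qed

lemma kernel_in_N:
 assumes h: "h \<in> hom \<Gamma> H" and H: "group H" and o: "order H = p ^ k"
 shows "kernel \<Gamma> H h \<in> \<N>"
proof -
 interpret group_hom \<Gamma> H h using h H by (simp add: group_hom_def group_hom_axioms_def)
 show ?thesis
  using normal_kernel kernel_index_prime_power[OF prime_p o] by (simp add: normal_subgroups_p_power_index_def)
qed

lemma coset_eq_iff: "N \<in> \<N> ==> g \<in> carrier \<Gamma> ==> N #> g = N \<longleftrightarrow> g \<in> N"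
 using coset_join1[of N g] coset_join2[of g N] N_subgroup by blast

lemma coset_hom: "N \<in> \<N> ==> (%g. N #> g) \<in> hom \<Gamma> (\<Gamma> Mod N)"
 by (rule normal.r_coset_hom_Mod[OF N_normal])

text \<open>The intersection is the kernel of the homomorphism into the product of the two
  quotients, whose order is a power of \<open>p\<close>.\<close>

lemma N_Int: assumes N: "N \<in> \<N>" and M: "M \<in> \<N>" shows "N \<inter> M \<in> \<N>"
proof -
 let ?H = "(\<Gamma> Mod N) \<times>\<times> (\<Gamma> Mod M)" and ?h = "%g. (N #> g, M #> g)"
 obtain k l where o: "order (\<Gamma> Mod N) = p ^ k" "order (\<Gamma> Mod M) = p ^ l" using N_order[OF N] N_order[OF M] by metis
 have "?h \<in> hom \<Gamma> ?H" using coset_hom[OF N] coset_hom[OF M] by (auto simp: hom_def DirProd_def)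
 moreover have "group ?H" by (rule DirProd_group[OF N_group[OF N] N_group[OF M]])
 moreover have "order ?H = p ^ (k + l)" using o by (simp add: order_def DirProd_def card_cartesian_product power_add)
 ultimately have "kernel \<Gamma> ?H ?h \<in> \<N>" by (rule kernel_in_N)
 also have "kernel \<Gamma> ?H ?h = N \<inter> M"
  using coset_eq_iff[OF N] coset_eq_iff[OF M] N_sub[OF N] by (auto simp: kernel_def DirProd_def FactGroup_def)
 finally show ?thesis .
qed

lemma carrier_in_N: "carrier \<Gamma> \<in> \<N>"
proof -
 have "rcosets (carrier \<Gamma>) = {carrier \<Gamma>}"
  using coset_join2[OF _ subgroup_self] by (auto simp: RCOSETS_def intro!: bexI[of _ \<one>])
 hence "card (rcosets (carrier \<Gamma>)) = p ^ 0" by simp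
 moreover have "carrier \<Gamma> \<lhd> \<Gamma>" by (rule normal_invI[OF subgroup_self]) simp
 ultimately show ?thesis unfolding normal_subgroups_p_power_index_def by blast
qed

lemma N_INT: "finite J ==> J \<subseteq> \<N> ==> \<exists>N\<in>\<N>. \<forall>M\<in>J. N \<subseteq> M"
proof (induction J rule: finite_induct)
 case empty
 thus ?case using carrier_in_N by auto
next
 case (insert M J)
 then obtain N where "N \<in> \<N>" "\<forall>M\<in>J. N \<subseteq> M" by auto
 thus ?case using insert.prems N_Int[of N M] by (intro bexI[of _ "N \<inter> M"]) auto
qed

lemma completion_carrier:
 "\<xi> \<in> carrier \<F> \<longleftrightarrow> \<xi> \<in> (\<Pi>\<^sub>E N\<in>\<N>. carrier (\<Gamma> Mod N)) \<and> (\<forall>N\<in>\<N>. \<forall>M\<in>\<N>. N \<subseteq> M --> \<xi> N \<subseteq> \<xi> M)"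
 by (simp add: pro_p_completion_def Let_def)

lemma completion_mem: "\<xi> \<in> carrier \<F> ==> N \<in> \<N> ==> \<xi> N \<in> carrier (\<Gamma> Mod N)"
 unfolding completion_carrier by (elim conjE) (rule PiE_mem)

lemma completion_mono: "\<xi> \<in> carrier \<F> ==> N \<in> \<N> ==> M \<in> \<N> ==> N \<subseteq> M ==> \<xi> N \<subseteq> \<xi> M"
 unfolding completion_carrier by simp

lemma completion_ext:
 assumes "\<xi> \<in> carrier \<F>" "\<eta> \<in> carrier \<F>" "!!N. N \<in> \<N> ==> \<xi> N = \<eta> N" shows "\<xi> = \<eta>"
 using assms(1,2)[unfolded completion_carrier] assms(3) by (intro PiE_ext[of \<xi> \<N> "%N. carrier (\<Gamma> Mod N)" \<eta>]) auto

lemma completion_mult: "N \<in> \<N> ==> (\<xi> \<otimes>\<^bsub>\<F>\<^esub> \<eta>) N = \<xi> N <#> \<eta> N"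
 by (simp add: pro_p_completion_def Let_def FactGroup_def)

lemma completion_one: "N \<in> \<N> ==> \<one>\<^bsub>\<F>\<^esub> N = N"
 by (simp add: pro_p_completion_def Let_def FactGroup_def)

lemma completion_rep:
 assumes "\<xi> \<in> carrier \<F>" "N \<in> \<N>" obtains g where "g \<in> carrier \<Gamma>" "g \<in> \<xi> N" "\<xi> N = N #> g"
proof -
 obtain g where "g \<in> carrier \<Gamma>" "\<xi> N = N #> g"
  using completion_mem[OF assms] by (auto simp: FactGroup_def RCOSETS_def)
 thus thesis using that[of g] rcos_self[OF _ N_subgroup[OF assms(2)], of g] by simp
qed

lemma Mod_mult_closed: "N \<in> \<N> ==> A \<in> carrier (\<Gamma> Mod N) ==> B \<in> carrier (\<Gamma> Mod N) ==> A <#> B \<in> carrier (\<Gamma> Mod N)"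
 using group.is_monoid[OF N_group] monoid.m_closed by (fastforce simp: FactGroup_def)

lemma group_completion: "group \<F>"
proof (rule groupI)
 show one: "\<one>\<^bsub>\<F>\<^esub> \<in> carrier \<F>"
 proof -
  have "N \<in> carrier (\<Gamma> Mod N)" if "N \<in> \<N>" for N
   using monoid.one_closed[OF group.is_monoid[OF N_group[OF that]]] by (simp add: FactGroup_def)
  thus ?thesis unfolding completion_carrier using completion_one
   by (auto simp: pro_p_completion_def Let_def FactGroup_def)
 qed
 show mult: "\<xi> \<otimes>\<^bsub>\<F>\<^esub> \<eta> \<in> carrier \<F>" if \<xi>: "\<xi> \<in> carrier \<F>" and \<eta>: "\<eta> \<in> carrier \<F>" for \<xi> \<eta>
  unfolding completion_carrier
 proof (intro conjI ballI impI)
  show "\<xi> \<otimes>\<^bsub>\<F>\<^esub> \<eta> \<in> (\<Pi>\<^sub>E N\<in>\<N>. carrier (\<Gamma> Mod N))"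
  proof (rule PiE_I)
   show "(\<xi> \<otimes>\<^bsub>\<F>\<^esub> \<eta>) N \<in> carrier (\<Gamma> Mod N)" if "N \<in> \<N>" for N
    unfolding completion_mult[OF that] by (intro Mod_mult_closed that completion_mem \<xi> \<eta>)
   show "(\<xi> \<otimes>\<^bsub>\<F>\<^esub> \<eta>) N = undefined" if "N \<notin> \<N>" for N
    using that by (simp add: pro_p_completion_def Let_def)
  qed
  fix N M assume NM: "N \<in> \<N>" "M \<in> \<N>" "N \<subseteq> M"
  have "\<xi> N <#> \<eta> N \<subseteq> \<xi> M <#> \<eta> M"
   by (rule mono_set_mult[OF completion_mono[OF \<xi> NM] completion_mono[OF \<eta> NM]])
  thus "(\<xi> \<otimes>\<^bsub>\<F>\<^esub> \<eta>) N \<subseteq> (\<xi> \<otimes>\<^bsub>\<F>\<^esub> \<eta>) M" using NM by (simp add: completion_mult)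
 qed
 fix \<xi> assume \<xi>: "\<xi> \<in> carrier \<F>"
 show "\<one>\<^bsub>\<F>\<^esub> \<otimes>\<^bsub>\<F>\<^esub> \<xi> = \<xi>"
 proof (rule completion_ext[OF mult[OF one \<xi>] \<xi>])
  fix N assume N: "N \<in> \<N>"
  have "\<one>\<^bsub>\<Gamma> Mod N\<^esub> \<otimes>\<^bsub>\<Gamma> Mod N\<^esub> \<xi> N = \<xi> N"
   by (rule monoid.l_one[OF group.is_monoid[OF N_group[OF N]] completion_mem[OF \<xi> N]])
  thus "(\<one>\<^bsub>\<F>\<^esub> \<otimes>\<^bsub>\<F>\<^esub> \<xi>) N = \<xi> N" using N by (simp add: completion_mult completion_one FactGroup_def)
 qed
 define \<eta> where "\<eta> = (\<lambda>N\<in>\<N>. set_inv (\<xi> N))"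
 have \<eta>N: "\<eta> N = inv\<^bsub>\<Gamma> Mod N\<^esub> (\<xi> N)" if "N \<in> \<N>" for N
  using normal.inv_FactGroup[OF N_normal[OF that] completion_mem[OF \<xi> that]] that by (simp add: \<eta>_def)
 have \<eta>: "\<eta> \<in> carrier \<F>"
  unfolding completion_carrier
 proof (intro conjI ballI impI)
  show "\<eta> \<in> (\<Pi>\<^sub>E N\<in>\<N>. carrier (\<Gamma> Mod N))"
   using \<eta>N group.inv_closed[OF N_group completion_mem[OF \<xi>]] by (auto simp: PiE_iff) (simp add: \<eta>_def)
  fix N M assume NM: "N \<in> \<N>" "M \<in> \<N>" "N \<subseteq> M"
  show "\<eta> N \<subseteq> \<eta> M" using completion_mono[OF \<xi> NM] NM(1,2) by (auto simp: \<eta>_def SET_INV_def)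
 qed
 moreover have "\<eta> \<otimes>\<^bsub>\<F>\<^esub> \<xi> = \<one>\<^bsub>\<F>\<^esub>"
 proof (rule completion_ext[OF mult[OF \<eta> \<xi>] one])
  fix N assume N: "N \<in> \<N>"
  have "\<eta> N \<otimes>\<^bsub>\<Gamma> Mod N\<^esub> \<xi> N = \<one>\<^bsub>\<Gamma> Mod N\<^esub>"
   unfolding \<eta>N[OF N] by (rule group.l_inv[OF N_group[OF N] completion_mem[OF \<xi> N]])
  thus "(\<eta> \<otimes>\<^bsub>\<F>\<^esub> \<xi>) N = \<one>\<^bsub>\<F>\<^esub> N" using N by (simp add: completion_mult completion_one FactGroup_def)
 qed
 ultimately show "\<exists>\<eta>\<in>carrier \<F>. \<eta> \<otimes>\<^bsub>\<F>\<^esub> \<xi> = \<one>\<^bsub>\<F>\<^esub>" by blast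
 fix \<zeta> \<theta> assume \<zeta>: "\<zeta> \<in> carrier \<F>" and \<theta>: "\<theta> \<in> carrier \<F>"
 show "\<xi> \<otimes>\<^bsub>\<F>\<^esub> \<zeta> \<otimes>\<^bsub>\<F>\<^esub> \<theta> = \<xi> \<otimes>\<^bsub>\<F>\<^esub> (\<zeta> \<otimes>\<^bsub>\<F>\<^esub> \<theta>)"
 proof (rule completion_ext[OF mult[OF mult[OF \<xi> \<zeta>] \<theta>] mult[OF \<xi> mult[OF \<zeta> \<theta>]]])
  fix N assume N: "N \<in> \<N>"
  have "\<xi> N \<otimes>\<^bsub>\<Gamma> Mod N\<^esub> \<zeta> N \<otimes>\<^bsub>\<Gamma> Mod N\<^esub> \<theta> N = \<xi> N \<otimes>\<^bsub>\<Gamma> Mod N\<^esub> (\<zeta> N \<otimes>\<^bsub>\<Gamma> Mod N\<^esub> \<theta> N)"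
   by (rule monoid.m_assoc[OF group.is_monoid[OF N_group[OF N]]]) (rule completion_mem[OF _ N], fact)+
  thus "(\<xi> \<otimes>\<^bsub>\<F>\<^esub> \<zeta> \<otimes>\<^bsub>\<F>\<^esub> \<theta>) N = (\<xi> \<otimes>\<^bsub>\<F>\<^esub> (\<zeta> \<otimes>\<^bsub>\<F>\<^esub> \<theta>)) N"
   using N by (simp add: completion_mult FactGroup_def)
 qed
qed

sublocale F: group \<F> by (rule group_completion)

lemma proj_hom: "N \<in> \<N> ==> group_hom \<F> (\<Gamma> Mod N) (%\<xi>. \<xi> N)"
 unfolding group_hom_def group_hom_axioms_def using N_group group_completion completion_mem
 by (auto intro!: homI simp: completion_mult FactGroup_def)

definition cyl :: "'a set => 'a set set => ('a set => 'a set) set" where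
 "cyl N S = {\<xi> \<in> carrier \<F>. \<xi> N \<in> S}"

lemma topspace_TT: "topspace TT = carrier \<F>"
proof -
 have "carrier \<F> \<subseteq> (\<Pi>\<^sub>E N\<in>\<N>. carrier (\<Gamma> Mod N))" by (rule subsetI) (simp only: completion_carrier)
 thus ?thesis by (simp add: pro_p_completion_topology_def Int_absorb1)
qed

lemma proj_continuous: "N \<in> \<N> ==> continuous_map TT (discrete_topology (carrier (\<Gamma> Mod N))) (%\<xi>. \<xi> N)"
 unfolding pro_p_completion_topology_def
 by (rule continuous_map_from_subtopology) (rule continuous_map_product_projection)

lemma cyl_open: assumes N: "N \<in> \<N>" shows "openin TT (cyl N S)"
proof -
 have "openin TT {\<xi> \<in> topspace TT. \<xi> N \<in> S \<inter> carrier (\<Gamma> Mod N)}"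
  by (rule openin_continuous_map_preimage[OF proj_continuous[OF N]]) simp
 also have "{\<xi> \<in> topspace TT. \<xi> N \<in> S \<inter> carrier (\<Gamma> Mod N)} = cyl N S"
  using completion_mem[OF _ N] by (auto simp: cyl_def topspace_TT)
 finally show ?thesis .
qed

text \<open>A basic open set of the product restricts finitely many coordinates only. One
  \<open>N\<close> inside the corresponding subgroups suffices, because the coordinate of a
  compatible family at \<open>N\<close> determines those at all larger subgroups.\<close>

lemma cyl_basis:
 assumes W: "openin TT W" and \<xi>: "\<xi> \<in> W"
 shows "\<exists>N\<in>\<N>. cyl N {\<xi> N} \<subseteq> W"
proof -
 let ?P = "product_topology (%N. discrete_topology (carrier (\<Gamma> Mod N))) \<N>"
 obtain S where S: "openin ?P S" "W = S \<inter> carrier \<F>"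
  using W unfolding pro_p_completion_topology_def openin_subtopology by blast
 have "\<xi> \<in> S" using \<xi> S(2) by simp
 with S(1)[unfolded openin_product_topology_alt]
 have "\<exists>U. finite {N \<in> \<N>. U N ~= topspace (discrete_topology (carrier (\<Gamma> Mod N)))} \<and>
   (\<forall>N\<in>\<N>. openin (discrete_topology (carrier (\<Gamma> Mod N))) (U N)) \<and> \<xi> \<in> Pi\<^sub>E \<N> U \<and> Pi\<^sub>E \<N> U \<subseteq> S"
  by (rule bspec)
 then obtain U where U: "finite {N \<in> \<N>. U N ~= topspace (discrete_topology (carrier (\<Gamma> Mod N)))}"
   "\<xi> \<in> Pi\<^sub>E \<N> U" "Pi\<^sub>E \<N> U \<subseteq> S"
  by (elim exE conjE)
 define J where "J = {N \<in> \<N>. U N ~= topspace (discrete_topology (carrier (\<Gamma> Mod N)))}"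
 have "finite J" "J \<subseteq> \<N>" using U(1) by (auto simp: J_def)
 then obtain N where N: "N \<in> \<N>" "\<forall>M\<in>J. N \<subseteq> M" using N_INT by blast
 have \<xi>F: "\<xi> \<in> carrier \<F>" using \<xi> S(2) by simp
 have "cyl N {\<xi> N} \<subseteq> W"
 proof
  fix \<eta> assume "\<eta> \<in> cyl N {\<xi> N}"
  hence \<eta>: "\<eta> \<in> carrier \<F>" "\<eta> N = \<xi> N" by (auto simp: cyl_def)
  have "\<eta> M \<in> U M" if M: "M \<in> \<N>" for M
  proof (cases "M \<in> J")
   case True
   hence NM: "N \<subseteq> M" using N(2) by simp
   obtain g where g: "g \<in> carrier \<Gamma>" "g \<in> \<xi> N" "\<xi> N = N #> g" using completion_rep[OF \<xi>F N(1)] .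
   have eq: "\<zeta> M = M #> g" if \<zeta>: "\<zeta> \<in> carrier \<F>" "\<zeta> N = \<xi> N" for \<zeta>
   proof -
    have "g \<in> \<zeta> M" using completion_mono[OF \<zeta>(1) N(1) M NM] g(2) \<zeta>(2) by blast
    moreover obtain h where "h \<in> carrier \<Gamma>" "\<zeta> M = M #> h" using completion_rep[OF \<zeta>(1) M] .
    ultimately show ?thesis using repr_independence[of g M h] N_subgroup[OF M] by simp
   qed
   have "\<eta> M = \<xi> M" using eq[OF \<eta>] eq[OF \<xi>F HOL.refl] by simp
   thus ?thesis using PiE_mem[OF U(2) M] by simp
  next
   case False
   hence "U M = carrier (\<Gamma> Mod M)" using M by (simp add: J_def)
   thus ?thesis using completion_mem[OF \<eta>(1) M] by simp
  qed
  moreover have "\<eta> \<in> extensional \<N>" using \<eta>(1) unfolding completion_carrier by (auto simp: PiE_iff)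
  ultimately have "\<eta> \<in> Pi\<^sub>E \<N> U" by (simp add: PiE_iff)
  thus "\<eta> \<in> W" using U(3) \<eta>(1) S(2) by blast
 qed
 thus ?thesis using N(1) by blast
qed

lemma cyl_self: "\<xi> \<in> carrier \<F> ==> \<xi> \<in> cyl N {\<xi> N}" by (simp add: cyl_def)

lemma continuous_into_completion:
 assumes "!!y. y \<in> topspace Y ==> f y \<in> carrier \<F>"
  and "!!N y. N \<in> \<N> ==> y \<in> topspace Y ==> \<exists>W. openin Y W \<and> y \<in> W \<and> (\<forall>y'\<in>W. f y' N = f y N)"
 shows "continuous_map Y TT f"
 unfolding continuous_map_def
proof (intro conjI allI impI)
 show "f \<in> topspace Y \<rightarrow> topspace TT" using assms(1) by (simp add: topspace_TT)
 fix S assume S: "openin TT S"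
 show "openin Y {y \<in> topspace Y. f y \<in> S}"
 proof (subst openin_subopen, intro ballI)
  fix y assume "y \<in> {y \<in> topspace Y. f y \<in> S}"
  hence y: "y \<in> topspace Y" "f y \<in> S" by auto
  obtain N where N: "N \<in> \<N>" "cyl N {f y N} \<subseteq> S" using cyl_basis[OF S y(2)] by blast
  obtain W where W: "openin Y W" "y \<in> W" "\<forall>y'\<in>W. f y' N = f y N" using assms(2)[OF N(1) y(1)] by blast
  have "W \<subseteq> {y \<in> topspace Y. f y \<in> S}"
  proof
   fix y' assume y': "y' \<in> W"
   hence t: "y' \<in> topspace Y" using openin_subset[OF W(1)] by blast
   hence "f y' \<in> cyl N {f y N}" using W(3) y' assms(1) by (simp add: cyl_def)
   thus "y' \<in> {y \<in> topspace Y. f y \<in> S}" using N(2) t by blast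
  qed
  thus "\<exists>W. openin Y W \<and> y \<in> W \<and> W \<subseteq> {y \<in> topspace Y. f y \<in> S}" using W by blast
 qed
qed

lemma completion_topological_group: "topological_group \<F> TT"
proof (unfold_locales)
 show "topspace TT = carrier \<F>" by (rule topspace_TT)
 show "continuous_map (prod_topology TT TT) TT (%(\<xi>, \<eta>). \<xi> \<otimes>\<^bsub>\<F>\<^esub> \<eta>)"
 proof (rule continuous_into_completion)
  fix y assume "y \<in> topspace (prod_topology TT TT)"
  then obtain \<xi> \<eta> where y: "y = (\<xi>, \<eta>)" "\<xi> \<in> carrier \<F>" "\<eta> \<in> carrier \<F>" by (auto simp: topspace_TT)
  thus "(case y of (\<xi>, \<eta>) => \<xi> \<otimes>\<^bsub>\<F>\<^esub> \<eta>) \<in> carrier \<F>" by simp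
  fix N assume N: "N \<in> \<N>"
  have "openin (prod_topology TT TT) (cyl N {\<xi> N} \<times> cyl N {\<eta> N})"
   using cyl_open[OF N] by (simp add: openin_prod_Times_iff)
  moreover have "y \<in> cyl N {\<xi> N} \<times> cyl N {\<eta> N}" using y cyl_self by simp
  moreover have "\<forall>y'\<in>cyl N {\<xi> N} \<times> cyl N {\<eta> N}.
    (case y' of (\<xi>, \<eta>) => \<xi> \<otimes>\<^bsub>\<F>\<^esub> \<eta>) N = (case y of (\<xi>, \<eta>) => \<xi> \<otimes>\<^bsub>\<F>\<^esub> \<eta>) N"
   using y N by (auto simp: completion_mult cyl_def)
  ultimately show "\<exists>W. openin (prod_topology TT TT) W \<and> y \<in> W \<and>
    (\<forall>y'\<in>W. (case y' of (\<xi>, \<eta>) => \<xi> \<otimes>\<^bsub>\<F>\<^esub> \<eta>) N = (case y of (\<xi>, \<eta>) => \<xi> \<otimes>\<^bsub>\<F>\<^esub> \<eta>) N)"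
   by (intro exI[of _ "cyl N {\<xi> N} \<times> cyl N {\<eta> N}"] conjI)
 qed
 show "continuous_map TT TT (%\<xi>. inv\<^bsub>\<F>\<^esub> \<xi>)"
 proof (rule continuous_into_completion)
  fix \<xi> assume "\<xi> \<in> topspace TT"
  hence \<xi>: "\<xi> \<in> carrier \<F>" by (simp add: topspace_TT)
  thus "inv\<^bsub>\<F>\<^esub> \<xi> \<in> carrier \<F>" by simp
  fix N assume N: "N \<in> \<N>"
  have i: "(inv\<^bsub>\<F>\<^esub> \<eta>) N = inv\<^bsub>\<Gamma> Mod N\<^esub> (\<eta> N)" if "\<eta> \<in> carrier \<F>" for \<eta>
   by (rule group_hom.hom_inv[OF proj_hom[OF N] that])
  show "\<exists>W. openin TT W \<and> \<xi> \<in> W \<and> (\<forall>y'\<in>W. (inv\<^bsub>\<F>\<^esub> y') N = (inv\<^bsub>\<F>\<^esub> \<xi>) N)"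
  proof (intro exI[of _ "cyl N {\<xi> N}"] conjI ballI)
   show "openin TT (cyl N {\<xi> N})" by (rule cyl_open[OF N])
   show "\<xi> \<in> cyl N {\<xi> N}" by (rule cyl_self[OF \<xi>])
   show "(inv\<^bsub>\<F>\<^esub> \<eta>) N = (inv\<^bsub>\<F>\<^esub> \<xi>) N" if "\<eta> \<in> cyl N {\<xi> N}" for \<eta>
    using that by (simp add: cyl_def i \<xi>)
  qed
 qed
qed

text \<open>The product of the finite quotients is compact. Compatibility is an intersection of
  closed conditions on two coordinates each: for given \<open>N\<close>, \<open>M\<close> and
  \<open>C\<close>, either the coordinate at \<open>N\<close> differs from \<open>C\<close> or the
  one at \<open>M\<close> contains \<open>C\<close>.\<close>

lemma completion_compact: "compact_space TT"
proof -
 let ?P = "product_topology (%N. discrete_topology (carrier (\<Gamma> Mod N))) \<N>"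
 let ?E = "\<Pi>\<^sub>E N\<in>\<N>. carrier (\<Gamma> Mod N)"
 have cP: "compact_space ?P"
  unfolding compact_space_product_topology using N_finite by (simp add: compact_space_discrete_topology)
 define B where "B = (%(N, M, C). {\<xi> \<in> topspace ?P. \<xi> N \<in> carrier (\<Gamma> Mod N) - {C}} \<union>
   {\<xi> \<in> topspace ?P. \<xi> M \<in> {D \<in> carrier (\<Gamma> Mod M). C \<subseteq> D}})"
 define I where "I = {(N, M, C). N \<in> \<N> \<and> M \<in> \<N> \<and> N \<subseteq> M \<and> C \<in> carrier (\<Gamma> Mod N)}"
 have cB: "closedin ?P (B i)" if "i \<in> I" for i
 proof -
  obtain N M C where e: "i = (N, M, C)" by (cases i)
  have i: "i = (N, M, C)" "N \<in> \<N>" "M \<in> \<N>" using that e by (simp_all add: I_def)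
  show ?thesis unfolding B_def i(1) prod.case
   by (intro closedin_Un closedin_continuous_map_preimage[OF continuous_map_product_projection[OF i(2)]]
     closedin_continuous_map_preimage[OF continuous_map_product_projection[OF i(3)]]) auto
 qed
 have "carrier \<F> = topspace ?P \<inter> \<Inter>(B ` I)"
 proof
  show "carrier \<F> \<subseteq> topspace ?P \<inter> \<Inter>(B ` I)"
  proof
   fix \<xi> assume \<xi>: "\<xi> \<in> carrier \<F>"
   have \<xi>E: "\<xi> \<in> ?E" using \<xi> by (simp only: completion_carrier)
   have "\<xi> \<in> B i" if iI: "i \<in> I" for i
   proof -
    obtain N M C where e: "i = (N, M, C)" by (cases i)
    have i: "N \<in> \<N>" "M \<in> \<N>" "N \<subseteq> M" using iI e by (simp_all add: I_def)
    show ?thesis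
     using completion_mono[OF \<xi> i] PiE_mem[OF \<xi>E i(1)] PiE_mem[OF \<xi>E i(2)] \<xi>E
     by (cases "\<xi> N = C") (simp_all add: B_def e)
   qed
   thus "\<xi> \<in> topspace ?P \<inter> \<Inter>(B ` I)" using \<xi>E by simp
  qed
  show "topspace ?P \<inter> \<Inter>(B ` I) \<subseteq> carrier \<F>"
  proof
   fix \<xi> assume \<xi>: "\<xi> \<in> topspace ?P \<inter> \<Inter>(B ` I)"
   have \<xi>E: "\<xi> \<in> ?E" using \<xi> by simp
   have "\<xi> N \<subseteq> \<xi> M" if NM: "N \<in> \<N>" "M \<in> \<N>" "N \<subseteq> M" for N M
   proof -
    have "(N, M, \<xi> N) \<in> I" using NM PiE_mem[OF \<xi>E NM(1)] by (simp add: I_def)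
    hence "\<xi> \<in> B (N, M, \<xi> N)" using \<xi> by blast
    thus ?thesis by (auto simp: B_def)
   qed
   thus "\<xi> \<in> carrier \<F>" unfolding completion_carrier using \<xi>E by blast
  qed
 qed
 moreover have "closedin ?P (topspace ?P \<inter> \<Inter>(B ` I))"
 proof (cases "I = {}")
  case False
  thus ?thesis using cB by (intro closedin_Int closedin_topspace closedin_Inter) auto
 next
  case True
  hence e: "topspace ?P \<inter> \<Inter>(B ` I) = topspace ?P" by (simp only: image_empty Inter_empty Int_UNIV_right)
  show ?thesis unfolding e by (rule closedin_topspace)
 qed
 ultimately have "closedin ?P (carrier \<F>)" by simp
 thus ?thesis
  unfolding pro_p_completion_topology_def by (intro compact_space_subtopology closedin_compact_space[OF cP])
qed

definition V :: "'a set => ('a set => 'a set) set" where "V N = kernel \<F> (\<Gamma> Mod N) (%\<xi>. \<xi> N)"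

text \<open>An open normal subgroup contains the kernel of the projection to some
  \<open>\<Gamma> Mod N\<close>, so the quotient by it is a homomorphic image of a finite p-group.
  Connected sets are points because their coordinates are.\<close>

lemma completion_pro_p: "pro_p_group p \<F> TT"
proof -
 interpret topological_group \<F> TT by (rule completion_topological_group)
 show ?thesis
 proof (unfold_locales)
  show "compact_space TT" by (rule completion_compact)
  show "Hausdorff_space TT"
   unfolding pro_p_completion_topology_def
   by (rule Hausdorff_space_subtopology) (simp add: Hausdorff_space_product_topology)
  show "\<exists>x. C \<subseteq> {x}" if C: "connectedin TT C" for C
  proof (cases "C = {}")
   case False
   then obtain \<xi> where \<xi>: "\<xi> \<in> C" by blast
   have CF: "C \<subseteq> carrier \<F>" using connectedin_subset_topspace[OF C] by (simp add: topspace_TT)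
   have "\<eta> = \<xi>" if \<eta>: "\<eta> \<in> C" for \<eta>
   proof (rule completion_ext)
    show "\<eta> \<in> carrier \<F>" "\<xi> \<in> carrier \<F>" using CF \<xi> \<eta> by auto
    fix N assume N: "N \<in> \<N>"
    have "connectedin (discrete_topology (carrier (\<Gamma> Mod N))) ((%\<xi>. \<xi> N) ` C)"
     by (rule connectedin_continuous_map_image[OF proj_continuous[OF N] C])
    then obtain a where "(%\<xi>. \<xi> N) ` C \<subseteq> {a}" unfolding connectedin_discrete_topology by blast
    thus "\<eta> N = \<xi> N" using \<xi> \<eta> by blast
   qed
   thus ?thesis by blast
  qed simp
  show "prime p" by (rule prime_p)
  fix W assume W: "W \<lhd> \<F>" "openin TT W"
  have sW: "subgroup W \<F>" using W(1) by (rule normal_imp_subgroup)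
  obtain N where N: "N \<in> \<N>" "cyl N {\<one>\<^bsub>\<F>\<^esub> N} \<subseteq> W" using cyl_basis[OF W(2) subgroup.one_closed[OF sW]] by blast
  interpret pr: group_hom \<F> "\<Gamma> Mod N" "%\<xi>. \<xi> N" by (rule proj_hom[OF N(1)])
  have VW: "V N \<subseteq> W" using N by (auto simp: V_def kernel_def cyl_def completion_one FactGroup_def)
  have VN: "V N \<lhd> \<F>" unfolding V_def by (rule pr.normal_kernel)
  obtain k where k: "order (\<Gamma> Mod N) = p ^ k" using N_order[OF N(1)] .
  obtain j where j: "card (rcosets\<^bsub>\<F>\<^esub> (V N)) = p ^ j"
   unfolding V_def using pr.kernel_index_prime_power[OF prime_p k] by blast
  interpret Wn: normal W \<F> by (rule W(1))
  interpret Vn: normal "V N" \<F> by (rule VN)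
  have gh: "group_hom \<F> (\<F> Mod W) (%\<xi>. W #>\<^bsub>\<F>\<^esub> \<xi>)"
   using Wn.r_coset_hom_Mod Wn.factorgroup_is_group by (simp add: group_hom_def group_hom_axioms_def group_completion)
  have Vk: "V N \<subseteq> kernel \<F> (\<F> Mod W) (%\<xi>. W #>\<^bsub>\<F>\<^esub> \<xi>)"
  proof
   fix v assume v: "v \<in> V N"
   have "v \<in> W" "v \<in> carrier \<F>" using v VW Vn.subset by auto
   thus "v \<in> kernel \<F> (\<F> Mod W) (%\<xi>. W #>\<^bsub>\<F>\<^esub> \<xi>)"
    using F.coset_join2[OF _ sW] by (simp add: kernel_def FactGroup_def)
  qed
  obtain \<theta> where \<theta>: "\<theta> \<in> hom (\<F> Mod V N) (\<F> Mod W)"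
    "!!\<xi>. \<xi> \<in> carrier \<F> ==> \<theta> (V N #>\<^bsub>\<F>\<^esub> \<xi>) = W #>\<^bsub>\<F>\<^esub> \<xi>"
   using group_hom.FactGroup_universal_kernel[OF gh VN Vk] by blast
  interpret th: group_hom "\<F> Mod V N" "\<F> Mod W" \<theta>
   using \<theta>(1) Wn.factorgroup_is_group Vn.factorgroup_is_group by (simp add: group_hom_def group_hom_axioms_def)
  have "\<theta> ` carrier (\<F> Mod V N) = carrier (\<F> Mod W)"
   using \<theta>(2) by (force simp: FactGroup_def RCOSETS_def image_UN)
  from th.surj_order_prime_power[OF prime_p _ this, of j] j
  show "\<exists>k. card (rcosets\<^bsub>\<F>\<^esub> W) = p ^ k" by (simp add: order_def FactGroup_def)
 qed
qed

definition iota :: "'a => 'a set => 'a set" where "iota g = (\<lambda>N\<in>\<N>. N #> g)"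

lemma iota_closed: assumes g: "g \<in> carrier \<Gamma>" shows "iota g \<in> carrier \<F>"
 unfolding completion_carrier iota_def
 using g N_sub by (auto simp: FactGroup_def intro!: rcosetsI) (auto simp: r_coset_def)

lemma iota_hom: "iota \<in> hom \<Gamma> \<F>"
proof (rule homI)
 fix g h assume g: "g \<in> carrier \<Gamma>" and h: "h \<in> carrier \<Gamma>"
 show "iota (g \<otimes> h) = iota g \<otimes>\<^bsub>\<F>\<^esub> iota h"
 proof (rule completion_ext)
  show "iota (g \<otimes> h) \<in> carrier \<F>" "iota g \<otimes>\<^bsub>\<F>\<^esub> iota h \<in> carrier \<F>" using g h iota_closed by simp_all
  fix N assume N: "N \<in> \<N>"
  show "iota (g \<otimes> h) N = (iota g \<otimes>\<^bsub>\<F>\<^esub> iota h) N"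
   using N normal.rcos_sum[OF N_normal[OF N] g h] by (simp add: completion_mult iota_def)
 qed
qed (rule iota_closed)

lemma iota_dense:
 assumes Y: "Y \<subseteq> carrier \<Gamma>" "generate \<Gamma> Y = carrier \<Gamma>"
 shows "TT closure_of (generate \<F> (iota ` Y)) = carrier \<F>"
proof
 interpret i: group_hom \<Gamma> \<F> iota using iota_hom by (simp add: group_hom_def group_hom_axioms_def group_completion)
 have gen: "generate \<F> (iota ` Y) = iota ` carrier \<Gamma>" using i.generate_img[OF Y(1)] Y(2) by simp
 show "TT closure_of (generate \<F> (iota ` Y)) \<subseteq> carrier \<F>"
  using closure_of_subset_topspace[of TT] by (simp add: topspace_TT)
 show "carrier \<F> \<subseteq> TT closure_of (generate \<F> (iota ` Y))"
 proof
  fix \<xi> assume \<xi>: "\<xi> \<in> carrier \<F>"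
  have "\<exists>y. y \<in> iota ` carrier \<Gamma> \<and> y \<in> W" if W: "\<xi> \<in> W" "openin TT W" for W
  proof -
   obtain N where N: "N \<in> \<N>" "cyl N {\<xi> N} \<subseteq> W" using cyl_basis[OF W(2,1)] by blast
   obtain g where g: "g \<in> carrier \<Gamma>" "g \<in> \<xi> N" "\<xi> N = N #> g" using completion_rep[OF \<xi> N(1)] .
   have "iota g \<in> cyl N {\<xi> N}" using iota_closed[OF g(1)] g(3) N(1) by (simp add: cyl_def iota_def)
   thus ?thesis using N(2) g(1) by blast
  qed
  thus "\<xi> \<in> TT closure_of (generate \<F> (iota ` Y))" unfolding in_closure_of gen using \<xi> by (simp add: topspace_TT)
 qed
qed

end

text \<open>The extension of \<open>\<psi>\<close> to the completion maps \<open>\<xi>\<close> to the only common point of the cosets of the open normal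
 subgroups that \<open>\<xi>\<close> determines.\<close>

locale pro_p_extension = pro_p_completed \<Gamma> p + H: pro_p_group p H TH
 for \<Gamma> :: "('a, 'b) monoid_scheme" and p :: nat
  and H :: "('h, 'c) monoid_scheme" (structure) and TH :: "'h topology" +
 fixes \<psi> :: "'a => 'h"
 assumes psi_hom: "\<psi> \<in> hom \<Gamma> H"
begin

abbreviation "OH \<equiv> open_normal_subgroups H TH"

definition pre :: "'h set => 'a set" where "pre U = {g \<in> carrier \<Gamma>. \<psi> g \<in> U}"

lemma psi_closed: "g \<in> carrier \<Gamma> ==> \<psi> g \<in> carrier H" using psi_hom by (rule hom_in_carrier)
lemma psi_mult: "g \<in> carrier \<Gamma> ==> h \<in> carrier \<Gamma> ==> \<psi> (g \<otimes>\<^bsub>\<Gamma>\<^esub> h) = \<psi> g \<otimes> \<psi> h" by (rule hom_mult[OF psi_hom])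

text \<open>The preimage is the kernel of the composite with the projection to
  \<open>H Mod U\<close>, a finite p-group. It is therefore one of the coordinates of the
  completion.\<close>

lemma pre_in_N: assumes U: "U \<in> OH" shows "pre U \<in> \<N>"
proof -
 have N: "U \<lhd> H" and s: "subgroup U H" using H.ons_normal[OF U] H.ons_subgroup[OF U] .
 have "(%g. U #> \<psi> g) \<in> hom \<Gamma> (H Mod U)"
 proof (rule homI)
  show "U #> \<psi> g \<in> carrier (H Mod U)" if "g \<in> carrier \<Gamma>" for g
   by (simp add: FactGroup_def H.coset_in_rcosets[OF U psi_closed[OF that]])
  show "U #> \<psi> (g \<otimes>\<^bsub>\<Gamma>\<^esub> h) = (U #> \<psi> g) \<otimes>\<^bsub>H Mod U\<^esub> (U #> \<psi> h)"
   if "g \<in> carrier \<Gamma>" "h \<in> carrier \<Gamma>" for g h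
   using that by (simp add: FactGroup_def psi_mult normal.rcos_sum[OF N psi_closed psi_closed])
 qed
 moreover obtain k where "order (H Mod U) = p ^ k" using H.ons_index[OF U] by (auto simp: order_def FactGroup_def)
 ultimately have "kernel \<Gamma> (H Mod U) (%g. U #> \<psi> g) \<in> \<N>"
  using normal.factorgroup_is_group[OF N] by (intro kernel_in_N)
 also have "kernel \<Gamma> (H Mod U) (%g. U #> \<psi> g) = pre U"
 proof -
  have "U #> \<psi> g = U \<longleftrightarrow> \<psi> g \<in> U" if "g \<in> carrier \<Gamma>" for g
   using H.coset_join1[of U "\<psi> g"] H.coset_join2[of "\<psi> g" U] s psi_closed[OF that] by blast
  thus ?thesis by (auto simp: kernel_def pre_def FactGroup_def)
 qed
 finally show ?thesis .
qed

text \<open>All \<open>g\<close> in the coordinate of \<open>\<xi>\<close> at \<open>pre U\<close>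
  give the same coset of \<open>U\<close>; the union avoids choosing one.\<close>

definition target :: "'h set => ('a set => 'a set) => 'h set" where
 "target U \<xi> = (\<Union>g\<in>\<xi> (pre U). U #> \<psi> g)"

lemma target_eq:
 assumes U: "U \<in> OH" and \<xi>: "\<xi> \<in> carrier \<F>" and g: "g \<in> \<xi> (pre U)"
 shows "target U \<xi> = U #> \<psi> g" "g \<in> carrier \<Gamma>"
proof -
 have N: "pre U \<in> \<N>" by (rule pre_in_N[OF U])
 obtain a where a: "a \<in> carrier \<Gamma>" "a \<in> \<xi> (pre U)" "\<xi> (pre U) = pre U #>\<^bsub>\<Gamma>\<^esub> a" using completion_rep[OF \<xi> N] .
 have *: "h \<in> carrier \<Gamma> \<and> U #> \<psi> h = U #> \<psi> a" if "h \<in> \<xi> (pre U)" for h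
 proof -
  obtain n where n: "n \<in> pre U" "h = n \<otimes>\<^bsub>\<Gamma>\<^esub> a" using \<open>h \<in> \<xi> (pre U)\<close> a(3) by (auto simp: r_coset_def)
  have nG: "n \<in> carrier \<Gamma>" "\<psi> n \<in> U" using n(1) by (auto simp: pre_def)
  have "\<psi> h \<in> U #> \<psi> a"
   unfolding n(2) psi_mult[OF nG(1) a(1)]
   by (rule H.rcosI[OF nG(2) subgroup.subset[OF H.ons_subgroup[OF U]] psi_closed[OF a(1)]])
  hence "U #> \<psi> a = U #> \<psi> h"
   by (rule H.repr_independence[OF _ psi_closed[OF a(1)] H.ons_subgroup[OF U]])
  thus ?thesis using n(2) nG(1) a(1) by simp
 qed
 have "target U \<xi> = (\<Union>h\<in>\<xi> (pre U). U #> \<psi> g)"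
  unfolding target_def using * g by (intro SUP_cong) simp_all
 thus "target U \<xi> = U #> \<psi> g" using g by (simp only: UN_constant) auto
 show "g \<in> carrier \<Gamma>" using *[OF g] by simp
qed

lemma target_rep:
 assumes "U \<in> OH" "\<xi> \<in> carrier \<F>"
 obtains g where "g \<in> carrier \<Gamma>" "g \<in> \<xi> (pre U)" "target U \<xi> = U #> \<psi> g"
 using completion_rep[OF assms(2) pre_in_N[OF assms(1)]] target_eq[OF assms] by metis

text \<open>The cosets \<open>target U \<xi>\<close> are closed. Finitely many of them share a point
  \<open>\<psi> g\<close>, with \<open>g\<close> taken from the coordinate of \<open>\<xi>\<close>
  at a level below all of them, so compactness gives a common point.\<close>

lemma target_point:
 assumes \<xi>: "\<xi> \<in> carrier \<F>" shows "\<exists>y. y \<in> carrier H \<and> (\<forall>U\<in>OH. y \<in> target U \<xi>)"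
proof -
 have tc: "closedin TH (target U \<xi>)" if U: "U \<in> OH" for U
 proof -
  obtain g where g: "g \<in> carrier \<Gamma>" "g \<in> \<xi> (pre U)" "target U \<xi> = U #> \<psi> g" using target_rep[OF U \<xi>] .
  show ?thesis unfolding g(3)
   by (rule H.closedin_r_coset[OF H.open_subgroup_closed[OF H.ons_subgroup[OF U] H.ons_open[OF U]] psi_closed[OF g(1)]])
 qed
 have fip: "\<Inter>D ~= {}" if D: "finite D" "D \<subseteq> (%U. target U \<xi>) ` OH" for D
 proof -
  obtain J where J: "J \<subseteq> OH" "finite J" "D = (%U. target U \<xi>) ` J"
   using finite_subset_image[OF D] by metis
  obtain W where W: "W \<in> OH" "!!U. U \<in> J ==> W \<subseteq> U" using H.ons_INT[OF J(2), of "%U. U"] J(1) by blast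
  obtain g where g: "g \<in> carrier \<Gamma>" "g \<in> \<xi> (pre W)" using target_rep[OF W(1) \<xi>] by metis
  have "\<psi> g \<in> target U \<xi>" if U: "U \<in> J" for U
  proof -
   have UO: "U \<in> OH" using U J(1) by blast
   have "pre W \<subseteq> pre U" using W(2)[OF U] by (auto simp: pre_def)
   hence "g \<in> \<xi> (pre U)" using completion_mono[OF \<xi> pre_in_N[OF W(1)] pre_in_N[OF UO]] g(2) by blast
   thus ?thesis
    using target_eq[OF UO \<xi>] H.rcos_self[OF psi_closed[OF g(1)] H.ons_subgroup[OF UO]] by simp
  qed
  hence "\<psi> g \<in> \<Inter>D" unfolding J(3) by simp
  thus ?thesis by blast
 qed
 have "\<Inter>((%U. target U \<xi>) ` OH) ~= {}"
  using H.compact[unfolded compact_space_fip, rule_format, of "(%U. target U \<xi>) ` OH"] tc fip by blast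
 then obtain y where y: "\<forall>U\<in>OH. y \<in> target U \<xi>" by auto
 have "y \<in> target (carrier H) \<xi>" using y H.carrier_in_ons by blast
 hence "y \<in> carrier H" using closedin_subset[OF tc[OF H.carrier_in_ons]] H.topspace_eq by blast
 thus ?thesis using y by blast
qed

lemma target_unique:
 assumes \<xi>: "\<xi> \<in> carrier \<F>" and y: "y \<in> carrier H" "\<forall>U\<in>OH. y \<in> target U \<xi>"
  and z: "z \<in> carrier H" "\<forall>U\<in>OH. z \<in> target U \<xi>"
 shows "y = z"
proof (rule ccontr)
 assume "y ~= z"
 hence ne: "y \<otimes> inv z ~= \<one>" using y(1) z(1) by (simp add: H.inv_solve_right' )
 have "y \<otimes> inv z \<in> carrier H" using y z by simp
 then obtain U where U: "U \<in> OH" "y \<otimes> inv z \<notin> U" using ne by (rule H.ons_separate)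
 have s: "subgroup U H" by (rule H.ons_subgroup[OF U(1)])
 obtain g where g: "g \<in> carrier \<Gamma>" "target U \<xi> = U #> \<psi> g" using target_rep[OF U(1) \<xi>] by metis
 have "z \<in> U #> \<psi> g" "y \<in> U #> \<psi> g" using y(2) z(2) U(1) g(2) by auto
 hence "y \<in> U #> z" using H.repr_independence[OF _ psi_closed[OF g(1)] s, of z] by simp
 then obtain u where "u \<in> U" "y = u \<otimes> z" by (auto simp: r_coset_def)
 hence "y \<otimes> inv z = u" using H.ons_carrier[OF U(1)] z(1) by (simp add: H.m_assoc)
 thus False using U(2) \<open>u \<in> U\<close> by simp
qed

definition ext :: "('a set => 'a set) => 'h" where
 "ext \<xi> = (SOME y. y \<in> carrier H \<and> (\<forall>U\<in>OH. y \<in> target U \<xi>))"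

lemma ext:
 assumes "\<xi> \<in> carrier \<F>" shows "ext \<xi> \<in> carrier H" "U \<in> OH ==> ext \<xi> \<in> target U \<xi>"
 using someI_ex[OF target_point[OF assms]] unfolding ext_def by blast+

lemma ext_eqI:
 assumes "\<xi> \<in> carrier \<F>" "y \<in> carrier H" "!!U. U \<in> OH ==> y \<in> target U \<xi>" shows "ext \<xi> = y"
 by (rule target_unique[OF assms(1)]) (use ext[OF assms(1)] assms in auto)

lemma ext_hom: "ext \<in> hom \<F> H"
proof (rule homI)
 fix \<xi> \<eta> assume \<xi>: "\<xi> \<in> carrier \<F>" and \<eta>: "\<eta> \<in> carrier \<F>"
 have \<xi>\<eta>: "\<xi> \<otimes>\<^bsub>\<F>\<^esub> \<eta> \<in> carrier \<F>" using \<xi> \<eta> by simp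
 show "ext (\<xi> \<otimes>\<^bsub>\<F>\<^esub> \<eta>) = ext \<xi> \<otimes> ext \<eta>"
 proof (rule ext_eqI[OF \<xi>\<eta>])
  show "ext \<xi> \<otimes> ext \<eta> \<in> carrier H" using ext(1) \<xi> \<eta> by simp
  fix U assume U: "U \<in> OH"
  obtain g where g: "g \<in> carrier \<Gamma>" "g \<in> \<xi> (pre U)" "target U \<xi> = U #> \<psi> g" using target_rep[OF U \<xi>] .
  obtain h where h: "h \<in> carrier \<Gamma>" "h \<in> \<eta> (pre U)" "target U \<eta> = U #> \<psi> h" using target_rep[OF U \<eta>] .
  have "g \<otimes>\<^bsub>\<Gamma>\<^esub> h \<in> \<xi> (pre U) <#>\<^bsub>\<Gamma>\<^esub> \<eta> (pre U)" using g(2) h(2) by (auto simp: set_mult_def)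
  hence "g \<otimes>\<^bsub>\<Gamma>\<^esub> h \<in> (\<xi> \<otimes>\<^bsub>\<F>\<^esub> \<eta>) (pre U)" by (simp add: completion_mult[OF pre_in_N[OF U]])
  hence "target U (\<xi> \<otimes>\<^bsub>\<F>\<^esub> \<eta>) = U #> (\<psi> g \<otimes> \<psi> h)"
   using target_eq(1)[OF U \<xi>\<eta>] psi_mult[OF g(1) h(1)] by simp
  also have "... = (U #> \<psi> g) <#> (U #> \<psi> h)"
   by (rule normal.rcos_sum[OF H.ons_normal[OF U] psi_closed[OF g(1)] psi_closed[OF h(1)], symmetric])
  finally have t: "target U (\<xi> \<otimes>\<^bsub>\<F>\<^esub> \<eta>) = target U \<xi> <#> target U \<eta>" unfolding g(3) h(3) .
  show "ext \<xi> \<otimes> ext \<eta> \<in> target U (\<xi> \<otimes>\<^bsub>\<F>\<^esub> \<eta>)"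
   unfolding t set_mult_def using ext(2)[OF \<xi> U] ext(2)[OF \<eta> U] by simp blast
 qed
qed (rule ext(1))

lemma ext_iota: assumes g: "g \<in> carrier \<Gamma>" shows "ext (iota g) = \<psi> g"
proof (rule ext_eqI[OF iota_closed[OF g] psi_closed[OF g]])
 fix U assume U: "U \<in> OH"
 have "g \<in> iota g (pre U)"
  using rcos_self[OF g N_subgroup[OF pre_in_N[OF U]]] pre_in_N[OF U] by (simp add: iota_def)
 thus "\<psi> g \<in> target U (iota g)"
  using target_eq(1)[OF U iota_closed[OF g]] H.rcos_self[OF psi_closed[OF g] H.ons_subgroup[OF U]] by simp
qed

text \<open>Up to the open subgroup \<open>U\<close>, the value of the extension depends only on the
  coordinate at \<open>pre U\<close>.\<close>

lemma ext_continuous: "continuous_map TT TH ext"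
 unfolding continuous_map_def
proof (intro conjI allI impI)
 show "ext \<in> topspace TT \<rightarrow> topspace TH" using ext(1) by (simp add: topspace_TT H.topspace_eq)
 fix S assume S: "openin TH S"
 show "openin TT {\<xi> \<in> topspace TT. ext \<xi> \<in> S}"
 proof (subst openin_subopen, intro ballI)
  fix \<xi> assume "\<xi> \<in> {\<xi> \<in> topspace TT. ext \<xi> \<in> S}"
  hence \<xi>: "\<xi> \<in> carrier \<F>" "ext \<xi> \<in> S" by (auto simp: topspace_TT)
  obtain U where U: "U \<in> OH" "U #> ext \<xi> \<subseteq> S" using S \<xi>(2) by (rule H.ons_r_coset_basis)
  have "cyl (pre U) {\<xi> (pre U)} \<subseteq> {\<xi> \<in> topspace TT. ext \<xi> \<in> S}"
  proof
   fix \<eta> assume "\<eta> \<in> cyl (pre U) {\<xi> (pre U)}"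
   hence \<eta>: "\<eta> \<in> carrier \<F>" "\<eta> (pre U) = \<xi> (pre U)" by (simp_all add: cyl_def)
   obtain g where g: "g \<in> carrier \<Gamma>" "target U \<xi> = U #> \<psi> g" using target_rep[OF U(1) \<xi>(1)] by metis
   have "target U \<eta> = target U \<xi>" using \<eta>(2) by (simp add: target_def)
   hence "ext \<eta> \<in> U #> \<psi> g" "ext \<xi> \<in> U #> \<psi> g"
    using ext(2)[OF \<eta>(1) U(1)] ext(2)[OF \<xi>(1) U(1)] g(2) by simp_all
   hence "ext \<eta> \<in> U #> ext \<xi>"
    using H.repr_independence[OF _ psi_closed[OF g(1)] H.ons_subgroup[OF U(1)], of "ext \<xi>"] by simp
   thus "\<eta> \<in> {\<xi> \<in> topspace TT. ext \<xi> \<in> S}" using U(2) \<eta>(1) by (auto simp: topspace_TT)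
  qed
  thus "\<exists>W. openin TT W \<and> \<xi> \<in> W \<and> W \<subseteq> {\<xi> \<in> topspace TT. ext \<xi> \<in> S}"
   by (intro exI[of _ "cyl (pre U) {\<xi> (pre U)}"] conjI cyl_open[OF pre_in_N[OF U(1)]] cyl_self[OF \<xi>(1)])
 qed
qed

text \<open>The image is compact, hence closed, and it contains a dense subgroup.\<close>

lemma ext_surj:
 assumes Y: "Y \<subseteq> carrier \<Gamma>" "TH closure_of (generate H (\<psi> ` Y)) = carrier H"
 shows "ext ` carrier \<F> = carrier H"
proof
 show "ext ` carrier \<F> \<subseteq> carrier H" using ext(1) by blast
 interpret e: group_hom \<F> H ext using ext_hom by (simp add: group_hom_def group_hom_axioms_def group_completion H.is_group)
 have "compactin TH (ext ` carrier \<F>)"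
  using image_compactin[OF _ ext_continuous, of "carrier \<F>"] completion_compact by (simp add: compact_space_def topspace_TT)
 hence "closedin TH (ext ` carrier \<F>)" by (rule compactin_imp_closedin[OF H.Hausdorff])
 moreover have "generate H (\<psi> ` Y) \<subseteq> ext ` carrier \<F>"
 proof (rule H.generate_subgroup_incl)
  show "subgroup (ext ` carrier \<F>) H" by (rule e.img_is_subgroup)
  show "\<psi> ` Y \<subseteq> ext ` carrier \<F>"
  proof (rule image_subsetI)
   fix g assume "g \<in> Y"
   hence g: "g \<in> carrier \<Gamma>" using Y(1) by blast
   show "\<psi> g \<in> ext ` carrier \<F>" using imageI[OF iota_closed[OF g], of ext] ext_iota[OF g] by simp
  qed
 qed
 ultimately have "TH closure_of (generate H (\<psi> ` Y)) \<subseteq> ext ` carrier \<F>" by (rule closure_of_minimal[rotated])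
 thus "carrier H \<subseteq> ext ` carrier \<F>" using Y(2) by simp
qed

end

section \<open>Relations of a generated pro-p group\<close>

text \<open>The generators of both groups are indexed by the same \<open>d\<close>, so that
  differences of a function on \<open>F\<close> along the \<open>X i\<close>, once they descend to
  \<open>G\<close>, form a vector in \<open>C\<^sup>d\<close>.\<close>

locale pro_p_cover = sylvester_pro_p p G T d x + F: generated_pro_p p F TF d X
 for p :: nat and G :: "('a, 'b) monoid_scheme" and T :: "'a topology"
  and d :: nat and x :: "nat => 'a"
  and F :: "('f, 'c) monoid_scheme" (structure) and TF :: "'f topology" and X :: "nat => 'f" +
 fixes \<phi> :: "'f => 'a"
 assumes phi_hom: "\<phi> \<in> hom F G" and phi_continuous: "continuous_map TF T \<phi>"
  and phi_surj: "\<phi> ` carrier F = carrier G" and phi_X: "i < d ==> \<phi> (X i) = x i"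
begin

sublocale phi: group_hom F G \<phi>
 using phi_hom by (simp add: group_hom_def group_hom_axioms_def F.is_group is_group)

abbreviation \<V> where "\<V> \<equiv> open_normal_subgroups F TF"
abbreviation mod_p (infix \<open>\<bumpeq>\<close> 50) where "a \<bumpeq> b \<equiv> mod_eq p a b"
abbreviation K where "K \<equiv> kernel F G \<phi>"
abbreviation conjg where "conjg g a \<equiv> g \<otimes> a \<otimes> inv g"

lemma K_normal: "K \<lhd> F" by (rule phi.normal_kernel)
lemma K_subgroup: "subgroup K F" by (rule phi.subgroup_kernel)
lemma K_carrier: "a \<in> K ==> a \<in> carrier F" by (simp add: kernel_def)
lemma K_mult: "a \<in> K ==> b \<in> K ==> a \<otimes> b \<in> K" by (rule subgroup.m_closed[OF K_subgroup])
lemma K_conj: "a \<in> K ==> g \<in> carrier F ==> conjg g a \<in> K" by (rule normal.inv_op_closed2[OF K_normal])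
lemma K_iff: "a \<in> K \<longleftrightarrow> a \<in> carrier F \<and> \<phi> a = \<one>\<^bsub>G\<^esub>" by (auto simp: kernel_def)

text \<open>The saturation \<open>S\<close> of \<open>V\<close> under the kernel is open. Its
  complement is compact and maps onto the complement of the image of \<open>V\<close>, which is
  therefore closed.\<close>

lemma image_open:
 assumes V: "V \<in> \<V>" shows "\<phi> ` V \<in> \<U>"
proof -
 have VF: "v \<in> carrier F" if "v \<in> V" for v by (rule F.ons_carrier[OF V that])
 define S where "S = (\<Union>k\<in>K. V #> k)"
 have "openin TF S"
  unfolding S_def using F.openin_r_coset[OF F.ons_open[OF V]] K_carrier by (intro openin_Union) auto
 hence "closedin TF (carrier F - S)" using F.topspace_eq by (metis closedin_diff closedin_topspace)
 hence "compactin TF (carrier F - S)" by (rule closedin_compact_space[OF F.compact])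
 hence "compactin T (\<phi> ` (carrier F - S))" by (rule image_compactin[OF _ phi_continuous])
 hence c: "closedin T (\<phi> ` (carrier F - S))" by (rule compactin_imp_closedin[OF Hausdorff])
 have sub: "\<phi> ` V \<subseteq> carrier G" using VF by auto
 have "\<phi> ` (carrier F - S) = carrier G - \<phi> ` V"
 proof
  show "\<phi> ` (carrier F - S) \<subseteq> carrier G - \<phi> ` V"
  proof
   fix y assume "y \<in> \<phi> ` (carrier F - S)"
   then obtain \<xi> where \<xi>: "\<xi> \<in> carrier F" "\<xi> \<notin> S" "y = \<phi> \<xi>" by blast
   have "y \<notin> \<phi> ` V"
   proof
    assume "y \<in> \<phi> ` V"
    hence "\<phi> \<xi> \<in> \<phi> ` V" unfolding \<xi>(3) .
    then obtain v where v: "\<phi> \<xi> = \<phi> v" "v \<in> V" by (rule imageE)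
    have vF: "v \<in> carrier F" by (rule VF[OF v(2)])
    have "inv v \<otimes> \<xi> \<in> K" using v vF \<xi>(1) by (simp add: K_iff)
    moreover have "\<xi> = v \<otimes> (inv v \<otimes> \<xi>)" using vF \<xi>(1) by (simp flip: F.m_assoc)
    ultimately have "\<xi> \<in> V #> (inv v \<otimes> \<xi>)" "inv v \<otimes> \<xi> \<in> K"
     using F.rcosI[OF v(2), of "inv v \<otimes> \<xi>"] subgroup.subset[OF F.ons_subgroup[OF V]] vF \<xi>(1) by simp_all
    hence "\<xi> \<in> S" unfolding S_def by (intro UN_I)
    thus False using \<xi>(2) by simp
   qed
   thus "y \<in> carrier G - \<phi> ` V" using \<xi> by simp
  qed
  show "carrier G - \<phi> ` V \<subseteq> \<phi> ` (carrier F - S)"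
  proof
   fix y assume y: "y \<in> carrier G - \<phi> ` V"
   then obtain \<xi> where \<xi>: "\<xi> \<in> carrier F" "y = \<phi> \<xi>" using phi_surj by blast
   have "\<xi> \<notin> S"
   proof
    assume "\<xi> \<in> S"
    then obtain k v where kv: "k \<in> K" "v \<in> V" "\<xi> = v \<otimes> k" unfolding S_def r_coset_def by blast
    hence "y = \<phi> v" using VF \<xi>(2) by (simp add: K_iff)
    thus False using y imageI[OF kv(2), of \<phi>] by simp
   qed
   thus "y \<in> \<phi> ` (carrier F - S)" using \<xi> by blast
  qed
 qed
 hence "closedin T (carrier G - \<phi> ` V)" using c by simp
 hence "openin T (\<phi> ` V)" using sub by (simp add: openin_closedin topspace_eq)
 moreover have "\<phi> ` V \<lhd> G"
  by (rule normal.surj_hom_normal_subgroup[OF F.ons_normal[OF V] phi.group_hom_axioms phi_surj])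
 ultimately show ?thesis by (simp add: open_normal_subgroups_def)
qed

definition lift :: "'a => 'f" where "lift z = (SOME \<xi>. \<xi> \<in> carrier F \<and> \<phi> \<xi> = z)"

lemma lift: "z \<in> carrier G ==> lift z \<in> carrier F \<and> \<phi> (lift z) = z"
proof -
 assume "z \<in> carrier G"
 hence "z \<in> \<phi> ` carrier F" by (simp only: phi_surj)
 then obtain \<xi> where "z = \<phi> \<xi>" "\<xi> \<in> carrier F" by (rule imageE)
 hence "\<exists>\<xi>. \<xi> \<in> carrier F \<and> \<phi> \<xi> = z" by (intro exI[of _ \<xi>]) simp
 thus ?thesis unfolding lift_def by (rule someI_ex)
qed

text \<open>\<open>lift\<close> is an arbitrary section without continuity. Two lifts differ by an
  element of the kernel, so invariance under \<open>K\<close> makes the choice irrelevant, and local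
  constancy follows from \<open>image_open\<close>.\<close>

lemma descend:
 assumes f: "f \<in> F.loc_const" and inv: "!!\<xi> a. \<xi> \<in> carrier F ==> a \<in> K ==> f (\<xi> \<otimes> a) \<bumpeq> f \<xi>"
 shows "(%z. f (lift z)) \<in> loc_const" "!!\<xi>. \<xi> \<in> carrier F ==> f (lift (\<phi> \<xi>)) \<bumpeq> f \<xi>"
proof -
 show *: "f (lift (\<phi> \<xi>)) \<bumpeq> f \<xi>" if \<xi>: "\<xi> \<in> carrier F" for \<xi>
 proof -
  let ?\<eta> = "lift (\<phi> \<xi>)"
  have \<eta>: "?\<eta> \<in> carrier F" "\<phi> ?\<eta> = \<phi> \<xi>" using lift[of "\<phi> \<xi>"] \<xi> by simp_all
  have "inv \<xi> \<otimes> ?\<eta> \<in> K" using \<xi> \<eta> by (simp add: K_iff)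
  from inv[OF \<xi> this] show ?thesis using \<xi> \<eta> by (simp flip: F.m_assoc)
 qed
 obtain V where V: "V \<in> \<V>" "F.invariant V f" using f by (rule F.loc_constE)
 have "f (lift (u \<otimes>\<^bsub>G\<^esub> z)) \<bumpeq> f (lift z)" if z: "z \<in> carrier G" and u: "u \<in> \<phi> ` V" for u z
 proof -
  obtain v where v: "u = \<phi> v" "v \<in> V" using u by (rule imageE)
  have vF: "v \<in> carrier F" by (rule F.ons_carrier[OF V(1) v(2)])
  let ?\<xi> = "lift z"
  have \<xi>: "?\<xi> \<in> carrier F" "\<phi> ?\<xi> = z" using lift[OF z] by simp_all
  have "u \<otimes>\<^bsub>G\<^esub> z = \<phi> (v \<otimes> ?\<xi>)" using v \<xi> vF by simp
  hence "f (lift (u \<otimes>\<^bsub>G\<^esub> z)) \<bumpeq> f (v \<otimes> ?\<xi>)" using *[of "v \<otimes> ?\<xi>"] vF \<xi>(1) by simp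
  also have "f (v \<otimes> ?\<xi>) \<bumpeq> f ?\<xi>" by (rule F.invariantD[OF V(2) \<xi>(1) v(2)])
  finally show ?thesis .
 qed
 hence "invariant (\<phi> ` V) (%z. f (lift z))" by (simp add: invariant_def)
 thus "(%z. f (lift z)) \<in> loc_const" by (rule loc_constI[OF image_open[OF V(1)]])
qed

text \<open>An element of \<open>H\<^sup>1(K, F\<^sub>p)\<close> that is invariant under
  \<open>G\<close>; the clause about \<open>K \<inter> V\<close> expresses continuity.\<close>

definition character :: "('f => int) => bool" where
 "character f \<longleftrightarrow> (\<forall>a\<in>K. \<forall>b\<in>K. f (a \<otimes> b) \<bumpeq> f a + f b) \<and>
   (\<forall>g\<in>carrier F. \<forall>a\<in>K. f (conjg g a) \<bumpeq> f a) \<and> (\<exists>V\<in>\<V>. \<forall>a\<in>K \<inter> V. f a \<bumpeq> 0)"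

definition extends :: "('f => int) => ('f => int) => bool" where
 "extends f e \<longleftrightarrow> e \<in> F.loc_const \<and> (\<forall>\<xi>\<in>carrier F. \<forall>a\<in>K. e (\<xi> \<otimes> a) \<bumpeq> e \<xi> + f a)"

text \<open>Every \<open>\<xi>\<close> in \<open>F\<close> is
  \<open>t \<xi> \<otimes> a \<otimes> v\<close> with \<open>t \<xi>\<close> a representative of its
  coset of \<open>K <#> V\<close>, \<open>a\<close> in \<open>K\<close> and \<open>v\<close> in
  \<open>V\<close>; the extension takes the value \<open>f a\<close>. This is well defined modulo
  \<open>p\<close>, as \<open>a\<close> is unique up to \<open>K \<inter> V\<close>, where
  \<open>f\<close> vanishes.\<close>

lemma character_extends:
 assumes "character f" shows "\<exists>e. extends f e"
proof -
 have add: "!!a b. a \<in> K ==> b \<in> K ==> f (a \<otimes> b) \<bumpeq> f a + f b"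
  using assms by (simp add: character_def)
 obtain V where V: "V \<in> \<V>" and van: "!!a. a \<in> K ==> a \<in> V ==> f a \<bumpeq> 0"
  using assms by (auto simp: character_def)
 have sV: "subgroup V F" by (rule F.ons_subgroup[OF V])
 have VF: "v \<in> carrier F" if "v \<in> V" for v by (rule F.ons_carrier[OF V that])
 define N where "N = K <#> V"
 have N: "N \<lhd> F" unfolding N_def by (rule F.normal_subgroup_set_mult_closed[OF K_normal F.ons_normal[OF V]])
 have sN: "subgroup N F" using N by (rule normal_imp_subgroup)
 have KN: "a \<in> N" if "a \<in> K" for a
  using set_mult_def[of F K V] that subgroup.one_closed[OF sV] K_carrier[OF that] unfolding N_def by force
 have VN: "v \<in> N" if "v \<in> V" for v
  using set_mult_def[of F K V] that subgroup.one_closed[OF K_subgroup] VF[OF that] unfolding N_def by force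
 define t where "t = (%\<xi>. SOME z. z \<in> N #> \<xi>)"
 have tF: "t \<xi> \<in> N #> \<xi>" if "\<xi> \<in> carrier F" for \<xi>
  unfolding t_def by (rule someI[of _ \<xi>]) (rule F.rcos_self[OF that sN])
 have tc: "t \<xi> \<in> carrier F" if \<xi>: "\<xi> \<in> carrier F" for \<xi>
  using tF[OF \<xi>] F.r_coset_subset_G[OF subgroup.subset[OF sN] \<xi>] by blast
 define P where "P = (%\<xi> a v. a \<in> K \<and> v \<in> V \<and> t \<xi> \<otimes> a \<otimes> v = \<xi>)"
 have Pex: "\<exists>a v. P \<xi> a v" if \<xi>: "\<xi> \<in> carrier F" for \<xi>
 proof -
  have "N #> \<xi> = N #> t \<xi>" by (rule F.repr_independence[OF tF[OF \<xi>] \<xi> sN])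
  hence "\<xi> \<in> t \<xi> <# N" using F.rcos_self[OF \<xi> sN] normal.coset_eq[OF N] tc[OF \<xi>] by simp
  then obtain n where n: "n \<in> N" "\<xi> = t \<xi> \<otimes> n" unfolding l_coset_def by blast
  obtain a v where av: "a \<in> K" "v \<in> V" "n = a \<otimes> v" using n(1) unfolding N_def set_mult_def by blast
  have "t \<xi> \<otimes> a \<otimes> v = t \<xi> \<otimes> n"
   unfolding av(3) using tc[OF \<xi>] K_carrier[OF av(1)] VF[OF av(2)] by (rule F.m_assoc)
  hence "P \<xi> a v" using av(1,2) n(2)[symmetric] by (simp add: P_def)
  thus ?thesis by blast
 qed
 define e where "e = (%\<xi>. f (SOME a. \<exists>v. P \<xi> a v))"
 have eP: "e \<xi> \<bumpeq> f a" if \<xi>: "\<xi> \<in> carrier F" and P: "P \<xi> a v" for \<xi> a v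
 proof -
  define b where "b = (SOME a. \<exists>v. P \<xi> a v)"
  have "\<exists>v. P \<xi> b v" unfolding b_def by (rule someI_ex) (rule Pex[OF \<xi>])
  then obtain w where b: "P \<xi> b w" by blast
  have c: "a \<in> carrier F" "b \<in> carrier F" "v \<in> carrier F" "w \<in> carrier F"
   using P b K_carrier VF by (auto simp: P_def)
  have "t \<xi> \<otimes> (a \<otimes> v) = t \<xi> \<otimes> (b \<otimes> w)"
   using P b c tc[OF \<xi>] unfolding P_def by (simp flip: F.m_assoc)
  hence "a \<otimes> v = b \<otimes> w" using c tc[OF \<xi>] by simp
  hence "b = a \<otimes> v \<otimes> inv w" using c by (simp add: F.m_assoc)
  hence u: "inv a \<otimes> b = v \<otimes> inv w" using c by (simp flip: F.m_assoc)
  have uV: "inv a \<otimes> b \<in> V"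
   unfolding u using P b subgroup.m_closed[OF sV] subgroup.m_inv_closed[OF sV] by (simp add: P_def)
  have aK: "a \<in> K" "b \<in> K" using P b by (auto simp: P_def)
  have uK: "inv a \<otimes> b \<in> K" by (rule K_mult[OF subgroup.m_inv_closed[OF K_subgroup aK(1)] aK(2)])
  have "f (a \<otimes> (inv a \<otimes> b)) \<bumpeq> f a + f (inv a \<otimes> b)" by (rule add[OF aK(1) uK])
  also have "... \<bumpeq> f a + 0" by (intro meq_add meq_refl van uK uV)
  finally have "f b \<bumpeq> f a" using c by (simp flip: F.m_assoc)
  thus ?thesis by (simp add: e_def b_def)
 qed
 have tN: "t (n \<otimes> \<xi>) = t \<xi>" if n: "n \<in> N" and \<xi>: "\<xi> \<in> carrier F" for n \<xi>
 proof -
  have "n \<otimes> \<xi> \<in> N #> \<xi>" using n by (auto simp: r_coset_def)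
  hence "N #> \<xi> = N #> (n \<otimes> \<xi>)" by (rule F.repr_independence[OF _ \<xi> sN])
  thus ?thesis by (simp add: t_def)
 qed
 have "e (\<xi> \<otimes> b) \<bumpeq> e \<xi> + f b" if \<xi>: "\<xi> \<in> carrier F" and b: "b \<in> K" for \<xi> b
 proof -
  obtain a v where P: "P \<xi> a v" using Pex[OF \<xi>] by blast
  have c: "a \<in> carrier F" "b \<in> carrier F" "v \<in> carrier F" using P b K_carrier VF by (auto simp: P_def)
  have aK: "a \<in> K" and vV: "v \<in> V" and \<xi>e: "\<xi> = t \<xi> \<otimes> a \<otimes> v" using P by (simp_all add: P_def)
  have "conjg \<xi> b \<in> N" by (rule KN[OF K_conj[OF b \<xi>]])
  from tN[OF this \<xi>] have t1: "t (\<xi> \<otimes> b) = t \<xi>" using \<xi> c by (simp add: F.m_assoc)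
  \<comment> \<open>Moving \<open>b\<close> to the left of \<open>v\<close> conjugates
    \<open>v\<close> by \<open>b\<close>, and \<open>V\<close> is normal.\<close>
  have "t \<xi> \<otimes> (a \<otimes> b) \<otimes> (inv b \<otimes> v \<otimes> b) = t \<xi> \<otimes> a \<otimes> v \<otimes> b"
  proof -
   have "b \<otimes> (inv b \<otimes> (v \<otimes> b)) = v \<otimes> b" using c by (simp flip: F.m_assoc)
   thus ?thesis using c tc[OF \<xi>] by (simp add: F.m_assoc)
  qed
  hence "t \<xi> \<otimes> (a \<otimes> b) \<otimes> (inv b \<otimes> v \<otimes> b) = \<xi> \<otimes> b"
   unfolding \<xi>e[symmetric] .
  hence "P (\<xi> \<otimes> b) (a \<otimes> b) (inv b \<otimes> v \<otimes> b)"
   unfolding P_def t1 by (intro conjI K_mult[OF aK b] F.ons_conj(2)[OF V vV c(2)])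
  hence "e (\<xi> \<otimes> b) \<bumpeq> f (a \<otimes> b)" by (rule eP[rotated]) (use \<xi> c in simp)
  also have "... \<bumpeq> f a + f b" by (rule add[OF aK b])
  also have "... \<bumpeq> e \<xi> + f b" by (intro meq_add meq_refl meq_sym[OF eP[OF \<xi> P]])
  finally show ?thesis .
 qed
 moreover have "F.invariant V e"
  unfolding F.invariant_def
 proof (intro ballI)
  fix \<xi> u assume \<xi>: "\<xi> \<in> carrier F" and u: "u \<in> V"
  obtain a v where P: "P \<xi> a v" using Pex[OF \<xi>] by blast
  have c: "a \<in> carrier F" "u \<in> carrier F" "v \<in> carrier F" using P u K_carrier VF by (auto simp: P_def)
  have aK: "a \<in> K" and vV: "v \<in> V" and \<xi>e: "\<xi> = t \<xi> \<otimes> a \<otimes> v" using P by (simp_all add: P_def)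
  let ?u = "inv \<xi> \<otimes> u \<otimes> \<xi>"
  have uV: "?u \<in> V" by (rule F.ons_conj(2)[OF V u \<xi>])
  have t1: "t (u \<otimes> \<xi>) = t \<xi>" by (rule tN[OF VN[OF u] \<xi>])
  have "u \<otimes> \<xi> = \<xi> \<otimes> ?u" using \<xi> c by (simp flip: F.m_assoc)
  also have "... = t \<xi> \<otimes> a \<otimes> v \<otimes> ?u" by (rule arg_cong[where f = "%z. z \<otimes> ?u", OF \<xi>e])
  also have "... = t \<xi> \<otimes> a \<otimes> (v \<otimes> ?u)" using c tc[OF \<xi>] \<xi> by (intro F.m_assoc) simp_all
  finally have "t \<xi> \<otimes> a \<otimes> (v \<otimes> ?u) = u \<otimes> \<xi>" by (rule HOL.sym)
  hence "P (u \<otimes> \<xi>) a (v \<otimes> ?u)"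
   unfolding P_def t1 by (intro conjI aK subgroup.m_closed[OF sV vV uV])
  hence "e (u \<otimes> \<xi>) \<bumpeq> f a" by (rule eP[rotated]) (use \<xi> c in simp)
  thus "e (u \<otimes> \<xi>) \<bumpeq> e \<xi>" by (rule meq_trans[OF _ meq_sym[OF eP[OF \<xi> P]]])
 qed
 ultimately show ?thesis unfolding extends_def using F.loc_constI[OF V] by blast
qed

text \<open>This represents the transgression from the invariant characters of the kernel to the second cohomology
 group of \<open>G\<close>.\<close>

definition transgression :: "('f => int) => (nat \<times> 'a => int)" where
 "transgression e = (%(i, z). e (X i \<otimes> lift z) - e (lift z))"

lemma F_loc_const_diff: "f \<in> F.loc_const ==> h \<in> F.loc_const ==> (%\<xi>. f \<xi> - h \<xi>) \<in> F.loc_const"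
 using F.loc_const_add[of f "%\<xi>. (-1) * h \<xi>"] F.loc_const_scale[of h "-1"] by simp

lemma extends_diff_inv:
 assumes e: "extends f e" and i: "i < d" and \<xi>: "\<xi> \<in> carrier F" and a: "a \<in> K"
 shows "e (X i \<otimes> (\<xi> \<otimes> a)) - e (\<xi> \<otimes> a) \<bumpeq> e (X i \<otimes> \<xi>) - e \<xi>"
proof -
 have "e (X i \<otimes> \<xi> \<otimes> a) - e (\<xi> \<otimes> a) \<bumpeq> (e (X i \<otimes> \<xi>) + f a) - (e \<xi> + f a)"
  using e \<xi> a F.x_closed[OF i] by (intro meq_diff) (auto simp: extends_def)
 thus ?thesis using \<xi> K_carrier[OF a] F.x_closed[OF i] by (simp add: F.m_assoc)
qed

lemma transgression_apply:
 assumes e: "extends f e" and i: "i < d"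
 shows "(%z. transgression e (i, z)) \<in> loc_const"
  and "!!\<xi>. \<xi> \<in> carrier F ==> transgression e (i, \<phi> \<xi>) \<bumpeq> e (X i \<otimes> \<xi>) - e \<xi>"
proof -
 have el: "e \<in> F.loc_const" using e by (simp add: extends_def)
 have l: "(%\<xi>. e (X i \<otimes> \<xi>) - e \<xi>) \<in> F.loc_const"
  by (rule F_loc_const_diff[OF F.loc_const_translate(1)[OF el F.x_closed[OF i]] el])
 show "(%z. transgression e (i, z)) \<in> loc_const"
  unfolding transgression_def prod.case by (rule descend(1)[OF l extends_diff_inv[OF e i]])
 show "transgression e (i, \<phi> \<xi>) \<bumpeq> e (X i \<otimes> \<xi>) - e \<xi>" if "\<xi> \<in> carrier F" for \<xi>
  unfolding transgression_def prod.case by (rule descend(2)[OF l extends_diff_inv[OF e i] that])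
qed

text \<open>The difference is \<open>\<delta>\<close> of the function on \<open>G\<close> induced by
  \<open>e (\<xi> \<otimes> \<eta>) - e \<xi>\<close>, where \<open>\<eta>\<close> is a lift of
  \<open>g\<close>. This function descends to \<open>G\<close> because \<open>f\<close> has the same
  value on an element of \<open>K\<close> and on its conjugate by the inverse of
  \<open>\<eta>\<close>.\<close>

lemma transgression_fixed:
 assumes f: "character f" and e: "extends f e"
 shows "transgression e \<in> fixed_vecs"
 unfolding fixed_vecs_def
proof (intro CollectI conjI ballI)
 show "transgression e \<in> vec d" unfolding vec_def using transgression_apply(1)[OF e] by simp
 fix g assume g: "g \<in> carrier G"
 define \<eta> where "\<eta> = lift g"
 have \<eta>: "\<eta> \<in> carrier F" "\<phi> \<eta> = g" using lift[OF g] by (auto simp: \<eta>_def)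
 have el: "e \<in> F.loc_const" using e by (simp add: extends_def)
 define hh where "hh = (%\<xi>. e (\<xi> \<otimes> \<eta>) - e \<xi>)"
 have hl: "hh \<in> F.loc_const"
  unfolding hh_def by (rule F_loc_const_diff[OF F.loc_const_translate(2)[OF el \<eta>(1)] el])
 have hinv: "hh (\<xi> \<otimes> a) \<bumpeq> hh \<xi>" if \<xi>: "\<xi> \<in> carrier F" and a: "a \<in> K" for \<xi> a
 proof -
  let ?b = "conjg (inv \<eta>) a"
  have aF: "a \<in> carrier F" by (rule K_carrier[OF a])
  have b: "?b \<in> K" by (rule K_conj[OF a]) (use \<eta> in simp)
  have "\<forall>g\<in>carrier F. \<forall>a\<in>K. f (conjg g a) \<bumpeq> f a" using f by (simp add: character_def)
  hence fb: "f ?b \<bumpeq> f a" by (rule bspec[OF bspec[OF _ F.inv_closed[OF \<eta>(1)]] a])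
  have "\<xi> \<otimes> \<eta> \<otimes> ?b = \<xi> \<otimes> a \<otimes> \<eta>"
  proof -
   have "\<eta> \<otimes> (inv \<eta> \<otimes> (a \<otimes> \<eta>)) = a \<otimes> \<eta>" using \<eta>(1) aF by (simp flip: F.m_assoc)
   thus ?thesis using \<xi> \<eta>(1) aF by (simp add: F.m_assoc)
  qed
  moreover have "e (\<xi> \<otimes> \<eta> \<otimes> ?b) \<bumpeq> e (\<xi> \<otimes> \<eta>) + f ?b" using e \<xi> \<eta>(1) b by (simp add: extends_def)
  ultimately have "e (\<xi> \<otimes> a \<otimes> \<eta>) \<bumpeq> e (\<xi> \<otimes> \<eta>) + f ?b" by simp
  also have "... \<bumpeq> e (\<xi> \<otimes> \<eta>) + f a" by (intro meq_add meq_refl fb)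
  finally have "e (\<xi> \<otimes> a \<otimes> \<eta>) - e (\<xi> \<otimes> a) \<bumpeq> (e (\<xi> \<otimes> \<eta>) + f a) - (e \<xi> + f a)"
   using e \<xi> a by (intro meq_diff) (simp_all add: extends_def)
  thus ?thesis by (simp add: hh_def)
 qed
 show "(%k. shift g (transgression e) k - transgression e k) \<in> im"
 proof (rule imI[OF descend(1)[OF hl hinv]])
  fix i z assume i: "i < d" and z: "z \<in> carrier G"
  define \<xi> where "\<xi> = lift z"
  have \<xi>: "\<xi> \<in> carrier F" "\<phi> \<xi> = z" using lift[OF z] by (auto simp: \<xi>_def)
  have Xi: "X i \<in> carrier F" by (rule F.x_closed[OF i])
  have 1: "transgression e (i, z) \<bumpeq> e (X i \<otimes> \<xi>) - e \<xi>"
   using transgression_apply(2)[OF e i \<xi>(1)] \<xi>(2) by simp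
  have 2: "transgression e (i, z \<otimes>\<^bsub>G\<^esub> g) \<bumpeq> e (X i \<otimes> (\<xi> \<otimes> \<eta>)) - e (\<xi> \<otimes> \<eta>)"
   using transgression_apply(2)[OF e i, of "\<xi> \<otimes> \<eta>"] \<xi> \<eta> by simp
  have 3: "hh (lift z) \<bumpeq> hh \<xi>" by (simp add: \<xi>_def)
  have "\<phi> (X i \<otimes> \<xi>) = x i \<otimes>\<^bsub>G\<^esub> z" using Xi \<xi> phi_X[OF i] by simp
  hence 4: "hh (lift (x i \<otimes>\<^bsub>G\<^esub> z)) \<bumpeq> hh (X i \<otimes> \<xi>)"
   using descend(2)[OF hl hinv, of "X i \<otimes> \<xi>"] Xi \<xi> by simp
  have "shift g (transgression e) (i, z) - transgression e (i, z) \<bumpeq>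
    (e (X i \<otimes> (\<xi> \<otimes> \<eta>)) - e (\<xi> \<otimes> \<eta>)) - (e (X i \<otimes> \<xi>) - e \<xi>)"
   using meq_diff[OF 2 1] z by (simp add: shift_def)
  also have "... = hh (X i \<otimes> \<xi>) - hh \<xi>"
   using Xi \<xi> \<eta> by (simp add: hh_def F.m_assoc)
  also have "... \<bumpeq> hh (lift (x i \<otimes>\<^bsub>G\<^esub> z)) - hh (lift z)" by (intro meq_diff meq_sym[OF 4] meq_sym[OF 3])
  finally show "shift g (transgression e) (i, z) - transgression e (i, z) \<bumpeq> hh (lift (x i \<otimes>\<^bsub>G\<^esub> z)) - hh (lift z)" .
 qed
qed

text \<open>The analogue of \<open>dual\<close> for characters of \<open>K\<close>; again half of
  the orthogonality relations suffices, so that a system can be extended at its end.\<close>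

definition dual_system :: "nat => (nat => 'f) => (nat => 'f => int) => bool" where
 "dual_system s r f \<longleftrightarrow> (\<forall>j<s. r j \<in> K \<and> character (f j) \<and> f j (r j) \<bumpeq> 1 \<and> (\<forall>i<j. f j (r i) \<bumpeq> 0))"

text \<open>Injectivity of the transgression. If a combination of transgressions is
  \<open>\<delta> h\<close>, the same combination \<open>E\<close> of the extensions, minus
  \<open>h\<close> composed with \<open>\<phi>\<close>, is unchanged by left translations by the
  \<open>X i\<close>, hence constant on \<open>F\<close>. The combination of the characters then
  vanishes on \<open>K\<close>, which evaluation at the \<open>r i\<close> refutes; so the
  transgressions are independent and \<open>indep_bound\<close> applies.\<close>

lemma dual_system_bound:
 assumes sys: "dual_system s r f" shows "s \<le> d"
proof -
 have "\<forall>j. \<exists>e. j < s --> extends (f j) e" using sys character_extends by (auto simp: dual_system_def)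
 then obtain e where e: "!!j. j < s ==> extends (f j) (e j)" by metis
 have fK: "f l (r i) \<bumpeq> (if l = i then 1 else 0)" if "i \<le> l" "l < s" for l i
  using sys that by (cases "l = i") (auto simp: dual_system_def)
 have rK: "r i \<in> K" if "i < s" for i using sys that by (simp add: dual_system_def)
 have el: "e j \<in> F.loc_const" if "j < s" for j using e[OF that] by (simp add: extends_def)
 have "indep s (%j. transgression (e j))"
  unfolding indep_def
 proof (intro allI impI conjI)
  fix j assume j: "j < s"
  show "transgression (e j) \<in> fixed_vecs"
   by (rule transgression_fixed[OF _ e[OF j]]) (use sys j in \<open>simp add: dual_system_def\<close>)
  fix c :: "nat => int"
  show "(%k. transgression (e j) k - (\<Sum>i<j. c i * transgression (e i) k)) \<notin> im"
  proof
   assume "(%k. transgression (e j) k - (\<Sum>i<j. c i * transgression (e i) k)) \<in> im"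
   then obtain h where h: "h \<in> loc_const" "\<forall>i<d. \<forall>z\<in>carrier G.
     transgression (e j) (i, z) - (\<Sum>l<j. c l * transgression (e l) (i, z)) \<bumpeq> h (x i \<otimes>\<^bsub>G\<^esub> z) - h z"
    by (rule imE)
   obtain U where U: "U \<in> \<U>" "invariant U h" using h(1) by (rule loc_constE)
   have "openin TF {\<xi> \<in> topspace TF. \<phi> \<xi> \<in> U}"
    by (rule openin_continuous_map_preimage[OF phi_continuous ons_open[OF U(1)]])
   moreover have "\<one> \<in> {\<xi> \<in> topspace TF. \<phi> \<xi> \<in> U}"
    using subgroup.one_closed[OF ons_subgroup[OF U(1)]] by (simp add: F.topspace_eq)
   ultimately obtain V where V: "V \<in> \<V>" "V \<subseteq> {\<xi> \<in> topspace TF. \<phi> \<xi> \<in> U}"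
    by (rule F.open_normal_subgroup_basis)
   have "h (\<phi> (v \<otimes> \<xi>)) \<bumpeq> h (\<phi> \<xi>)" if "\<xi> \<in> carrier F" "v \<in> V" for v \<xi>
    using invariantD[OF U(2), of "\<phi> \<xi>" "\<phi> v"] V(2) that F.ons_carrier[OF V(1) that(2)] by auto
   hence hl: "(%\<xi>. h (\<phi> \<xi>)) \<in> F.loc_const" by (intro F.loc_constI[OF V(1)]) (simp add: F.invariant_def)
   define E where "E = (%\<xi>. e j \<xi> - (\<Sum>l<j. c l * e l \<xi>) - h (\<phi> \<xi>))"
   have El: "E \<in> F.loc_const"
    unfolding E_def using el j
    by (intro F_loc_const_diff hl F.loc_const_sum F.loc_const_scale) auto
   have EX: "E (X i \<otimes> \<xi>) \<bumpeq> E \<xi>" if i: "i < d" and \<xi>: "\<xi> \<in> carrier F" for i \<xi>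
   proof -
    have Xi: "X i \<in> carrier F" by (rule F.x_closed[OF i])
    have "h (x i \<otimes>\<^bsub>G\<^esub> \<phi> \<xi>) - h (\<phi> \<xi>) \<bumpeq> transgression (e j) (i, \<phi> \<xi>) - (\<Sum>l<j. c l * transgression (e l) (i, \<phi> \<xi>))"
     by (rule meq_sym) (use h(2) i \<xi> in simp)
    also have "... \<bumpeq> (e j (X i \<otimes> \<xi>) - e j \<xi>) - (\<Sum>l<j. c l * (e l (X i \<otimes> \<xi>) - e l \<xi>))"
    proof (intro meq_diff meq_sum meq_scale_left)
     show "transgression (e j) (i, \<phi> \<xi>) \<bumpeq> e j (X i \<otimes> \<xi>) - e j \<xi>"
      by (rule transgression_apply(2)[OF e[OF j] i \<xi>])
     fix l assume "l \<in> {..<j}"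
     hence l: "l < s" using j by simp
     show "transgression (e l) (i, \<phi> \<xi>) \<bumpeq> e l (X i \<otimes> \<xi>) - e l \<xi>"
      by (rule transgression_apply(2)[OF e[OF l] i \<xi>])
    qed
    finally have *: "h (x i \<otimes>\<^bsub>G\<^esub> \<phi> \<xi>) - h (\<phi> \<xi>) \<bumpeq>
     (e j (X i \<otimes> \<xi>) - e j \<xi>) - (\<Sum>l<j. c l * (e l (X i \<otimes> \<xi>) - e l \<xi>))" .
    have "E (X i \<otimes> \<xi>) - E \<xi> = ((e j (X i \<otimes> \<xi>) - e j \<xi>) - (\<Sum>l<j. c l * (e l (X i \<otimes> \<xi>) - e l \<xi>)))
      - (h (x i \<otimes>\<^bsub>G\<^esub> \<phi> \<xi>) - h (\<phi> \<xi>))"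
     using Xi \<xi> phi_X[OF i] by (simp add: E_def right_diff_distrib sum_subtractf)
    also have "... \<bumpeq> 0" using meq_sym[OF *] by (simp add: meq_iff_dvd)
    finally show ?thesis by (simp add: meq_iff_dvd)
   qed
   have rel: "f j a - (\<Sum>l<j. c l * f l a) \<bumpeq> 0" if a: "a \<in> K" for a
   proof -
    have aF: "a \<in> carrier F" by (rule K_carrier[OF a])
    have ea: "e l a - e l \<one> \<bumpeq> f l a" if "l < s" for l
    proof -
     have "e l (\<one> \<otimes> a) \<bumpeq> e l \<one> + f l a" using e[OF that] a by (simp add: extends_def)
     thus ?thesis using aF by (simp add: meq_iff_dvd algebra_simps)
    qed
    have "f j a - (\<Sum>l<j. c l * f l a) \<bumpeq> (e j a - e j \<one>) - (\<Sum>l<j. c l * (e l a - e l \<one>))"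
    proof (intro meq_diff meq_sum meq_scale_left)
     show "f j a \<bumpeq> e j a - e j \<one>" by (rule meq_sym[OF ea[OF j]])
     fix l assume "l \<in> {..<j}"
     hence l: "l < s" using j by simp
     show "f l a \<bumpeq> e l a - e l \<one>" by (rule meq_sym[OF ea[OF l]])
    qed
    also have "... = E a - E \<one>"
     using a by (simp add: E_def right_diff_distrib sum_subtractf K_iff)
    also have "... \<bumpeq> 0" using F.translation_invariant_const[OF El EX aF] by (simp add: meq_iff_dvd)
    finally show ?thesis .
   qed
   \<comment> \<open>Evaluation at \<open>r i\<close> for increasing \<open>i\<close>: characters
     with larger index vanish there, and the coefficients with smaller index are already known to be
     zero. What remains is evaluation at \<open>r j\<close>, which gives 1.\<close>
   have c0: "c i \<bumpeq> 0" if "i < j" for i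
    using that
   proof (induction i rule: less_induct)
    case (less i)
    have i_s: "i < s" using less.prems j by simp
    have "(\<Sum>l<j. c l * f l (r i)) \<bumpeq> (\<Sum>l<j. if l = i then c i else 0)"
    proof (rule meq_sum)
     fix l assume l: "l \<in> {..<j}"
     show "c l * f l (r i) \<bumpeq> (if l = i then c i else 0)"
     proof (cases "l < i")
      case True
      hence "c l \<bumpeq> 0" using less.IH l by simp
      from meq_scale_right[OF this, of "f l (r i)"] show ?thesis using True by simp
     next
      case False
      hence "f l (r i) \<bumpeq> (if l = i then 1 else 0)" using fK l j by simp
      from meq_scale_left[OF this, of "c l"] show ?thesis by (auto split: if_splits)
     qed
    qed
    also have "(\<Sum>l<j. if l = i then c i else 0) = c i" using less.prems by simp
    finally have "f j (r i) - (\<Sum>l<j. c l * f l (r i)) \<bumpeq> 0 - c i"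
     using fK[of i j] less.prems j by (intro meq_diff) auto
    hence "0 - c i \<bumpeq> 0" by (rule meq_trans[OF meq_sym rel[OF rK[OF i_s]]])
    thus ?case by (simp add: meq_iff_dvd)
   qed
   have "(\<Sum>l<j. c l * f l (r j)) \<bumpeq> (\<Sum>l<j. 0)"
   proof (rule meq_sum)
    fix l assume "l \<in> {..<j}"
    thus "c l * f l (r j) \<bumpeq> 0" using meq_scale_right[OF c0[of l], of "f l (r j)"] by simp
   qed
   hence "f j (r j) - (\<Sum>l<j. c l * f l (r j)) \<bumpeq> 1 - 0"
    using fK[of j j] j by (intro meq_diff) auto
   hence "1 - 0 \<bumpeq> 0" by (rule meq_trans[OF meq_sym rel[OF rK[OF j]]])
   thus False using prime_gt_1_nat[OF prime_p] by (simp add: meq_iff_dvd)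
  qed
 qed
 thus ?thesis by (rule indep_bound)
qed

text \<open>A point of the kernel outside a closed normal subgroup \<open>M1\<close> lies outside \<open>M1\<close> times an open normal subgroup.
 A maximal proper normal subgroup of the kernel that contains their common part has index \<open>p\<close> and is the kernel of
 a character that vanishes on \<open>M1\<close>.\<close>

lemma separating_character:
 assumes M1: "M1 \<lhd> F" "closedin TF M1" and y: "y \<in> K" "y \<notin> M1"
 shows "\<exists>r0\<in>K. \<exists>f0. character f0 \<and> f0 r0 \<bumpeq> 1 \<and> (\<forall>a\<in>K \<inter> M1. f0 a \<bumpeq> 0)"
proof -
 have yF: "y \<in> carrier F" by (rule K_carrier[OF y(1)])
 have sM1: "subgroup M1 F" using M1(1) by (rule normal_imp_subgroup)
 have "openin TF (topspace TF - M1)" using M1(2) by (simp add: openin_diff)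
 moreover have "y \<in> topspace TF - M1" using yF y(2) by (simp add: F.topspace_eq)
 ultimately obtain V where V: "V \<in> \<V>" "V #> y \<subseteq> topspace TF - M1" by (rule F.ons_r_coset_basis)
 have sV: "subgroup V F" by (rule F.ons_subgroup[OF V(1)])
 have VF: "v \<in> carrier F" if "v \<in> V" for v by (rule F.ons_carrier[OF V(1) that])
 have M1F: "m \<in> carrier F" if "m \<in> M1" for m by (rule subgroup.mem_carrier[OF sM1 that])
 define W where "W = M1 <#> V"
 have W: "W \<lhd> F" unfolding W_def by (rule F.normal_subgroup_set_mult_closed[OF M1(1) F.ons_normal[OF V(1)]])
 have VW: "v \<in> W" if "v \<in> V" for v
  using set_mult_def[of F M1 V] that subgroup.one_closed[OF sM1] VF[OF that] unfolding W_def by force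
 have MW: "m \<in> W" if "m \<in> M1" for m
  using set_mult_def[of F M1 V] that subgroup.one_closed[OF sV] M1F[OF that] unfolding W_def by force
 \<comment> \<open>If \<open>y\<close> were \<open>m \<otimes> v\<close>, normality of
   \<open>V\<close> would put \<open>m\<close> into \<open>V #> y\<close>, which misses
   \<open>M1\<close>.\<close>
 have yW: "y \<notin> W"
 proof
  assume "y \<in> W"
  then obtain m v where mv: "m \<in> M1" "v \<in> V" "y = m \<otimes> v" unfolding W_def set_mult_def by blast
  have mF: "m \<in> carrier F" and vF: "v \<in> carrier F" using M1F VF mv by auto
  have "m \<otimes> inv v \<otimes> inv m \<in> V"
   by (rule F.ons_conj(1)[OF V(1) subgroup.m_inv_closed[OF sV mv(2)] mF])
  moreover have "m = (m \<otimes> inv v \<otimes> inv m) \<otimes> y"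
  proof -
   have "inv v \<otimes> (inv m \<otimes> (m \<otimes> v)) = \<one>"
    using mF vF F.m_assoc[of "inv m" m v] by simp
   thus ?thesis unfolding mv(3) using mF vF by (simp add: F.m_assoc)
  qed
  ultimately have "m \<in> V #> y"
   using F.rcosI[OF _ subgroup.subset[OF sV] yF, of "m \<otimes> inv v \<otimes> inv m"] by simp
  thus False using V(2) mv(1) by blast
 qed
 define Fam where "Fam = {L. L \<lhd> F \<and> L \<subseteq> K \<and> K \<inter> W \<subseteq> L \<and> L ~= K}"
 \<comment> \<open>A subset of \<open>K\<close> that is stable under \<open>K \<inter> V\<close> is
   cut out of \<open>K\<close> by a union of cosets of \<open>V\<close>, and there are finitely many
   such unions. This makes finite both the family \<open>Fam\<close> and the index of each of its
   members in \<open>K\<close>.\<close>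
 have sat: "D \<in> (%S. K \<inter> \<Union>S) ` Pow (rcosets V)"
  if DK: "D \<subseteq> K" and D: "!!v l. v \<in> V ==> v \<in> K ==> l \<in> D ==> v \<otimes> l \<in> D" for D
 proof -
  let ?S = "(%l. V #> l) ` D"
  have "?S \<subseteq> rcosets V"
   by (rule image_subsetI) (rule F.coset_in_rcosets[OF V(1) K_carrier[OF subsetD[OF DK]]])
  moreover have "D = K \<inter> \<Union>?S"
  proof
   show "D \<subseteq> K \<inter> \<Union>?S"
   proof
    fix l assume l: "l \<in> D"
    have lK: "l \<in> K" by (rule subsetD[OF DK l])
    have "l \<in> V #> l" by (rule F.rcos_self[OF K_carrier[OF lK] sV])
    thus "l \<in> K \<inter> \<Union>?S" by (intro IntI lK UnionI[OF imageI[OF l]])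
   qed
   show "K \<inter> \<Union>?S \<subseteq> D"
   proof
    fix k assume "k \<in> K \<inter> \<Union>?S"
    then obtain l v where k: "k \<in> K" "l \<in> D" "v \<in> V" "k = v \<otimes> l" unfolding r_coset_def by blast
    have lK: "l \<in> K" using DK k(2) by blast
    have "v = k \<otimes> inv l" using k(4) VF[OF k(3)] K_carrier[OF lK] by (simp add: F.m_assoc)
    hence "v \<in> K" using K_mult[OF k(1) subgroup.m_inv_closed[OF K_subgroup lK]] by simp
    thus "k \<in> D" unfolding k(4) by (rule D[OF k(3) _ k(2)])
   qed
  qed
  ultimately show ?thesis by blast
 qed
 have satI: "D \<in> (%S. K \<inter> \<Union>S) ` Pow (rcosets V)"
  if L: "subgroup L F" "L \<subseteq> K" "K \<inter> W \<subseteq> L" and a: "a \<in> K" "D = L #> a" for L a D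
 proof (rule sat)
  have aF: "a \<in> carrier F" by (rule K_carrier[OF a(1)])
  show "D \<subseteq> K" using a L(2) K_mult by (auto simp: r_coset_def)
  fix v l assume v: "v \<in> V" "v \<in> K" and l: "l \<in> D"
  have vL: "v \<in> L" using L(3) VW[OF v(1)] v(2) by blast
  obtain m where m: "m \<in> L" "l = m \<otimes> a" using l a(2) by (auto simp: r_coset_def)
  have "v \<otimes> l = (v \<otimes> m) \<otimes> a"
   unfolding m(2) using VF[OF v(1)] subgroup.mem_carrier[OF L(1) m(1)] aF by (simp add: F.m_assoc)
  thus "v \<otimes> l \<in> D"
   unfolding a(2) using F.rcosI[OF subgroup.m_closed[OF L(1) vL m(1)] subgroup.subset[OF L(1)] aF] by simp
 qed
 have "Fam \<subseteq> (%S. K \<inter> \<Union>S) ` Pow (rcosets V)"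
 proof
  fix L assume L: "L \<in> Fam"
  have sL: "subgroup L F" and LK: "L \<subseteq> K" "K \<inter> W \<subseteq> L" using L normal_imp_subgroup by (auto simp: Fam_def)
  have "L = L #> \<one>" by (rule F.coset_mult_one[OF subgroup.subset[OF sL], symmetric])
  from satI[OF sL LK subgroup.one_closed[OF K_subgroup] this]
  show "L \<in> (%S. K \<inter> \<Union>S) ` Pow (rcosets V)" .
 qed
 hence "finite Fam" using F.ons_finite_index[OF V(1)] by (meson finite_Pow_iff finite_imageI finite_subset)
 moreover have "K \<inter> W \<in> Fam"
  using F.normal_subgroup_intersect[OF K_normal W] y(1) yW by (auto simp: Fam_def)
 ultimately obtain L where L: "L \<in> Fam" "!!L'. L' \<in> Fam ==> L \<subseteq> L' ==> L = L'"
  using finite_has_maximal[of Fam] by blast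
 have LF: "L \<lhd> F" and LK: "L \<subseteq> K" and WL: "K \<inter> W \<subseteq> L" and Lne: "L ~= K" using L(1) by (auto simp: Fam_def)
 have sL: "subgroup L F" using LF by (rule normal_imp_subgroup)
 define M where "M = F\<lparr>carrier := K\<rparr>"
 have Mc: "carrier M = K" and Mm: "mult M = mult F" by (simp_all add: M_def)
 have gM: "group M" unfolding M_def by (rule F.subgroup_imp_group[OF K_subgroup])
 interpret MG: group M by (rule gM)
 have Mi: "inv\<^bsub>M\<^esub> a = inv a" if "a \<in> K" for a
  unfolding M_def by (rule F.m_inv_consistent[OF K_subgroup that])
 have Mp: "a [^]\<^bsub>M\<^esub> (k::nat) = a [^] k" for a k unfolding M_def by (rule F.nat_pow_consistent[symmetric])
 have LM: "L' \<lhd> M" if "L' \<lhd> F" "L' \<subseteq> K" for L'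
  unfolding M_def by (rule F.normal_restrict_supergroup[OF K_subgroup that])
 obtain k where k: "card (rcosets V) = p ^ k" using F.ons_index[OF V(1)] .
 interpret VN: normal V F by (rule F.ons_normal[OF V(1)])
 interpret P: p_action_mod_maximal p M L F V k conjg
 proof (rule p_action_mod_maximal.intro)
  show pam: "p_action_mod p M L F V k conjg"
  proof (rule p_action_mod.intro)
   show "prime p" by (rule prime_p)
   show "L \<lhd> M" by (rule LM[OF LF LK])
   have "rcosets\<^bsub>M\<^esub> L \<subseteq> (%S. K \<inter> \<Union>S) ` Pow (rcosets V)"
    using satI[OF sL LK WL] by (auto simp: RCOSETS_def r_coset_def Mc Mm)
   thus "finite (rcosets\<^bsub>M\<^esub> L)"
    using F.ons_finite_index[OF V(1)] by (meson finite_Pow_iff finite_imageI finite_subset)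
   show "L ~= carrier M" using Lne Mc by simp
   \<comment> \<open>The order \<open>p ^ k\<close> of \<open>F Mod V\<close> annihilates the coset
     of \<open>m\<close>, so this power of \<open>m\<close> lies in
     \<open>K \<inter> V\<close>.\<close>
   show "\<exists>j. m [^]\<^bsub>M\<^esub> (p ^ j :: nat) \<in> L" if "m \<in> carrier M" for m
   proof -
    have mK: "m \<in> K" using that Mc by simp
    have mF: "m \<in> carrier F" by (rule K_carrier[OF mK])
    interpret Q: group "F Mod V" by (rule VN.factorgroup_is_group)
    have "(V #> m) [^]\<^bsub>F Mod V\<^esub> order (F Mod V) = \<one>\<^bsub>F Mod V\<^esub>"
     by (rule Q.pow_order_eq_1) (use F.coset_in_rcosets[OF V(1) mF] in \<open>simp add: FactGroup_def\<close>)
    hence "V #> (m [^] (p ^ k)) = V"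
     using VN.FactGroup_pow[OF mF] k by (simp add: order_def FactGroup_def)
    hence "m [^] (p ^ k) \<in> V" by (rule F.coset_join1) (use mF sV in simp_all)
    moreover have "m [^] (p ^ k) \<in> K"
     using MG.nat_pow_closed[of m "p ^ k"] mK Mc Mp by simp
    ultimately have "m [^]\<^bsub>M\<^esub> (p ^ k :: nat) \<in> L" using WL VW Mp by auto
    thus ?thesis by (rule exI)
   qed
   show "V \<lhd> F" by (rule F.ons_normal[OF V(1)])
   show "card (rcosets V) = p ^ k" by (rule k)
   show "conjg g \<in> hom M M" if g: "g \<in> carrier F" for g
   proof (rule homI)
    show "conjg g a \<in> carrier M" if "a \<in> carrier M" for a using K_conj[OF _ g] that Mc by simp
    show "conjg g (a \<otimes>\<^bsub>M\<^esub> b) = conjg g a \<otimes>\<^bsub>M\<^esub> conjg g b" if "a \<in> carrier M" "b \<in> carrier M" for a b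
    proof -
     have ab: "a \<in> carrier F" "b \<in> carrier F" using that Mc K_carrier by auto
     have "inv g \<otimes> (g \<otimes> (b \<otimes> inv g)) = b \<otimes> inv g"
      using ab g by (simp flip: F.m_assoc)
     thus ?thesis using ab g by (simp add: Mm F.m_assoc)
    qed
   qed
   show "conjg (g \<otimes> h) m = conjg g (conjg h m)" if "g \<in> carrier F" "h \<in> carrier F" "m \<in> carrier M" for g h m
    using that Mc K_carrier by (simp add: F.m_assoc F.inv_mult_group)
   show "conjg g l \<in> L" if "g \<in> carrier F" "l \<in> L" for g l by (rule normal.inv_op_closed2[OF LF that])
   \<comment> \<open>This commutator lies in \<open>K \<inter> V\<close>, as both subgroups are
     normal.\<close>
   show "conjg u m \<otimes>\<^bsub>M\<^esub> inv\<^bsub>M\<^esub> m \<in> L" if u: "u \<in> V" and m: "m \<in> carrier M" for u m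
   proof -
    have mK: "m \<in> K" using m Mc by simp
    have mF: "m \<in> carrier F" by (rule K_carrier[OF mK])
    have uF: "u \<in> carrier F" by (rule VF[OF u])
    have "conjg u m \<otimes> inv m \<in> K"
     by (rule K_mult[OF K_conj[OF mK uF] subgroup.m_inv_closed[OF K_subgroup mK]])
    moreover have "conjg u m \<otimes> inv m = u \<otimes> conjg m (inv u)"
     using uF mF by (simp add: F.m_assoc)
    moreover have "u \<otimes> conjg m (inv u) \<in> V"
     by (rule subgroup.m_closed[OF sV u F.ons_conj(1)[OF V(1) subgroup.m_inv_closed[OF sV u] mF]])
    ultimately show ?thesis using WL VW Mi[OF mK] Mm by auto
   qed
  qed
  interpret P: p_action_mod p M L F V k conjg by (rule pam)
  show "p_action_mod_maximal_axioms M L F conjg"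
  proof (rule p_action_mod_maximal_axioms.intro)
   \<comment> \<open>A coset fixed under conjugation by \<open>F\<close> is fixed under conjugation
     by \<open>K\<close>, hence central in the quotient of \<open>K\<close> by
     \<open>L\<close>.\<close>
   fix m z assume fm: "P.fixed m" and z: "z \<in> carrier M"
   have zK: "z \<in> K" using z Mc by simp
   have m: "m \<in> carrier M" and cos: "L #>\<^bsub>M\<^esub> conjg z m = L #>\<^bsub>M\<^esub> m"
    using fm K_carrier[OF zK] by (simp_all add: P.fixed_iff)
   have cM: "conjg z m \<in> carrier M" using K_conj[OF _ K_carrier[OF zK]] m Mc by simp
   have "conjg z m \<in> L #>\<^bsub>M\<^esub> m" by (rule MG.repr_independenceD[OF P.L.subgroup_axioms cM cos[symmetric]])
   then obtain l where l: "l \<in> L" "conjg z m = l \<otimes>\<^bsub>M\<^esub> m" by (auto simp: r_coset_def)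
   have "conjg z m \<otimes>\<^bsub>M\<^esub> inv\<^bsub>M\<^esub> m = l" unfolding l(2) using m P.L.mem_carrier[OF l(1)] by (simp add: MG.m_assoc)
   hence "conjg z m \<otimes>\<^bsub>M\<^esub> inv\<^bsub>M\<^esub> m \<in> L" using l(1) by simp
   thus "z \<otimes>\<^bsub>M\<^esub> m \<otimes>\<^bsub>M\<^esub> inv\<^bsub>M\<^esub> z \<otimes>\<^bsub>M\<^esub> inv\<^bsub>M\<^esub> m \<in> L"
    using Mi[OF zK] Mm by simp
  next
   fix L' assume L': "L' \<lhd> M" "L \<subseteq> L'" "L' ~= L" and inv: "!!g l. g \<in> carrier F ==> l \<in> L' ==> conjg g l \<in> L'"
   have sM: "subgroup L' M" using L'(1) by (rule normal_imp_subgroup)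
   have L'K: "L' \<subseteq> K" using subgroup.subset[OF sM] Mc by simp
   have "subgroup L' F" using F.incl_subgroup[OF K_subgroup] sM by (simp add: M_def)
   hence "L' \<lhd> F" using inv by (intro F.normal_invI) auto
   thus "L' = carrier M" using L(2)[of L'] L' L'K WL Mc by (auto simp: Fam_def)
  qed
 qed
 from P.invariant_character obtain r0 and \<xi> :: "'f => int" where r0: "r0 \<in> K"
  and add: "!!a b. a \<in> K ==> b \<in> K ==> \<xi> (a \<otimes> b) \<bumpeq> \<xi> a + \<xi> b"
  and ker: "!!a. a \<in> K ==> a \<in> L \<longleftrightarrow> \<xi> a \<bumpeq> 0" and r01: "\<xi> r0 \<bumpeq> 1"
  and inv: "!!g a. g \<in> carrier F ==> a \<in> K ==> \<xi> (conjg g a) \<bumpeq> \<xi> a"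
  unfolding Mc Mm mod_eq_def by blast
 have "\<xi> a \<bumpeq> 0" if "a \<in> K" "a \<in> W" for a using ker[OF that(1)] WL that by blast
 hence "\<forall>a\<in>K \<inter> V. \<xi> a \<bumpeq> 0" "\<forall>a\<in>K \<inter> M1. \<xi> a \<bumpeq> 0" using VW MW by simp_all
 moreover from this(1) have "character \<xi>"
  unfolding character_def using add inv V(1) by (intro conjI ballI bexI[of _ V]) simp_all
 ultimately have "character \<xi>" "\<forall>a\<in>K \<inter> M1. \<xi> a \<bumpeq> 0" by simp_all
 thus ?thesis using r0 r01 by blast
qed

text \<open>The elements \<open>r i\<close> of a dual system of greatest length are the relators. A
  closed normal subgroup that contains them but not \<open>K\<close> would admit a character of
  \<open>K\<close> that vanishes on its part in \<open>K\<close>, and this character would extend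
  the system.\<close>

theorem kernel_closed_normal_closure:
 "\<exists>R. finite R \<and> R \<subseteq> carrier F \<and> K = closed_normal_closure F TF R"
proof -
 define P where "P = (%s. \<exists>r f. dual_system s r f)"
 have P0: "P 0" by (auto simp: P_def dual_system_def)
 have Pd: "s \<le> d" if "P s" for s using that dual_system_bound by (auto simp: P_def)
 define s where "s = (GREATEST s. P s)"
 have "P s" unfolding s_def by (rule GreatestI_nat[of P 0 d]) (use P0 Pd in auto)
 then obtain r f where sys: "dual_system s r f" by (auto simp: P_def)
 have max: "\<not> P (Suc s)"
 proof
  assume "P (Suc s)"
  hence "Suc s \<le> s" unfolding s_def by (rule Greatest_le_nat[of P _ d]) (use Pd in auto)
  thus False by simp
 qed
 define R where "R = r ` {..<s}"
 have RK: "R \<subseteq> K" using sys by (auto simp: R_def dual_system_def)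
 have "closedin T {\<one>\<^bsub>G\<^esub>}" using Hausdorff by (simp add: topspace_eq closedin_Hausdorff_singleton)
 hence "closedin TF {\<xi> \<in> topspace TF. \<phi> \<xi> \<in> {\<one>\<^bsub>G\<^esub>}}" by (rule closedin_continuous_map_preimage[OF phi_continuous])
 moreover have "{\<xi> \<in> topspace TF. \<phi> \<xi> \<in> {\<one>\<^bsub>G\<^esub>}} = K" by (auto simp: kernel_def F.topspace_eq)
 ultimately have "closed_normal_closure F TF R \<subseteq> K"
  unfolding closed_normal_closure_def using K_normal RK by auto
 moreover have "K \<subseteq> M1" if M1: "M1 \<lhd> F" "closedin TF M1" "R \<subseteq> M1" for M1
 proof
  fix y assume y: "y \<in> K"
  show "y \<in> M1"
  proof (rule ccontr)
   assume "y \<notin> M1"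
   then obtain r0 f0 where new: "r0 \<in> K" "character f0" "f0 r0 \<bumpeq> 1" "\<forall>a\<in>K \<inter> M1. f0 a \<bumpeq> 0"
    using separating_character[OF M1(1,2) y] by blast
   have "r i \<in> K \<inter> M1" if "i < s" for i using RK M1(3) that by (auto simp: R_def)
   hence "dual_system (Suc s) (r(s := r0)) (f(s := f0))"
    using sys new by (auto simp: dual_system_def less_Suc_eq)
   thus False using max by (auto simp: P_def)
  qed
 qed
 ultimately have "K = closed_normal_closure F TF R" unfolding closed_normal_closure_def by blast
 moreover have "finite R" "R \<subseteq> carrier F" using RK K_carrier by (auto simp: R_def)
 ultimately show ?thesis by blast
qed

end

text \<open>\<open>pro_p_cover\<close> is applied to the completed free group on as many letters as
  \<open>G\<close> has chosen generators, so that \<open>phi_X\<close> holds by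
  construction.\<close>

lemma sylvester_pro_p_finitely_presented:
  assumes "sylvester_pro_p p G T d x" shows "finitely_presented_pro_p p G T"
proof -
  interpret sylvester_pro_p p G T d x by (rule assms)
  let ?\<Gamma> = "free_group {..<d}" and ?gens = "free_gen {..<d} ` {..<d}"
  let ?F = "free_pro_p_group p d" and ?TF = "free_pro_p_topology p d"
  have xG: "x ` {..<d} \<subseteq> carrier G" using x_closed by auto
  obtain \<psi> where \<psi>: "\<psi> \<in> hom ?\<Gamma> G" and \<psi>x0: "\<forall>i\<in>{..<d}. \<psi> (free_gen {..<d} i) = x i"
    by (rule free_group_universal[OF xG])
  have \<psi>x: "\<psi> (free_gen {..<d} i) = x i" if "i \<in> {..<d}" for i by (rule bspec[OF \<psi>x0 that])
  interpret E: pro_p_extension ?\<Gamma> p G T \<psi>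
    by (intro pro_p_extension.intro pro_p_completed.intro pro_p_completed_axioms.intro pro_p_extension_axioms.intro
        group_free_group prime_p pro_p_group_axioms \<psi>)
  have gens: "?gens \<subseteq> carrier ?\<Gamma>" using free_gen_carrier by (intro image_subsetI)
  define X where "X = (\<lambda>i. E.iota (free_gen {..<d} i))"
  have X: "X ` {..<d} = E.iota ` ?gens" by (simp add: X_def image_image)
  have "\<psi> ` ?gens = x ` {..<d}" unfolding image_image using \<psi>x by (intro image_cong) simp_all
  then have surj: "E.ext ` carrier ?F = carrier G" using E.ext_surj[OF gens] x_generate by simp
  interpret P: pro_p_cover p G T d x ?F ?TF X E.ext
  proof (intro pro_p_cover.intro pro_p_cover_axioms.intro generated_pro_p.intro generated_pro_p_axioms.intro)
    show "sylvester_pro_p p G T d x" by (rule assms)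
    show "pro_p_group p ?F ?TF" by (rule E.completion_pro_p)
    show "X i \<in> carrier ?F" if "i < d" for i
      unfolding X_def by (rule E.iota_closed[OF free_gen_carrier]) (use that in simp)
    show "?TF closure_of (generate ?F (X ` {..<d})) = carrier ?F"
      unfolding X by (rule E.iota_dense[OF gens free_group_generate])
    show "E.ext \<in> hom ?F G" by (rule E.ext_hom)
    show "continuous_map ?TF T E.ext" by (rule E.ext_continuous)
    show "E.ext ` carrier ?F = carrier G" by (rule surj)
    show "E.ext (X i) = x i" if "i < d" for i
    proof -
      have i: "i \<in> {..<d}" using that by simp
      show ?thesis unfolding X_def using E.ext_iota[OF free_gen_carrier[OF i]] \<psi>x[OF i] by simp
    qed
  qed
  obtain R where "finite R" "R \<subseteq> carrier ?F" "kernel ?F G E.ext = closed_normal_closure ?F ?TF R"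
    using P.kernel_closed_normal_closure by (elim exE conjE)
  then show ?thesis
    unfolding finitely_presented_pro_p_def using E.ext_hom E.ext_continuous surj
    by (intro exI[of _ d] exI[of _ R] exI[of _ E.ext] conjI)
qed

theorem proposition3p3:
  fixes p :: nat and G :: "('g, 'b) monoid_scheme" and T :: "'g topology"
  assumes "prime p"
    and "pro_p_group p G T"
    and "topologically_finitely_generated G T"
    and "sylvester_domain (completed_group_algebra (residue_ring (int p)) G T)"
  shows "finitely_presented_pro_p p G T \<and> cohomological_dimension TYPE('m) G T \<le> 2"
proof -
  obtain Y where Y: "finite Y" "Y \<subseteq> carrier G" "T closure_of (generate G Y) = carrier G"
    using assms(3) by (auto simp: topologically_finitely_generated_def)
  obtain x where "bij_betw x {0..<card Y} Y" using ex_bij_betw_nat_finite[OF Y(1)] by blast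
  then have x: "x ` {..<card Y} = Y" by (simp add: bij_betw_def atLeast0LessThan)
  have S: "sylvester_pro_p p G T (card Y) x"
  proof (intro sylvester_pro_p.intro generated_pro_p.intro generated_pro_p_axioms.intro sylvester_pro_p_axioms.intro assms(2,4))
    show "x i \<in> carrier G" if "i < card Y" for i using x Y(2) that by auto
    show "T closure_of (generate G (x ` {..<card Y})) = carrier G" unfolding x by (rule Y(3))
  qed
  show ?thesis
    by (intro conjI sylvester_pro_p_finitely_presented[OF S] sylvester_pro_p.cohomological_dimension_le_2[OF S])
qed

end
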